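(* For every integer $m\ge 2$ the following estimates hold. (i) For every $m<p\le\infty$, $$m^{m/p}\le H^{\mathrm{pol}}_{m,p}(\mathbb C)\le m^{m/p}\left[e\left(1+\frac{4e}{\pi}\right)^{m-1}\right]^{1/q(m,p)}.$$ (ii) If $m<p\le 2m$, so that $q(m,p)=p/(p-m)$, then $$H^{\mathrm{pol}}_{m,p}(\mathbb C)\le c_m\,m^{m/p}\,2^{(m-1)/q(m,p)}.$$ (iii) If $2m\le p\le\infty$ and $\tau:=2m/p$, then $$H^{\mathrm{pol}}_{m,p}(\mathbb C)\le D_m^{\,1-\tau}\Lambda_m^{\,\tau}.$$ Consequently, $$\limsup_{m\to\infty}\ \sup_{m<p\le\infty}\bigl(H^{\mathrm{pol}}_{m,p}(\mathbb C)\bigr)^{1/m}\le\sqrt2.$$ Moreover, if $(R_m)$ is a sequence with $R_m\to\infty$, then $$\sup_{p\ge mR_m}\left|\bigl(H^{\mathrm{pol}}_{m,p}(\mathbb C)\bigr)^{1/m}-1\right|\longrightarrow 0\qquad(m\to\infty).$$ If there are constants $C,b$ such that $D_m\le Cm^b$ for all $m\ge2$, and $c>0$ is fixed, then for every sequence $(p_m)$ with $m<p_m\le\infty$, $$p_m\ge c\,\frac{m^2}{\log m}\ \text{ for all } m\quad\Longrightarrow\quad H^{\mathrm{pol}}_{m,p_m}(\mathbb C)\le m^{\,b+(\log 2)/c+o(1)}\qquad(m\to\infty).$$ If $(p_m)$ is a sequence with $m<p_m\le\infty$ and $p_m/m^2\to\infty$, then $$H^{\mathrm{pol}}_{m,p_m}(\mathbb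 C)\le(1+o(1))D_m\qquad(m\to\infty).$$
   Context: Convention: $1/\infty=0$. For $m,n\in\mathbb N=\{1,2,\dots\}$, let $\mathcal M_m(n)=\{\alpha\in\mathbb N_0^n:\ |\alpha|=\alpha_1+\cdots+\alpha_n=m\}$, and let $\mathcal P_m(\mathbb K^n)$ ($\mathbb K\in\{\mathbb R,\mathbb C\}$) be the space of $m$-homogeneous polynomials $P(z)=\sum_{\alpha\in\mathcal M_m(n)}a_\alpha z^\alpha$ on $\mathbb K^n$ with coefficients in $\mathbb K$. Put $\|P\|_p=\sup\{|P(z)|: z\in\mathbb K^n,\ \|z\|_p\le1\}$, where $\|z\|_p=(\sum_j|z_j|^p)^{1/p}$ for $p<\infty$ and $\|z\|_\infty=\max_j|z_j|$, and $|P|_r=(\sum_\alpha|a_\alpha|^r)^{1/r}$ for $1\le r<\infty$. For $m<p\le\infty$ set $q(m,p)=\frac{p}{p-m}$ if $m<p<2m$; $q(m,p)=\frac{2mp}{mp+p-2m}$ if $2m\le p<\infty$; $q(m,p)=\frac{2m}{m+1}$ if $p=\infty$. (At $p=2m$ this equals $2=p/(p-m)$.) $H^{\mathrm{pol}}_{m,p}(\mathbb K)$ denotes the least constant $C$ such that $|P|_{q(m,p)}\le C\|P\|_p$ for all $n\in\mathbb N$ and all $P\in\mathcal P_m(\mathbb K^n)$ (finite by the polynomial Hardy--Littlewood inequality; for $p=\infty$, the Bohnenblust--Hille inequality). For $m\ge2$: $D_m:=H^{\mathrm{pol}}_{m,\infty}(\mathbb C)$, $c_m:=\left(\frac{m}{m-1}\right)^{m-1}$,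 $\Lambda_m:=c_m\sqrt m\,2^{(m-1)/2}$. *)

theory Defs
  imports "HOL-Analysis.Analysis"
begin

text \<open>
  Exponents \<open>p \<in> (m, \<infinity>]\<close> are extended reals, so that \<open>1/\<infinity> = 0\<close> is the library's
  convention for division in \<^typ>\<open>ereal\<close>.

  Since the dimension \<open>n\<close> has to be quantified inside a definition, vectors in \<open>\<complex>\<^sup>n\<close> and
  multi-indices in \<open>\<nat>\<^sub>0\<^sup>n\<close> are functions on \<^typ>\<open>nat\<close>, of which only the values at
  \<open>0, \<dots>, n - 1\<close> are used. Multi-indices are normalised to be zero elsewhere, so
  that distinct functions are distinct multi-indices.
\<close>

definition multi_indices :: "nat \<Rightarrow> nat \<Rightarrow> (nat \<Rightarrow> nat) set" where
  "multi_indices m n = {\<alpha>. (\<forall>j\<ge>n. \<alpha> j = 0) \<and> (\<Sum>j<n. \<alpha> j) = m}"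

text \<open>
  An \<open>m\<close>-homogeneous polynomial on \<open>\<complex>\<^sup>n\<close> is given by its coefficient family
  \<open>a\<close>, of which only the values on \<^term>\<open>multi_indices m n\<close> are used.
\<close>

definition poly_eval :: "nat \<Rightarrow> nat \<Rightarrow> ((nat \<Rightarrow> nat) \<Rightarrow> complex) \<Rightarrow> (nat \<Rightarrow> complex) \<Rightarrow> complex" where
  "poly_eval m n a z = (\<Sum>\<alpha>\<in>multi_indices m n. a \<alpha> * (\<Prod>j<n. z j ^ \<alpha> j))"

definition lp_norm :: "ereal \<Rightarrow> nat \<Rightarrow> (nat \<Rightarrow> complex) \<Rightarrow> real" where
  "lp_norm p n z =
     (if p = \<infinity> then Max ((\<lambda>j. norm (z j)) ` {..<n})
      else (\<Sum>j<n. norm (z j) powr real_of_ereal p) powr (1 / real_of_ereal p))"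

definition poly_norm :: "ereal \<Rightarrow> nat \<Rightarrow> nat \<Rightarrow> ((nat \<Rightarrow> nat) \<Rightarrow> complex) \<Rightarrow> real" where
  "poly_norm p m n a = (SUP z\<in>{z. lp_norm p n z \<le> 1}. norm (poly_eval m n a z))"

definition coeff_norm :: "real \<Rightarrow> nat \<Rightarrow> nat \<Rightarrow> ((nat \<Rightarrow> nat) \<Rightarrow> complex) \<Rightarrow> real" where
  "coeff_norm r m n a = (\<Sum>\<alpha>\<in>multi_indices m n. norm (a \<alpha>) powr r) powr (1 / r)"

definition hl_exponent :: "nat \<Rightarrow> ereal \<Rightarrow> real" where
  "hl_exponent m p =
     (if p = \<infinity> then 2 * real m / (real m + 1)
      else let r = real_of_ereal p in
        if r < 2 * real m then r / (r - real m)
        else 2 * real m * r / (real m * r + r - 2 * real m))"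

text \<open>
  The optimal constant is an extended real: it is \<open>\<infinity>\<close> if no finite constant is
  admissible, so that a finite upper bound on it includes the validity of the
  corresponding Hardy--Littlewood inequality. Otherwise the infimum is attained,
  each of the inequalities being closed in \<open>C\<close>.
\<close>

definition H_pol :: "nat \<Rightarrow> ereal \<Rightarrow> ereal" where
  "H_pol m p =
     (INF C\<in>{C :: real. \<forall>n\<ge>1. \<forall>a. coeff_norm (hl_exponent m p) m n a \<le> C * poly_norm p m n a}.
        ereal C)"

definition D_const :: "nat \<Rightarrow> real" where
  "D_const m = real_of_ereal (H_pol m \<infinity>)"

definition c_const :: "nat \<Rightarrow> real" where
  "c_const m = (real m / (real m - 1)) ^ (m - 1)"

definition Lambda_const :: "nat \<Rightarrow> real" where
  "Lambda_const m = c_const m * sqrt (real m) * 2 powr ((real m - 1) / 2)"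

lemma hl_exponent_le_2m:
  assumes "m \<ge> 1" "ereal (real m) < p" "p \<le> ereal (2 * real m)"
  shows "hl_exponent m p = real_of_ereal p / (real_of_ereal p - real m)"
proof (cases p)
  case (real r)
  show ?thesis
  proof (cases "r < 2 * real m")
    case False
    then have "r = 2 * real m" using assms real by simp
    moreover have "real m > 0" using assms by simp
    ultimately show ?thesis
      using real by (simp add: hl_exponent_def Let_def field_simps)
  qed (use real in \<open>simp add: hl_exponent_def\<close>)
qed (use assms in auto)

end

theory Submission
  imports Defs "HOL-Complex_Analysis.Complex_Analysis" "HOL-Real_Asymp.Real_Asymp"
begin

text \<open>
  Every upper bound starts on the polydisc. If \<open>x \<ge> 0\<close> and \<open>\<Sum> x\<^sub>j\<^sup>p \<le> 1\<close>, then the polynomial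
  with coefficients \<open>a\<^sub>\<alpha> x\<^sup>\<alpha>\<close> is bounded by \<open>\<parallel>P\<parallel>\<^sub>p\<close> on the polydisc
  (\<open>polydisc_bound_rescaled\<close>). An inequality on the polydisc thus becomes a family of inequalities
  for \<open>P\<close>, one for each \<open>x\<close>, and the point is to choose \<open>x\<close> well.

  The basic inequality on the polydisc is \<open>mixed_inequality\<close>: if \<open>P\<close> has coefficients \<open>c\<^sub>\<alpha>\<close>, is
  bounded by \<open>B\<close>, and \<open>q \<ge> 2\<close>, then
  \<open>\<Sum>\<^sub>k (\<Sum>\<^sub>\<alpha> \<alpha>\<^sub>k |c\<^sub>\<alpha>|\<^sup>q)\<^bsup>1/q\<^esup> \<le> m c\<^sub>m 2\<^bsup>(m-1)/q\<^esup> B\<close>. The sums over \<open>\<alpha>\<close> belong to the partial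
  derivatives of \<open>P\<close>. Cauchy's estimate gives \<open>\<Sum>\<^sub>k |\<partial>\<^sub>k P| \<le> m c\<^sub>m B\<close> on the torus, and
  Carleman's inequality \<open>\<Sum> 2\<^bsup>-j\<^esup> |c\<^sub>j|\<^sup>2 \<le> (mean |f|)\<^sup>2\<close>, applied in one variable after the other,
  passes from the values of a polynomial of degree \<open>m - 1\<close> to its coefficients at the price
  \<open>2\<^bsup>(m-1)/q\<^esup>\<close>.

  The good \<open>x\<close> is a power of a maximiser \<open>y\<close> of \<open>\<Sum> b\<^sub>\<alpha> y\<^sup>\<alpha> - \<Sum> y\<^sub>k\<^sup>p\<close>, where the terms
  \<open>\<Sum>\<^sub>\<alpha> \<alpha>\<^sub>k b\<^sub>\<alpha> y\<^sup>\<alpha>\<close> are proportional to \<open>y\<^sub>k\<^sup>p\<close> (\<open>exists_balanced_point\<close>). At such a point the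
  sum over \<open>k\<close> in the mixed inequality collapses to the factor of proportionality \<open>\<mu>\<close>, and the
  weighted inequality between the arithmetic and the geometric mean gives \<open>m \<Sum> b\<^sub>\<alpha> \<le> \<mu>\<close>. For
  \<open>b\<^sub>\<alpha> = |a\<^sub>\<alpha>|\<^sup>q\<close> this is \<open>sum_le_by_balancing\<close>, and it yields (ii). For \<open>p \<ge> 2m\<close> the choice
  \<open>b\<^sub>\<alpha> = |a\<^sub>\<alpha>|\<^sup>2\<close> yields a weighted \<open>\<ell>\<^sub>2\<close> bound with constant \<open>\<Lambda>\<^sub>m\<close>; Hoelder's inequality combines
  it with the Bohnenblust--Hille inequality for the rescaled polynomial, whose constant is \<open>D\<^sub>m\<close>,
  and this is (iii). The mixed inequality for \<open>q = 2\<close> also proves \<open>D\<^sub>m \<le> \<Lambda>\<^sub>m\<close>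
  (\<open>bohnenblust_hille\<close>).

  The bound (i) contains no power \<open>c\<^sub>m\<^sup>q\<close>, hence it needs another argument when \<open>q\<close> is large. The
  indices with a support of size \<open>s\<close> are distributed over the colourings of the variables with \<open>s\<close>
  colours and over the compositions of \<open>m\<close> into \<open>s\<close> degrees, one for each colour. The coefficients
  captured by a colouring and a composition are those of an \<open>s\<close>-linear form that is still bounded by
  \<open>\<parallel>P\<parallel>\<close>, because it arises by averaging \<open>P\<close> over rotations of the variables. For multilinear
  forms Carleman's inequality can be replaced by the comparison of moments of a linear form on the
  torus, with a constant \<open>\<kappa> = 32/27\<close> for \<open>q \<ge> 4\<close> that is small enough for the final sum
  \<open>\<Sum>\<^sub>s (s\<^sup>s/s!) (m-1 choose s-1) \<kappa>\<^bsup>s-1\<^esup>\<close> (\<open>decoupled_coefficient_bound\<close>). In the other cases (i)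
  is a numerical consequence of (ii), of (iii), or of the same sum with \<open>\<kappa> = 2\<close>. The lower bound
  comes from \<open>z\<^sub>1 \<cdots> z\<^sub>m\<close>.

  The bound on the limit superior is read off from (ii) and (iii). The other asymptotic statements
  follow from \<open>D\<^sub>m\<^bsup>1-\<tau>\<^esup> \<Lambda>\<^sub>m\<^bsup>\<tau>\<^esup> \<le> D\<^sub>m \<Lambda>\<^sub>m\<^bsup>\<tau>\<^esup>\<close>, as \<open>\<Lambda>\<^sub>m\<close> grows at most exponentially; the one for \<open>R\<^sub>m\<close>
  requires in addition \<open>D\<^sub>m\<^bsup>1/m\<^esup> \<rightarrow> 1\<close>. For this, a multi-index of degree \<open>m\<close> is cut into blocks of
  bounded degree, and the Bohnenblust--Hille inequality with its exponential constant is used only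
  in the degree of the blocks (\<open>bohnenblust_hille_subexponential\<close>).
\<close>

section \<open>Multi-indices and boxes of exponents\<close>

definition monomial :: "nat \<Rightarrow> (nat \<Rightarrow> 'a::comm_monoid_mult) \<Rightarrow> (nat \<Rightarrow> nat) \<Rightarrow> 'a" where
  "monomial n z \<alpha> = (\<Prod>j<n. z j ^ \<alpha> j)"

text \<open>
  Sums over a box factorise into sums over the coordinates. Besides exponents, its elements serve as
  points of a grid on the torus (powers of a root of unity) and as indices of multilinear forms.
\<close>

definition exponent_box :: "nat \<Rightarrow> nat \<Rightarrow> (nat \<Rightarrow> nat) set" where
  "exponent_box n d = {\<beta>. (\<forall>j<n. \<beta> j \<le> d) \<and> (\<forall>j\<ge>n. \<beta> j = 0)}"

lemma exponent_box_0 [simp]: "exponent_box 0 d = {\<lambda>_. 0}"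
  by (auto simp: exponent_box_def)

lemma bij_betw_exponent_box_Suc:
  "bij_betw (\<lambda>(\<beta>, l). \<beta>(n := l)) (exponent_box n d \<times> {..d}) (exponent_box (Suc n) d)"
proof (rule bij_betw_byWitness[where f' = "\<lambda>\<beta>. (\<beta>(n := 0), \<beta> n)"])
  show "(\<lambda>\<beta>. (\<beta>(n := 0), \<beta> n)) ` exponent_box (Suc n) d \<subseteq> exponent_box n d \<times> {..d}"
    by (auto simp: exponent_box_def)
  show "(\<lambda>(\<beta>, l). \<beta>(n := l)) ` (exponent_box n d \<times> {..d}) \<subseteq> exponent_box (Suc n) d"
    by (auto simp: exponent_box_def less_Suc_eq)
qed (auto simp: exponent_box_def fun_eq_iff)

lemma sum_exponent_box_Suc:
  "(\<Sum>\<beta>\<in>exponent_box (Suc n) d. f \<beta>) = (\<Sum>\<beta>\<in>exponent_box n d. \<Sum>l\<le>d. f (\<beta>(n := l)))"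
  by (subst sum.reindex_bij_betw[OF bij_betw_exponent_box_Suc, symmetric])
     (simp add: sum.cartesian_product case_prod_unfold)

lemma finite_exponent_box [simp, intro]: "finite (exponent_box n d)"
proof (induction n)
  case (Suc n)
  then show ?case
    using bij_betw_finite[OF bij_betw_exponent_box_Suc[of n d]] by simp
qed simp

lemma sum_prod_exponent_box:
  fixes f :: "nat \<Rightarrow> nat \<Rightarrow> 'a::comm_semiring_1"
  shows "(\<Sum>\<beta>\<in>exponent_box n d. \<Prod>j<n. f j (\<beta> j)) = (\<Prod>j<n. \<Sum>l\<le>d. f j l)"
proof (induction n)
  case (Suc n)
  have "(\<Sum>\<beta>\<in>exponent_box (Suc n) d. \<Prod>j<Suc n. f j (\<beta> j))
      = (\<Sum>\<beta>\<in>exponent_box n d. \<Sum>l\<le>d. (\<Prod>j<n. f j (\<beta> j)) * f n l)"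
    unfolding sum_exponent_box_Suc by (intro sum.cong refl) auto
  also have "\<dots> = (\<Sum>\<beta>\<in>exponent_box n d. \<Prod>j<n. f j (\<beta> j)) * (\<Sum>l\<le>d. f n l)"
    by (simp add: sum_product)
  finally show ?case using Suc.IH by simp
qed simp

lemma card_exponent_box: "card (exponent_box n d) = (d + 1) ^ n"
  using sum_prod_exponent_box[of "\<lambda>_ _. 1::nat" n d] by (simp add: prod_constant)

lemma multi_indices_le: "\<alpha> \<in> multi_indices m n \<Longrightarrow> \<alpha> j \<le> m"
proof (cases "j < n")
  case True
  assume "\<alpha> \<in> multi_indices m n"
  then show ?thesis
    using member_le_sum[of j "{..<n}" \<alpha>] True by (auto simp: multi_indices_def)
qed (auto simp: multi_indices_def)

lemma multi_indices_subset_box: "multi_indices m n \<subseteq> exponent_box n m"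
  using multi_indices_le by (force simp: exponent_box_def multi_indices_def)

lemma finite_multi_indices [simp, intro]: "finite (multi_indices m n)"
  using finite_subset[OF multi_indices_subset_box] by blast

lemma multi_indices_sum: "\<alpha> \<in> multi_indices m n \<Longrightarrow> (\<Sum>j<n. \<alpha> j) = m"
  by (simp add: multi_indices_def)

lemma multi_indices_zero: "\<alpha> \<in> multi_indices m n \<Longrightarrow> j \<ge> n \<Longrightarrow> \<alpha> j = 0"
  by (simp add: multi_indices_def)

lemma multi_indices_nonempty: "n \<ge> 1 \<Longrightarrow> multi_indices m n \<noteq> {}"
proof -
  assume "n \<ge> 1"
  then have "(\<lambda>j. if j = 0 then m else 0) \<in> multi_indices m n"
    by (auto simp: multi_indices_def)
  then show ?thesis by blast
qed

lemma poly_eval_monomial: "poly_eval m n a z = (\<Sum>\<alpha>\<in>multi_indices m n. a \<alpha> * monomial n z \<alpha>)"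
  by (simp add: poly_eval_def monomial_def)

lemma monomial_mult: "monomial n (\<lambda>j. x j * y j) \<alpha> = monomial n x \<alpha> * monomial n y \<alpha>"
  by (simp add: monomial_def power_mult_distrib prod.distrib)

lemma monomial_const: "\<alpha> \<in> multi_indices m n \<Longrightarrow> monomial n (\<lambda>_. t) \<alpha> = t ^ m"
  by (simp add: monomial_def power_sum[symmetric] multi_indices_sum)

lemma norm_monomial:
  fixes z :: "nat \<Rightarrow> 'a::{real_normed_field}"
  shows "norm (monomial n z \<alpha>) = monomial n (\<lambda>j. norm (z j)) \<alpha>"
  by (simp add: monomial_def norm_power flip: prod_norm)

lemma monomial_of_real:
  "monomial n (\<lambda>j. of_real (x j) :: 'a::{real_normed_field}) \<alpha> = of_real (monomial n x \<alpha>)"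
  by (simp add: monomial_def)

lemma monomial_nonneg: "(\<And>j. j < n \<Longrightarrow> x j \<ge> (0::real)) \<Longrightarrow> monomial n x \<alpha> \<ge> 0"
  unfolding monomial_def by (intro prod_nonneg) auto

lemma monomial_pos: "(\<And>j. j < n \<Longrightarrow> x j > (0::real)) \<Longrightarrow> monomial n x \<alpha> > 0"
  unfolding monomial_def by (intro prod_pos) auto

lemma monomial_le_1:
  "(\<And>j. j < n \<Longrightarrow> x j \<ge> (0::real)) \<Longrightarrow> (\<And>j. j < n \<Longrightarrow> x j \<le> 1) \<Longrightarrow> monomial n x \<alpha> \<le> 1"
  unfolding monomial_def by (intro prod_le_1) (auto simp: power_le_one)

lemma monomial_powr:
  assumes "\<And>j. j < n \<Longrightarrow> x j \<ge> (0::real)"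
  shows "monomial n (\<lambda>j. x j powr r) \<alpha> = monomial n x \<alpha> powr r"
proof -
  have "(\<Prod>j<n. (x j powr r) ^ \<alpha> j) = (\<Prod>j<n. (x j ^ \<alpha> j) powr r)"
  proof (intro prod.cong refl)
    fix j assume "j \<in> {..<n}"
    then have "x j \<ge> 0" using assms by auto
    consider "\<alpha> j = 0" | "\<alpha> j > 0" "x j = 0" | "x j > 0" using \<open>x j \<ge> 0\<close> by fastforce
    then show "(x j powr r) ^ \<alpha> j = (x j ^ \<alpha> j) powr r"
      by cases (auto simp: zero_power powr_powr mult.commute simp flip: powr_realpow)
  qed
  also have "\<dots> = (\<Prod>j<n. x j ^ \<alpha> j) powr r"
    by (rule prod_powr_distrib[symmetric])
  finally show ?thesis by (simp add: monomial_def)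
qed

text \<open>
  Weighted arithmetic and geometric means with the weights \<open>\<alpha>\<^sub>j / m\<close>, by concavity of the logarithm.
\<close>

lemma monomial_le_weighted_mean_power:
  assumes "\<alpha> \<in> multi_indices m n" "m \<ge> 1" "\<And>j. j < n \<Longrightarrow> u j > (0::real)"
  shows "monomial n u \<alpha> \<le> ((\<Sum>j<n. real (\<alpha> j) * u j) / real m) ^ m"
proof -
  have sum1: "(\<Sum>j<n. real (\<alpha> j) / real m) = 1"
    using multi_indices_sum[OF assms(1)] assms(2)
    by (simp flip: sum_divide_distrib of_nat_sum)
  have "n > 0"
    using multi_indices_sum[OF assms(1)] assms(2) by (cases n) auto
  define S where "S = (\<Sum>j<n. (real (\<alpha> j) / real m) *\<^sub>R u j)"
  have "ln S \<ge> (\<Sum>j<n. (real (\<alpha> j) / real m) * ln (u j))"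
    unfolding S_def
    by (rule concave_on_sum[OF _ _ ln_concave])
       (use assms sum1 \<open>n > 0\<close> in \<open>auto simp: lessThan_empty_iff\<close>)
  have S_pos: "S > 0"
  proof -
    obtain j where j: "j < n" "\<alpha> j \<noteq> 0"
      using multi_indices_sum[OF assms(1)] assms(2) by (metis lessThan_iff not_one_le_zero sum.neutral)
    have "0 < (real (\<alpha> j) / real m) *\<^sub>R u j" using j assms by simp
    also have "\<dots> \<le> S" unfolding S_def
      by (rule member_le_sum) (use j assms in \<open>auto intro!: mult_nonneg_nonneg divide_nonneg_nonneg less_imp_le[OF assms(3)]\<close>)
    finally show ?thesis .
  qed
  have "ln (monomial n u \<alpha>) = (\<Sum>j<n. real (\<alpha> j) * ln (u j))"
    unfolding monomial_def using assms(3)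
    by (subst ln_prod) (auto simp: ln_realpow order_less_imp_not_eq2)
  also have "\<dots> = real m * (\<Sum>j<n. (real (\<alpha> j) / real m) * ln (u j))"
    using assms(2) unfolding sum_distrib_left by (intro sum.cong refl) simp
  also have "\<dots> \<le> real m * ln S"
    using \<open>ln S \<ge> _\<close> by (intro mult_left_mono) auto
  also have "\<dots> = ln (S ^ m)"
    using \<open>S > 0\<close> by (simp add: ln_realpow)
  finally have "monomial n u \<alpha> \<le> S ^ m"
    using S_pos monomial_pos[of n u \<alpha>] assms(3) by simp
  also have "S = (\<Sum>j<n. real (\<alpha> j) * u j) / real m"
    by (simp add: S_def sum_divide_distrib)
  finally show ?thesis .
qed

section \<open>Polynomials on the polydisc\<close>

definition polydisc_bound :: "nat \<Rightarrow> nat \<Rightarrow> ((nat \<Rightarrow> nat) \<Rightarrow> complex) \<Rightarrow> real \<Rightarrow> bool" where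
  "polydisc_bound m n c B \<longleftrightarrow>
     (\<forall>z. (\<forall>j<n. norm (z j) \<le> 1) \<longrightarrow> norm (poly_eval m n c z) \<le> B)"

lemma polydisc_boundD:
  "polydisc_bound m n c B \<Longrightarrow> (\<And>j. j < n \<Longrightarrow> norm (z j) \<le> 1) \<Longrightarrow> norm (poly_eval m n c z) \<le> B"
  by (simp add: polydisc_bound_def)

lemma polydisc_bound_nonneg: "polydisc_bound m n c B \<Longrightarrow> B \<ge> 0"
  by (rule order_trans[OF norm_ge_zero, OF polydisc_boundD[of m n c B "\<lambda>_. 0"]]) auto

lemma poly_eval_scale: "poly_eval m n c (\<lambda>j. t * z j) = t ^ m * poly_eval m n c z"
  unfolding poly_eval_monomial monomial_mult sum_distrib_left
  by (intro sum.cong refl) (simp add: monomial_const)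

lemma polydisc_bound_scale:
  assumes "polydisc_bound m n c B" "R \<ge> 0" "\<And>j. j < n \<Longrightarrow> norm (z j) \<le> R"
  shows "norm (poly_eval m n c z) \<le> B * R ^ m"
proof (cases "R = 0")
  case True
  show ?thesis
  proof (cases "m = 0")
    case True
    have "norm (poly_eval m n c z) \<le> B"
      by (rule polydisc_boundD[OF assms(1)]) (use assms(3) \<open>R = 0\<close> in force)
    then show ?thesis using True by simp
  next
    case False
    have "monomial n z \<alpha> = 0" if "\<alpha> \<in> multi_indices m n" for \<alpha>
    proof -
      obtain j where j: "j < n" "\<alpha> j \<noteq> 0"
        using multi_indices_sum[OF \<open>\<alpha> \<in> multi_indices m n\<close>] False by (metis lessThan_iff sum.neutral)
      moreover have "z j = 0" using assms(3)[of j] \<open>R = 0\<close> j by auto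
      ultimately show ?thesis unfolding monomial_def by (intro prod_zero) auto
    qed
    then show ?thesis using False True by (simp add: poly_eval_monomial power_0_left)
  qed
next
  case False
  then have "R > 0" using assms by auto
  have "poly_eval m n c z = poly_eval m n c (\<lambda>j. of_real R * (z j / of_real R))"
    using \<open>R > 0\<close> by simp
  also have "\<dots> = of_real R ^ m * poly_eval m n c (\<lambda>j. z j / of_real R)"
    by (rule poly_eval_scale)
  finally have "norm (poly_eval m n c z) = R ^ m * norm (poly_eval m n c (\<lambda>j. z j / of_real R))"
    using \<open>R > 0\<close> by (simp add: norm_mult norm_power)
  also have "\<dots> \<le> R ^ m * B"
    by (intro mult_left_mono polydisc_boundD[OF assms(1)])
       (use assms(3) \<open>R > 0\<close> in \<open>auto simp: norm_divide field_simps\<close>)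
  finally show ?thesis by (simp add: mult.commute)
qed

section \<open>The norms on the balls\<close>

lemma lp_norm_le_1_iff:
  assumes "r > 0"
  shows "lp_norm (ereal r) n z \<le> 1 \<longleftrightarrow> (\<Sum>j<n. norm (z j) powr r) \<le> 1"
proof -
  define S where "S = (\<Sum>j<n. norm (z j) powr r)"
  have "S \<ge> 0" unfolding S_def by (intro sum_nonneg) auto
  then have "S powr (1 / r) \<le> 1 \<longleftrightarrow> S \<le> 1"
    using assms powr_le1[of "1/r" S] powr_less_mono2[of "1/r" 1 S] by (cases "S \<le> 1") (simp_all add: not_le)
  then show ?thesis by (simp add: lp_norm_def S_def)
qed

lemma lp_norm_infinity_le_1_iff:
  "n \<ge> 1 \<Longrightarrow> lp_norm \<infinity> n z \<le> 1 \<longleftrightarrow> (\<forall>j<n. norm (z j) \<le> 1)"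
proof -
  assume "n \<ge> 1"
  then have "(\<lambda>j. norm (z j)) ` {..<n} \<noteq> {}" by (auto simp: lessThan_empty_iff)
  then show ?thesis using Max_le_iff[of "(\<lambda>j. norm (z j)) ` {..<n}" 1] by (auto simp: lp_norm_def)
qed

lemma lp_norm_le_1_imp:
  assumes "n \<ge> 1" "p > 0" "lp_norm p n z \<le> 1" "j < n"
  shows "norm (z j) \<le> 1"
proof (cases p)
  case (real r)
  then have r: "r > 0" using assms by simp
  have "norm (z j) powr r \<le> (\<Sum>j<n. norm (z j) powr r)"
    by (rule member_le_sum) (use assms in auto)
  also have "\<dots> \<le> 1" using assms lp_norm_le_1_iff[OF r] real by simp
  finally show ?thesis using r
    by (smt (verit) norm_ge_zero powr_less_mono2 powr_one_eq_one)
qed (use assms lp_norm_infinity_le_1_iff in auto)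

lemma norm_poly_eval_le_sum:
  assumes "\<And>j. j < n \<Longrightarrow> norm (z j) \<le> 1"
  shows "norm (poly_eval m n a z) \<le> (\<Sum>\<alpha>\<in>multi_indices m n. norm (a \<alpha>))"
  unfolding poly_eval_monomial
proof (rule sum_norm_le)
  fix \<alpha> assume "\<alpha> \<in> multi_indices m n"
  have "norm (monomial n z \<alpha>) \<le> 1"
    unfolding norm_monomial by (intro monomial_le_1) (use assms in auto)
  then show "norm (a \<alpha> * monomial n z \<alpha>) \<le> norm (a \<alpha>)"
    by (simp add: norm_mult mult_left_le)
qed

lemma bdd_above_poly_norm:
  assumes "n \<ge> 1" "p > 0"
  shows "bdd_above ((\<lambda>z. norm (poly_eval m n a z)) ` {z. lp_norm p n z \<le> 1})"
  by (rule bdd_aboveI2[of _ _ "\<Sum>\<alpha>\<in>multi_indices m n. norm (a \<alpha>)"])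
     (auto intro!: norm_poly_eval_le_sum lp_norm_le_1_imp[OF assms])

lemma norm_poly_eval_le_poly_norm:
  assumes "n \<ge> 1" "p > 0" "lp_norm p n z \<le> 1"
  shows "norm (poly_eval m n a z) \<le> poly_norm p m n a"
  unfolding poly_norm_def by (rule cSUP_upper[OF _ bdd_above_poly_norm]) (use assms in auto)

lemma poly_norm_leI:
  assumes "n \<ge> 1" "p > 0" "\<And>z. lp_norm p n z \<le> 1 \<Longrightarrow> norm (poly_eval m n a z) \<le> B"
  shows "poly_norm p m n a \<le> B"
proof -
  have "lp_norm p n (\<lambda>_. 0) \<le> 1"
    using assms(1,2) by (cases p) (auto simp: lp_norm_infinity_le_1_iff lp_norm_le_1_iff)
  then show ?thesis unfolding poly_norm_def by (intro cSUP_least) (use assms in auto)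
qed

lemma poly_norm_nonneg: "n \<ge> 1 \<Longrightarrow> p > 0 \<Longrightarrow> poly_norm p m n a \<ge> 0"
proof -
  assume "n \<ge> 1" "p > 0"
  have "lp_norm p n (\<lambda>_. 0) \<le> 1"
    using \<open>n \<ge> 1\<close> \<open>p > 0\<close> by (cases p) (auto simp: lp_norm_infinity_le_1_iff lp_norm_le_1_iff)
  from norm_poly_eval_le_poly_norm[OF \<open>n \<ge> 1\<close> \<open>p > 0\<close> this, of m a]
  show ?thesis by (rule order_trans[OF norm_ge_zero])
qed

text \<open>
  The map \<open>z \<mapsto> (x\<^sub>j z\<^sub>j)\<close> sends the polydisc into the unit ball of \<open>\<ell>\<^sub>r\<close>.
\<close>

lemma polydisc_bound_rescaled:
  assumes "n \<ge> 1" "r > 0" "\<And>j. j < n \<Longrightarrow> x j \<ge> 0" "(\<Sum>j<n. x j powr r) \<le> 1"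
  shows "polydisc_bound m n (\<lambda>\<alpha>. a \<alpha> * of_real (monomial n x \<alpha>)) (poly_norm (ereal r) m n a)"
  unfolding polydisc_bound_def
proof (intro allI impI)
  fix z :: "nat \<Rightarrow> complex" assume z: "\<forall>j<n. norm (z j) \<le> 1"
  have "poly_eval m n (\<lambda>\<alpha>. a \<alpha> * of_real (monomial n x \<alpha>)) z
      = poly_eval m n a (\<lambda>j. of_real (x j) * z j)"
    by (simp add: poly_eval_monomial monomial_mult monomial_of_real mult.assoc)
  also have "norm \<dots> \<le> poly_norm (ereal r) m n a"
  proof (rule norm_poly_eval_le_poly_norm)
    have "(\<Sum>j<n. norm (of_real (x j) * z j) powr r) \<le> (\<Sum>j<n. x j powr r)"
    proof (intro sum_mono powr_mono2)
      fix j assume "j \<in> {..<n}"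
      then show "norm (of_real (x j) * z j) \<le> x j"
        using assms(3) z by (simp add: norm_mult mult_left_le)
    qed (use assms in auto)
    then show "lp_norm (ereal r) n (\<lambda>j. of_real (x j) * z j) \<le> 1"
      using assms by (simp add: lp_norm_le_1_iff)
  qed (use assms in auto)
  finally show "norm (poly_eval m n (\<lambda>\<alpha>. a \<alpha> * of_real (monomial n x \<alpha>)) z)
    \<le> poly_norm (ereal r) m n a" .
qed

lemma polydisc_bound_infinity:
  "n \<ge> 1 \<Longrightarrow> polydisc_bound m n a (poly_norm \<infinity> m n a)"
  unfolding polydisc_bound_def
  by (auto intro!: norm_poly_eval_le_poly_norm simp: lp_norm_infinity_le_1_iff)

section \<open>Averages over roots of unity\<close>

definition unity_root :: "nat \<Rightarrow> complex" where
  "unity_root N = cis (2 * pi / real N)"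

lemma norm_unity_root [simp]: "norm (unity_root N) = 1"
  by (simp add: unity_root_def)

lemma unity_root_power_self: "N > 0 \<Longrightarrow> unity_root N ^ N = 1"
  by (simp add: unity_root_def Complex.DeMoivre)

lemma unity_root_power_eq_1_iff:
  assumes "N > 0" shows "unity_root N ^ k = 1 \<longleftrightarrow> N dvd k"
proof
  assume "N dvd k" then show "unity_root N ^ k = 1"
    by (metis assms dvd_def power_mult power_one unity_root_power_self)
next
  assume "unity_root N ^ k = 1"
  then have "exp (2 * of_real pi * \<i> * of_nat k / of_nat N) = 1"
    by (simp add: unity_root_def cis_conv_exp mult_ac flip: exp_of_nat_mult)
  then show "N dvd k"
    using complex_root_unity_eq_1[of N k] assms by simp
qed

text \<open>
  The range of summation may be any multiple \<open>L\<close> of the order \<open>N\<close>, so that roots of unity of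
  different orders can be averaged over a common range.
\<close>

lemma sum_unity_root_powers:
  assumes "N > 0" "N dvd L"
  shows "(\<Sum>i<L. (unity_root N ^ i) ^ k) = (if N dvd k then of_nat L else 0)"
proof (cases "N dvd k")
  case True
  then have "(unity_root N ^ i) ^ k = 1" for i
    using unity_root_power_eq_1_iff[OF assms(1)] by (metis dvd_triv_left mult.commute power_mult power_one)
  then show ?thesis using True by simp
next
  case False
  define x where "x = unity_root N ^ k"
  have "x \<noteq> 1" using False unity_root_power_eq_1_iff[OF assms(1)] by (simp add: x_def)
  have "x ^ L = 1"
    unfolding x_def using unity_root_power_eq_1_iff[OF assms(1), of "k * L"] assms(2)
    by (simp add: power_mult)
  have "(\<Sum>i<L. (unity_root N ^ i) ^ k) = (\<Sum>i<L. x ^ i)"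
    by (simp add: x_def mult.commute flip: power_mult)
  also have "\<dots> = 0" using \<open>x \<noteq> 1\<close> \<open>x ^ L = 1\<close> by (simp add: geometric_sum)
  finally show ?thesis using False by simp
qed

lemma sum_unity_root_orthogonal:
  assumes "a < N" "b < N"
  shows "(\<Sum>i<N. (unity_root N ^ i) ^ a * cnj ((unity_root N ^ i) ^ b)) = (if a = b then of_nat N else 0)"
proof -
  have N: "N > 0" using assms by auto
  have *: "(unity_root N ^ i) ^ a * cnj ((unity_root N ^ i) ^ b) = (unity_root N ^ i) ^ (a + (N - b))" for i
  proof -
    define x where "x = (unity_root N ^ i) ^ b"
    have "norm x = 1" by (simp add: x_def norm_power)
    then have x: "x * cnj x = 1" by (simp flip: complex_norm_square)
    have "x * (unity_root N ^ i) ^ (N - b) = (unity_root N ^ N) ^ i"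
    proof -
      have "i * b + i * (N - b) = N * i"
        using assms(2) by (simp flip: distrib_left)
      then show ?thesis unfolding x_def by (simp flip: power_add power_mult)
    qed
    also have "\<dots> = 1" by (simp add: unity_root_power_self[OF N])
    finally have y: "x * (unity_root N ^ i) ^ (N - b) = 1" .
    have "cnj x = cnj x * (x * (unity_root N ^ i) ^ (N - b))" by (simp only: y mult_1_right)
    also have "\<dots> = (x * cnj x) * (unity_root N ^ i) ^ (N - b)" by (simp only: mult_ac)
    finally have "cnj x = (unity_root N ^ i) ^ (N - b)" by (simp only: x mult_1_left)
    then show ?thesis by (simp add: power_add x_def)
  qed
  have "N dvd a + (N - b) \<longleftrightarrow> a = b"
  proof
    assume "N dvd a + (N - b)"
    then obtain k where k: "a + (N - b) = N * k" by auto
    have "N * k < N * 2" "N * 0 < N * k" using k assms by linarith+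
    then have "k < 2" "0 < k" unfolding mult_less_cancel1 by blast+
    then have "k = 1" by simp
    then show "a = b" using k assms by simp
  qed (use assms in auto)
  then show ?thesis
    unfolding * using sum_unity_root_powers[OF N, of N "a + (N - b)"] by simp
qed

lemma lessThan_eq_atMost: "N > 0 \<Longrightarrow> {..<N} = {..N - (1::nat)}"
  by (metis Suc_pred' lessThan_Suc_atMost)

lemma grid_orthogonal:
  assumes "\<And>j. j < n \<Longrightarrow> \<alpha> j < N" "\<And>j. j < n \<Longrightarrow> \<beta> j < N" "N > 0"
  shows "(\<Sum>i\<in>exponent_box n (N - 1). monomial n (\<lambda>j. unity_root N ^ i j) \<alpha> *
            cnj (monomial n (\<lambda>j. unity_root N ^ i j) \<beta>))
       = (if \<forall>j<n. \<alpha> j = \<beta> j then of_nat N ^ n else 0)"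
proof -
  have "(\<Sum>i\<in>exponent_box n (N - 1). monomial n (\<lambda>j. unity_root N ^ i j) \<alpha> *
            cnj (monomial n (\<lambda>j. unity_root N ^ i j) \<beta>))
      = (\<Sum>i\<in>exponent_box n (N - 1). \<Prod>j<n. (unity_root N ^ i j) ^ \<alpha> j * cnj ((unity_root N ^ i j) ^ \<beta> j))"
    by (simp add: monomial_def prod.distrib)
  also have "\<dots> = (\<Prod>j<n. \<Sum>l\<le>N-1. (unity_root N ^ l) ^ \<alpha> j * cnj ((unity_root N ^ l) ^ \<beta> j))"
    by (rule sum_prod_exponent_box)
  also have "\<dots> = (\<Prod>j<n. if \<alpha> j = \<beta> j then of_nat N else 0)"
    using assms sum_unity_root_orthogonal[of "\<alpha> _" N "\<beta> _"]
    unfolding lessThan_eq_atMost[OF assms(3), symmetric] by (intro prod.cong refl) simp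
  also have "\<dots> = (if \<forall>j<n. \<alpha> j = \<beta> j then of_nat N ^ n else 0)"
    by (auto intro!: prod_zero)
  finally show ?thesis .
qed

lemma grid_parseval:
  assumes "A \<subseteq> exponent_box n d" "d < N"
  shows "(\<Sum>i\<in>exponent_box n (N - 1). (norm (\<Sum>\<alpha>\<in>A. c \<alpha> * monomial n (\<lambda>j. unity_root N ^ i j) \<alpha>))\<^sup>2)
       = real N ^ n * (\<Sum>\<alpha>\<in>A. (norm (c \<alpha>))\<^sup>2)"
proof -
  have "finite A" using assms(1) finite_subset by blast
  define w where "w i \<alpha> = monomial n (\<lambda>j. unity_root N ^ i j) \<alpha>" for i :: "nat \<Rightarrow> nat" and \<alpha>
  have "complex_of_real (\<Sum>i\<in>exponent_box n (N - 1). (norm (\<Sum>\<alpha>\<in>A. c \<alpha> * w i \<alpha>))\<^sup>2)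
      = (\<Sum>i\<in>exponent_box n (N - 1). (\<Sum>\<alpha>\<in>A. c \<alpha> * w i \<alpha>) * cnj (\<Sum>\<alpha>\<in>A. c \<alpha> * w i \<alpha>))"
    by (simp only: of_real_sum complex_norm_square)
  also have "\<dots> = (\<Sum>i\<in>exponent_box n (N - 1). \<Sum>\<alpha>\<in>A. \<Sum>\<beta>\<in>A. c \<alpha> * cnj (c \<beta>) * (w i \<alpha> * cnj (w i \<beta>)))"
    by (simp add: sum_product mult_ac)
  also have "\<dots> = (\<Sum>\<alpha>\<in>A. \<Sum>\<beta>\<in>A. c \<alpha> * cnj (c \<beta>) * (\<Sum>i\<in>exponent_box n (N - 1). w i \<alpha> * cnj (w i \<beta>)))"
    unfolding sum_distrib_left
    by (subst sum.swap, rule sum.cong[OF refl], rule sum.swap)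
  also have "\<dots> = (\<Sum>\<alpha>\<in>A. \<Sum>\<beta>\<in>A. if \<alpha> = \<beta> then c \<alpha> * cnj (c \<beta>) * of_nat N ^ n else 0)"
  proof (intro sum.cong refl)
    fix \<alpha> \<beta> assume "\<alpha> \<in> A" "\<beta> \<in> A"
    then have "\<alpha> \<in> exponent_box n d" "\<beta> \<in> exponent_box n d" using assms by auto
    then have b: "\<And>j. j < n \<Longrightarrow> \<alpha> j < N" "\<And>j. j < n \<Longrightarrow> \<beta> j < N"
      and e: "(\<forall>j<n. \<alpha> j = \<beta> j) \<longleftrightarrow> \<alpha> = \<beta>"
      using assms(2) by (auto simp: exponent_box_def fun_eq_iff) (metis not_le)+
    show "c \<alpha> * cnj (c \<beta>) * (\<Sum>i\<in>exponent_box n (N - 1). w i \<alpha> * cnj (w i \<beta>))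
        = (if \<alpha> = \<beta> then c \<alpha> * cnj (c \<beta>) * of_nat N ^ n else 0)"
      unfolding w_def using grid_orthogonal[of n \<alpha> N \<beta>] b e assms(2) by auto
  qed
  also have "\<dots> = (\<Sum>\<alpha>\<in>A. of_real ((norm (c \<alpha>))\<^sup>2) * of_nat N ^ n)"
    using \<open>finite A\<close> by (simp add: complex_norm_square del: of_real_power)
  also have "\<dots> = complex_of_real (real N ^ n * (\<Sum>\<alpha>\<in>A. (norm (c \<alpha>))\<^sup>2))"
    by (simp add: sum_distrib_left mult.commute)
  finally show ?thesis unfolding of_real_eq_iff w_def .
qed

lemma norm_unity_root_power [simp]: "norm (unity_root N ^ i) = 1"
  by (simp add: norm_power)

text \<open>
  Cauchy's estimate for one coefficient, with the contour integral replaced by the mean over the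
  roots of unity of order \<open>d + 1\<close>.
\<close>

lemma cauchy_estimate_poly:
  fixes c :: "nat \<Rightarrow> complex"
  assumes "\<And>w. norm w = 1 \<Longrightarrow> norm (\<Sum>k\<le>d. c k * (of_real r * w) ^ k) \<le> B" "k \<le> d" "r > 0"
  shows "norm (c k) * r ^ k \<le> B"
proof -
  define N where "N = Suc d"
  define u where "u i = unity_root N ^ i" for i
  have N: "d < N" "N > 0" by (auto simp: N_def)
  have [simp]: "norm (u i) = 1" for i by (simp add: u_def)
  have "(\<Sum>i<N. (\<Sum>l\<le>d. c l * (of_real r * u i) ^ l) * cnj (u i ^ k))
      = (\<Sum>i<N. \<Sum>l\<le>d. (c l * of_real r ^ l) * (u i ^ l * cnj (u i ^ k)))"
    unfolding sum_distrib_right by (intro sum.cong refl) (simp add: power_mult_distrib)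
  also have "\<dots> = (\<Sum>l\<le>d. (c l * of_real r ^ l) * (\<Sum>i<N. u i ^ l * cnj (u i ^ k)))"
    unfolding sum_distrib_left by (rule sum.swap)
  also have "\<dots> = (\<Sum>l\<le>d. if l = k then (c l * of_real r ^ l) * of_nat N else 0)"
  proof (intro sum.cong refl)
    fix l assume "l \<in> {..d}"
    then show "(c l * of_real r ^ l) * (\<Sum>i<N. u i ^ l * cnj (u i ^ k))
        = (if l = k then (c l * of_real r ^ l) * of_nat N else 0)"
      using sum_unity_root_orthogonal[of l N k] assms(2) N unfolding u_def by simp
  qed
  also have "\<dots> = c k * of_real r ^ k * of_nat N" using assms(2) by simp
  finally have "norm (c k * of_real r ^ k * of_nat N)
      = norm (\<Sum>i<N. (\<Sum>l\<le>d. c l * (of_real r * u i) ^ l) * cnj (u i ^ k))" by simp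
  also have "\<dots> \<le> (\<Sum>i<N. B)"
    by (intro sum_norm_le) (use assms(1) in \<open>auto simp: norm_mult norm_power\<close>)
  finally have "(norm (c k) * r ^ k) * real N \<le> B * real N"
    using assms(3) by (simp add: norm_mult norm_power mult_ac)
  then show ?thesis using N by simp
qed

section \<open>Hoelder's inequality and averaging families\<close>

text \<open>
  Young's inequality for each term, after both sums are normalised to \<open>1\<close>.
\<close>

lemma holder_sum:
  fixes a b :: "'i \<Rightarrow> real"
  assumes "finite I" "\<And>i. i \<in> I \<Longrightarrow> a i \<ge> 0" "\<And>i. i \<in> I \<Longrightarrow> b i \<ge> 0" "0 \<le> \<theta>" "\<theta> \<le> 1"
  shows "(\<Sum>i\<in>I. a i powr \<theta> * b i powr (1 - \<theta>)) \<le> (\<Sum>i\<in>I. a i) powr \<theta> * (\<Sum>i\<in>I. b i) powr (1 - \<theta>)"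
proof -
  define A B where "A = (\<Sum>i\<in>I. a i)" and "B = (\<Sum>i\<in>I. b i)"
  have AB: "A \<ge> 0" "B \<ge> 0" unfolding A_def B_def using assms by (auto intro: sum_nonneg)
  show ?thesis
  proof (cases "A = 0 \<or> B = 0")
    case True
    then have "a i powr \<theta> * b i powr (1 - \<theta>) = 0" if "i \<in> I" for i
      using that assms sum_nonneg_eq_0_iff[OF assms(1), of a] sum_nonneg_eq_0_iff[OF assms(1), of b]
      unfolding A_def B_def by auto
    then show ?thesis by (simp add: sum.neutral)
  next
    case False
    then have pos: "A > 0" "B > 0" using AB by auto
    have "(\<Sum>i\<in>I. a i powr \<theta> * b i powr (1 - \<theta>))
        \<le> (\<Sum>i\<in>I. (A powr \<theta> * B powr (1 - \<theta>)) * (\<theta> * (a i / A) + (1 - \<theta>) * (b i / B)))"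
    proof (intro sum_mono)
      fix i assume i: "i \<in> I"
      have "(a i / A) powr \<theta> * (b i / B) powr (1 - \<theta>) \<le> \<theta> * (a i / A) + (1 - \<theta>) * (b i / B)"
      proof (cases "a i = 0 \<or> b i = 0")
        case True
        then show ?thesis using assms pos i by auto
      next
        case False
        then show ?thesis using assms pos i
          by (intro Youngs_inequality_0) (auto simp: less_le)
      qed
      then have "(A powr \<theta> * B powr (1 - \<theta>)) * ((a i / A) powr \<theta> * (b i / B) powr (1 - \<theta>))
          \<le> (A powr \<theta> * B powr (1 - \<theta>)) * (\<theta> * (a i / A) + (1 - \<theta>) * (b i / B))"
        by (intro mult_left_mono) auto
      moreover have "(A powr \<theta> * B powr (1 - \<theta>)) * ((a i / A) powr \<theta> * (b i / B) powr (1 - \<theta>))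
          = a i powr \<theta> * b i powr (1 - \<theta>)"
        using pos assms(2,3)[OF i] by (simp add: powr_divide)
      ultimately show "a i powr \<theta> * b i powr (1 - \<theta>)
          \<le> (A powr \<theta> * B powr (1 - \<theta>)) * (\<theta> * (a i / A) + (1 - \<theta>) * (b i / B))" by simp
    qed
    also have "\<dots> = (A powr \<theta> * B powr (1 - \<theta>)) * (\<theta> * (A / A) + (1 - \<theta>) * (B / B))"
      unfolding A_def B_def
      by (simp only: sum_distrib_left[symmetric] sum.distrib sum_divide_distrib[symmetric])
    also have "\<dots> = A powr \<theta> * B powr (1 - \<theta>)" using pos by simp
    finally show ?thesis by (simp add: A_def B_def)
  qed
qed

text \<open>
  A family \<open>\<Phi>\<close> of vectors is averaging if the \<open>\<ell>\<^sub>q\<close> norm of a coefficient vector, with weights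
  \<open>\<omega>\<close>, is at most some mean over \<open>\<phi> \<in> \<Phi>\<close> of \<open>|\<Sum>\<^sub>l c\<^sub>l \<phi>\<^sub>l|\<close>, with the same mean for all
  \<open>c\<close>. The definition keeps only what is used of the mean: for finitely many coefficient vectors with
  weights, a single \<open>\<phi>\<close> does at least as well as the mean. The index set consists of pairs, since
  \<open>averaging_minkowski\<close> is applied to an outer sum over \<open>k\<close> and an inner sum over multi-indices.
\<close>

definition averaging :: "(nat \<Rightarrow> complex) set \<Rightarrow> (nat \<Rightarrow> real) \<Rightarrow> nat \<Rightarrow> real \<Rightarrow> bool" where
  "averaging \<Phi> \<omega> d q \<longleftrightarrow>
     (\<forall>(I :: (nat \<times> (nat \<Rightarrow> nat)) set) lam c. finite I \<longrightarrow> (\<forall>i\<in>I. lam i \<ge> 0) \<longrightarrow>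
        (\<exists>\<phi>\<in>\<Phi>. (\<Sum>i\<in>I. lam i * (\<Sum>l\<le>d. \<omega> l * norm (c i l) powr q) powr (1 / q))
                \<le> (\<Sum>i\<in>I. lam i * norm (\<Sum>l\<le>d. c i l * \<phi> l))))"

lemma averagingD:
  fixes I :: "(nat \<times> (nat \<Rightarrow> nat)) set"
  assumes "averaging \<Phi> \<omega> d q" "finite I" "\<And>i. i \<in> I \<Longrightarrow> lam i \<ge> 0"
  shows "\<exists>\<phi>\<in>\<Phi>. (\<Sum>i\<in>I. lam i * (\<Sum>l\<le>d. \<omega> l * norm (c i l) powr q) powr (1 / q))
       \<le> (\<Sum>i\<in>I. lam i * norm (\<Sum>l\<le>d. c i l * \<phi> l))"
  by (rule assms(1)[unfolded averaging_def, rule_format, of I lam c]) (use assms(2,3) in auto)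

text \<open>
  In integral form this is Minkowski's inequality: an \<open>\<ell>\<^sub>q\<close> norm over \<open>j\<close> of means is at most the mean
  of the \<open>\<ell>\<^sub>q\<close> norms. As a single \<open>\<phi>\<close> is required, the outer norm is first replaced by a linear
  functional that is tangent to it at the vector of the values \<open>e k j\<close>; the hypothesis applies to the
  linear functional, and Hoelder's inequality bounds the functional by the norm.
\<close>

lemma averaging_minkowski:
  fixes K :: "nat set" and J :: "(nat \<Rightarrow> nat) set"
  assumes av: "averaging \<Phi> \<omega> d q" and q: "q > 1" and fin: "finite K" "finite J"
    and W: "\<And>j. j \<in> J \<Longrightarrow> W j \<ge> 0" and \<omega>: "\<And>l. \<omega> l \<ge> 0"
  shows "\<exists>\<phi>\<in>\<Phi>. (\<Sum>k\<in>K. (\<Sum>j\<in>J. W j * (\<Sum>l\<le>d. \<omega> l * norm (c k j l) powr q)) powr (1 / q))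
               \<le> (\<Sum>k\<in>K. (\<Sum>j\<in>J. W j * norm (\<Sum>l\<le>d. c k j l * \<phi> l) powr q) powr (1 / q))"
proof -
  define E where "E k j = (\<Sum>l\<le>d. \<omega> l * norm (c k j l) powr q)" for k j
  define e where "e k j = E k j powr (1 / q)" for k j
  define N where "N k = (\<Sum>j\<in>J. W j * E k j) powr (1 / q)" for k
  \<comment> \<open>the gradient of the weighted norm \<open>N k\<close> with respect to the values \<open>e k j\<close>\<close>
  define lam where "lam = (\<lambda>(k, j). W j * e k j powr (q - 1) / N k powr (q - 1))"
  have E0: "E k j \<ge> 0" for k j unfolding E_def using \<omega> by (intro sum_nonneg) auto
  have eq: "e k j powr q = E k j" for k j using q E0[of k j] by (simp add: e_def powr_powr)
  have WE0: "(\<Sum>j\<in>J. W j * E k j) \<ge> 0" for k using W E0 by (intro sum_nonneg) auto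
  have Nq: "N k powr q = (\<Sum>j\<in>J. W j * E k j)" for k
    using q WE0[of k] by (simp add: N_def powr_powr)
  have N0: "N k \<ge> 0" "e k j \<ge> 0" for k j by (simp_all add: N_def e_def)
  have "\<exists>\<phi>\<in>\<Phi>. (\<Sum>i\<in>K \<times> J. lam i * (\<Sum>l\<le>d. \<omega> l * norm (c (fst i) (snd i) l) powr q) powr (1 / q))
       \<le> (\<Sum>i\<in>K \<times> J. lam i * norm (\<Sum>l\<le>d. c (fst i) (snd i) l * \<phi> l))"
    by (rule averagingD[OF av]) (use fin W in \<open>auto simp: lam_def\<close>)
  then obtain \<phi> where \<phi>: "\<phi> \<in> \<Phi>"
    "(\<Sum>i\<in>K \<times> J. lam i * (\<Sum>l\<le>d. \<omega> l * norm (c (fst i) (snd i) l) powr q) powr (1 / q))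
       \<le> (\<Sum>i\<in>K \<times> J. lam i * norm (\<Sum>l\<le>d. c (fst i) (snd i) l * \<phi> l))"
    by (rule bexE)
  define f where "f k j = norm (\<Sum>l\<le>d. c k j l * \<phi> l)" for k j
  have main: "(\<Sum>k\<in>K. \<Sum>j\<in>J. lam (k, j) * e k j) \<le> (\<Sum>k\<in>K. \<Sum>j\<in>J. lam (k, j) * f k j)"
    using \<phi>(2) by (simp add: sum.cartesian_product e_def E_def f_def case_prod_unfold)
  have "(\<Sum>k\<in>K. N k) = (\<Sum>k\<in>K. \<Sum>j\<in>J. lam (k, j) * e k j)"
  proof (intro sum.cong refl)
    fix k
    have "(\<Sum>j\<in>J. lam (k, j) * e k j) = (\<Sum>j\<in>J. W j * E k j / N k powr (q - 1))"
    proof (intro sum.cong refl)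
      fix j
      have "e k j powr (q - 1) * e k j = e k j powr q"
        using N0(2)[of k j] q powr_add[of "e k j" "q - 1" 1] by (cases "e k j = 0") auto
      then show "lam (k, j) * e k j = W j * E k j / N k powr (q - 1)"
        by (simp add: lam_def mult.assoc eq)
    qed
    also have "\<dots> = N k powr q / N k powr (q - 1)" by (simp add: Nq flip: sum_divide_distrib)
    also have "\<dots> = N k"
      using N0(1)[of k] powr_diff[of "N k" q "q - 1"] by (cases "N k = 0") auto
    finally show "N k = (\<Sum>j\<in>J. lam (k, j) * e k j)" by simp
  qed
  also note main
  also have "(\<Sum>k\<in>K. \<Sum>j\<in>J. lam (k, j) * f k j) \<le> (\<Sum>k\<in>K. (\<Sum>j\<in>J. W j * f k j powr q) powr (1 / q))"
  proof (intro sum_mono)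
    fix k
    show "(\<Sum>j\<in>J. lam (k, j) * f k j) \<le> (\<Sum>j\<in>J. W j * f k j powr q) powr (1 / q)"
    proof (cases "N k = 0")
      case True then show ?thesis by (simp add: lam_def)
    next
      case False
      then have Np: "N k > 0" using N0(1)[of k] by auto
      have "(\<Sum>j\<in>J. lam (k, j) * f k j)
          = (\<Sum>j\<in>J. (W j * f k j powr q) powr (1 / q) * (W j * E k j / N k powr q) powr (1 - 1 / q))"
      proof (intro sum.cong refl)
        fix j assume j: "j \<in> J"
        have "(f k j powr q) powr (1 / q) = f k j" using q by (simp add: powr_powr f_def)
        moreover have "E k j powr (1 - 1 / q) = e k j powr (q - 1)"
          using q by (simp add: e_def powr_powr divide_simps)
        moreover have "(N k powr q) powr (1 - 1 / q) = N k powr (q - 1)"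
          using q by (simp add: powr_powr right_diff_distrib)
        moreover have "W j powr (1 / q) * W j powr (1 - 1 / q) = W j"
          using W[OF j] powr_add[of "W j" "1/q" "1 - 1/q"] by (cases "W j = 0") auto
        ultimately show "lam (k, j) * f k j
          = (W j * f k j powr q) powr (1 / q) * (W j * E k j / N k powr q) powr (1 - 1 / q)"
          using W[OF j] E0[of k j]
          by (simp add: lam_def powr_mult powr_divide flip: mult.assoc)
      qed
      also have "\<dots> \<le> (\<Sum>j\<in>J. W j * f k j powr q) powr (1 / q)
                   * (\<Sum>j\<in>J. W j * E k j / N k powr q) powr (1 - 1 / q)"
        by (rule holder_sum) (use fin W E0 q in auto)
      also have "(\<Sum>j\<in>J. W j * E k j / N k powr q) = 1"
        using Np by (simp add: Nq[symmetric] flip: sum_divide_distrib)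
      finally show ?thesis by simp
    qed
  qed
  finally show ?thesis using \<phi>(1) unfolding N_def E_def f_def by blast
qed

text \<open>
  The coordinates are averaged one after the other: the induction hypothesis for \<open>n\<close> is applied to the
  coefficients that remain after the last coordinate has been evaluated at \<open>\<psi>\<close>.
\<close>

lemma averaging_iterate:
  fixes K :: "nat set"
  assumes "q > 1" "finite K" "\<And>j l. \<omega> j l \<ge> 0"
    and "\<And>j. j < n \<Longrightarrow> averaging (\<Phi> j) (\<omega> j) d q"
  shows "\<exists>\<phi>. (\<forall>j<n. \<phi> j \<in> \<Phi> j) \<and>
     (\<Sum>k\<in>K. (\<Sum>\<beta>\<in>exponent_box n d. (\<Prod>j<n. \<omega> j (\<beta> j)) * norm (r k \<beta>) powr q) powr (1 / q))
       \<le> (\<Sum>k\<in>K. norm (\<Sum>\<beta>\<in>exponent_box n d. r k \<beta> * (\<Prod>j<n. \<phi> j (\<beta> j))))"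
  using assms(4)
proof (induction n arbitrary: r)
  case 0
  show ?case using assms(1) by (simp add: powr_powr)
next
  case (Suc n)
  define W where "W \<beta> = (\<Prod>j<n. \<omega> j (\<beta> j))" for \<beta> :: "nat \<Rightarrow> nat"
  from averaging_minkowski[of "\<Phi> n" "\<omega> n" d q K "exponent_box n d" W "\<lambda>k \<beta> l. r k (\<beta>(n := l))"]
  obtain \<psi> where \<psi>: "\<psi> \<in> \<Phi> n"
    "(\<Sum>k\<in>K. (\<Sum>\<beta>\<in>exponent_box n d. W \<beta> * (\<Sum>l\<le>d. \<omega> n l * norm (r k (\<beta>(n := l))) powr q)) powr (1 / q))
     \<le> (\<Sum>k\<in>K. (\<Sum>\<beta>\<in>exponent_box n d. W \<beta> * norm (\<Sum>l\<le>d. r k (\<beta>(n := l)) * \<psi> l) powr q) powr (1 / q))"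
    using assms Suc.prems by (auto simp: W_def prod_nonneg)
  from Suc.IH[of "\<lambda>k \<beta>. \<Sum>l\<le>d. r k (\<beta>(n := l)) * \<psi> l"] Suc.prems
  obtain \<phi> where \<phi>: "\<forall>j<n. \<phi> j \<in> \<Phi> j"
    "(\<Sum>k\<in>K. (\<Sum>\<beta>\<in>exponent_box n d. W \<beta> * norm (\<Sum>l\<le>d. r k (\<beta>(n := l)) * \<psi> l) powr q) powr (1 / q))
     \<le> (\<Sum>k\<in>K. norm (\<Sum>\<beta>\<in>exponent_box n d. (\<Sum>l\<le>d. r k (\<beta>(n := l)) * \<psi> l) * (\<Prod>j<n. \<phi> j (\<beta> j))))"
    unfolding W_def by auto
  have 1: "(\<Sum>\<beta>\<in>exponent_box (Suc n) d. (\<Prod>j<Suc n. \<omega> j (\<beta> j)) * norm (r k \<beta>) powr q)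
     = (\<Sum>\<beta>\<in>exponent_box n d. W \<beta> * (\<Sum>l\<le>d. \<omega> n l * norm (r k (\<beta>(n := l))) powr q))" for k
    unfolding sum_exponent_box_Suc W_def by (simp add: sum_distrib_left mult.assoc)
  have 2: "(\<Sum>\<beta>\<in>exponent_box (Suc n) d. r k \<beta> * (\<Prod>j<Suc n. (\<phi>(n := \<psi>)) j (\<beta> j)))
     = (\<Sum>\<beta>\<in>exponent_box n d. (\<Sum>l\<le>d. r k (\<beta>(n := l)) * \<psi> l) * (\<Prod>j<n. \<phi> j (\<beta> j)))" for k
    unfolding sum_exponent_box_Suc sum_distrib_right by (intro sum.cong refl) (simp add: mult_ac)
  show ?case
    by (rule exI[of _ "\<phi>(n := \<psi>)"]) (use \<phi> \<psi> order_trans[OF \<psi>(2) \<phi>(2)] 1 2 in \<open>auto simp: less_Suc_eq\<close>)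
qed

text \<open>
  The family that evaluates a coordinate without averaging. It is used in the slot of a multilinear
  form that carries the outer sum.
\<close>

lemma averaging_trivial:
  assumes "q > 0"
  shows "averaging {\<lambda>l. if l = 0 then 1 else 0} (\<lambda>l. if l = 0 then 1 else 0) d q"
  using assms unfolding averaging_def
  by (simp add: if_distrib[of "\<lambda>x. _ * x"] if_distrib[of "\<lambda>x. x * _"] powr_powr cong: if_cong)

section \<open>Linear forms on the torus\<close>

text \<open>
  The third roots of unity have the same moments \<open>\<Sum> w = \<Sum> w\<^sup>2 = 0\<close> as the circle, and no others
  enter the second and the fourth moment of \<open>|c + r w|\<close>. A finite mean therefore suffices.
\<close>

lemma sum_third_roots_moments:
  fixes c r :: complex
  defines "w \<equiv> \<lambda>l. unity_root 3 ^ l"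
  shows "(\<Sum>l\<le>2. (norm (c + r * w l))\<^sup>2) = 3 * ((norm c)\<^sup>2 + (norm r)\<^sup>2)"
    and "(\<Sum>l\<le>2. (norm (c + r * w l)) ^ 4)
       = 3 * ((norm c) ^ 4 + 4 * (norm c)\<^sup>2 * (norm r)\<^sup>2 + (norm r) ^ 4)"
proof -
  define u where "u = cnj c * r"
  define C where "C = (norm c)\<^sup>2 + (norm r)\<^sup>2"
  have nw: "norm (w l) = 1" for l by (simp add: w_def)
  have sq: "(norm (c + r * w l))\<^sup>2 = C + 2 * Re (u * w l)" for l
  proof -
    have "(norm (c + r * w l))\<^sup>2 = (norm c)\<^sup>2 + (norm (r * w l))\<^sup>2 + 2 * Re (cnj c * (r * w l))"
      by (simp only: cmod_power2 plus_complex.sel cnj.sel times_complex.sel)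
         (simp add: power2_eq_square algebra_simps)
    then show ?thesis by (simp add: C_def u_def norm_mult nw mult.assoc)
  qed
  have resq: "(Re z)\<^sup>2 = ((norm z)\<^sup>2 + Re (z\<^sup>2)) / 2" for z
    by (simp only: cmod_power2) (simp add: power2_eq_square)
  have s1: "(\<Sum>l\<le>2. w l) = 0" and s2: "(\<Sum>l\<le>2. (w l)\<^sup>2) = 0"
    using sum_unity_root_powers[of 3 3 1] sum_unity_root_powers[of 3 3 2]
    by (simp_all add: w_def lessThan_eq_atMost[of 3])
  have S1: "(\<Sum>l\<le>2. Re (u * w l)) = 0"
  proof -
    have "(\<Sum>l\<le>2. Re (u * w l)) = Re (u * (\<Sum>l\<le>2. w l))"
      by (simp only: Re_sum sum_distrib_left)
    then show ?thesis by (simp only: s1) simp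
  qed
  have "(\<Sum>l\<le>2. Re ((u * w l)\<^sup>2)) = Re (u\<^sup>2 * (\<Sum>l\<le>2. (w l)\<^sup>2))"
    by (simp add: sum_distrib_left power_mult_distrib del: sum.atMost_Suc)
  then have S2: "(\<Sum>l\<le>2. Re ((u * w l)\<^sup>2)) = 0" by (simp only: s2) simp
  have "(\<Sum>l\<le>2. (Re (u * w l))\<^sup>2) = (\<Sum>l\<le>2. (norm u)\<^sup>2 / 2 + Re ((u * w l)\<^sup>2) / 2)"
    by (simp only: resq) (simp add: norm_mult nw add_divide_distrib)
  also have "\<dots> = 3 * (norm u)\<^sup>2 / 2"
    using S2 by (simp only: sum.distrib sum_divide_distrib[symmetric]) simp
  finally have S3: "(\<Sum>l\<le>2. (Re (u * w l))\<^sup>2) = 3 * (norm u)\<^sup>2 / 2" .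
  show "(\<Sum>l\<le>2. (norm (c + r * w l))\<^sup>2) = 3 * ((norm c)\<^sup>2 + (norm r)\<^sup>2)"
    using S1 by (simp only: sq sum.distrib sum_distrib_left[symmetric]) (simp add: C_def)
  have "(\<Sum>l\<le>2. (norm (c + r * w l)) ^ 4) = (\<Sum>l\<le>2. C\<^sup>2 + 4 * C * Re (u * w l) + 4 * (Re (u * w l))\<^sup>2)"
  proof (intro sum.cong refl)
    fix l
    have "(norm (c + r * w l)) ^ 4 = ((norm (c + r * w l))\<^sup>2)\<^sup>2" by simp
    also have "\<dots> = C\<^sup>2 + 4 * C * Re (u * w l) + 4 * (Re (u * w l))\<^sup>2"
      unfolding sq by (simp add: power2_eq_square algebra_simps)
    finally show "(norm (c + r * w l)) ^ 4 = C\<^sup>2 + 4 * C * Re (u * w l) + 4 * (Re (u * w l))\<^sup>2" .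
  qed
  also have "\<dots> = 3 * C\<^sup>2 + 6 * (norm u)\<^sup>2"
    using S1 S3 by (simp only: sum.distrib sum_distrib_left[symmetric]) simp
  also have "(norm u)\<^sup>2 = (norm c)\<^sup>2 * (norm r)\<^sup>2" by (simp add: u_def norm_mult power_mult_distrib)
  also have "3 * C\<^sup>2 + 6 * ((norm c)\<^sup>2 * (norm r)\<^sup>2)
    = 3 * ((norm c) ^ 4 + 4 * (norm c)\<^sup>2 * (norm r)\<^sup>2 + (norm r) ^ 4)"
    by (simp add: C_def power2_eq_square power4_eq_xxxx algebra_simps)
  finally show "(\<Sum>l\<le>2. (norm (c + r * w l)) ^ 4)
       = 3 * ((norm c) ^ 4 + 4 * (norm c)\<^sup>2 * (norm r)\<^sup>2 + (norm r) ^ 4)" .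
qed

lemma linear_form_moments:
  fixes c :: complex and r :: "nat \<Rightarrow> complex"
  defines "s n \<equiv> \<Sum>l<n. (norm (r l))\<^sup>2" and "t n \<equiv> \<Sum>l<n. (norm (r l)) ^ 4"
  shows "(\<Sum>i\<in>exponent_box n 2. (norm (c + (\<Sum>l<n. r l * unity_root 3 ^ i l)))\<^sup>2)
           = 3 ^ n * ((norm c)\<^sup>2 + s n)"
    and "(\<Sum>i\<in>exponent_box n 2. (norm (c + (\<Sum>l<n. r l * unity_root 3 ^ i l))) ^ 4)
           = 3 ^ n * ((norm c) ^ 4 + 4 * (norm c)\<^sup>2 * s n + 2 * (s n)\<^sup>2 - t n)"
proof -
  have "(\<Sum>i\<in>exponent_box n 2. (norm (c + (\<Sum>l<n. r l * unity_root 3 ^ i l)))\<^sup>2)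
           = 3 ^ n * ((norm c)\<^sup>2 + s n) \<and>
     (\<Sum>i\<in>exponent_box n 2. (norm (c + (\<Sum>l<n. r l * unity_root 3 ^ i l))) ^ 4)
           = 3 ^ n * ((norm c) ^ 4 + 4 * (norm c)\<^sup>2 * s n + 2 * (s n)\<^sup>2 - t n)"
  proof (induction n arbitrary: c)
    case 0 show ?case by (simp add: s_def t_def)
  next
    case (Suc n)
    have eq: "(\<Sum>i\<in>exponent_box (Suc n) 2. (norm (c + (\<Sum>l<Suc n. r l * unity_root 3 ^ i l))) ^ p)
      = (\<Sum>j\<le>2. \<Sum>i\<in>exponent_box n 2. (norm ((c + r n * unity_root 3 ^ j) + (\<Sum>l<n. r l * unity_root 3 ^ i l))) ^ p)" for p
      unfolding sum_exponent_box_Suc by (subst sum.swap) (simp add: add_ac del: sum.atMost_Suc)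
    define g where "g = norm c" define h where "h = norm (r n)"
    have sS: "s (Suc n) = s n + h\<^sup>2" "t (Suc n) = t n + h ^ 4" by (simp_all add: s_def t_def h_def)
    have m2: "(\<Sum>j\<le>2. (norm (c + r n * unity_root 3 ^ j))\<^sup>2) = 3 * (g\<^sup>2 + h\<^sup>2)"
      and m4: "(\<Sum>j\<le>2. (norm (c + r n * unity_root 3 ^ j)) ^ 4) = 3 * (g ^ 4 + 4 * g\<^sup>2 * h\<^sup>2 + h ^ 4)"
      unfolding g_def h_def by (rule sum_third_roots_moments)+
    have "(\<Sum>j\<le>2. 3 ^ n * ((norm (c + r n * unity_root 3 ^ j))\<^sup>2 + s n)) = 3 ^ n * (3 * (g\<^sup>2 + h\<^sup>2) + 3 * s n)"
      by (simp only: sum_distrib_left[symmetric] sum.distrib m2) simp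
    moreover have "(\<Sum>j\<le>2. 3 ^ n * ((norm (c + r n * unity_root 3 ^ j)) ^ 4
          + 4 * (norm (c + r n * unity_root 3 ^ j))\<^sup>2 * s n + 2 * (s n)\<^sup>2 - t n))
        = 3 ^ n * (3 * (g ^ 4 + 4 * g\<^sup>2 * h\<^sup>2 + h ^ 4) + 4 * (3 * (g\<^sup>2 + h\<^sup>2)) * s n + 3 * (2 * (s n)\<^sup>2 - t n))"
      by (simp only: sum_distrib_left[symmetric] sum_distrib_right[symmetric] sum.distrib sum_subtractf m2 m4)
         (simp add: algebra_simps)
    ultimately show ?case
      unfolding eq by (simp only: Suc.IH sS g_def[symmetric])
        (simp add: power2_eq_square power4_eq_xxxx algebra_simps)
  qed
  then show "(\<Sum>i\<in>exponent_box n 2. (norm (c + (\<Sum>l<n. r l * unity_root 3 ^ i l)))\<^sup>2)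
           = 3 ^ n * ((norm c)\<^sup>2 + s n)"
    and "(\<Sum>i\<in>exponent_box n 2. (norm (c + (\<Sum>l<n. r l * unity_root 3 ^ i l))) ^ 4)
           = 3 ^ n * ((norm c) ^ 4 + 4 * (norm c)\<^sup>2 * s n + 2 * (s n)\<^sup>2 - t n)" by auto
qed

text \<open>
  A coefficient is the mean of the form against the conjugate of its character.
\<close>

lemma linear_form_coeff_le_mean:
  assumes "k < n"
  shows "3 ^ n * norm (r k) \<le> (\<Sum>i\<in>exponent_box n 2. norm (\<Sum>l<n. r l * unity_root 3 ^ i l))"
proof -
  define e where "e l = (\<lambda>j::nat. if j = l then 1 else 0 :: nat)" for l :: nat
  have mon: "monomial n w (e l) = w l" if "l < n" for w :: "nat \<Rightarrow> complex" and l
    using that by (simp add: monomial_def e_def if_distrib[of "\<lambda>x. _ ^ x"] prod.delta cong: if_cong)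
  have "(\<Sum>i\<in>exponent_box n 2. (\<Sum>l<n. r l * unity_root 3 ^ i l) * cnj (unity_root 3 ^ i k))
      = (\<Sum>l<n. r l * (\<Sum>i\<in>exponent_box n 2. unity_root 3 ^ i l * cnj (unity_root 3 ^ i k)))"
    unfolding sum_distrib_left sum_distrib_right by (subst sum.swap) (simp only: mult.assoc)
  also have "\<dots> = (\<Sum>l<n. if l = k then r l * 3 ^ n else 0)"
  proof (intro sum.cong refl)
    fix l assume "l \<in> {..<n}"
    then have l: "l < n" by simp
    have "(\<forall>j<n. e l j = e k j) \<longleftrightarrow> l = k" using assms by (auto simp: e_def)
    then show "r l * (\<Sum>i\<in>exponent_box n 2. unity_root 3 ^ i l * cnj (unity_root 3 ^ i k))
      = (if l = k then r l * 3 ^ n else 0)"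
      using grid_orthogonal[of n "e l" 3 "e k"] mon[OF l] mon[OF assms] by (simp add: e_def)
  qed
  also have "\<dots> = r k * 3 ^ n" using assms by simp
  finally have "3 ^ n * norm (r k)
      = norm (\<Sum>i\<in>exponent_box n 2. (\<Sum>l<n. r l * unity_root 3 ^ i l) * cnj (unity_root 3 ^ i k))"
    by (simp add: norm_mult norm_power)
  also have "\<dots> \<le> (\<Sum>i\<in>exponent_box n 2. norm (\<Sum>l<n. r l * unity_root 3 ^ i l))"
    by (intro sum_norm_le) (simp add: norm_mult norm_power)
  finally show ?thesis .
qed

text \<open>
  The first moment \<open>A\<close> of \<open>|\<Sum> r\<^sub>l w\<^sub>l|\<close> is bounded below by the second moment \<open>s\<close> and the fourth
  moment \<open>F = 2 s\<^sup>2 - t\<close> through \<open>s\<^sup>3 \<le> A\<^sup>2 F\<close>. Dropping \<open>t\<close> gives \<open>s \<le> 2 A\<^sup>2\<close>. Keeping it gives the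
  constant \<open>32/27\<close>, which is the maximum of \<open>t F\<^sup>2 = t (2 - t)\<^sup>2\<close> over \<open>0 \<le> t \<le> 1\<close> for \<open>s = 1\<close>.
\<close>

lemma linear_form_mean_bounds:
  fixes r :: "nat \<Rightarrow> complex" and n :: nat
  defines "A \<equiv> (\<Sum>i\<in>exponent_box n 2. norm (\<Sum>l<n. r l * unity_root 3 ^ i l)) / 3 ^ n"
  shows "(\<Sum>l<n. (norm (r l))\<^sup>2) \<le> 2 * A\<^sup>2"
    and "(\<Sum>l<n. (norm (r l)) ^ 4) \<le> 32 / 27 * A ^ 4"
proof -
  define s where "s = (\<Sum>l<n. (norm (r l))\<^sup>2)"
  define t where "t = (\<Sum>l<n. (norm (r l)) ^ 4)"
  define F where "F = 2 * s\<^sup>2 - t"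
  define R where "R i = norm (\<Sum>l<n. r l * unity_root 3 ^ i l)" for i :: "nat \<Rightarrow> nat"
  have "s \<ge> 0" "t \<ge> 0" unfolding s_def t_def by (intro sum_nonneg; simp)+
  have "t \<le> (\<Sum>l<n. s * (norm (r l))\<^sup>2)"
    unfolding t_def
  proof (intro sum_mono)
    fix l assume "l \<in> {..<n}"
    then have "(norm (r l))\<^sup>2 \<le> s" unfolding s_def by (intro member_le_sum) auto
    then show "norm (r l) ^ 4 \<le> s * (norm (r l))\<^sup>2"
      using mult_right_mono[of "(norm (r l))\<^sup>2" s "(norm (r l))\<^sup>2"]
      by (simp add: power2_eq_square power4_eq_xxxx)
  qed
  then have ts: "t \<le> s\<^sup>2" by (simp add: s_def power2_eq_square sum_distrib_left)
  have A0: "A \<ge> 0" unfolding A_def by (intro divide_nonneg_nonneg sum_nonneg) auto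
  have m2: "(\<Sum>i\<in>exponent_box n 2. (R i)\<^sup>2) = 3 ^ n * s"
    and m4: "(\<Sum>i\<in>exponent_box n 2. (R i) ^ 4) = 3 ^ n * F"
    using linear_form_moments[of 0 r n] by (simp_all add: R_def s_def t_def F_def)
  have key: "s ^ 3 \<le> A\<^sup>2 * F"
  proof (cases "s = 0")
    case True then show ?thesis using ts \<open>t \<ge> 0\<close> by (simp add: F_def)
  next
    case False
    then have "s > 0" using \<open>s \<ge> 0\<close> by simp
    then have "F > 0" using ts by (simp add: F_def) (smt (verit) zero_less_power)
    \<comment> \<open>\<open>\<theta>\<close> maximises the left-hand side \<open>3 \<theta> s - \<theta>\<^sup>3 F\<close> of the inequality that results from
      summing the pointwise bound \<open>pw\<close>\<close>
    define \<theta> where "\<theta> = sqrt (s / F)"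
    have \<theta>: "\<theta> > 0" "\<theta>\<^sup>2 = s / F" using \<open>s > 0\<close> \<open>F > 0\<close> by (auto simp: \<theta>_def)
    have pw: "3 * \<theta> * x\<^sup>2 - \<theta> ^ 3 * x ^ 4 \<le> 2 * x" if "x \<ge> 0" for x
    proof -
      define y where "y = \<theta> * x"
      have "y \<ge> 0" using that \<theta> by (simp add: y_def)
      have "2 + y ^ 3 - 3 * y = (y - 1)\<^sup>2 * (y + 2)" by (simp add: power2_eq_square power3_eq_cube algebra_simps)
      also have "\<dots> \<ge> 0" using \<open>y \<ge> 0\<close> by simp
      finally have "x * (3 * y - y ^ 3) \<le> x * 2" using that by (intro mult_left_mono) auto
      then show ?thesis by (simp add: y_def power2_eq_square power3_eq_cube power4_eq_xxxx algebra_simps)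
    qed
    have "3 * \<theta> * (3 ^ n * s) - \<theta> ^ 3 * (3 ^ n * F) = (\<Sum>i\<in>exponent_box n 2. 3 * \<theta> * (R i)\<^sup>2 - \<theta> ^ 3 * (R i) ^ 4)"
      by (simp add: sum_subtractf m2 m4 flip: sum_distrib_left)
    also have "\<dots> \<le> (\<Sum>i\<in>exponent_box n 2. 2 * R i)"
      by (intro sum_mono pw) (simp add: R_def)
    also have "\<dots> = 2 * (3 ^ n * A)" by (simp add: A_def R_def flip: sum_distrib_left)
    finally have "3 ^ n * (3 * \<theta> * s - \<theta> ^ 3 * F) \<le> 3 ^ n * (2 * A)" by (simp add: algebra_simps)
    then have "3 * \<theta> * s - \<theta> ^ 3 * F \<le> 2 * A" by simp
    moreover have "\<theta> ^ 3 * F = \<theta> * s"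
      using \<theta>(2) \<open>F > 0\<close> by (simp add: power3_eq_cube power2_eq_square mult.assoc)
    ultimately have "\<theta> * s \<le> A" by simp
    then have "(\<theta> * s)\<^sup>2 \<le> A\<^sup>2" using \<theta> \<open>s > 0\<close> by (intro power_mono) auto
    then have "(s / F) * s\<^sup>2 \<le> A\<^sup>2" using \<theta>(2) by (simp add: power_mult_distrib)
    then show ?thesis using \<open>F > 0\<close> by (simp add: field_simps power2_eq_square power3_eq_cube)
  qed
  show "(\<Sum>l<n. (norm (r l))\<^sup>2) \<le> 2 * A\<^sup>2"
  proof (cases "s = 0")
    case True then show ?thesis using A0 by (simp add: s_def[symmetric])
  next
    case False
    have "s\<^sup>2 * s \<le> s\<^sup>2 * (2 * A\<^sup>2)"
    proof -
      have "s\<^sup>2 * s = s ^ 3" by (simp add: power2_eq_square power3_eq_cube)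
      also note key
      also have "A\<^sup>2 * F \<le> A\<^sup>2 * (2 * s\<^sup>2)" using \<open>t \<ge> 0\<close> by (intro mult_left_mono) (auto simp: F_def)
      finally show ?thesis by (simp add: mult_ac)
    qed
    then show ?thesis using False by (simp add: s_def[symmetric])
  qed
  show "(\<Sum>l<n. (norm (r l)) ^ 4) \<le> 32 / 27 * A ^ 4"
  proof (cases "s = 0")
    case True then show ?thesis using ts \<open>t \<ge> 0\<close> A0 by (simp add: t_def[symmetric])
  next
    case False
    then have "s > 0" using \<open>s \<ge> 0\<close> by simp
    then have "F > 0" using ts by (simp add: F_def) (smt (verit) zero_less_power)
    \<comment> \<open>the double root \<open>t = 2 s\<^sup>2 / 3\<close> is the critical point of \<open>t F\<^sup>2\<close>\<close>
    have "32 * s ^ 6 - 27 * (t * F\<^sup>2) = (3 * t - 2 * s\<^sup>2)\<^sup>2 * (8 * s\<^sup>2 - 3 * t)"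
      unfolding F_def by algebra
    also have "\<dots> \<ge> 0" using ts \<open>t \<ge> 0\<close> by (intro mult_nonneg_nonneg) auto
    finally have "t * F\<^sup>2 \<le> 32 / 27 * s ^ 6" by simp
    also have "s ^ 6 = (s ^ 3)\<^sup>2" by (simp flip: power_mult)
    also have "(s ^ 3)\<^sup>2 \<le> (A\<^sup>2 * F)\<^sup>2" using key \<open>s > 0\<close> by (intro power_mono) auto
    also have "(A\<^sup>2 * F)\<^sup>2 = A ^ 4 * F\<^sup>2" by (simp add: power_mult_distrib flip: power_mult)
    finally have "t * F\<^sup>2 \<le> (32 / 27 * A ^ 4) * F\<^sup>2" by (simp add: mult.assoc)
    then show ?thesis using \<open>F > 0\<close> by (simp add: t_def[symmetric])
  qed
qed

text \<open>
  For exponents above the one for which \<open>linear_form_mean_bounds\<close> is stated, the excess \<open>q - p\<close> is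
  taken care of by the trivial bound of each coefficient by the mean.
\<close>

lemma averaging_linear:
  assumes "q \<ge> 2 \<and> \<kappa> = 2 \<or> q \<ge> 4 \<and> \<kappa> = 32 / 27"
  shows "averaging {\<phi>. \<forall>l. norm (\<phi> l) = 1} (\<lambda>_. 1 / \<kappa>) d q"
  unfolding averaging_def
proof (intro allI impI)
  fix I :: "(nat \<times> (nat \<Rightarrow> nat)) set" and lam :: "nat \<times> (nat \<Rightarrow> nat) \<Rightarrow> real"
    and c :: "nat \<times> (nat \<Rightarrow> nat) \<Rightarrow> nat \<Rightarrow> complex"
  assume "finite I" and lam: "\<forall>i\<in>I. lam i \<ge> 0"
  have q: "q > 0" "\<kappa> > 0" using assms by auto
  define n where "n = Suc d"
  have n: "{..<n} = {..d}" by (simp add: n_def lessThan_Suc_atMost)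
  define R where "R i g = norm (\<Sum>l<n. c i l * unity_root 3 ^ g l)" for i and g :: "nat \<Rightarrow> nat"
  define A where "A i = (\<Sum>g\<in>exponent_box n 2. R i g) / 3 ^ n" for i
  define e where "e i = (\<Sum>l\<le>d. 1 / \<kappa> * norm (c i l) powr q) powr (1 / q)" for i
  have A0: "A i \<ge> 0" for i unfolding A_def R_def by (intro divide_nonneg_nonneg sum_nonneg) auto
  have cA: "norm (c i l) \<le> A i" if "l < n" for i l
    using linear_form_coeff_le_mean[OF that, of "c i"] by (simp add: A_def R_def field_simps)
  have eA: "e i \<le> A i" for i
  proof -
    have step: "(\<Sum>l<n. norm (c i l) powr q) \<le> \<kappa> * A i powr q"
      if p: "real p \<le> q" "p > 0" "(\<Sum>l<n. norm (c i l) ^ p) \<le> \<kappa> * A i ^ p" for p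
    proof -
      have "(\<Sum>l<n. norm (c i l) powr q) \<le> (\<Sum>l<n. A i powr (q - p) * norm (c i l) ^ p)"
      proof (intro sum_mono)
        fix l assume "l \<in> {..<n}"
        then have "norm (c i l) \<le> A i" using cA by simp
        show "norm (c i l) powr q \<le> A i powr (q - p) * norm (c i l) ^ p"
        proof (cases "c i l = 0")
          case True then show ?thesis using p by (simp add: A0)
        next
          case False
          then have "norm (c i l) powr q = norm (c i l) powr (q - p) * norm (c i l) ^ p"
            by (simp add: powr_diff powr_realpow)
          also have "\<dots> \<le> A i powr (q - p) * norm (c i l) ^ p"
            using p \<open>norm (c i l) \<le> A i\<close> by (intro mult_right_mono powr_mono2) auto
          finally show ?thesis .
        qed
      qed
      also have "\<dots> \<le> A i powr (q - p) * (\<kappa> * A i ^ p)"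
        using p by (simp flip: sum_distrib_left add: mult_left_mono)
      also have "\<dots> = \<kappa> * A i powr q"
      proof (cases "A i = 0")
        case True then show ?thesis using p by simp
      next
        case False then show ?thesis using A0[of i] by (simp add: powr_diff powr_realpow)
      qed
      finally show ?thesis .
    qed
    have "(\<Sum>l<n. norm (c i l) powr q) \<le> \<kappa> * A i powr q"
    proof -
      have "(\<Sum>l<n. norm (c i l) ^ 2) \<le> 2 * A i ^ 2" "(\<Sum>l<n. norm (c i l) ^ 4) \<le> 32 / 27 * A i ^ 4"
        using linear_form_mean_bounds[where n = n and r = "c i"] unfolding A_def R_def .
      then show ?thesis using assms step[of 2] step[of 4] by fastforce
    qed
    then have "(\<Sum>l\<le>d. 1 / \<kappa> * norm (c i l) powr q) \<le> A i powr q"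
      using q unfolding n by (simp add: field_simps flip: sum_divide_distrib)
    then have "e i \<le> (A i powr q) powr (1 / q)"
      unfolding e_def using q by (intro powr_mono2 sum_nonneg) auto
    then show ?thesis using q A0[of i] by (simp add: powr_powr)
  qed
  have "(\<Sum>i\<in>I. lam i * e i) \<le> (\<Sum>i\<in>I. lam i * A i)"
    using lam eA by (intro sum_mono mult_left_mono) auto
  also have "\<dots> = (\<Sum>g\<in>exponent_box n 2. \<Sum>i\<in>I. lam i * R i g) / 3 ^ n"
    unfolding A_def by (subst sum.swap) (simp add: sum_divide_distrib sum_distrib_left)
  finally have le: "3 ^ n * (\<Sum>i\<in>I. lam i * e i) \<le> (\<Sum>g\<in>exponent_box n 2. \<Sum>i\<in>I. lam i * R i g)"
    by (simp add: field_simps)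
  have "\<exists>g\<in>exponent_box n 2. (\<Sum>i\<in>I. lam i * e i) \<le> (\<Sum>i\<in>I. lam i * R i g)"
  proof (rule ccontr)
    assume neg: "\<not> ?thesis"
    have "(\<Sum>g\<in>exponent_box n 2. \<Sum>i\<in>I. lam i * R i g) < (\<Sum>g\<in>exponent_box n 2. \<Sum>i\<in>I. lam i * e i)"
    proof (rule sum_strict_mono)
      show "exponent_box n 2 \<noteq> {}" using card_exponent_box[of n 2] by auto
    qed (use neg in \<open>auto simp: not_le\<close>)
    then show False using le by (simp add: card_exponent_box)
  qed
  then obtain g where g: "(\<Sum>i\<in>I. lam i * e i) \<le> (\<Sum>i\<in>I. lam i * R i g)" by blast
  then show "\<exists>\<phi>\<in>{\<phi>. \<forall>l. norm (\<phi> l) = 1}.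
      (\<Sum>i\<in>I. lam i * (\<Sum>l\<le>d. 1 / \<kappa> * norm (c i l) powr q) powr (1 / q))
        \<le> (\<Sum>i\<in>I. lam i * norm (\<Sum>l\<le>d. c i l * \<phi> l))"
    by (intro bexI[of _ "\<lambda>l. unity_root 3 ^ g l"]) (auto simp: e_def R_def n)
qed

section \<open>Carleman's inequality on the circle\<close>

definition circle_mean :: "(complex \<Rightarrow> real) \<Rightarrow> real" where
  "circle_mean g = integral {0..1} (\<lambda>t. g (cis (2 * pi * t)))"

lemma continuous_on_circle_param:
  assumes "continuous_on UNIV g"
  shows "continuous_on {0..1} (\<lambda>t. g (cis (2 * pi * t)))"
  by (rule continuous_on_compose2[OF assms]) (auto intro!: continuous_intros)

lemma circle_mean_mono:
  assumes "continuous_on UNIV f" "continuous_on UNIV g" "\<And>w. norm w = 1 \<Longrightarrow> f w \<le> g w"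
  shows "circle_mean f \<le> circle_mean g"
  unfolding circle_mean_def
  by (intro integral_le integrable_continuous_real continuous_on_circle_param assms) auto

lemma circle_mean_nonneg:
  assumes "continuous_on UNIV g" "\<And>w. norm w = 1 \<Longrightarrow> 0 \<le> g w"
  shows "0 \<le> circle_mean g"
  unfolding circle_mean_def
  by (intro integral_nonneg integrable_continuous_real continuous_on_circle_param assms) auto

lemma circle_mean_cong: "(\<And>w. norm w = 1 \<Longrightarrow> f w = g w) \<Longrightarrow> circle_mean f = circle_mean g"
  unfolding circle_mean_def by (intro integral_cong) auto

lemma circle_mean_add:
  assumes "continuous_on UNIV f" "continuous_on UNIV g"
  shows "circle_mean (\<lambda>w. f w + g w) = circle_mean f + circle_mean g"
  unfolding circle_mean_def
  by (intro integral_add integrable_continuous_real continuous_on_circle_param assms)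

lemma circle_mean_cmult: "circle_mean (\<lambda>w. a * f w) = a * circle_mean f"
  by (simp add: circle_mean_def)

lemma circle_mean_sum:
  assumes "finite I" "\<And>i. i \<in> I \<Longrightarrow> continuous_on UNIV (f i)"
  shows "circle_mean (\<lambda>w. \<Sum>i\<in>I. f i w) = (\<Sum>i\<in>I. circle_mean (f i))"
  unfolding circle_mean_def
  by (intro integral_sum integrable_continuous_real continuous_on_circle_param assms)

text \<open>
  A mean is at most the maximum; this is how means turn into single points of the circle.
\<close>

lemma circle_mean_le_attained:
  assumes "continuous_on UNIV g"
  shows "\<exists>w. norm w = 1 \<and> circle_mean g \<le> g w"
proof -
  have "compact {w :: complex. norm w = 1}" using compact_sphere[of "0::complex" 1] by (simp add: sphere_def)
  moreover have "{w :: complex. norm w = 1} \<noteq> {}" using norm_one by blast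
  ultimately obtain w where w: "norm w = 1" "\<forall>v. norm v = 1 \<longrightarrow> g v \<le> g w"
    using continuous_attains_sup[of "{w :: complex. norm w = 1}" g] continuous_on_subset[OF assms]
    by auto
  then have "circle_mean g \<le> circle_mean (\<lambda>_. g w)"
    by (intro circle_mean_mono assms) auto
  then show ?thesis using w by (auto simp: circle_mean_def)
qed

lemma has_integral_circle_char:
  "((\<lambda>t. cis (2 * pi * t) ^ a * cnj (cis (2 * pi * t) ^ b)) has_integral (if a = b then 1 else 0)) {0..1}"
proof -
  define k where "k = real a - real b"
  have eq: "cis (2 * pi * t) ^ a * cnj (cis (2 * pi * t) ^ b) = cis (2 * pi * k * t)" for t
    by (simp add: Complex.DeMoivre cis_cnj cis_mult k_def algebra_simps)
  show ?thesis
  proof (cases "a = b")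
    case True
    then show ?thesis
      unfolding eq using has_integral_const_real[of "1::complex" 0 1] by (simp add: k_def)
  next
    case False
    then have k: "k \<noteq> 0" by (simp add: k_def)
    define F where "F = (\<lambda>t. cis (2 * pi * k * t) / (2 * pi * k * \<i>))"
    have "((\<lambda>t. cis (2 * pi * k * t)) has_integral (F 1 - F 0)) {0..1}"
    proof (rule fundamental_theorem_of_calculus)
      fix t :: real assume "t \<in> {0..1}"
      have "((\<lambda>t. exp (\<i> * of_real (2 * pi * k * t)) / (2 * pi * k * \<i>)) has_vector_derivative
          exp (\<i> * of_real (2 * pi * k * t))) (at t within {0..1})"
        using k by (auto intro!: derivative_eq_intros has_vector_derivative_real_field simp: field_simps)
      then show "(F has_vector_derivative cis (2 * pi * k * t)) (at t within {0..1})"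
        by (simp add: F_def cis_conv_exp)
    qed simp
    moreover have "F 1 = F 0"
    proof -
      have "cis (2 * pi * k) = cis (2 * pi * real a) / cis (2 * pi * real b)"
        by (simp add: cis_divide k_def algebra_simps)
      also have "\<dots> = 1"
        using cis_2pi Complex.DeMoivre[of "2 * pi" a] Complex.DeMoivre[of "2 * pi" b]
        by (simp add: mult.commute)
      finally show ?thesis by (simp add: F_def)
    qed
    ultimately show ?thesis unfolding eq using False by simp
  qed
qed

lemma circle_mean_poly_square:
  "circle_mean (\<lambda>w. (norm (\<Sum>k<N. c k * w ^ k))\<^sup>2) = (\<Sum>k<N. (norm (c k))\<^sup>2)"
proof -
  define u where "u t = cis (2 * pi * t)" for t
  have "((\<lambda>t. \<Sum>a<N. \<Sum>b<N. c a * cnj (c b) * (u t ^ a * cnj (u t ^ b)))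
      has_integral (\<Sum>a<N. \<Sum>b<N. c a * cnj (c b) * (if a = b then 1 else 0))) {0..1}"
    unfolding u_def by (intro has_integral_sum has_integral_mult_right has_integral_circle_char) auto
  moreover have "(\<Sum>a<N. \<Sum>b<N. c a * cnj (c b) * (u t ^ a * cnj (u t ^ b)))
      = complex_of_real ((norm (\<Sum>k<N. c k * u t ^ k))\<^sup>2)" for t
    unfolding complex_norm_square by (simp add: sum_product mult_ac)
  moreover have "(\<Sum>a<N. \<Sum>b<N. c a * cnj (c b) * (if a = b then 1 else 0))
      = complex_of_real (\<Sum>k<N. (norm (c k))\<^sup>2)"
    by (simp add: complex_norm_square if_distrib[of "\<lambda>x. _ * x"] del: of_real_power cong: if_cong)
  ultimately have "((\<lambda>t. complex_of_real ((norm (\<Sum>k<N. c k * u t ^ k))\<^sup>2))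
      has_integral complex_of_real (\<Sum>k<N. (norm (c k))\<^sup>2)) {0..1}" by simp
  from has_integral_linear[OF this bounded_linear_Re]
  have "((\<lambda>t. (norm (\<Sum>k<N. c k * u t ^ k))\<^sup>2) has_integral (\<Sum>k<N. (norm (c k))\<^sup>2)) {0..1}"
    by (simp only: o_def Re_complex_of_real)
  then show ?thesis unfolding circle_mean_def u_def by (rule integral_unique)
qed

lemma coeff_le_circle_mean:
  assumes "k < N"
  shows "norm (c k) \<le> circle_mean (\<lambda>w. norm (\<Sum>l<N. c l * w ^ l))"
proof -
  define u where "u t = cis (2 * pi * t)" for t
  define f where "f t = (\<Sum>l<N. c l * u t ^ l)" for t
  have cont: "continuous_on {0..1} u" unfolding u_def by (intro continuous_intros)
  have "((\<lambda>t. \<Sum>l<N. c l * (u t ^ l * cnj (u t ^ k)))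
      has_integral (\<Sum>l<N. c l * (if l = k then 1 else 0))) {0..1}"
    unfolding u_def by (intro has_integral_sum has_integral_mult_right has_integral_circle_char) auto
  moreover have "(\<Sum>l<N. c l * (if l = k then 1 else 0)) = c k"
    using assms by (simp add: if_distrib[of "\<lambda>x. _ * x"] cong: if_cong)
  moreover have "(\<Sum>l<N. c l * (u t ^ l * cnj (u t ^ k))) = f t * cnj (u t ^ k)" for t
    by (simp add: f_def sum_distrib_left mult_ac)
  ultimately have "integral {0..1} (\<lambda>t. f t * cnj (u t ^ k)) = c k"
    by (simp add: integral_unique)
  moreover have "norm (integral {0..1} (\<lambda>t. f t * cnj (u t ^ k))) \<le> integral {0..1} (\<lambda>t. norm (f t))"
    using cont unfolding f_def
    by (intro integral_norm_bound_integral integrable_continuous_real continuous_intros)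
       (auto simp: norm_mult norm_power u_def)
  ultimately show ?thesis by (simp add: circle_mean_def f_def u_def)
qed

text \<open>
  Parseval's identity for a partial sum of the series, which is uniformly close to \<open>h\<close> on the circle.
  The function \<open>g\<close> extends \<open>|h|\<close> continuously to the plane, where circle means are considered.
\<close>

lemma circle_bessel:
  fixes h :: "complex \<Rightarrow> complex" and H :: "nat \<Rightarrow> complex"
  assumes R: "R > 1" and h: "\<And>w. norm w < R \<Longrightarrow> (\<lambda>k. H k * w ^ k) sums h w"
    and g: "continuous_on UNIV g" "\<And>w. norm w = 1 \<Longrightarrow> g w = norm (h w)"
  shows "(\<Sum>k<N. (norm (H k))\<^sup>2) \<le> circle_mean (\<lambda>w. (g w)\<^sup>2)"
proof -
  define x where "x = (1 + R) / 2"
  have x: "1 < x" "x < R" using R by (auto simp: x_def)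
  have "summable (\<lambda>k. H k * of_real x ^ k)"
    using h[of "of_real x"] x by (auto intro: sums_summable)
  from powser_insidea[OF this, of 1] x have sm: "summable (\<lambda>k. norm (H k))" by simp
  have main: "(\<Sum>k<N. (norm (H k))\<^sup>2) \<le> circle_mean (\<lambda>w. (g w)\<^sup>2) + 2 * e * circle_mean g + e\<^sup>2"
    if e: "e > 0" for e
  proof -
    obtain M0 where M0: "\<And>M. M \<ge> M0 \<Longrightarrow> norm (\<Sum>k. norm (H (k + M))) < e"
      using suminf_exist_split[OF e sm] by auto
    define M where "M = max M0 N"
    define S where "S w = (\<Sum>k<M. H k * w ^ k)" for w
    have close: "norm (S w) \<le> g w + e" if w: "norm w = 1" for w
    proof -
      have sw: "(\<lambda>k. H k * w ^ k) sums h w" using h[of w] w R by simp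
      have sn: "summable (\<lambda>k. norm (H (k + M) * w ^ (k + M)))"
        using summable_ignore_initial_segment[OF sm, of M] w by (simp add: norm_mult norm_power)
      have "h w = (\<Sum>k. H (k + M) * w ^ (k + M)) + S w"
        unfolding S_def using suminf_split_initial_segment[OF sums_summable[OF sw], of M] sums_unique[OF sw] by simp
      moreover have "norm (\<Sum>k. H (k + M) * w ^ (k + M)) \<le> (\<Sum>k. norm (H (k + M) * w ^ (k + M)))"
        by (rule summable_norm[OF sn])
      moreover have "(\<Sum>k. norm (H (k + M) * w ^ (k + M))) \<le> e"
        using M0[of M] w by (simp add: norm_mult norm_power M_def)
      moreover have "norm (S w) \<le> norm (h w) + norm (\<Sum>k. H (k + M) * w ^ (k + M))"
        using norm_triangle_ineq4[of "h w" "\<Sum>k. H (k + M) * w ^ (k + M)"] calculation(1)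
        by (simp add: algebra_simps)
      ultimately show ?thesis using g(2)[OF w] by linarith
    qed
    have "(\<Sum>k<N. (norm (H k))\<^sup>2) \<le> (\<Sum>k<M. (norm (H k))\<^sup>2)"
      by (intro sum_mono2) (auto simp: M_def)
    also have "\<dots> = circle_mean (\<lambda>w. (norm (S w))\<^sup>2)"
      unfolding S_def by (rule circle_mean_poly_square[symmetric])
    also have "\<dots> \<le> circle_mean (\<lambda>w. ((g w)\<^sup>2 + (2 * e) * g w) + e\<^sup>2)"
    proof (rule circle_mean_mono)
      fix w :: complex assume "norm w = 1"
      then have "(norm (S w))\<^sup>2 \<le> (g w + e)\<^sup>2" using close by (intro power_mono) auto
      then show "(norm (S w))\<^sup>2 \<le> ((g w)\<^sup>2 + (2 * e) * g w) + e\<^sup>2"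
        by (simp add: power2_eq_square algebra_simps)
    qed (use g(1) in \<open>auto simp: S_def intro!: continuous_intros\<close>)
    also have "\<dots> = circle_mean (\<lambda>w. (g w)\<^sup>2) + 2 * e * circle_mean g + e\<^sup>2"
    proof -
      have "circle_mean (\<lambda>w. (g w)\<^sup>2 + (2 * e) * g w) = circle_mean (\<lambda>w. (g w)\<^sup>2) + circle_mean (\<lambda>w. (2 * e) * g w)"
        using g(1) by (intro circle_mean_add continuous_intros)
      moreover have "circle_mean (\<lambda>_. e\<^sup>2) = e\<^sup>2" by (simp add: circle_mean_def)
      ultimately show ?thesis
        using g(1) by (subst circle_mean_add) (auto simp: circle_mean_cmult intro!: continuous_intros)
    qed
    finally show ?thesis .
  qed
  have "((\<lambda>e. circle_mean (\<lambda>w. (g w)\<^sup>2) + 2 * e * circle_mean g + e\<^sup>2) \<longlongrightarrow>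
      circle_mean (\<lambda>w. (g w)\<^sup>2) + 2 * 0 * circle_mean g + 0\<^sup>2) (at_right 0)"
    by (intro tendsto_intros)
  moreover have "\<forall>\<^sub>F e in at_right 0. (\<Sum>k<N. (norm (H k))\<^sup>2)
      \<le> circle_mean (\<lambda>w. (g w)\<^sup>2) + 2 * e * circle_mean g + e\<^sup>2"
    using main by (auto simp: eventually_at_right_field intro: exI[of _ 1])
  ultimately show ?thesis
    using tendsto_lowerbound[of _ _ "at_right (0::real)"] by fastforce
qed

text \<open>
  The left-hand side of Carleman's inequality, truncated at \<open>N\<close>. The truncation is kept fixed while
  zeros are moved, so it is not tied to the degree of \<open>f\<close>.
\<close>

definition weighted_coeff_norm :: "nat \<Rightarrow> complex poly \<Rightarrow> real" where
  "weighted_coeff_norm N f = (\<Sum>k\<le>N. (1 / 2) ^ k * (norm (coeff f k))\<^sup>2)"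

text \<open>
  Coefficientwise, the difference of the squares for the two factors is \<open>1 - |a|\<^sup>2\<close> times the
  difference of the squares of two consecutive coefficients of \<open>g\<close>, and the weights \<open>2\<^bsup>-k\<^esup>\<close> decrease.
\<close>

lemma weighted_coeff_norm_reflect:
  assumes "norm a \<le> 1"
  shows "weighted_coeff_norm N ([:- a, 1:] * g) \<le> weighted_coeff_norm N ([:1, - cnj a:] * g)"
proof -
  define p where "p k = (if k = 0 then 0 else coeff g (k - 1))" for k
  have c1: "coeff ([:- a, 1:] * g) k = p k - a * coeff g k" for k
    by (cases k) (simp_all add: p_def)
  have c2: "coeff ([:1, - cnj a:] * g) k = coeff g k - cnj a * p k" for k
    by (cases k) (simp_all add: p_def)
  have diff: "(norm (u - cnj a * v))\<^sup>2 - (norm (v - a * u))\<^sup>2 = (1 - (norm a)\<^sup>2) * ((norm u)\<^sup>2 - (norm v)\<^sup>2)"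
    for u v :: complex
    by (simp only: cmod_power2 minus_complex.sel cnj.sel times_complex.sel)
       (simp add: power2_eq_square algebra_simps)
  have "(\<Sum>k\<le>N. (1 / 2) ^ k * (norm (p k))\<^sup>2) \<le> (\<Sum>k\<le>N. (1 / 2) ^ k * (norm (coeff g k))\<^sup>2)"
  proof (cases N)
    case (Suc M)
    have "(\<Sum>k\<le>N. (1 / 2) ^ k * (norm (p k))\<^sup>2) = (\<Sum>k\<le>M. (1 / 2) ^ Suc k * (norm (coeff g k))\<^sup>2)"
      unfolding Suc by (subst sum.atMost_Suc_shift) (simp add: p_def)
    also have "\<dots> \<le> (\<Sum>k\<le>M. (1 / 2) ^ k * (norm (coeff g k))\<^sup>2)"
      by (intro sum_mono mult_right_mono) auto
    also have "\<dots> \<le> (\<Sum>k\<le>N. (1 / 2) ^ k * (norm (coeff g k))\<^sup>2)"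
      unfolding Suc by simp
    finally show ?thesis .
  qed (simp add: p_def)
  then have "0 \<le> (1 - (norm a)\<^sup>2) * ((\<Sum>k\<le>N. (1 / 2) ^ k * (norm (coeff g k))\<^sup>2) - (\<Sum>k\<le>N. (1 / 2) ^ k * (norm (p k))\<^sup>2))"
    using assms by (intro mult_nonneg_nonneg) (auto simp: abs_square_le_1)
  also have "\<dots> = (\<Sum>k\<le>N. (1 / 2) ^ k * ((norm (coeff g k - cnj a * p k))\<^sup>2 - (norm (p k - a * coeff g k))\<^sup>2))"
    unfolding diff by (simp add: sum_distrib_left algebra_simps flip: sum_subtractf)
  also have "\<dots> = weighted_coeff_norm N ([:1, - cnj a:] * g) - weighted_coeff_norm N ([:- a, 1:] * g)"
    unfolding weighted_coeff_norm_def c1 c2 by (simp add: right_diff_distrib sum_subtractf)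
  finally show ?thesis by simp
qed

text \<open>
  Replacing a factor \<open>z - a\<close> with \<open>|a| < 1\<close> by \<open>1 - a\<^sup>* z\<close> leaves the modulus on the circle
  unchanged and does not decrease the weighted coefficient norm. Here \<open>g\<close> collects the factors that are
  already free of zeros in the disc.
\<close>

lemma move_zeros_out_of_disc:
  fixes g h :: "complex poly"
  assumes "\<And>z. norm z < 1 \<Longrightarrow> poly g z \<noteq> 0" "h \<noteq> 0"
  shows "\<exists>f. (\<forall>z. norm z < 1 \<longrightarrow> poly f z \<noteq> 0) \<and> (\<forall>z. norm z = 1 \<longrightarrow> norm (poly f z) = norm (poly (g * h) z))
    \<and> weighted_coeff_norm N (g * h) \<le> weighted_coeff_norm N f"
  using assms
proof (induction "degree h" arbitrary: g h rule: less_induct)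
  case less
  show ?case
  proof (cases "\<exists>a. norm a < 1 \<and> poly h a = 0")
    case False
    then show ?thesis using less.prems by (intro exI[of _ "g * h"]) auto
  next
    case True
    then obtain a where a: "norm a < 1" "poly h a = 0" by blast
    then obtain h' where h': "h = [:- a, 1:] * h'" by (auto simp: poly_eq_0_iff_dvd)
    then have "h' \<noteq> 0" using less.prems by auto
    then have deg: "degree h' < degree h"
      unfolding h' by (subst degree_mult_eq) auto
    define g' where "g' = g * [:1, - cnj a:]"
    have "poly g' z \<noteq> 0" if z: "norm z < 1" for z
    proof -
      have "norm (cnj a * z) < 1 * 1" unfolding norm_mult using a z by (intro mult_strict_mono) auto
      then have "1 - cnj a * z \<noteq> 0" by (metis eq_iff_diff_eq_0 less_irrefl mult_1 norm_one)
      then show ?thesis using less.prems(1)[OF z] by (simp add: g'_def mult.commute)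
    qed
    from less.hyps[OF deg this \<open>h' \<noteq> 0\<close>] obtain f where f:
      "\<And>z. norm z < 1 \<Longrightarrow> poly f z \<noteq> 0" "\<And>z. norm z = 1 \<Longrightarrow> norm (poly f z) = norm (poly (g' * h') z)"
      "weighted_coeff_norm N (g' * h') \<le> weighted_coeff_norm N f" by auto
    have "norm (poly (g' * h') z) = norm (poly (g * h) z)" if z: "norm z = 1" for z
    proof -
      have zz: "z * cnj z = 1" using z by (simp flip: complex_norm_square)
      have "1 - cnj a * z = z * cnj (z - a)" using zz by (simp add: algebra_simps)
      then have "norm (1 - cnj a * z) = norm (z - a)" by (simp add: norm_mult z del: complex_cnj_diff)
      moreover have "poly (g' * h') z = poly g z * (1 - cnj a * z) * poly h' z"
        by (simp add: g'_def algebra_simps)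
      moreover have "poly (g * h) z = poly g z * (z - a) * poly h' z"
        by (simp add: h' algebra_simps)
      ultimately show ?thesis by (simp only: norm_mult)
    qed
    moreover have "weighted_coeff_norm N (g * h) \<le> weighted_coeff_norm N (g' * h')"
    proof -
      have "g * h = [:- a, 1:] * (g * h')" "g' * h' = [:1, - cnj a:] * (g * h')"
        unfolding g'_def h' by (simp_all only: mult_ac)
      then show ?thesis using weighted_coeff_norm_reflect[of a N "g * h'"] a by simp
    qed
    ultimately show ?thesis using f by (intro exI[of _ f]) auto
  qed
qed

text \<open>
  A polynomial without zeros in a neighbourhood of the closed disc is a square \<open>h\<^sup>2\<close> there. Its \<open>k\<close>th
  coefficient is a convolution of \<open>k + 1\<close> terms, so its square is at most \<open>k + 1 \<le> 2\<^sup>k\<close> times the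
  convolution of the squares of the coefficients of \<open>h\<close>; the sum of the latter is the mean of
  \<open>|h|\<^sup>2 = |f|\<close>.
\<close>

lemma carleman_zero_free:
  fixes f :: "complex poly"
  assumes R: "R > 1" and nz: "\<And>z. norm z < R \<Longrightarrow> poly f z \<noteq> 0"
  shows "weighted_coeff_norm N f \<le> (circle_mean (\<lambda>w. norm (poly f w)))\<^sup>2"
proof -
  have "poly f holomorphic_on ball 0 R" by (intro holomorphic_intros)
  from contractible_imp_holomorphic_sqrt[OF this convex_imp_contractible[OF convex_ball]] nz
  obtain h where h: "h holomorphic_on ball 0 R" "\<And>z. z \<in> ball 0 R \<Longrightarrow> poly f z = h z ^ 2"
    by auto
  define F where "F = fps_expansion h 0"
  have hF: "h has_fps_expansion F"
    unfolding F_def using h(1) R by (intro has_fps_expansion_fps_expansion) auto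
  have "poly f has_fps_expansion F * F"
  proof -
    have "(\<lambda>z. h z * h z) has_fps_expansion F * F"
      by (intro has_fps_expansion_mult hF)
    moreover have "\<forall>\<^sub>F z in nhds 0. h z * h z = poly f z"
      using eventually_nhds_in_open[of "ball 0 R" "0::complex"] R
      by (auto elim!: eventually_mono simp: h(2) power2_eq_square)
    ultimately show ?thesis
      using has_fps_expansion_cong[of "\<lambda>z. h z * h z" "poly f" "F * F" "F * F"] by simp
  qed
  moreover have "poly f has_fps_expansion fps_of_poly f"
    by (simp add: has_fps_expansion_def)
  ultimately have "F * F = fps_of_poly f" by (rule fps_expansion_unique_complex)
  then have coeff: "coeff f k = (\<Sum>i=0..k. fps_nth F i * fps_nth F (k - i))" for k
    by (metis fps_mult_nth fps_of_poly_nth)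
  define b where "b i = (norm (fps_nth F i))\<^sup>2" for i
  define g where "g w = sqrt (norm (poly f w))" for w
  have "(\<Sum>k<Suc N. b k) \<le> circle_mean (\<lambda>w. (g w)\<^sup>2)"
    unfolding b_def
  proof (rule circle_bessel[OF R])
    fix w :: complex assume "norm w < R"
    then show "(\<lambda>k. fps_nth F k * w ^ k) sums h w"
      using holomorphic_power_series[OF h(1), of w] hF by (simp add: fps_nth_fps_expansion)
  next
    show "continuous_on UNIV g" unfolding g_def by (intro continuous_intros)
    show "g w = norm (h w)" if "norm w = 1" for w
      using h(2)[of w] that R by (simp add: g_def norm_power real_sqrt_unique)
  qed
  then have bes: "(\<Sum>k\<le>N. b k) \<le> circle_mean (\<lambda>w. norm (poly f w))"
    by (simp add: g_def lessThan_Suc_atMost)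
  have b0: "b i \<ge> 0" for i by (simp add: b_def)
  have "weighted_coeff_norm N f \<le> (\<Sum>k\<le>N. \<Sum>i\<le>k. b i * b (k - i))"
    unfolding weighted_coeff_norm_def
  proof (intro sum_mono)
    fix k
    have "norm (coeff f k) \<le> (\<Sum>i\<le>k. norm (fps_nth F i * fps_nth F (k - i)))"
      unfolding coeff atLeast0AtMost by (rule norm_sum)
    then have "(norm (coeff f k))\<^sup>2 \<le> (\<Sum>i\<le>k. 1 * norm (fps_nth F i * fps_nth F (k - i)))\<^sup>2"
      by (intro power_mono) auto
    also have "\<dots> \<le> (\<Sum>i\<le>k. 1\<^sup>2) * (\<Sum>i\<le>k. (norm (fps_nth F i * fps_nth F (k - i)))\<^sup>2)"
      by (rule Cauchy_Schwarz_ineq_sum)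
    also have "\<dots> = real (k + 1) * (\<Sum>i\<le>k. b i * b (k - i))"
      by (simp add: b_def norm_mult power_mult_distrib)
    also have "\<dots> \<le> 2 ^ k * (\<Sum>i\<le>k. b i * b (k - i))"
    proof (rule mult_right_mono)
      have "k + 1 \<le> 2 ^ k" by (induction k) auto
      then show "real (k + 1) \<le> 2 ^ k" by (metis numeral_power_le_of_nat_cancel_iff of_nat_le_iff of_nat_numeral of_nat_power)
    qed (auto intro!: sum_nonneg b0 mult_nonneg_nonneg)
    finally show "(1 / 2) ^ k * (norm (coeff f k))\<^sup>2 \<le> (\<Sum>i\<le>k. b i * b (k - i))"
      by (simp add: power_divide field_simps)
  qed
  also have "\<dots> = (\<Sum>(k, i)\<in>(SIGMA k:{..N}. {..k}). b i * b (k - i))"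
    by (simp add: sum.Sigma)
  also have "\<dots> \<le> (\<Sum>(i, j)\<in>{..N} \<times> {..N}. b i * b j)"
    by (rule sum_le_included[where i = "\<lambda>(i, j). (i + j, i)"])
       (auto intro!: mult_nonneg_nonneg b0 bexI[of _ "(_, _)"] simp: case_prod_unfold, force)
  also have "\<dots> = (\<Sum>k\<le>N. b k)\<^sup>2"
    by (simp add: power2_eq_square sum_product sum.cartesian_product)
  also have "\<dots> \<le> (circle_mean (\<lambda>w. norm (poly f w)))\<^sup>2"
    using bes b0 by (intro power_mono sum_nonneg) auto
  finally show ?thesis .
qed

text \<open>
  Zeros on the circle are avoided by passing to \<open>f (\<rho> z)\<close> and letting \<open>\<rho>\<close> tend to \<open>1\<close>.
\<close>

lemma carleman_zero_free_open_disc: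
  fixes f :: "complex poly"
  assumes nz: "\<And>z. norm z < 1 \<Longrightarrow> poly f z \<noteq> 0"
  shows "weighted_coeff_norm N f \<le> (circle_mean (\<lambda>w. norm (poly f w)))\<^sup>2"
proof -
  define A where "A = circle_mean (\<lambda>w. norm (poly f w))"
  \<comment> \<open>bounds \<open>|f (\<rho> w) - f w|\<close> on the circle\<close>
  define D where "D \<rho> = (\<Sum>k\<le>degree f. norm (coeff f k) * (1 - \<rho> ^ k))" for \<rho> :: real
  have "(\<Sum>k\<le>N. (1 / 2) ^ k * (\<rho> ^ k * norm (coeff f k))\<^sup>2) \<le> (A + D \<rho>)\<^sup>2"
    if \<rho>: "0 < \<rho>" "\<rho> < 1" for \<rho>
  proof -
    define f2 where "f2 = pcompose f [:0, of_real \<rho>:]"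
    have pf2: "poly f2 w = poly f (of_real \<rho> * w)" for w by (simp add: f2_def poly_pcompose mult.commute)
    have W: "weighted_coeff_norm N f2 \<le> (circle_mean (\<lambda>w. norm (poly f2 w)))\<^sup>2"
    proof (rule carleman_zero_free)
      show "1 < 1 / \<rho>" using \<rho> by simp
      fix z :: complex assume "norm z < 1 / \<rho>"
      then have "norm (of_real \<rho> * z) < 1" using \<rho> by (simp add: norm_mult field_simps)
      then show "poly f2 z \<noteq> 0" unfolding pf2 by (rule nz)
    qed
    have "circle_mean (\<lambda>w. norm (poly f2 w)) \<le> circle_mean (\<lambda>w. norm (poly f w) + D \<rho>)"
    proof (rule circle_mean_mono)
      fix w :: complex assume w: "norm w = 1"
      have "poly f2 w - poly f w = (\<Sum>k\<le>degree f. coeff f k * ((of_real (\<rho> ^ k) - 1) * w ^ k))"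
        unfolding pf2 by (simp add: poly_altdef power_mult_distrib sum_subtractf[symmetric] algebra_simps)
      also have "norm \<dots> \<le> D \<rho>"
        unfolding D_def
      proof (rule sum_norm_le)
        fix k
        have "\<rho> ^ k \<le> 1" using \<rho> by (simp add: power_le_one)
        then have "norm (complex_of_real (\<rho> ^ k) - 1) = 1 - \<rho> ^ k"
          by (metis abs_minus_commute abs_of_nonneg diff_ge_0_iff_ge norm_of_real of_real_1 of_real_diff)
        then show "norm (coeff f k * ((of_real (\<rho> ^ k) - 1) * w ^ k)) \<le> norm (coeff f k) * (1 - \<rho> ^ k)"
          using w by (simp only: norm_mult norm_power) simp
      qed
      finally show "norm (poly f2 w) \<le> norm (poly f w) + D \<rho>"
        using norm_triangle_sub[of "poly f2 w" "poly f w"] by linarith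
    qed (auto intro!: continuous_intros)
    also have "\<dots> = A + D \<rho>"
      unfolding A_def by (subst circle_mean_add) (auto simp: circle_mean_def intro!: continuous_intros)
    finally have "(circle_mean (\<lambda>w. norm (poly f2 w)))\<^sup>2 \<le> (A + D \<rho>)\<^sup>2"
      by (intro power_mono circle_mean_nonneg continuous_intros) auto
    with W have "weighted_coeff_norm N f2 \<le> (A + D \<rho>)\<^sup>2" by linarith
    then show ?thesis
      using \<rho> by (simp add: weighted_coeff_norm_def f2_def coeff_pcompose_linear norm_mult norm_power)
  qed
  then have ev: "\<forall>\<^sub>F \<rho> in at_left 1. (\<Sum>k\<le>N. (1 / 2) ^ k * (\<rho> ^ k * norm (coeff f k))\<^sup>2) \<le> (A + D \<rho>)\<^sup>2"
    by (auto simp: eventually_at_left_field intro!: exI[of _ 0])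
  have l1: "((\<lambda>\<rho>. (\<Sum>k\<le>N. (1 / 2) ^ k * (\<rho> ^ k * norm (coeff f k))\<^sup>2)) \<longlongrightarrow>
      (\<Sum>k\<le>N. (1 / 2) ^ k * (1 ^ k * norm (coeff f k))\<^sup>2)) (at_left (1::real))"
    by (intro tendsto_intros)
  have l2: "((\<lambda>\<rho>. (A + D \<rho>)\<^sup>2) \<longlongrightarrow> (A + D 1)\<^sup>2) (at_left (1::real))"
    unfolding D_def by (intro tendsto_intros)
  have "(\<Sum>k\<le>N. (1 / 2) ^ k * (1 ^ k * norm (coeff f k))\<^sup>2) \<le> (A + D 1)\<^sup>2"
    by (rule tendsto_le[OF _ l2 l1 ev]) simp
  then show ?thesis by (simp add: D_def weighted_coeff_norm_def A_def)
qed

text \<open>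
  Carleman's inequality with the weights \<open>2\<^bsup>-k\<^esup>\<close> in place of \<open>1/(k + 1)\<close>. The geometric weights
  multiply to \<open>2\<^bsup>-|\<alpha>|\<^esup>\<close> over several variables, which is constant on homogeneous polynomials.
\<close>

lemma carleman_inequality:
  fixes c :: "nat \<Rightarrow> complex"
  shows "(\<Sum>k\<le>N. (1 / 2) ^ k * (norm (c k))\<^sup>2) \<le> (circle_mean (\<lambda>w. norm (\<Sum>k\<le>N. c k * w ^ k)))\<^sup>2"
proof -
  define f where "f = (\<Sum>k\<le>N. monom (c k) k)"
  have pf: "poly f w = (\<Sum>k\<le>N. c k * w ^ k)" for w
    by (simp add: f_def poly_sum poly_monom)
  have cf: "coeff f k = c k" if "k \<le> N" for k
    using that by (simp add: f_def coeff_sum)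
  have W: "weighted_coeff_norm N f = (\<Sum>k\<le>N. (1 / 2) ^ k * (norm (c k))\<^sup>2)"
    unfolding weighted_coeff_norm_def by (intro sum.cong refl) (simp add: cf)
  show ?thesis
  proof (cases "f = 0")
    case True
    then show ?thesis using W by (simp add: weighted_coeff_norm_def)
  next
    case False
    from move_zeros_out_of_disc[of 1 f N] False obtain f1 where f1:
      "\<And>z. norm z < 1 \<Longrightarrow> poly f1 z \<noteq> 0" "\<And>z. norm z = 1 \<Longrightarrow> norm (poly f1 z) = norm (poly f z)"
      "weighted_coeff_norm N f \<le> weighted_coeff_norm N f1" by auto
    note f1(3)
    also have "weighted_coeff_norm N f1 \<le> (circle_mean (\<lambda>w. norm (poly f1 w)))\<^sup>2"
      by (rule carleman_zero_free_open_disc) (rule f1(1))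
    also have "circle_mean (\<lambda>w. norm (poly f1 w)) = circle_mean (\<lambda>w. norm (\<Sum>k\<le>N. c k * w ^ k))"
      using f1(2) by (intro circle_mean_cong) (simp add: pf)
    finally show ?thesis unfolding W .
  qed
qed

text \<open>
  The exponents above \<open>2\<close> follow from Carleman's inequality because each coefficient is at most the
  mean.
\<close>

lemma averaging_powers:
  assumes "q \<ge> 2"
  shows "averaging {\<phi>. \<exists>w. norm w = 1 \<and> \<phi> = (\<lambda>l. w ^ l)} (\<lambda>l. (1 / 2) ^ l) d q"
  unfolding averaging_def
proof (intro allI impI)
  fix I :: "(nat \<times> (nat \<Rightarrow> nat)) set" and lam :: "nat \<times> (nat \<Rightarrow> nat) \<Rightarrow> real"
    and c :: "nat \<times> (nat \<Rightarrow> nat) \<Rightarrow> nat \<Rightarrow> complex"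
  assume fin: "finite I" and lam: "\<forall>i\<in>I. lam i \<ge> 0"
  define A where "A i = circle_mean (\<lambda>w. norm (\<Sum>l\<le>d. c i l * w ^ l))" for i
  have A0: "A i \<ge> 0" for i
    unfolding A_def by (intro circle_mean_nonneg continuous_intros) auto
  have eA: "(\<Sum>l\<le>d. (1 / 2) ^ l * norm (c i l) powr q) powr (1 / q) \<le> A i" for i
  proof -
    have "(\<Sum>l\<le>d. (1 / 2) ^ l * norm (c i l) powr q) \<le> (\<Sum>l\<le>d. A i powr (q - 2) * ((1 / 2) ^ l * (norm (c i l))\<^sup>2))"
    proof (intro sum_mono)
      fix l assume "l \<in> {..d}"
      then have "norm (c i l) \<le> A i"
        using coeff_le_circle_mean[of l "Suc d" "c i"] by (simp add: A_def lessThan_Suc_atMost)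
      have "norm (c i l) powr q \<le> A i powr (q - 2) * (norm (c i l))\<^sup>2"
      proof (cases "c i l = 0")
        case False
        then have "norm (c i l) powr q = norm (c i l) powr (q - 2) * (norm (c i l))\<^sup>2"
          by (simp add: powr_diff)
        also have "\<dots> \<le> A i powr (q - 2) * (norm (c i l))\<^sup>2"
          using assms \<open>norm (c i l) \<le> A i\<close> by (intro mult_right_mono powr_mono2) auto
        finally show ?thesis .
      qed simp
      then show "(1 / 2) ^ l * norm (c i l) powr q \<le> A i powr (q - 2) * ((1 / 2) ^ l * (norm (c i l))\<^sup>2)"
        using mult_left_mono[of _ _ "(1/2::real) ^ l"] by (simp add: mult_ac)
    qed
    also have "\<dots> \<le> A i powr (q - 2) * (A i)\<^sup>2"
      unfolding sum_distrib_left[symmetric] A_def by (intro mult_left_mono carleman_inequality) auto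
    also have "\<dots> = A i powr q"
      using A0[of i] by (cases "A i = 0") (auto simp: powr_diff)
    finally have "(\<Sum>l\<le>d. (1 / 2) ^ l * norm (c i l) powr q) powr (1 / q) \<le> (A i powr q) powr (1 / q)"
      using assms by (intro powr_mono2 sum_nonneg) auto
    then show ?thesis using assms A0[of i] by (simp add: powr_powr)
  qed
  define g where "g w = (\<Sum>i\<in>I. lam i * norm (\<Sum>l\<le>d. c i l * w ^ l))" for w
  have "continuous_on UNIV g" unfolding g_def by (intro continuous_intros)
  then obtain w where w: "norm w = 1" "circle_mean g \<le> g w"
    using circle_mean_le_attained by blast
  have "(\<Sum>i\<in>I. lam i * (\<Sum>l\<le>d. (1 / 2) ^ l * norm (c i l) powr q) powr (1 / q)) \<le> (\<Sum>i\<in>I. lam i * A i)"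
    using lam eA by (intro sum_mono mult_left_mono) auto
  also have "\<dots> = circle_mean g"
    unfolding g_def A_def using fin
    by (subst circle_mean_sum) (auto simp: circle_mean_cmult intro!: continuous_intros)
  also note w(2)
  finally show "\<exists>\<phi>\<in>{\<phi>. \<exists>w. norm w = 1 \<and> \<phi> = (\<lambda>l. w ^ l)}.
      (\<Sum>i\<in>I. lam i * (\<Sum>l\<le>d. (1 / 2) ^ l * norm (c i l) powr q) powr (1 / q))
        \<le> (\<Sum>i\<in>I. lam i * norm (\<Sum>l\<le>d. c i l * \<phi> l))"
    using w(1) unfolding g_def by blast
qed

section \<open>Homogeneous parts and polarization\<close>

definition multi_choose :: "nat \<Rightarrow> (nat \<Rightarrow> nat) \<Rightarrow> (nat \<Rightarrow> nat) \<Rightarrow> nat" where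
  "multi_choose n \<alpha> \<gamma> = (\<Prod>j<n. \<alpha> j choose \<gamma> j)"

text \<open>
  The value at \<open>z\<close> of \<open>z\<^sup>\<gamma> \<partial>\<^sup>\<gamma> P / \<gamma>!\<close>.
\<close>

definition partial_eval ::
  "nat \<Rightarrow> nat \<Rightarrow> ((nat \<Rightarrow> nat) \<Rightarrow> complex) \<Rightarrow> (nat \<Rightarrow> nat) \<Rightarrow> (nat \<Rightarrow> complex) \<Rightarrow> complex" where
  "partial_eval m n c \<gamma> z = poly_eval m n (\<lambda>\<alpha>. of_nat (multi_choose n \<alpha> \<gamma>) * c \<alpha>) z"

lemma multi_binomial:
  fixes u :: "nat \<Rightarrow> complex"
  assumes "\<alpha> \<in> multi_indices m n"
  shows "monomial n (\<lambda>j. 1 + t * u j) \<alpha>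
       = (\<Sum>\<gamma>\<in>exponent_box n m. of_nat (multi_choose n \<alpha> \<gamma>) * monomial n u \<gamma> * t ^ (\<Sum>j<n. \<gamma> j))"
proof -
  have "(\<Sum>\<gamma>\<in>exponent_box n m. of_nat (multi_choose n \<alpha> \<gamma>) * monomial n u \<gamma> * t ^ (\<Sum>j<n. \<gamma> j))
      = (\<Sum>\<gamma>\<in>exponent_box n m. \<Prod>j<n. of_nat (\<alpha> j choose \<gamma> j) * (t * u j) ^ \<gamma> j)"
    by (intro sum.cong refl)
       (simp add: multi_choose_def monomial_def power_sum prod.distrib power_mult_distrib mult_ac)
  also have "\<dots> = (\<Prod>j<n. \<Sum>l\<le>m. of_nat (\<alpha> j choose l) * (t * u j) ^ l)"
    by (rule sum_prod_exponent_box)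
  also have "\<dots> = (\<Prod>j<n. (1 + t * u j) ^ \<alpha> j)"
  proof (intro prod.cong refl)
    fix j
    have "(1 + t * u j) ^ \<alpha> j = (\<Sum>l\<le>\<alpha> j. of_nat (\<alpha> j choose l) * (t * u j) ^ l)"
      using binomial_ring[of "t * u j" 1 "\<alpha> j"] by (simp add: add.commute)
    also have "\<dots> = (\<Sum>l\<le>m. of_nat (\<alpha> j choose l) * (t * u j) ^ l)"
      by (intro sum.mono_neutral_left) (use multi_indices_le[OF assms, of j] in auto)
    finally show "(\<Sum>l\<le>m. of_nat (\<alpha> j choose l) * (t * u j) ^ l) = (1 + t * u j) ^ \<alpha> j" by simp
  qed
  finally show ?thesis by (simp add: monomial_def)
qed

text \<open>
  Moving each variable by a factor \<open>1 + t u\<^sub>j\<close> expands \<open>P\<close> into a polynomial in \<open>t\<close> whose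
  coefficients are themselves homogeneous polynomials in \<open>u\<close>.
\<close>

lemma poly_eval_perturb:
  "poly_eval m n c (\<lambda>j. z j * (1 + t * u j))
     = (\<Sum>\<kappa>\<le>n * m. (\<Sum>\<gamma>\<in>{\<gamma>\<in>exponent_box n m. (\<Sum>j<n. \<gamma> j) = \<kappa>}. monomial n u \<gamma> * partial_eval m n c \<gamma> z) * t ^ \<kappa>)"
proof -
  have "poly_eval m n c (\<lambda>j. z j * (1 + t * u j))
      = (\<Sum>\<alpha>\<in>multi_indices m n. c \<alpha> * monomial n z \<alpha> *
          (\<Sum>\<gamma>\<in>exponent_box n m. of_nat (multi_choose n \<alpha> \<gamma>) * monomial n u \<gamma> * t ^ (\<Sum>j<n. \<gamma> j)))"
    unfolding poly_eval_monomial
    by (intro sum.cong refl) (simp add: monomial_mult multi_binomial mult.assoc)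
  also have "\<dots> = (\<Sum>\<gamma>\<in>exponent_box n m. \<Sum>\<alpha>\<in>multi_indices m n. c \<alpha> * monomial n z \<alpha> *
          (of_nat (multi_choose n \<alpha> \<gamma>) * monomial n u \<gamma> * t ^ (\<Sum>j<n. \<gamma> j)))"
    unfolding sum_distrib_left by (rule sum.swap)
  also have "\<dots> = (\<Sum>\<gamma>\<in>exponent_box n m. monomial n u \<gamma> * partial_eval m n c \<gamma> z * t ^ (\<Sum>j<n. \<gamma> j))"
    unfolding partial_eval_def poly_eval_monomial sum_distrib_left sum_distrib_right
    by (intro sum.cong refl) (simp add: mult_ac)
  also have "\<dots> = (\<Sum>\<kappa>\<le>n * m. \<Sum>\<gamma>\<in>{\<gamma>\<in>exponent_box n m. (\<Sum>j<n. \<gamma> j) = \<kappa>}.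
      monomial n u \<gamma> * partial_eval m n c \<gamma> z * t ^ (\<Sum>j<n. \<gamma> j))"
  proof (rule sum.group[symmetric])
    show "(\<lambda>\<gamma>. \<Sum>j<n. \<gamma> j) ` exponent_box n m \<subseteq> {..n * m}"
    proof (clarsimp)
      fix \<gamma> assume "\<gamma> \<in> exponent_box n m"
      then show "(\<Sum>j<n. \<gamma> j) \<le> n * m"
        using sum_bounded_above[of "{..<n}" \<gamma> m] by (auto simp: exponent_box_def)
    qed
  qed auto
  also have "\<dots> = (\<Sum>\<kappa>\<le>n * m. (\<Sum>\<gamma>\<in>{\<gamma>\<in>exponent_box n m. (\<Sum>j<n. \<gamma> j) = \<kappa>}. monomial n u \<gamma> * partial_eval m n c \<gamma> z) * t ^ \<kappa>)"
    unfolding sum_distrib_right by (intro sum.cong refl) auto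
  finally show ?thesis .
qed

text \<open>
  Cauchy's estimate on the circle \<open>|w| = t\<close> for the polynomial in \<open>w\<close> of \<open>poly_eval_perturb\<close>, whose
  values are bounded by \<open>B (1 + t)\<^sup>m\<close> by homogeneity.
\<close>

lemma homogeneous_part_bound:
  assumes P: "polydisc_bound m n c B" and z: "\<And>j. j < n \<Longrightarrow> norm (z j) \<le> 1"
    and u: "\<And>j. j < n \<Longrightarrow> norm (u j) \<le> 1" and \<kappa>: "\<kappa> \<le> m" and t: "t > 0" and n: "n \<ge> 1"
  shows "norm (\<Sum>\<gamma>\<in>multi_indices \<kappa> n. monomial n u \<gamma> * partial_eval m n c \<gamma> z) * t ^ \<kappa> \<le> B * (1 + t) ^ m"
proof -
  have "multi_indices \<kappa> n = {\<gamma>\<in>exponent_box n m. (\<Sum>j<n. \<gamma> j) = \<kappa>}"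
  proof (intro set_eqI iffI)
    fix \<gamma> assume "\<gamma> \<in> multi_indices \<kappa> n"
    then show "\<gamma> \<in> {\<gamma>\<in>exponent_box n m. (\<Sum>j<n. \<gamma> j) = \<kappa>}"
      using multi_indices_le[of \<gamma> \<kappa> n] \<kappa> order_trans
      by (auto simp: exponent_box_def multi_indices_def)
  qed (auto simp: exponent_box_def multi_indices_def)
  moreover have "norm (\<Sum>\<gamma>\<in>{\<gamma>\<in>exponent_box n m. (\<Sum>j<n. \<gamma> j) = \<kappa>}. monomial n u \<gamma> * partial_eval m n c \<gamma> z) * t ^ \<kappa>
      \<le> B * (1 + t) ^ m"
  proof (rule cauchy_estimate_poly[where d = "n * m" and c = "\<lambda>\<kappa>. \<Sum>\<gamma>\<in>{\<gamma>\<in>exponent_box n m. (\<Sum>j<n. \<gamma> j) = \<kappa>}. monomial n u \<gamma> * partial_eval m n c \<gamma> z"])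
    fix w :: complex assume w: "norm w = 1"
    show "norm (\<Sum>\<kappa>\<le>n * m. (\<Sum>\<gamma>\<in>{\<gamma>\<in>exponent_box n m. (\<Sum>j<n. \<gamma> j) = \<kappa>}. monomial n u \<gamma> * partial_eval m n c \<gamma> z)
         * (of_real t * w) ^ \<kappa>) \<le> B * (1 + t) ^ m"
      unfolding poly_eval_perturb[symmetric]
    proof (rule polydisc_bound_scale[OF P])
      fix j assume j: "j < n"
      have "norm (1 + of_real t * w * u j) \<le> 1 + t * norm (u j)"
        using norm_triangle_ineq[of 1 "of_real t * w * u j"] t w by (simp add: norm_mult)
      also have "\<dots> \<le> 1 + t" using u[OF j] t by simp
      finally show "norm (z j * (1 + of_real t * w * u j)) \<le> 1 + t"
        using mult_mono[of "norm (z j)" 1 "norm (1 + of_real t * w * u j)" "1 + t"] z[OF j] t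
        by (simp add: norm_mult)
    qed (use t in auto)
  next
    show "\<kappa> \<le> n * m"
      by (rule order_trans[OF \<kappa>]) (rule mult_le_mono1[OF n, of m, unfolded nat_mult_1])
  qed (rule t)
  ultimately show ?thesis by simp
qed

definition unit_index :: "nat \<Rightarrow> nat \<Rightarrow> nat" where
  "unit_index k = (\<lambda>j. if j = k then 1 else 0)"

lemma bij_betw_unit_index: "bij_betw unit_index {..<n} (multi_indices 1 n)"
proof (rule bij_betw_imageI)
  show "inj_on unit_index {..<n}"
    by (auto simp: inj_on_def unit_index_def fun_eq_iff split: if_splits)
  show "unit_index ` {..<n} = multi_indices 1 n"
  proof (intro equalityI subsetI)
    fix \<alpha> assume a: "\<alpha> \<in> multi_indices 1 n"
    then obtain k where k: "k < n" "\<alpha> k \<noteq> 0"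
      by (metis (no_types, lifting) lessThan_iff multi_indices_sum sum.neutral zero_neq_one)
    have "\<alpha> k = 1" using k multi_indices_le[OF a, of k] by simp
    moreover have "\<alpha> j = 0" if "j \<noteq> k" for j
    proof (cases "j < n")
      case True
      have "(\<Sum>i\<in>{j, k}. \<alpha> i) \<le> (\<Sum>i<n. \<alpha> i)" using True k by (intro sum_mono2) auto
      then show ?thesis using \<open>\<alpha> k = 1\<close> that multi_indices_sum[OF a] by simp
    qed (use multi_indices_zero[OF a] in auto)
    ultimately have "\<alpha> = unit_index k" by (auto simp: unit_index_def)
    then show "\<alpha> \<in> unit_index ` {..<n}" using k by auto
  qed (auto simp: multi_indices_def unit_index_def)
qed

lemma monomial_unit_index: "k < n \<Longrightarrow> monomial n u (unit_index k) = u k"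
  by (simp add: monomial_def unit_index_def if_distrib[of "\<lambda>x. _ ^ x"] prod.delta cong: if_cong)

lemma multi_choose_unit_index: "k < n \<Longrightarrow> multi_choose n \<alpha> (unit_index k) = \<alpha> k"
  unfolding multi_choose_def unit_index_def by (subst prod.remove[of _ k]) auto

text \<open>
  The homogeneous part of degree one in \<open>u\<close> is the linear form \<open>\<Sum> u\<^sub>k z\<^sub>k \<partial>\<^sub>k P\<close>; its norm is the sum
  of the moduli of its coefficients.
\<close>

lemma sum_partials_bound:
  assumes P: "polydisc_bound m n c B" and z: "\<And>j. j < n \<Longrightarrow> norm (z j) \<le> 1"
    and m: "m \<ge> 2" and n: "n \<ge> 1"
  shows "(\<Sum>k<n. norm (partial_eval m n c (unit_index k) z)) \<le> real m * c_const m * B"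
proof -
  define S where "S k = partial_eval m n c (unit_index k) z" for k
  define u where "u k = cnj (sgn (S k))" for k
  \<comment> \<open>the minimiser of \<open>(1 + t)\<^sup>m / t\<close>, where the minimum is \<open>m c\<^sub>m\<close>\<close>
  define t where "t = 1 / (real m - 1)"
  have t: "t > 0" using m by (simp add: t_def)
  have "norm (\<Sum>\<gamma>\<in>multi_indices 1 n. monomial n u \<gamma> * partial_eval m n c \<gamma> z) * t ^ 1 \<le> B * (1 + t) ^ m"
    by (rule homogeneous_part_bound[OF P z]) (use m n t in \<open>auto simp: u_def norm_sgn\<close>)
  also have "(\<Sum>\<gamma>\<in>multi_indices 1 n. monomial n u \<gamma> * partial_eval m n c \<gamma> z)
     = (\<Sum>k<n. monomial n u (unit_index k) * partial_eval m n c (unit_index k) z)"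
    by (rule sum.reindex_bij_betw[OF bij_betw_unit_index, symmetric])
  also have "\<dots> = (\<Sum>k<n. of_real (norm (S k)))"
  proof (intro sum.cong refl)
    fix k assume "k \<in> {..<n}"
    then have "monomial n u (unit_index k) * partial_eval m n c (unit_index k) z = cnj (sgn (S k)) * S k"
      by (simp add: monomial_unit_index u_def S_def)
    also have "\<dots> = of_real (norm (S k))"
      by (cases "S k = 0") (simp_all add: sgn_eq mult.commute[of "cnj _"] power2_eq_square flip: complex_norm_square)
    finally show "monomial n u (unit_index k) * partial_eval m n c (unit_index k) z = of_real (norm (S k))" .
  qed
  also have "norm \<dots> = (\<Sum>k<n. norm (S k))"
    by (simp flip: of_real_sum add: sum_nonneg)
  finally have "(\<Sum>k<n. norm (S k)) \<le> B * ((1 + t) ^ m / t)" using t by (simp add: field_simps)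
  also have "(1 + t) ^ m / t = real m * c_const m"
  proof -
    obtain k where k: "m = Suc k" "k > 0" using m by (cases m) auto
    have "1 + t = real m / (real m - 1)" using m by (simp add: t_def field_simps)
    then have "(1 + t) ^ m / t = (real m / (real m - 1)) ^ k * (real m / (real m - 1)) * (real m - 1)"
      using k by (simp add: t_def)
    also have "\<dots> = (real m / (real m - 1)) ^ k * real m" using k by (simp add: field_simps)
    finally show ?thesis using k by (simp add: c_const_def)
  qed
  finally show ?thesis by (simp add: S_def mult.commute)
qed

section \<open>The mixed inequality on the polydisc\<close>

lemma bij_betw_increment:
  assumes "k < n"
  shows "bij_betw (\<lambda>\<beta>. \<beta>(k := Suc (\<beta> k))) (multi_indices m n) {\<alpha>\<in>multi_indices (Suc m) n. \<alpha> k > 0}"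
proof (rule bij_betw_byWitness[where f' = "\<lambda>\<alpha>. \<alpha>(k := \<alpha> k - 1)"])
  have s: "(\<Sum>j<n. (\<beta>(k := v)) j) = v + (\<Sum>j\<in>{..<n} - {k}. \<beta> j)" for \<beta> :: "nat \<Rightarrow> nat" and v
    using assms by (subst sum.remove[of _ k]) auto
  have s': "(\<Sum>j<n. \<beta> j) = \<beta> k + (\<Sum>j\<in>{..<n} - {k}. \<beta> j)" for \<beta> :: "nat \<Rightarrow> nat"
    using assms by (subst sum.remove[of _ k]) auto
  show "(\<lambda>\<beta>. \<beta>(k := Suc (\<beta> k))) ` multi_indices m n \<subseteq> {\<alpha>\<in>multi_indices (Suc m) n. \<alpha> k > 0}"
    using assms by (auto simp: multi_indices_def s s' simp del: fun_upd_apply) (auto)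
  show "(\<lambda>\<alpha>. \<alpha>(k := \<alpha> k - 1)) ` {\<alpha>\<in>multi_indices (Suc m) n. \<alpha> k > 0} \<subseteq> multi_indices m n"
    using assms by (auto simp: multi_indices_def s s' simp del: fun_upd_apply) (auto)
qed auto

text \<open>
  The coefficients of \<open>\<partial>\<^sub>k P\<close> are \<open>\<alpha>\<^sub>k c\<^sub>\<alpha>\<close>, and its degree is \<open>m - 1\<close>. Averaging over the torus
  compares, for all \<open>k\<close> at the same point, the coefficients of \<open>\<partial>\<^sub>k P\<close> with its values; the sum of the
  values over \<open>k\<close> is controlled by \<open>sum_partials_bound\<close>. The weight \<open>\<alpha>\<^sub>k\<close> on the left is at most
  \<open>\<alpha>\<^sub>k\<^sup>q\<close>.
\<close>

lemma mixed_inequality: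
  assumes P: "polydisc_bound m n c B" and m: "m \<ge> 2" and n: "n \<ge> 1" and q: "q \<ge> 2"
  shows "(\<Sum>k<n. (\<Sum>\<alpha>\<in>multi_indices m n. real (\<alpha> k) * norm (c \<alpha>) powr q) powr (1 / q))
       \<le> real m * c_const m * 2 powr ((real m - 1) / q) * B"
proof -
  obtain m' where m': "m = Suc m'" using m by (cases m) auto
  \<comment> \<open>the coefficients of \<open>\<partial>\<^sub>k P\<close>, extended by zero to a box\<close>
  define r where "r k \<beta> = (if \<beta> \<in> multi_indices m' n
      then of_nat (Suc (\<beta> k)) * c (\<beta>(k := Suc (\<beta> k))) else 0)" for k \<beta>
  have sub: "multi_indices m' n \<subseteq> exponent_box n m"
    using multi_indices_subset_box[of m' n] by (auto simp: exponent_box_def m' le_Suc_eq)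
  have reduce: "(\<Sum>\<beta>\<in>exponent_box n m. g (r k \<beta>) \<beta>)
      = (\<Sum>\<beta>\<in>multi_indices m' n. g (of_nat (Suc (\<beta> k)) * c (\<beta>(k := Suc (\<beta> k)))) \<beta>)"
    if "\<And>\<beta>. g 0 \<beta> = 0" for g :: "complex \<Rightarrow> (nat \<Rightarrow> nat) \<Rightarrow> 'b::comm_monoid_add" and k
    by (rule sum.mono_neutral_cong_right) (use sub that in \<open>auto simp: r_def\<close>)
  have shift: "(\<Sum>\<beta>\<in>multi_indices m' n. g (\<beta>(k := Suc (\<beta> k)))) = (\<Sum>\<alpha>\<in>{\<alpha>\<in>multi_indices m n. \<alpha> k > 0}. g \<alpha>)"
    if "k < n" for g :: "(nat \<Rightarrow> nat) \<Rightarrow> 'b::comm_monoid_add" and k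
    unfolding m' by (rule sum.reindex_bij_betw[OF bij_betw_increment[OF that]])
  have "\<exists>\<phi>. (\<forall>j<n. \<phi> j \<in> {\<phi>. \<exists>w. norm w = 1 \<and> \<phi> = (\<lambda>l. w ^ l)}) \<and>
     (\<Sum>k\<in>{..<n}. (\<Sum>\<beta>\<in>exponent_box n m. (\<Prod>j<n. (1 / 2) ^ (\<beta> j)) * norm (r k \<beta>) powr q) powr (1 / q))
       \<le> (\<Sum>k\<in>{..<n}. norm (\<Sum>\<beta>\<in>exponent_box n m. r k \<beta> * (\<Prod>j<n. \<phi> j (\<beta> j))))"
    by (rule averaging_iterate) (use q averaging_powers[OF q] in auto)
  then obtain \<phi> where \<phi>: "\<forall>j<n. \<exists>w. norm w = 1 \<and> \<phi> j = (\<lambda>l. w ^ l)"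
    "(\<Sum>k\<in>{..<n}. (\<Sum>\<beta>\<in>exponent_box n m. (\<Prod>j<n. (1 / 2) ^ (\<beta> j)) * norm (r k \<beta>) powr q) powr (1 / q))
       \<le> (\<Sum>k\<in>{..<n}. norm (\<Sum>\<beta>\<in>exponent_box n m. r k \<beta> * (\<Prod>j<n. \<phi> j (\<beta> j))))"
    by auto
  from \<phi>(1) obtain w where w: "\<And>j. j < n \<Longrightarrow> norm (w j) = 1" "\<And>j. j < n \<Longrightarrow> \<phi> j = (\<lambda>l. w j ^ l)"
    by metis
  have mon: "(\<Prod>j<n. \<phi> j (\<beta> j)) = monomial n w \<beta>" for \<beta>
    by (simp add: monomial_def w)
  have lower: "(1 / 2) powr ((real m - 1) / q) * (\<Sum>\<alpha>\<in>multi_indices m n. real (\<alpha> k) * norm (c \<alpha>) powr q) powr (1 / q)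
     \<le> (\<Sum>\<beta>\<in>exponent_box n m. (\<Prod>j<n. (1 / 2) ^ (\<beta> j)) * norm (r k \<beta>) powr q) powr (1 / q)" if k: "k < n" for k
  proof -
    have "(\<Sum>\<alpha>\<in>multi_indices m n. real (\<alpha> k) * norm (c \<alpha>) powr q)
        = (\<Sum>\<alpha>\<in>{\<alpha>\<in>multi_indices m n. \<alpha> k > 0}. real (\<alpha> k) * norm (c \<alpha>) powr q)"
      by (rule sum.mono_neutral_right) auto
    also have "\<dots> \<le> (\<Sum>\<alpha>\<in>{\<alpha>\<in>multi_indices m n. \<alpha> k > 0}. norm (of_nat (\<alpha> k) * c \<alpha>) powr q)"
    proof (intro sum_mono)
      fix \<alpha> assume "\<alpha> \<in> {\<alpha>\<in>multi_indices m n. \<alpha> k > 0}"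
      then have "real (\<alpha> k) \<le> real (\<alpha> k) powr q"
        using q powr_mono[of 1 q "real (\<alpha> k)"] by simp
      then show "real (\<alpha> k) * norm (c \<alpha>) powr q \<le> norm (of_nat (\<alpha> k) * c \<alpha>) powr q"
        by (simp add: norm_mult powr_mult mult_right_mono)
    qed
    also have "\<dots> = (\<Sum>\<beta>\<in>multi_indices m' n. norm (of_nat ((\<beta>(k := Suc (\<beta> k))) k) * c (\<beta>(k := Suc (\<beta> k)))) powr q)"
      by (rule shift[OF k, symmetric])
    finally have "(1 / 2) ^ m' * (\<Sum>\<alpha>\<in>multi_indices m n. real (\<alpha> k) * norm (c \<alpha>) powr q)
      \<le> (1 / 2) ^ m' * (\<Sum>\<beta>\<in>multi_indices m' n. norm (of_nat (Suc (\<beta> k)) * c (\<beta>(k := Suc (\<beta> k)))) powr q)"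
      by (intro mult_left_mono) auto
    also have "\<dots> = (\<Sum>\<beta>\<in>multi_indices m' n. (\<Prod>j<n. (1 / 2) ^ (\<beta> j)) * norm (of_nat (Suc (\<beta> k)) * c (\<beta>(k := Suc (\<beta> k)))) powr q)"
      unfolding sum_distrib_left
      by (intro sum.cong refl) (simp add: multi_indices_sum power_sum[symmetric] del: of_nat_Suc)
    also have "\<dots> = (\<Sum>\<beta>\<in>exponent_box n m. (\<Prod>j<n. (1 / 2) ^ (\<beta> j)) * norm (r k \<beta>) powr q)"
      by (rule reduce[symmetric]) simp
    finally have "((1 / 2) ^ m' * (\<Sum>\<alpha>\<in>multi_indices m n. real (\<alpha> k) * norm (c \<alpha>) powr q)) powr (1 / q)
      \<le> (\<Sum>\<beta>\<in>exponent_box n m. (\<Prod>j<n. (1 / 2) ^ (\<beta> j)) * norm (r k \<beta>) powr q) powr (1 / q)"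
      using q by (intro powr_mono2 mult_nonneg_nonneg sum_nonneg) auto
    moreover have "((1 / 2) ^ m') powr (1 / q) = (1 / 2 :: real) powr ((real m - 1) / q)"
      by (simp add: powr_powr m' flip: powr_realpow)
    ultimately show ?thesis by (simp add: powr_mult sum_nonneg)
  qed
  have upper: "norm (\<Sum>\<beta>\<in>exponent_box n m. r k \<beta> * (\<Prod>j<n. \<phi> j (\<beta> j)))
      = norm (partial_eval m n c (unit_index k) w)" if k: "k < n" for k
  proof -
    have "w k * (\<Sum>\<beta>\<in>exponent_box n m. r k \<beta> * (\<Prod>j<n. \<phi> j (\<beta> j)))
      = (\<Sum>\<beta>\<in>exponent_box n m. r k \<beta> * (w k * monomial n w \<beta>))"
      by (simp add: sum_distrib_left mon mult_ac)
    also have "\<dots> = (\<Sum>\<beta>\<in>multi_indices m' n. of_nat (Suc (\<beta> k)) * c (\<beta>(k := Suc (\<beta> k))) * (w k * monomial n w \<beta>))"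
      by (rule reduce) simp
    also have "\<dots> = (\<Sum>\<beta>\<in>multi_indices m' n. of_nat ((\<beta>(k := Suc (\<beta> k))) k) * c (\<beta>(k := Suc (\<beta> k))) * monomial n w (\<beta>(k := Suc (\<beta> k))))"
    proof (intro sum.cong refl)
      fix \<beta>
      have "w k * monomial n w \<beta> = monomial n w (\<beta>(k := Suc (\<beta> k)))"
        unfolding monomial_def using k by (subst (1 2) prod.remove[of _ k]) auto
      then show "of_nat (Suc (\<beta> k)) * c (\<beta>(k := Suc (\<beta> k))) * (w k * monomial n w \<beta>)
        = of_nat ((\<beta>(k := Suc (\<beta> k))) k) * c (\<beta>(k := Suc (\<beta> k))) * monomial n w (\<beta>(k := Suc (\<beta> k)))" by simp
    qed
    also have "\<dots> = (\<Sum>\<alpha>\<in>{\<alpha>\<in>multi_indices m n. \<alpha> k > 0}. of_nat (\<alpha> k) * c \<alpha> * monomial n w \<alpha>)"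
      by (rule shift[OF k])
    also have "\<dots> = (\<Sum>\<alpha>\<in>multi_indices m n. of_nat (\<alpha> k) * c \<alpha> * monomial n w \<alpha>)"
      by (rule sum.mono_neutral_left) auto
    also have "\<dots> = partial_eval m n c (unit_index k) w"
      by (simp add: partial_eval_def poly_eval_monomial multi_choose_unit_index[OF k])
    finally have "norm (w k) * norm (\<Sum>\<beta>\<in>exponent_box n m. r k \<beta> * (\<Prod>j<n. \<phi> j (\<beta> j)))
        = norm (partial_eval m n c (unit_index k) w)" by (simp only: norm_mult[symmetric])
    then show ?thesis using w(1)[OF k] by simp
  qed
  have "(1 / 2) powr ((real m - 1) / q) * (\<Sum>k<n. (\<Sum>\<alpha>\<in>multi_indices m n. real (\<alpha> k) * norm (c \<alpha>) powr q) powr (1 / q))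
     \<le> (\<Sum>k<n. (\<Sum>\<beta>\<in>exponent_box n m. (\<Prod>j<n. (1 / 2) ^ (\<beta> j)) * norm (r k \<beta>) powr q) powr (1 / q))"
    unfolding sum_distrib_left using lower by (intro sum_mono) auto
  also note \<phi>(2)
  also have "(\<Sum>k\<in>{..<n}. norm (\<Sum>\<beta>\<in>exponent_box n m. r k \<beta> * (\<Prod>j<n. \<phi> j (\<beta> j))))
      = (\<Sum>k<n. norm (partial_eval m n c (unit_index k) w))"
    using upper by (intro sum.cong refl) auto
  also have "\<dots> \<le> real m * c_const m * B"
    by (rule sum_partials_bound[OF P _ m n]) (simp add: w(1))
  finally have "(1 / 2) powr ((real m - 1) / q) * (\<Sum>k<n. (\<Sum>\<alpha>\<in>multi_indices m n. real (\<alpha> k) * norm (c \<alpha>) powr q) powr (1 / q))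
     \<le> real m * c_const m * B" .
  then show ?thesis by (simp add: powr_divide field_simps)
qed

section \<open>Balanced points\<close>

text \<open>
  The value of \<open>y\<^sub>k \<partial>\<^sub>k Q\<close> for the polynomial \<open>Q\<close> with coefficients \<open>b\<close>.
\<close>

definition euler_term :: "nat \<Rightarrow> nat \<Rightarrow> ((nat \<Rightarrow> nat) \<Rightarrow> real) \<Rightarrow> (nat \<Rightarrow> real) \<Rightarrow> nat \<Rightarrow> real" where
  "euler_term m n b y k = (\<Sum>\<alpha>\<in>multi_indices m n. real (\<alpha> k) * b \<alpha> * monomial n y \<alpha>)"

lemma compact_coordinate_box:
  "compact {y :: nat \<Rightarrow> real. \<forall>j. y j \<in> (if j < n then {0..R} else {0})}" (is "compact ?K")
proof -
  have K: "?K = PiE UNIV (\<lambda>j. if j < n then {0..R} else {0})" by (auto simp: PiE_def Pi_def)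
  have "compactin (product_topology (\<lambda>_. euclidean) UNIV) (PiE UNIV (\<lambda>j. if j < n then {0..R} else {0::real}))"
    by (subst compactin_PiE) auto
  then show ?thesis unfolding K by (simp only: euclidean_product_topology compactin_euclidean_iff)
qed

lemma exists_small_powr:
  assumes "s > 0" "e > 0"
  shows "\<exists>t::real. 0 < t \<and> t \<le> 1 \<and> t powr e < s"
proof (intro exI conjI)
  let ?t = "(min (s / 2) 1) powr (1 / e)"
  show "0 < ?t" using assms by simp
  show "?t \<le> 1" using assms by (intro powr_le1) auto
  show "?t powr e < s" using assms by (simp add: powr_powr min_def)
qed

text \<open>
  As \<open>p > m\<close>, the function \<open>\<Psi> y = Q y - \<Sum> y\<^sub>k\<^sup>p\<close> attains its maximum over the nonnegative orthant.
  All coefficients are positive, hence the maximum does not lie on the boundary, and the equations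
  say that the partial derivatives of \<open>\<Psi>\<close> vanish there.
\<close>

lemma exists_critical_point:
  assumes b: "\<And>\<alpha>. \<alpha> \<in> multi_indices m n \<Longrightarrow> b \<alpha> > 0" and m: "m \<ge> 1" and n: "n \<ge> 1" and p: "real m < p"
  shows "\<exists>y. (\<forall>k<n. y k > 0) \<and> (\<forall>k<n. euler_term m n b y k = p * y k powr p)"
proof -
  let ?M = "multi_indices m n"
  define Q where "Q y = (\<Sum>\<alpha>\<in>?M. b \<alpha> * monomial n y \<alpha>)" for y :: "nat \<Rightarrow> real"
  define \<Psi> where "\<Psi> y = Q y - (\<Sum>k<n. y k powr p)" for y :: "nat \<Rightarrow> real"
  define C where "C = (\<Sum>\<alpha>\<in>?M. b \<alpha>)"
  \<comment> \<open>\<open>R\<^bsup>p - m\<^esup>\<close> exceeds the sum of the coefficients, so \<open>\<Psi>\<close> is negative once a coordinate is the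
    largest one and equals \<open>R\<close>\<close>
  define R where "R = (C + 1) powr (1 / (p - m))"
  define K where "K = {y :: nat \<Rightarrow> real. \<forall>j. y j \<in> (if j < n then {0..R} else {0})}"
  have p1: "p > 1" using p m by linarith
  have C0: "C \<ge> 0" unfolding C_def by (intro sum_nonneg less_imp_le b)
  have R1: "R \<ge> 1" using C0 p by (simp add: R_def ge_one_powr_ge_zero)
  have RC: "C * R ^ m < R powr p"
  proof -
    have "R powr p = R powr (p - m) * R powr m" by (simp flip: powr_add)
    also have "R powr (p - m) = C + 1" using C0 p by (simp add: R_def powr_powr)
    finally show ?thesis using R1 by (simp add: powr_realpow)
  qed
  have KD: "0 \<le> y j" "y j \<le> R" if "y \<in> K" "j < n" for y j using that by (auto simp: K_def split: if_splits)
  have Kupd: "y(k := t) \<in> K" if "y \<in> K" "k < n" "0 \<le> t" "t \<le> R" for y k t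
  proof -
    have "(y(k := t)) j \<in> (if j < n then {0..R} else {0})" for j
    proof (cases "j = k")
      case False
      have "y j \<in> (if j < n then {0..R} else {0})" using that(1) unfolding K_def by blast
      then show ?thesis using False by simp
    qed (use that in auto)
    then show ?thesis unfolding K_def by blast
  qed
  have "continuous_on K \<Psi>"
    unfolding \<Psi>_def Q_def monomial_def
    by (intro continuous_on_diff continuous_on_sum continuous_on_mult continuous_on_prod continuous_on_power
        continuous_on_powr' continuous_on_const continuous_on_subset[OF continuous_on_product_coordinates])
       (use KD p1 in auto)
  moreover have "K \<noteq> {}"
  proof -
    have "(\<lambda>_. 0) \<in> K" using R1 by (auto simp: K_def)
    then show ?thesis by blast
  qed
  moreover have "compact K" unfolding K_def by (rule compact_coordinate_box)
  ultimately obtain y where y: "y \<in> K" and ymax: "\<And>z. z \<in> K \<Longrightarrow> \<Psi> z \<le> \<Psi> y"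
    using continuous_attains_sup[of K \<Psi>] by blast
  have mon_upd: "monomial n (z(k := t)) \<alpha> = t ^ \<alpha> k * (\<Prod>j\<in>{..<n} - {k}. z j ^ \<alpha> j)"
    if "k < n" for z :: "nat \<Rightarrow> real" and k t \<alpha>
    unfolding monomial_def using that by (subst prod.remove[of _ k]) auto
  have pow_upd: "(\<Sum>j<n. (z(k := t)) j powr p) = t powr p + (\<Sum>j\<in>{..<n} - {k}. z j powr p)"
    if "k < n" for z :: "nat \<Rightarrow> real" and k t
    using that by (subst sum.remove[of _ k]) auto
  \<comment> \<open>on the first axis \<open>\<Psi>\<close> is at least \<open>b t\<^sup>m - t\<^sup>p\<close>, which is positive for small \<open>t\<close>\<close>
  have pos: "\<Psi> y > 0"
  proof -
    define \<alpha>0 where "\<alpha>0 = (\<lambda>j::nat. if j = 0 then m else 0)"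
    have a0: "\<alpha>0 \<in> ?M" using n by (auto simp: \<alpha>0_def multi_indices_def)
    obtain t where t: "0 < t" "t \<le> 1" "t powr (p - m) < b \<alpha>0"
      using exists_small_powr[of "b \<alpha>0" "p - m"] b[OF a0] p by auto
    define z where "z = (\<lambda>j::nat. if j = 0 then t else 0 :: real)"
    have "z \<in> K" using t R1 n by (auto simp: K_def z_def)
    have "monomial n z \<alpha>0 = t ^ m"
      unfolding monomial_def \<alpha>0_def z_def using n by (subst prod.remove[of _ 0]) auto
    then have "b \<alpha>0 * t ^ m \<le> Q z"
    proof -
      assume mon0: "monomial n z \<alpha>0 = t ^ m"
      have "monomial n z \<alpha> \<ge> 0" for \<alpha> using t by (intro monomial_nonneg) (auto simp: z_def)
      then have "b \<alpha>0 * monomial n z \<alpha>0 \<le> Q z"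
        unfolding Q_def by (intro member_le_sum[OF a0] mult_nonneg_nonneg less_imp_le[OF b]) auto
      then show ?thesis by (simp add: mon0)
    qed
    moreover have "(\<Sum>k<n. z k powr p) = t powr p"
      using n by (subst sum.remove[of _ 0]) (auto simp: z_def)
    moreover have "t powr p < b \<alpha>0 * t ^ m"
    proof -
      have "t powr p = t powr (p - m) * t ^ m" using t by (simp add: powr_diff powr_realpow)
      then show ?thesis using t by (simp add: mult_strict_right_mono)
    qed
    ultimately have "\<Psi> z > 0" by (simp add: \<Psi>_def)
    then show ?thesis using ymax[OF \<open>z \<in> K\<close>] by linarith
  qed
  have ypos: "\<exists>j<n. y j > 0"
  proof (rule ccontr)
    assume "\<not> ?thesis"
    then have z: "y j = 0" if "j < n" for j using KD[OF y that] that by force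
    have "Q y = 0" unfolding Q_def
    proof (intro sum.neutral ballI)
      fix \<alpha> assume "\<alpha> \<in> ?M"
      then obtain j where "j < n" "\<alpha> j \<noteq> 0"
        using m by (metis lessThan_iff multi_indices_sum not_one_le_zero sum.neutral)
      then have "monomial n y \<alpha> = 0" unfolding monomial_def using z by (intro prod_zero) auto
      then show "b \<alpha> * monomial n y \<alpha> = 0" by simp
    qed
    then have "\<Psi> y \<le> 0" by (auto simp: \<Psi>_def intro!: sum_nonneg)
    then show False using pos by simp
  qed
  have lt_R: "y k < R" if k: "k < n" for k
  proof (rule ccontr)
    assume "\<not> ?thesis"
    then have "y k = R" using KD[OF y k] by simp
    have "Q y \<le> (\<Sum>\<alpha>\<in>?M. b \<alpha> * R ^ m)"
      unfolding Q_def
    proof (intro sum_mono mult_left_mono)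
      fix \<alpha> assume a: "\<alpha> \<in> ?M"
      have "monomial n y \<alpha> \<le> monomial n (\<lambda>_. R) \<alpha>"
        unfolding monomial_def using KD[OF y] by (intro prod_mono) (auto intro!: power_mono)
      then show "monomial n y \<alpha> \<le> R ^ m" unfolding monomial_const[OF a, of R] .
    qed (use b in \<open>auto intro: less_imp_le\<close>)
    also have "\<dots> = C * R ^ m" by (simp add: C_def sum_distrib_right)
    also note RC
    also have "R powr p \<le> (\<Sum>k<n. y k powr p)"
      unfolding \<open>y k = R\<close>[symmetric] using k by (intro member_le_sum) auto
    finally show False using pos by (simp add: \<Psi>_def)
  qed
  \<comment> \<open>raising a vanishing coordinate to \<open>t\<close> adds at least \<open>s t - t\<^sup>p\<close> to \<open>\<Psi>\<close>, which is positive for small \<open>t\<close>\<close>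
  have gt_0: "y k > 0" if k: "k < n" for k
  proof (rule ccontr)
    assume "\<not> ?thesis"
    then have yk: "y k = 0" using KD[OF y k] by simp
    obtain j where j: "j < n" "y j > 0" using ypos by blast
    have jk: "j \<noteq> k" using j yk by auto
    define \<alpha>1 where "\<alpha>1 = (\<lambda>i. if i = k then 1 else if i = j then m - 1 else 0)"
    have "(\<Sum>i<n. \<alpha>1 i) = (\<Sum>i\<in>{k, j}. \<alpha>1 i)"
      using j k by (intro sum.mono_neutral_right) (auto simp: \<alpha>1_def)
    then have a1: "\<alpha>1 \<in> ?M"
      using jk m j k by (auto simp: multi_indices_def \<alpha>1_def)
    define s where "s = b \<alpha>1 * y j ^ (m - 1)"
    have "s > 0" using b[OF a1] j by (simp add: s_def)
    then obtain t where t: "0 < t" "t \<le> 1" "t powr (p - 1) < s"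
      using exists_small_powr[of s "p - 1"] p1 by auto
    define z where "z = y(k := t)"
    have "z \<in> K" unfolding z_def using t R1 y k by (intro Kupd) auto
    have rest0: "(\<Prod>i\<in>{..<n} - {k}. y i ^ \<alpha> i) \<ge> 0" for \<alpha>
      using KD[OF y] by (intro prod_nonneg) auto
    have yupd: "y(k := 0) = y" using yk by auto
    have mon_y: "monomial n y \<alpha> = 0 ^ \<alpha> k * (\<Prod>i\<in>{..<n} - {k}. y i ^ \<alpha> i)" for \<alpha>
      using mon_upd[OF k, of y 0 \<alpha>] by (simp add: yupd)
    have "Q z - Q y = (\<Sum>\<alpha>\<in>?M. b \<alpha> * (monomial n z \<alpha> - monomial n y \<alpha>))"
      unfolding Q_def by (simp add: right_diff_distrib sum_subtractf)
    also have "\<dots> \<ge> b \<alpha>1 * (monomial n z \<alpha>1 - monomial n y \<alpha>1)"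
    proof (rule member_le_sum[OF a1])
      fix \<alpha> assume "\<alpha> \<in> ?M - {\<alpha>1}"
      then have "b \<alpha> > 0" using b by auto
      moreover have "monomial n z \<alpha> - monomial n y \<alpha> \<ge> 0"
        unfolding z_def mon_upd[OF k] mon_y left_diff_distrib[symmetric]
        using t rest0 by (intro mult_nonneg_nonneg) (auto intro!: power_mono)
      ultimately show "0 \<le> b \<alpha> * (monomial n z \<alpha> - monomial n y \<alpha>)" by simp
    qed simp
    also have "b \<alpha>1 * (monomial n z \<alpha>1 - monomial n y \<alpha>1) = s * t"
    proof -
      have "(\<Prod>i\<in>{..<n} - {k}. y i ^ \<alpha>1 i) = y j ^ (m - 1)"
      proof -
        have "(\<Prod>i\<in>{..<n} - {k}. y i ^ \<alpha>1 i) = (\<Prod>i\<in>{j}. y i ^ \<alpha>1 i)"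
          using j jk by (intro prod.mono_neutral_right) (auto simp: \<alpha>1_def)
        then show ?thesis using jk by (simp add: \<alpha>1_def)
      qed
      then show ?thesis unfolding z_def mon_upd[OF k] mon_y by (simp add: \<alpha>1_def s_def)
    qed
    finally have Qd: "s * t \<le> Q z - Q y" .
    have "(\<Sum>i<n. z i powr p) = t powr p + (\<Sum>i<n. y i powr p)"
      unfolding z_def pow_upd[OF k] using pow_upd[OF k, of y 0] by (simp add: yupd)
    moreover have "t powr p < s * t"
    proof -
      have "t powr p = t powr (p - 1) * t" using t by (simp add: powr_diff)
      then show ?thesis using t by (simp add: mult_strict_right_mono)
    qed
    ultimately have "\<Psi> z > \<Psi> y" using Qd by (simp add: \<Psi>_def)
    then show False using ymax[OF \<open>z \<in> K\<close>] by simp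
  qed
  have "euler_term m n b y k = p * y k powr p" if k: "k < n" for k
  proof -
    define rest where "rest \<alpha> = (\<Prod>i\<in>{..<n} - {k}. y i ^ \<alpha> i)" for \<alpha>
    define f where "f t = (\<Sum>\<alpha>\<in>?M. b \<alpha> * (t ^ \<alpha> k * rest \<alpha>)) - (t powr p + (\<Sum>i\<in>{..<n} - {k}. y i powr p))" for t
    have f: "f t = \<Psi> (y(k := t))" for t
      by (simp only: f_def \<Psi>_def Q_def mon_upd[OF k] pow_upd[OF k] rest_def)
    define l where "l = (\<Sum>\<alpha>\<in>?M. b \<alpha> * (real (\<alpha> k) * y k ^ (\<alpha> k - 1) * rest \<alpha>)) - p * y k powr (p - 1)"
    have "(f has_real_derivative l) (at (y k))"
      unfolding f_def l_def using gt_0[OF k]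
      by (auto intro!: derivative_eq_intros sum.cong simp: mult_ac)
    moreover have "0 < min (y k) (R - y k)" using gt_0[OF k] lt_R[OF k] by simp
    moreover have "\<forall>t. \<bar>y k - t\<bar> < min (y k) (R - y k) \<longrightarrow> f t \<le> f (y k)"
      unfolding f using Kupd[OF y k] ymax by auto
    ultimately have "l = 0" by (rule DERIV_local_max)
    have "euler_term m n b y k = (\<Sum>\<alpha>\<in>?M. b \<alpha> * (real (\<alpha> k) * y k ^ (\<alpha> k - 1) * rest \<alpha>)) * y k"
      unfolding euler_term_def sum_distrib_right
    proof (intro sum.cong refl)
      fix \<alpha>
      have "monomial n y \<alpha> = y k ^ \<alpha> k * rest \<alpha>"
        using mon_upd[OF k, of y "y k" \<alpha>] by (simp add: rest_def)
      then show "real (\<alpha> k) * b \<alpha> * monomial n y \<alpha> = b \<alpha> * (real (\<alpha> k) * y k ^ (\<alpha> k - 1) * rest \<alpha>) * y k"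
        by (cases "\<alpha> k") auto
    qed
    also have "\<dots> = p * y k powr (p - 1) * y k" using \<open>l = 0\<close> by (simp add: l_def)
    also have "\<dots> = p * y k powr p" using gt_0[OF k] by (simp add: powr_diff)
    finally show ?thesis .
  qed
  then show ?thesis using gt_0 by blast
qed

text \<open>
  Euler terms have degree \<open>m\<close> in \<open>y\<close>, so a critical point can be scaled to satisfy any
  normalisation; the factor \<open>p\<close> then becomes another factor \<open>\<mu>\<close>. The coefficients need only be
  nonnegative if \<open>exists_critical_point\<close> is applied after a small constant has been added to them,
  which accounts for the error \<open>\<epsilon>\<close>.
\<close>

lemma exists_balanced_point:
  assumes b: "\<And>\<alpha>. \<alpha> \<in> multi_indices m n \<Longrightarrow> b \<alpha> \<ge> 0" and m: "m \<ge> 1" and n: "n \<ge> 1"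
    and p: "real m < p" and \<sigma>: "\<sigma> > 0" and \<epsilon>: "\<epsilon> > 0"
  obtains y \<mu> where "\<And>k. k < n \<Longrightarrow> y k > 0" "(\<Sum>k<n. y k powr \<sigma>) = 1" "\<mu> \<ge> 0"
    "\<And>k. k < n \<Longrightarrow> euler_term m n b y k \<le> \<mu> * y k powr p"
    "\<And>k. k < n \<Longrightarrow> \<mu> * y k powr p \<le> euler_term m n b y k + \<epsilon>"
proof -
  let ?M = "multi_indices m n"
  define \<delta> where "\<delta> = \<epsilon> / (real m * card ?M + 1)"
  have \<delta>: "\<delta> > 0" using \<epsilon> by (auto simp: \<delta>_def intro!: divide_pos_pos add_nonneg_pos)
  define b' where "b' \<alpha> = b \<alpha> + \<delta>" for \<alpha>
  obtain y0 where y0: "\<And>k. k < n \<Longrightarrow> y0 k > 0" "\<And>k. k < n \<Longrightarrow> euler_term m n b' y0 k = p * y0 k powr p"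
    using exists_critical_point[of m n b' p] b \<delta> m n p by (auto simp: b'_def add_nonneg_pos)
  define N where "N = (\<Sum>k<n. y0 k powr \<sigma>)"
  have "y0 k powr \<sigma> > 0" if "k < n" for k using y0(1)[OF that] by simp
  then have "N > 0" unfolding N_def using n by (intro sum_pos) (auto simp: lessThan_empty_iff)
  define l where "l = N powr (1 / \<sigma>)"
  have l: "l > 0" "l powr \<sigma> = N" using \<open>N > 0\<close> \<sigma> by (auto simp: l_def powr_powr)
  define y where "y k = y0 k / l" for k
  have ypos: "y k > 0" if "k < n" for k using y0(1)[OF that] l by (simp add: y_def)
  have ysum: "(\<Sum>k<n. y k powr \<sigma>) = 1"
  proof -
    have "(\<Sum>k<n. y k powr \<sigma>) = (\<Sum>k<n. y0 k powr \<sigma> / N)"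
      using y0(1) l by (intro sum.cong refl) (auto simp: y_def powr_divide less_imp_le)
    also have "\<dots> = 1" using \<open>N > 0\<close> by (simp add: N_def flip: sum_divide_distrib)
    finally show ?thesis .
  qed
  have yle: "y k \<le> 1" if "k < n" for k
  proof -
    have "y k powr \<sigma> \<le> (\<Sum>k<n. y k powr \<sigma>)" using that by (intro member_le_sum) auto
    then have le: "y k powr \<sigma> \<le> 1" using ysum by linarith
    show ?thesis
    proof (rule ccontr)
      assume "\<not> ?thesis"
      then have "1 powr \<sigma> < y k powr \<sigma>" using \<sigma> by (intro powr_less_mono2) auto
      then show False using le unfolding powr_one_eq_one by linarith
    qed
  qed
  define \<mu> where "\<mu> = p * l powr (p - m)"
  have mon: "monomial n y0 \<alpha> = l ^ m * monomial n y \<alpha>" if "\<alpha> \<in> ?M" for \<alpha>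
    using monomial_mult[of n "\<lambda>_. l" y \<alpha>] monomial_const[OF that, of l] l
    by (simp add: y_def)
  have E': "euler_term m n b' y k = \<mu> * y k powr p" if k: "k < n" for k
  proof -
    have "l ^ m * euler_term m n b' y k = euler_term m n b' y0 k"
      unfolding euler_term_def sum_distrib_left by (intro sum.cong refl) (simp add: mon)
    also have "\<dots> = p * (l * y k) powr p" using y0(2)[OF k] l by (simp add: y_def)
    also have "\<dots> = p * (l powr p * y k powr p)" using l ypos[OF k] by (simp add: powr_mult)
    also have "l powr p = l ^ m * l powr (p - m)" using l by (simp add: powr_diff powr_realpow)
    finally show ?thesis using l by (simp add: \<mu>_def)
  qed
  show thesis
  proof (rule that[of y \<mu>])
    fix k assume k: "k < n"
    have mon1: "0 \<le> monomial n y \<alpha>" "monomial n y \<alpha> \<le> 1" for \<alpha>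
      using monomial_nonneg[of n y \<alpha>] monomial_le_1[of n y \<alpha>] yle less_imp_le[OF ypos] by auto
    have diff: "euler_term m n b' y k = euler_term m n b y k + \<delta> * (\<Sum>\<alpha>\<in>?M. real (\<alpha> k) * monomial n y \<alpha>)"
      unfolding euler_term_def b'_def sum_distrib_left sum.distrib[symmetric]
      by (intro sum.cong refl) (simp add: algebra_simps)
    have "0 \<le> (\<Sum>\<alpha>\<in>?M. real (\<alpha> k) * monomial n y \<alpha>)"
      using mon1 by (intro sum_nonneg mult_nonneg_nonneg) auto
    then show "euler_term m n b y k \<le> \<mu> * y k powr p"
      using diff \<delta> E'[OF k] by simp
    have "(\<Sum>\<alpha>\<in>?M. real (\<alpha> k) * monomial n y \<alpha>) \<le> (\<Sum>\<alpha>\<in>?M. real m * 1)"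
      using mon1 multi_indices_le by (intro sum_mono mult_mono) auto
    then have "\<delta> * (\<Sum>\<alpha>\<in>?M. real (\<alpha> k) * monomial n y \<alpha>) \<le> \<delta> * (real m * card ?M + 1)"
      using \<delta> by (intro mult_left_mono) (auto simp: mult.commute)
    also have "\<dots> = \<epsilon>"
    proof -
      have "real m * card ?M + 1 > 0" by (intro add_nonneg_pos) auto
      then show ?thesis by (simp add: \<delta>_def)
    qed
    finally show "\<mu> * y k powr p \<le> euler_term m n b y k + \<epsilon>"
      using diff E'[OF k] by simp
  qed (use ypos ysum p l in \<open>auto simp: \<mu>_def\<close>)
qed

lemma powr_subadditive:
  fixes a b :: real
  assumes "a \<ge> 0" "b \<ge> 0" "0 < r" "r \<le> 1"
  shows "(a + b) powr r \<le> a powr r + b powr r"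
proof (cases "a + b = 0")
  case False
  then have pos: "a + b > 0" using assms by simp
  have le: "x / (a + b) \<le> (x / (a + b)) powr r" if "0 \<le> x" "x \<le> a + b" for x
  proof (cases "x = 0")
    case False
    then show ?thesis
      using powr_mono'[of r 1 "x / (a + b)"] that pos assms by simp
  qed simp
  have "1 = a / (a + b) + b / (a + b)" using pos by (simp flip: add_divide_distrib)
  also have "\<dots> \<le> (a / (a + b)) powr r + (b / (a + b)) powr r"
    using le[of a] le[of b] assms by (intro add_mono) auto
  also have "\<dots> = (a powr r + b powr r) / (a + b) powr r"
    using assms pos by (simp add: powr_divide add_divide_distrib)
  finally show ?thesis using pos by (simp add: field_simps)
qed (use assms in auto)

text \<open>
  The weighted mean inequality for \<open>y\<^sub>j\<^bsup>m s\<^esup>\<close>. The exponent may be negative.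
\<close>

lemma monomial_powr_le_weighted_mean:
  assumes "\<alpha> \<in> multi_indices m n" "m \<ge> 1" "\<And>j. j < n \<Longrightarrow> y j > (0::real)"
  shows "real m * monomial n y \<alpha> powr s \<le> (\<Sum>j<n. real (\<alpha> j) * y j powr (real m * s))"
proof -
  define S where "S = (\<Sum>j<n. real (\<alpha> j) * y j powr (real m * s))"
  have "S \<ge> 0" unfolding S_def by (intro sum_nonneg) auto
  have "(monomial n y \<alpha> powr s) ^ m = monomial n y \<alpha> powr (real m * s)"
    using monomial_pos[of n y \<alpha>] assms(3) by (simp add: powr_powr mult.commute flip: powr_realpow)
  also have "\<dots> = monomial n (\<lambda>j. y j powr (real m * s)) \<alpha>"
    by (rule monomial_powr[symmetric]) (use assms(3) in \<open>auto intro: less_imp_le\<close>)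
  also have "\<dots> \<le> (S / real m) ^ m"
    unfolding S_def by (rule monomial_le_weighted_mean_power[OF assms(1,2)]) (use assms(3) in force)
  finally have "monomial n y \<alpha> powr s \<le> S / real m"
    using \<open>S \<ge> 0\<close> assms(2) power_mono_iff[of "monomial n y \<alpha> powr s" "S / real m" m] by simp
  then show ?thesis using assms(2) by (simp add: S_def field_simps)
qed

text \<open>
  The weight \<open>y\<^bsup>-\<alpha> s/m\<^esup>\<close> is at most the mean of the \<open>y\<^sub>k\<^bsup>-s\<^esup>\<close> with the weights \<open>\<alpha>\<^sub>k / m\<close>. Exchanging the sums
  produces the Euler terms, which are known at a balanced point.
\<close>

lemma balanced_point_weighted_sum:
  assumes b: "\<And>\<alpha>. \<alpha> \<in> multi_indices m n \<Longrightarrow> b \<alpha> \<ge> 0" and m: "m \<ge> 1"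
    and y: "\<And>k. k < n \<Longrightarrow> y k > 0"
    and E: "\<And>k. k < n \<Longrightarrow> euler_term m n b y k \<le> \<mu> * y k powr p"
    and s: "(\<Sum>k<n. y k powr (p - s)) = 1"
  shows "real m * (\<Sum>\<alpha>\<in>multi_indices m n. b \<alpha> * monomial n y \<alpha> powr (1 - s / m)) \<le> \<mu>"
proof -
  have "real m * (\<Sum>\<alpha>\<in>multi_indices m n. b \<alpha> * monomial n y \<alpha> powr (1 - s / m))
     \<le> (\<Sum>\<alpha>\<in>multi_indices m n. b \<alpha> * monomial n y \<alpha> * (\<Sum>k<n. real (\<alpha> k) * y k powr (- s)))"
    unfolding sum_distrib_left
  proof (intro sum_mono)
    fix \<alpha> assume a: "\<alpha> \<in> multi_indices m n"
    have mp: "monomial n y \<alpha> > 0" using y by (intro monomial_pos) auto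
    have "real m * monomial n y \<alpha> powr (- s / m) \<le> (\<Sum>k<n. real (\<alpha> k) * y k powr (real m * (- s / m)))"
      by (rule monomial_powr_le_weighted_mean[OF a m y])
    then have "(b \<alpha> * monomial n y \<alpha>) * (real m * monomial n y \<alpha> powr (- s / m))
       \<le> (b \<alpha> * monomial n y \<alpha>) * (\<Sum>k<n. real (\<alpha> k) * y k powr (- s))"
      using b[OF a] mp m by (intro mult_left_mono) auto
    moreover have "monomial n y \<alpha> powr (1 - s / m) = monomial n y \<alpha> * monomial n y \<alpha> powr (- s / m)"
      using mp by (simp add: powr_diff powr_minus_divide)
    ultimately show "real m * (b \<alpha> * monomial n y \<alpha> powr (1 - s / m))
       \<le> (\<Sum>k<n. b \<alpha> * monomial n y \<alpha> * (real (\<alpha> k) * y k powr (- s)))"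
      by (simp add: sum_distrib_left mult_ac)
  qed
  also have "\<dots> = (\<Sum>k<n. euler_term m n b y k * y k powr (- s))"
    unfolding euler_term_def sum_distrib_left sum_distrib_right
    by (subst sum.swap) (simp add: mult_ac)
  also have "\<dots> \<le> (\<Sum>k<n. \<mu> * y k powr p * y k powr (- s))"
    using E by (intro sum_mono mult_right_mono) auto
  also have "\<dots> = \<mu> * (\<Sum>k<n. y k powr (p - s))"
    unfolding sum_distrib_left by (intro sum.cong refl) (simp add: powr_add[symmetric])
  finally show ?thesis using s by simp
qed

text \<open>
  The transfer from the polydisc to the ball. The hypothesis is what an inequality on the polydisc
  gives for the polynomial that is rescaled by \<open>x\<close>. At a balanced point, with \<open>x\<^sub>k = y\<^sub>k\<^bsup>1/q\<^esup>\<close>, each term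
  of the sum over \<open>S\<close> is \<open>\<mu>\<^bsup>1/q\<^esup> x\<^sub>k\<^sup>p\<close> up to a small error, so the hypothesis reads
  \<open>\<mu>\<^bsup>1/q\<^esup> \<le> B\<close>, whatever \<open>S\<close> is. The exponent \<open>q = p/(p - m)\<close> is the one for which the weights in
  \<open>balanced_point_weighted_sum\<close> disappear. The set \<open>S\<close> is allowed to depend on \<open>x\<close>: for coloured
  variables it is one colour class. The lower bound \<open>1/m\<close> keeps the error small relative to the sum
  over \<open>S\<close>.
\<close>

lemma sum_le_by_balancing:
  assumes b: "\<And>\<alpha>. \<alpha> \<in> multi_indices m n \<Longrightarrow> b \<alpha> \<ge> 0" and m: "m \<ge> 1" and n: "n \<ge> 1"
    and p: "real m < p" and q: "q = p / (p - real m)" and B: "B \<ge> 0"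
    and hyp: "\<And>x. (\<And>k. k < n \<Longrightarrow> x k > 0) \<Longrightarrow> (\<Sum>k<n. x k powr p) = 1 \<Longrightarrow>
      \<exists>S\<subseteq>{..<n}. 1 / real m \<le> (\<Sum>k\<in>S. x k powr p) \<and>
        (\<Sum>k\<in>S. (\<Sum>\<alpha>\<in>multi_indices m n. real (\<alpha> k) * b \<alpha> * monomial n x \<alpha> powr q) powr (1 / q))
          \<le> B * (\<Sum>k\<in>S. x k powr p)"
  shows "real m * (\<Sum>\<alpha>\<in>multi_indices m n. b \<alpha>) \<le> B powr q"
proof -
  have q1: "q > 1" unfolding q using p m by (simp add: pos_less_divide_eq)
  have pq: "p / q = p - m" using p m q by simp
  have "(real m * (\<Sum>\<alpha>\<in>multi_indices m n. b \<alpha>)) powr (1 / q) \<le> B + e" if e: "e > 0" for e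
  proof -
    define \<epsilon> where "\<epsilon> = (e / (real n * real m)) powr q"
    have "\<epsilon> > 0" using e n m by (simp add: \<epsilon>_def)
    obtain y \<mu> where y: "\<And>k. k < n \<Longrightarrow> y k > 0" "(\<Sum>k<n. y k powr (p - m)) = 1" "\<mu> \<ge> 0"
      "\<And>k. k < n \<Longrightarrow> euler_term m n b y k \<le> \<mu> * y k powr p"
      "\<And>k. k < n \<Longrightarrow> \<mu> * y k powr p \<le> euler_term m n b y k + \<epsilon>"
      by (rule exists_balanced_point[of m n b p "p - m" \<epsilon>]) (use b m n p \<open>\<epsilon> > 0\<close> in auto)
    define x where "x k = y k powr (1 / q)" for k
    have xp: "x k powr p = y k powr (p - m)" for k by (simp add: x_def powr_powr pq)
    have monx: "monomial n x \<alpha> powr q = monomial n y \<alpha>" for \<alpha>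
      using monomial_powr[of n y "1 / q" \<alpha>] y(1) q1 monomial_nonneg[of n y \<alpha>]
      by (simp add: x_def[abs_def] powr_powr less_imp_le)
    have "\<exists>S\<subseteq>{..<n}. 1 / real m \<le> (\<Sum>k\<in>S. x k powr p) \<and>
        (\<Sum>k\<in>S. (\<Sum>\<alpha>\<in>multi_indices m n. real (\<alpha> k) * b \<alpha> * monomial n x \<alpha> powr q) powr (1 / q))
          \<le> B * (\<Sum>k\<in>S. x k powr p)"
    proof (rule hyp)
      show "x k > 0" if "k < n" for k using y(1)[OF that] by (simp add: x_def)
    qed (use y(2) in \<open>simp add: xp\<close>)
    then obtain S where S: "S \<subseteq> {..<n}" "1 / real m \<le> (\<Sum>k\<in>S. x k powr p)"
      "(\<Sum>k\<in>S. (euler_term m n b y k) powr (1 / q)) \<le> B * (\<Sum>k\<in>S. x k powr p)"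
      unfolding monx euler_term_def by blast
    define s where "s = (\<Sum>k\<in>S. x k powr p)"
    have s: "1 / real m \<le> s" "s > 0" using S(2) m unfolding s_def[symmetric] by (auto intro: less_le_trans[of 0 "1 / real m"])
    have E0: "euler_term m n b y k \<ge> 0" for k
      unfolding euler_term_def using b y(1) by (intro sum_nonneg mult_nonneg_nonneg monomial_nonneg) (auto intro: less_imp_le)
    have step: "\<mu> powr (1 / q) * x k powr p \<le> (euler_term m n b y k) powr (1 / q) + e / (real n * real m)"
      if k: "k < n" for k
    proof -
      have "\<mu> powr (1 / q) * x k powr p = (\<mu> * y k powr p) powr (1 / q)"
        using y(3) y(1)[OF k] by (simp add: powr_mult powr_powr xp pq)
      also have "\<dots> \<le> (euler_term m n b y k + \<epsilon>) powr (1 / q)"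
        using y(3) y(5)[OF k] q1 by (intro powr_mono2) auto
      also have "\<dots> \<le> (euler_term m n b y k) powr (1 / q) + \<epsilon> powr (1 / q)"
        using E0 \<open>\<epsilon> > 0\<close> q1 by (intro powr_subadditive) auto
      also have "\<epsilon> powr (1 / q) = e / (real n * real m)"
        using e q1 by (simp add: \<epsilon>_def powr_powr)
      finally show ?thesis .
    qed
    have "\<mu> powr (1 / q) * s = (\<Sum>k\<in>S. \<mu> powr (1 / q) * x k powr p)" by (simp add: s_def sum_distrib_left)
    also have "\<dots> \<le> (\<Sum>k\<in>S. (euler_term m n b y k) powr (1 / q) + e / (real n * real m))"
      using step S(1) by (intro sum_mono) auto
    also have "\<dots> \<le> B * s + real (card S) * (e / (real n * real m))"
      using S(3) by (simp add: sum.distrib s_def)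
    also have "\<dots> \<le> B * s + real n * (e / (real n * real m))"
      using e card_mono[OF _ S(1)] by (intro add_left_mono mult_right_mono) auto
    also have "real n * (e / (real n * real m)) = e * (1 / real m)" using n by simp
    also have "e * (1 / real m) \<le> e * s" using s e by (intro mult_left_mono) auto
    finally have "\<mu> powr (1 / q) * s \<le> (B + e) * s" by (simp add: algebra_simps)
    then have mu: "\<mu> powr (1 / q) \<le> B + e" using s(2) by simp
    have "real m * (\<Sum>\<alpha>\<in>multi_indices m n. b \<alpha> * monomial n y \<alpha> powr (1 - real m / m)) \<le> \<mu>"
      by (rule balanced_point_weighted_sum[where p = p]) (use b m y in auto)
    moreover have "monomial n y \<alpha> powr (1 - real m / m) = 1" for \<alpha>
      using m y(1) monomial_pos[of n y \<alpha>] by auto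
    ultimately have "real m * (\<Sum>\<alpha>\<in>multi_indices m n. b \<alpha>) \<le> \<mu>" by simp
    then have "(real m * (\<Sum>\<alpha>\<in>multi_indices m n. b \<alpha>)) powr (1 / q) \<le> \<mu> powr (1 / q)"
      using b q1 by (intro powr_mono2 mult_nonneg_nonneg sum_nonneg) auto
    with mu show ?thesis by linarith
  qed
  then have "(real m * (\<Sum>\<alpha>\<in>multi_indices m n. b \<alpha>)) powr (1 / q) \<le> B"
    by (rule field_le_epsilon)
  then have "((real m * (\<Sum>\<alpha>\<in>multi_indices m n. b \<alpha>)) powr (1 / q)) powr q \<le> B powr q"
    using q1 by (intro powr_mono2) auto
  then show ?thesis using q1 b by (simp add: powr_powr sum_nonneg)
qed

lemma coeff_norm_bound_small_exponent:
  assumes m: "m \<ge> 2" and n: "n \<ge> 1" and p: "real m < p" "p \<le> 2 * real m" and q: "q = p / (p - real m)"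
  shows "coeff_norm q m n a \<le> c_const m * real m powr (real m / p) * 2 powr ((real m - 1) / q) * poly_norm (ereal p) m n a"
proof -
  define N where "N = poly_norm (ereal p) m n a"
  define B where "B = real m * c_const m * 2 powr ((real m - 1) / q) * N"
  have q2: "q \<ge> 2" unfolding q using p by (simp add: pos_le_divide_eq)
  have p0: "p > 0" using p m by linarith
  have N0: "N \<ge> 0" unfolding N_def using n p0 by (intro poly_norm_nonneg) auto
  have c0: "c_const m \<ge> 0" using m by (simp add: c_const_def)
  have B0: "B \<ge> 0" unfolding B_def using N0 c0 by simp
  have "real m * (\<Sum>\<alpha>\<in>multi_indices m n. norm (a \<alpha>) powr q) \<le> B powr q"
  proof (rule sum_le_by_balancing[OF _ _ n p(1) q B0])
    fix x :: "nat \<Rightarrow> real" assume x: "\<And>k. k < n \<Longrightarrow> x k > 0" "(\<Sum>k<n. x k powr p) = 1"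
    have pd: "polydisc_bound m n (\<lambda>\<alpha>. a \<alpha> * of_real (monomial n x \<alpha>)) N"
      unfolding N_def by (rule polydisc_bound_rescaled) (use n p0 x in \<open>auto intro: less_imp_le\<close>)
    have eq: "norm (a \<alpha> * of_real (monomial n x \<alpha>)) powr q = norm (a \<alpha>) powr q * monomial n x \<alpha> powr q" for \<alpha>
      using monomial_nonneg[of n x \<alpha>] x(1) by (simp add: norm_mult powr_mult less_imp_le)
    have "(\<Sum>k<n. (\<Sum>\<alpha>\<in>multi_indices m n. real (\<alpha> k) * norm (a \<alpha>) powr q * monomial n x \<alpha> powr q) powr (1 / q)) \<le> B"
      using mixed_inequality[OF pd m n q2] by (simp add: eq B_def mult.assoc)
    then show "\<exists>S\<subseteq>{..<n}. 1 / real m \<le> (\<Sum>k\<in>S. x k powr p) \<and>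
        (\<Sum>k\<in>S. (\<Sum>\<alpha>\<in>multi_indices m n. real (\<alpha> k) * norm (a \<alpha>) powr q * monomial n x \<alpha> powr q) powr (1 / q))
          \<le> B * (\<Sum>k\<in>S. x k powr p)"
      using x(2) m by (intro exI[of _ "{..<n}"]) auto
  qed (use m in auto)
  then have "(\<Sum>\<alpha>\<in>multi_indices m n. norm (a \<alpha>) powr q) powr (1 / q) \<le> (B powr q / real m) powr (1 / q)"
    using q2 m by (intro powr_mono2 sum_nonneg) (auto simp: field_simps)
  also have "\<dots> = B / real m powr (1 / q)" using B0 q2 by (simp add: powr_divide powr_powr)
  also have "\<dots> = c_const m * real m powr (real m / p) * 2 powr ((real m - 1) / q) * N"
  proof -
    have "1 / q = (p - real m) / p" by (simp add: q)
    then have "1 - 1 / q = real m / p" using p0 by (simp add: diff_divide_distrib)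
    then have "real m / real m powr (1 / q) = real m powr (real m / p)"
      using m powr_diff[of "real m" 1 "1 / q"] by simp
    moreover have "B / real m powr (1 / q)
        = c_const m * (real m / real m powr (1 / q)) * 2 powr ((real m - 1) / q) * N"
      by (simp add: B_def)
    ultimately show ?thesis by simp
  qed
  finally show ?thesis by (simp add: coeff_norm_def N_def)
qed

section \<open>The Bohnenblust--Hille inequality and its interpolation\<close>

text \<open>
  Multinomial coefficients are at least \<open>1\<close>. The induction removes one factor, of each variable that
  occurs.
\<close>

lemma sum_monomial_le:
  assumes "\<And>k. k < n \<Longrightarrow> t k \<ge> (0::real)"
  shows "(\<Sum>\<alpha>\<in>multi_indices m n. monomial n t \<alpha>) \<le> (\<Sum>k<n. t k) ^ m"
proof (induction m)
  case 0
  have "multi_indices 0 n = {\<lambda>_. 0}" by (auto simp: multi_indices_def fun_eq_iff) (metis lessThan_iff not_le)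
  then show ?case by (simp add: monomial_def)
next
  case (Suc m)
  have mon0: "monomial n t \<alpha> \<ge> 0" for \<alpha> using assms by (intro monomial_nonneg) auto
  have "(\<Sum>\<alpha>\<in>multi_indices (Suc m) n. monomial n t \<alpha>)
      \<le> (\<Sum>\<alpha>\<in>multi_indices (Suc m) n. \<Sum>k\<in>{k\<in>{..<n}. \<alpha> k > 0}. monomial n t \<alpha>)"
  proof (intro sum_mono)
    fix \<alpha> assume "\<alpha> \<in> multi_indices (Suc m) n"
    then obtain k where "k < n" "\<alpha> k \<noteq> 0"
      by (metis lessThan_iff multi_indices_sum sum.neutral nat.distinct(1))
    then show "monomial n t \<alpha> \<le> (\<Sum>k\<in>{k\<in>{..<n}. \<alpha> k > 0}. monomial n t \<alpha>)"
      using mon0 by (intro member_le_sum[of k _ "\<lambda>_. monomial n t \<alpha>"]) auto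
  qed
  also have "\<dots> = (\<Sum>k<n. \<Sum>\<alpha>\<in>{\<alpha>\<in>multi_indices (Suc m) n. \<alpha> k > 0}. monomial n t \<alpha>)"
    by (rule sum.swap_restrict) auto
  also have "\<dots> = (\<Sum>k<n. \<Sum>\<beta>\<in>multi_indices m n. t k * monomial n t \<beta>)"
  proof (rule sum.cong[OF refl])
    fix k assume "k \<in> {..<n}"
    then have k: "k < n" by simp
    have "(\<Sum>\<alpha>\<in>{\<alpha>\<in>multi_indices (Suc m) n. \<alpha> k > 0}. monomial n t \<alpha>)
        = (\<Sum>\<beta>\<in>multi_indices m n. monomial n t (\<beta>(k := Suc (\<beta> k))))"
      by (rule sum.reindex_bij_betw[OF bij_betw_increment[OF k], symmetric])
    also have "\<dots> = (\<Sum>\<beta>\<in>multi_indices m n. t k * monomial n t \<beta>)"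
      unfolding monomial_def using k by (intro sum.cong refl, subst (1 2) prod.remove[of _ k]) auto
    finally show "(\<Sum>\<alpha>\<in>{\<alpha>\<in>multi_indices (Suc m) n. \<alpha> k > 0}. monomial n t \<alpha>)
        = (\<Sum>\<beta>\<in>multi_indices m n. t k * monomial n t \<beta>)" .
  qed
  also have "\<dots> = (\<Sum>k<n. t k) * (\<Sum>\<beta>\<in>multi_indices m n. monomial n t \<beta>)"
    by (simp add: sum_product)
  also have "\<dots> \<le> (\<Sum>k<n. t k) * (\<Sum>k<n. t k) ^ m"
    using Suc.IH assms by (intro mult_left_mono sum_nonneg) auto
  finally show ?case by simp
qed

text \<open>
  Hoelder's inequality with the exponents \<open>(m + 1)/m\<close> and \<open>m + 1\<close>. The exponent \<open>2 m/(m + 1)\<close> of the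
  Bohnenblust--Hille inequality arises here, with arbitrary weights of total mass at most \<open>1\<close>.
\<close>

lemma weighted_l2_bound:
  fixes v w :: "'i \<Rightarrow> real"
  assumes "finite A" "\<And>\<alpha>. \<alpha> \<in> A \<Longrightarrow> v \<alpha> \<ge> 0" "\<And>\<alpha>. \<alpha> \<in> A \<Longrightarrow> w \<alpha> > 0" "(\<Sum>\<alpha>\<in>A. w \<alpha>) \<le> 1" "m \<ge> (1::nat)"
  defines "s \<equiv> 2 * real m / (real m + 1)"
  shows "(\<Sum>\<alpha>\<in>A. v \<alpha> powr s) powr (1 / s) \<le> (\<Sum>\<alpha>\<in>A. (v \<alpha>)\<^sup>2 * w \<alpha> powr (- 1 / real m)) powr (1 / 2)"
proof -
  define \<theta> where "\<theta> = real m / (real m + 1)"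
  have \<theta>: "0 \<le> \<theta>" "\<theta> \<le> 1" "s = 2 * \<theta>" "\<theta> > 0" "1 - \<theta> = \<theta> / real m"
  proof -
    have "real m > 0" using assms(5) by simp
    moreover from this have "real m + real m * real m > 0" by (simp add: add_pos_pos)
    ultimately show "0 \<le> \<theta>" "\<theta> \<le> 1" "s = 2 * \<theta>" "\<theta> > 0" "1 - \<theta> = \<theta> / real m"
      by (auto simp: \<theta>_def s_def field_simps)
  qed
  define S where "S = (\<Sum>\<alpha>\<in>A. (v \<alpha>)\<^sup>2 * w \<alpha> powr (- 1 / real m))"
  have S0: "S \<ge> 0" unfolding S_def by (intro sum_nonneg) auto
  have "(\<Sum>\<alpha>\<in>A. v \<alpha> powr s) = (\<Sum>\<alpha>\<in>A. ((v \<alpha>)\<^sup>2 * w \<alpha> powr (- 1 / real m)) powr \<theta> * w \<alpha> powr (1 - \<theta>))"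
  proof (intro sum.cong refl)
    fix \<alpha> assume a: "\<alpha> \<in> A"
    have "((v \<alpha>)\<^sup>2) powr \<theta> = v \<alpha> powr s"
    proof (cases "v \<alpha> = 0")
      case False
      then have "(v \<alpha>)\<^sup>2 = v \<alpha> powr 2" using assms(2)[OF a] by simp
      then show ?thesis by (simp only: powr_powr \<theta>(3))
    qed (use \<theta> in simp)
    moreover have "(w \<alpha> powr (- 1 / real m)) powr \<theta> * w \<alpha> powr (1 - \<theta>) = 1"
      using assms(3)[OF a] \<theta>(5) by (simp add: powr_powr flip: powr_add)
    ultimately show "v \<alpha> powr s = ((v \<alpha>)\<^sup>2 * w \<alpha> powr (- 1 / real m)) powr \<theta> * w \<alpha> powr (1 - \<theta>)"
      by (simp add: powr_mult mult.assoc)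
  qed
  also have "\<dots> \<le> S powr \<theta> * (\<Sum>\<alpha>\<in>A. w \<alpha>) powr (1 - \<theta>)"
    unfolding S_def by (rule holder_sum) (use assms(1,3) \<theta> in \<open>auto intro: less_imp_le\<close>)
  also have "\<dots> \<le> S powr \<theta> * 1"
    using assms(3,4) \<theta> by (intro mult_left_mono powr_le1) (auto intro!: sum_nonneg less_imp_le simp: abs_of_nonneg sum_nonneg less_imp_le)
  finally have "(\<Sum>\<alpha>\<in>A. v \<alpha> powr s) powr (1 / s) \<le> (S powr \<theta>) powr (1 / s)"
    using \<theta> by (intro powr_mono2 sum_nonneg) auto
  also have "\<dots> = S powr (1 / 2)" using \<theta> by (simp add: powr_powr)
  finally show ?thesis by (simp add: S_def)
qed

text \<open>
  The weights in \<open>weighted_l2_bound\<close> are the monomials \<open>t\<^sup>\<alpha>\<close> with \<open>t\<^sub>k\<close> proportional to \<open>\<surd>G\<^sub>k\<close>, where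
  \<open>G\<^sub>k\<close> are the sums in the mixed inequality for \<open>q = 2\<close>. By the inequality between the means
  the weighted sum of squares is at most \<open>(\<Sum> G\<^sub>k / t\<^sub>k) / m = (\<Sum> \<surd>G\<^sub>k)\<^sup>2 / m\<close>. The positive constant
  \<open>d\<close> is added to \<open>\<surd>G\<^sub>k\<close> in order that all weights are positive.
\<close>

lemma bohnenblust_hille:
  assumes P: "polydisc_bound m n c B" and m: "m \<ge> 2" and n: "n \<ge> 1"
  shows "coeff_norm (2 * real m / (real m + 1)) m n c \<le> Lambda_const m * B"
proof -
  let ?M = "multi_indices m n"
  define G where "G k = (\<Sum>\<alpha>\<in>?M. real (\<alpha> k) * (norm (c \<alpha>))\<^sup>2)" for k
  have G0: "G k \<ge> 0" for k unfolding G_def by (intro sum_nonneg) auto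
  have mixed: "(\<Sum>k<n. sqrt (G k)) \<le> sqrt (real m) * (Lambda_const m * B)"
  proof -
    have "(\<Sum>k<n. (\<Sum>\<alpha>\<in>?M. real (\<alpha> k) * norm (c \<alpha>) powr 2) powr (1 / 2))
       \<le> real m * c_const m * 2 powr ((real m - 1) / 2) * B"
      using mixed_inequality[OF P m n, of 2] by simp
    also have "real m * c_const m * 2 powr ((real m - 1) / 2) * B = sqrt (real m) * (Lambda_const m * B)"
      by (simp add: Lambda_const_def)
    finally show ?thesis using G0 by (simp add: G_def powr_half_sqrt)
  qed
  have "coeff_norm (2 * real m / (real m + 1)) m n c \<le> Lambda_const m * B + e" if e: "e > 0" for e
  proof -
    define d where "d = sqrt (real m) * e / real n"
    have d: "d > 0" using e m n by (simp add: d_def)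
    define g where "g k = sqrt (G k) + d" for k
    define T where "T = (\<Sum>k<n. g k)"
    have g: "g k > 0" for k using G0[of k] d by (simp add: g_def add_nonneg_pos)
    have T: "T > 0" unfolding T_def using g n by (intro sum_pos) (auto simp: lessThan_empty_iff)
    define t where "t k = g k / T" for k
    have t: "t k > 0" for k using g T by (simp add: t_def)
    have tsum: "(\<Sum>k<n. t k) = 1" using T by (simp add: t_def T_def flip: sum_divide_distrib)
    have T_le: "T \<le> sqrt (real m) * (Lambda_const m * B + e)"
    proof -
      have "T = (\<Sum>k<n. sqrt (G k)) + real n * d" by (simp add: T_def g_def sum.distrib)
      also have "real n * d = sqrt (real m) * e" using n by (simp add: d_def)
      finally show ?thesis using mixed by (simp add: distrib_left)
    qed
    have "coeff_norm (2 * real m / (real m + 1)) m n c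
       \<le> (\<Sum>\<alpha>\<in>?M. (norm (c \<alpha>))\<^sup>2 * monomial n t \<alpha> powr (- 1 / real m)) powr (1 / 2)"
      unfolding coeff_norm_def
    proof (rule weighted_l2_bound)
      show "(\<Sum>\<alpha>\<in>?M. monomial n t \<alpha>) \<le> 1"
        using sum_monomial_le[of n t m] t tsum by (simp add: less_imp_le)
    qed (use m t in \<open>auto intro: monomial_pos\<close>)
    also have "(\<Sum>\<alpha>\<in>?M. (norm (c \<alpha>))\<^sup>2 * monomial n t \<alpha> powr (- 1 / real m)) \<le> T\<^sup>2 / real m"
    proof -
      have "(\<Sum>\<alpha>\<in>?M. (norm (c \<alpha>))\<^sup>2 * (real m * monomial n t \<alpha> powr (- 1 / real m)))
         \<le> (\<Sum>\<alpha>\<in>?M. (norm (c \<alpha>))\<^sup>2 * (\<Sum>k<n. real (\<alpha> k) * t k powr (- 1)))"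
      proof (intro sum_mono mult_left_mono)
        fix \<alpha> assume "\<alpha> \<in> ?M"
        then show "real m * monomial n t \<alpha> powr (- 1 / real m) \<le> (\<Sum>k<n. real (\<alpha> k) * t k powr (- 1))"
          using monomial_powr_le_weighted_mean[of \<alpha> m n t "- 1 / real m"] m t by simp
      qed auto
      also have "\<dots> = (\<Sum>k<n. G k * (T / g k))"
        unfolding G_def sum_distrib_left sum_distrib_right
        by (subst sum.swap) (simp add: t_def powr_minus_divide mult_ac T g less_imp_le)
      also have "\<dots> \<le> (\<Sum>k<n. g k * T)"
      proof (intro sum_mono)
        fix k
        have "G k = sqrt (G k) * sqrt (G k)" using G0 by simp
        also have "\<dots> \<le> g k * g k" unfolding g_def using G0 d by (intro mult_mono) auto
        finally show "G k * (T / g k) \<le> g k * T" using g[of k] T by (simp add: field_simps)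
      qed
      also have "\<dots> = T\<^sup>2" by (simp add: T_def power2_eq_square sum_distrib_right)
      finally show ?thesis using m by (simp add: sum_distrib_left field_simps)
    qed
    then have "(\<Sum>\<alpha>\<in>?M. (norm (c \<alpha>))\<^sup>2 * monomial n t \<alpha> powr (- 1 / real m)) powr (1 / 2) \<le> (T\<^sup>2 / real m) powr (1 / 2)"
      by (intro powr_mono2 sum_nonneg) auto
    also have "\<dots> = T / sqrt (real m)"
      using T by (simp add: powr_half_sqrt real_sqrt_divide)
    also have "\<dots> \<le> Lambda_const m * B + e"
      using T_le m by (simp add: field_simps)
    finally show ?thesis .
  qed
  then show ?thesis by (rule field_le_epsilon)
qed

lemma Lambda_const_pos: "m \<ge> 2 \<Longrightarrow> Lambda_const m > 0"
  by (auto simp: Lambda_const_def c_const_def)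

text \<open>
  Hoelder's inequality with \<open>1/q = (1 - \<tau>)/s + \<tau>/2\<close>, where \<open>s = 2 m/(m + 1)\<close>, between two
  estimates for the coefficients rescaled by a vector \<open>x\<close> with \<open>\<Sum> x\<^sub>k\<^sup>p = 1\<close>. The first is the
  Bohnenblust--Hille inequality for \<open>|a\<^sub>\<alpha>| x\<^sup>\<alpha>\<close>, which holds for every \<open>x\<close>. The second is
  \<open>\<Sum> |a\<^sub>\<alpha>|\<^sup>2 x\<^bsup>-\<kappa>\<alpha>\<^esup> \<le> (\<Lambda> \<parallel>P\<parallel>)\<^sup>2\<close>, which follows from the mixed inequality if \<open>x\<close> is the square root of a
  balanced point for \<open>|a\<^sub>\<alpha>|\<^sup>2\<close>. The powers of \<open>x\<close> cancel in the product.
\<close>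

lemma coeff_norm_bound_large_exponent:
  assumes BH: "\<And>c B. polydisc_bound m n c B \<Longrightarrow> coeff_norm (2 * real m / (real m + 1)) m n c \<le> D * B"
    and D: "D > 0" and m: "m \<ge> 2" and n: "n \<ge> 1" and p: "2 * real m \<le> p"
    and q: "q = 2 * real m * p / (real m * p + p - 2 * real m)" and \<tau>: "\<tau> = 2 * real m / p"
  shows "coeff_norm q m n a \<le> D powr (1 - \<tau>) * Lambda_const m powr \<tau> * poly_norm (ereal p) m n a"
proof -
  let ?M = "multi_indices m n"
  define N where "N = poly_norm (ereal p) m n a"
  define L where "L = Lambda_const m"
  define s where "s = 2 * real m / (real m + 1)"
  define v where "v \<alpha> = norm (a \<alpha>)" for \<alpha>
  have L: "L > 0" unfolding L_def by (rule Lambda_const_pos[OF m])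
  have mp: "real m < p" and p0: "p > 0" using p m by linarith+
  have \<tau>01: "0 < \<tau>" "\<tau> \<le> 1" unfolding \<tau> using p p0 m by (auto simp: field_simps)
  have N0: "N \<ge> 0" unfolding N_def using n p0 by (intro poly_norm_nonneg) auto
  have s0: "s > 0" using m by (simp add: s_def)
  have den: "real m * p + p - 2 * real m > 0"
    using p m p0 mult_pos_pos[of "real m" p] by linarith
  have q0: "q > 0" unfolding q using den p0 m by simp
  have iq: "1 / q = (1 - \<tau>) / s + \<tau> / 2"
    unfolding q \<tau> s_def using den p0 m by (simp add: field_simps)
  define \<theta> where "\<theta> = \<tau> * q / 2"
  have \<theta>: "\<theta> > 0" "1 - \<theta> = (1 - \<tau>) * q / s"
  proof -
    have "1 = q * (1 / q)" using q0 by simp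
    also have "\<dots> = (1 - \<tau>) * q / s + \<theta>" unfolding iq \<theta>_def by (simp add: algebra_simps)
    finally show "1 - \<theta> = (1 - \<tau>) * q / s" by simp
  qed (use \<tau>01 q0 in \<open>simp add: \<theta>_def\<close>)
  then have \<theta>1: "\<theta> \<le> 1" using \<tau>01 q0 s0 by (smt (verit) divide_nonneg_pos mult_nonneg_nonneg)
  define \<kappa> where "\<kappa> = p / real m - 2"
  have \<kappa>: "\<kappa> * \<theta> = (1 - \<tau>) * q"
    unfolding \<kappa>_def \<theta>_def \<tau> using p0 m by (simp add: field_simps)
  have main: "coeff_norm q m n a \<le> (D * N) powr (1 - \<tau>) * (L * N + e) powr \<tau>" if e: "e > 0" for e
  proof -
    define d where "d = sqrt (real m) * e / real n"
    have d: "d > 0" using e m n by (simp add: d_def)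
    obtain y \<mu> where y: "\<And>k. k < n \<Longrightarrow> y k > 0" "(\<Sum>k<n. y k powr (p / 2)) = 1" "\<mu> \<ge> 0"
      "\<And>k. k < n \<Longrightarrow> euler_term m n (\<lambda>\<alpha>. (v \<alpha>)\<^sup>2) y k \<le> \<mu> * y k powr p"
      "\<And>k. k < n \<Longrightarrow> \<mu> * y k powr p \<le> euler_term m n (\<lambda>\<alpha>. (v \<alpha>)\<^sup>2) y k + d\<^sup>2"
      by (rule exists_balanced_point[of m n "\<lambda>\<alpha>. (v \<alpha>)\<^sup>2" p "p / 2" "d\<^sup>2"]) (use m n mp p0 d in auto)
    define x where "x k = y k powr (1 / 2)" for k
    have x0: "x k > 0" if "k < n" for k using y(1)[OF that] by (simp add: x_def)
    have xp: "x k powr p = y k powr (p / 2)" for k by (simp add: x_def powr_powr)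
    have monx: "monomial n x \<alpha> = monomial n y \<alpha> powr (1 / 2)" for \<alpha>
      using monomial_powr[of n y "1 / 2" \<alpha>] y(1) by (simp add: x_def[abs_def] less_imp_le)
    have mony: "monomial n y \<alpha> > 0" for \<alpha> using y(1) by (intro monomial_pos) auto
    have monx0: "monomial n x \<alpha> > 0" for \<alpha> using mony[of \<alpha>] by (simp add: monx)
    have pd: "polydisc_bound m n (\<lambda>\<alpha>. a \<alpha> * of_real (monomial n x \<alpha>)) N"
      unfolding N_def by (rule polydisc_bound_rescaled) (use n p0 x0 y(2) in \<open>auto intro: less_imp_le simp: xp\<close>)
    have nrm: "norm (a \<alpha> * of_real (monomial n x \<alpha>)) = v \<alpha> * monomial n x \<alpha>" for \<alpha>
      using monx0[of \<alpha>] by (simp add: norm_mult v_def)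
    define E where "E k = euler_term m n (\<lambda>\<alpha>. (v \<alpha>)\<^sup>2) y k" for k
    have E0: "E k \<ge> 0" for k
      unfolding E_def euler_term_def using mony by (intro sum_nonneg mult_nonneg_nonneg) (auto intro: less_imp_le)
    have Esum: "(\<Sum>k<n. sqrt (E k)) \<le> sqrt (real m) * (L * N)"
    proof -
      have "(\<Sum>k<n. (\<Sum>\<alpha>\<in>?M. real (\<alpha> k) * norm (a \<alpha> * of_real (monomial n x \<alpha>)) powr 2) powr (1 / 2))
         \<le> real m * c_const m * 2 powr ((real m - 1) / 2) * N"
        using mixed_inequality[OF pd m n, of 2] by simp
      also have "real m * c_const m * 2 powr ((real m - 1) / 2) * N = sqrt (real m) * (L * N)"
        by (simp add: L_def Lambda_const_def)
      finally have "(\<Sum>k<n. (\<Sum>\<alpha>\<in>?M. real (\<alpha> k) * norm (a \<alpha> * of_real (monomial n x \<alpha>)) powr 2) powr (1 / 2))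
         \<le> sqrt (real m) * (L * N)" .
      moreover have "(\<Sum>\<alpha>\<in>?M. real (\<alpha> k) * norm (a \<alpha> * of_real (monomial n x \<alpha>)) powr 2) = E k" for k
        unfolding E_def euler_term_def nrm
        by (intro sum.cong refl) (use mony monx0 in \<open>simp add: monx power_mult_distrib powr_half_sqrt less_imp_le v_def\<close>)
      ultimately show ?thesis using E0 by (simp only:) (simp add: powr_half_sqrt)
    qed
    have mu: "sqrt \<mu> \<le> sqrt (real m) * (L * N + e)"
    proof -
      have "sqrt \<mu> * x k powr p \<le> sqrt (E k) + d" if k: "k < n" for k
      proof -
        have "sqrt \<mu> * x k powr p = sqrt (\<mu> * y k powr p)"
          using y(1)[OF k] by (simp add: real_sqrt_mult xp powr_powr flip: powr_half_sqrt)
        also have "\<dots> \<le> sqrt (E k + d\<^sup>2)" using y(5)[OF k] by (simp add: E_def)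
        also have "\<dots> \<le> sqrt (E k) + sqrt (d\<^sup>2)" using E0 by (intro sqrt_add_le_add_sqrt) auto
        finally show ?thesis using d by simp
      qed
      then have "(\<Sum>k<n. sqrt \<mu> * x k powr p) \<le> (\<Sum>k<n. sqrt (E k) + d)" by (intro sum_mono) auto
      also have "\<dots> = (\<Sum>k<n. sqrt (E k)) + sqrt (real m) * e" using n by (simp add: sum.distrib d_def)
      also have "\<dots> \<le> sqrt (real m) * (L * N + e)" using Esum by (simp add: distrib_left)
      finally show ?thesis using y(2) by (simp add: xp flip: sum_distrib_left)
    qed
    have l2: "(\<Sum>\<alpha>\<in>?M. (v \<alpha>)\<^sup>2 * monomial n x \<alpha> powr (- \<kappa>)) \<le> (L * N + e)\<^sup>2"
    proof -
      have "real m * (\<Sum>\<alpha>\<in>?M. (v \<alpha>)\<^sup>2 * monomial n y \<alpha> powr (1 - (p / 2) / m)) \<le> \<mu>"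
        by (rule balanced_point_weighted_sum[where p = p]) (use m y in auto)
      moreover have "monomial n y \<alpha> powr (1 - (p / 2) / m) = monomial n x \<alpha> powr (- \<kappa>)" for \<alpha>
        unfolding monx powr_powr \<kappa>_def by (simp add: algebra_simps)
      ultimately have "real m * (\<Sum>\<alpha>\<in>?M. (v \<alpha>)\<^sup>2 * monomial n x \<alpha> powr (- \<kappa>)) \<le> (sqrt \<mu>)\<^sup>2"
        using y(3) by simp
      also have "\<dots> \<le> (sqrt (real m) * (L * N + e))\<^sup>2" using mu y(3) by (intro power_mono) auto
      also have "\<dots> = real m * (L * N + e)\<^sup>2" by (simp add: power_mult_distrib)
      finally show ?thesis using m by simp
    qed
    have ls: "(\<Sum>\<alpha>\<in>?M. (v \<alpha> * monomial n x \<alpha>) powr s) \<le> (D * N) powr s"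
    proof -
      have "(\<Sum>\<alpha>\<in>?M. (v \<alpha> * monomial n x \<alpha>) powr s) powr (1 / s) \<le> D * N"
        using BH[OF pd] unfolding coeff_norm_def nrm s_def .
      then have "((\<Sum>\<alpha>\<in>?M. (v \<alpha> * monomial n x \<alpha>) powr s) powr (1 / s)) powr s \<le> (D * N) powr s"
        using s0 by (intro powr_mono2) auto
      then show ?thesis using s0 by (simp add: powr_powr sum_nonneg)
    qed
    have "(\<Sum>\<alpha>\<in>?M. v \<alpha> powr q)
        = (\<Sum>\<alpha>\<in>?M. ((v \<alpha>)\<^sup>2 * monomial n x \<alpha> powr (- \<kappa>)) powr \<theta> * ((v \<alpha> * monomial n x \<alpha>) powr s) powr (1 - \<theta>))"
    proof (intro sum.cong refl)
      fix \<alpha>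
      show "v \<alpha> powr q = ((v \<alpha>)\<^sup>2 * monomial n x \<alpha> powr (- \<kappa>)) powr \<theta> * ((v \<alpha> * monomial n x \<alpha>) powr s) powr (1 - \<theta>)"
      proof (cases "v \<alpha> = 0")
        case False
        then have v0: "v \<alpha> > 0" by (simp add: v_def)
        have "((v \<alpha>)\<^sup>2) powr \<theta> = v \<alpha> powr (\<tau> * q)"
        proof -
          have "(v \<alpha>)\<^sup>2 = v \<alpha> powr 2" using v0 by simp
          then show ?thesis by (simp only: powr_powr) (simp add: \<theta>_def)
        qed
        moreover have "(v \<alpha> powr s) powr (1 - \<theta>) = v \<alpha> powr ((1 - \<tau>) * q)"
          "(monomial n x \<alpha> powr s) powr (1 - \<theta>) = monomial n x \<alpha> powr ((1 - \<tau>) * q)"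
          using s0 by (simp_all add: \<theta>(2) powr_powr)
        moreover have "(monomial n x \<alpha> powr (- \<kappa>)) powr \<theta> = monomial n x \<alpha> powr (- ((1 - \<tau>) * q))"
          using \<kappa> by (simp add: powr_powr)
        moreover have "v \<alpha> powr q = v \<alpha> powr (\<tau> * q) * v \<alpha> powr ((1 - \<tau>) * q)"
          by (simp add: algebra_simps flip: powr_add)
        moreover have "monomial n x \<alpha> powr (- ((1 - \<tau>) * q)) * monomial n x \<alpha> powr ((1 - \<tau>) * q) = 1"
          using monx0[of \<alpha>] by (simp flip: powr_add)
        ultimately show ?thesis using v0 monx0[of \<alpha>] by (simp add: powr_mult mult_ac)
      qed (use q0 in simp)
    qed
    also have "\<dots> \<le> (\<Sum>\<alpha>\<in>?M. (v \<alpha>)\<^sup>2 * monomial n x \<alpha> powr (- \<kappa>)) powr \<theta>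
        * (\<Sum>\<alpha>\<in>?M. (v \<alpha> * monomial n x \<alpha>) powr s) powr (1 - \<theta>)"
      by (rule holder_sum) (use \<theta> \<theta>1 in auto)
    also have "\<dots> \<le> ((L * N + e)\<^sup>2) powr \<theta> * ((D * N) powr s) powr (1 - \<theta>)"
      using l2 ls \<theta> \<theta>1 by (intro mult_mono powr_mono2 sum_nonneg) auto
    also have "\<dots> = ((L * N + e) powr \<tau> * (D * N) powr (1 - \<tau>)) powr q"
    proof -
      have "L * N + e > 0" using L N0 e by (simp add: add_nonneg_pos)
      then have "((L * N + e)\<^sup>2) powr \<theta> = (L * N + e) powr (\<tau> * q)"
      proof -
        assume "L * N + e > 0"
        then have "(L * N + e)\<^sup>2 = (L * N + e) powr 2" by simp
        then show ?thesis by (simp only: powr_powr) (simp add: \<theta>_def)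
      qed
      moreover have "((D * N) powr s) powr (1 - \<theta>) = (D * N) powr ((1 - \<tau>) * q)"
        using s0 by (simp add: powr_powr \<theta>(2))
      ultimately show ?thesis by (simp add: powr_mult powr_powr)
    qed
    finally have "(\<Sum>\<alpha>\<in>?M. v \<alpha> powr q) powr (1 / q)
        \<le> (((L * N + e) powr \<tau> * (D * N) powr (1 - \<tau>)) powr q) powr (1 / q)"
      using q0 by (intro powr_mono2 sum_nonneg) auto
    also have "\<dots> = (D * N) powr (1 - \<tau>) * (L * N + e) powr \<tau>"
      using q0 by (simp add: powr_powr mult.commute)
    finally show ?thesis by (simp add: coeff_norm_def v_def)
  qed
  have "((\<lambda>e. (D * N) powr (1 - \<tau>) * (L * N + e) powr \<tau>) \<longlongrightarrow> (D * N) powr (1 - \<tau>) * (L * N + 0) powr \<tau>) (at_right 0)"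
    using \<tau>01 L N0
    by (intro tendsto_mult tendsto_const tendsto_powr' tendsto_add tendsto_ident_at)
       (auto simp: eventually_at_right_field intro!: exI[of _ 1] add_nonneg_nonneg)
  moreover have "\<forall>\<^sub>F e in at_right 0. coeff_norm q m n a \<le> (D * N) powr (1 - \<tau>) * (L * N + e) powr \<tau>"
    using main by (auto simp: eventually_at_right_field intro!: exI[of _ 1])
  ultimately have "coeff_norm q m n a \<le> (D * N) powr (1 - \<tau>) * (L * N + 0) powr \<tau>"
    by (rule tendsto_lowerbound) simp
  also have "\<dots> = D powr (1 - \<tau>) * L powr \<tau> * (N powr (1 - \<tau>) * N powr \<tau>)"
    using D L N0 by (simp add: powr_mult)
  also have "N powr (1 - \<tau>) * N powr \<tau> = N" using N0 by (cases "N = 0") (auto simp flip: powr_add)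
  finally show ?thesis by (simp add: N_def L_def)
qed

section \<open>Decoupling by colourings\<close>

text \<open>
  Averaging over rotations of the variables, twisted by \<open>u\<close>, keeps the bound and extracts the part of
  the polynomial on which the twisted mean is \<open>1\<close> instead of \<open>0\<close>.
\<close>

lemma polydisc_bound_average:
  fixes w :: "'g \<Rightarrow> nat \<Rightarrow> complex"
  assumes P: "polydisc_bound m n c B" and G: "finite G" "G \<noteq> {}"
    and w: "\<And>g k. g \<in> G \<Longrightarrow> k < n \<Longrightarrow> norm (w g k) = 1" and u: "\<And>g. g \<in> G \<Longrightarrow> norm (u g) \<le> 1"
    and avg: "\<And>\<alpha>. \<alpha> \<in> multi_indices m n \<Longrightarrow>
      (\<Sum>g\<in>G. u g * monomial n (w g) \<alpha>) = (if Q \<alpha> then of_nat (card G) else 0)"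
  shows "polydisc_bound m n (\<lambda>\<alpha>. if Q \<alpha> then c \<alpha> else 0) B"
  unfolding polydisc_bound_def
proof (intro allI impI)
  fix z :: "nat \<Rightarrow> complex" assume z: "\<forall>j<n. norm (z j) \<le> 1"
  have "(\<Sum>g\<in>G. u g * poly_eval m n c (\<lambda>k. w g k * z k))
      = (\<Sum>\<alpha>\<in>multi_indices m n. c \<alpha> * monomial n z \<alpha> * (\<Sum>g\<in>G. u g * monomial n (w g) \<alpha>))"
    unfolding poly_eval_monomial monomial_mult sum_distrib_left
    by (subst sum.swap) (simp add: mult_ac)
  also have "\<dots> = of_nat (card G) * poly_eval m n (\<lambda>\<alpha>. if Q \<alpha> then c \<alpha> else 0) z"
    unfolding poly_eval_monomial
    by (subst sum_distrib_left[where A = "multi_indices m n"], rule sum.cong[OF refl]) (simp add: avg)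
  finally have "real (card G) * norm (poly_eval m n (\<lambda>\<alpha>. if Q \<alpha> then c \<alpha> else 0) z)
      = norm (\<Sum>g\<in>G. u g * poly_eval m n c (\<lambda>k. w g k * z k))"
    by (metis norm_mult norm_of_nat)
  also have "\<dots> \<le> (\<Sum>g\<in>G. B)"
  proof (rule sum_norm_le)
    fix g assume g: "g \<in> G"
    have "norm (poly_eval m n c (\<lambda>k. w g k * z k)) \<le> B"
      by (rule polydisc_boundD[OF P]) (use w[OF g] z in \<open>auto simp: norm_mult\<close>)
    then show "norm (u g * poly_eval m n c (\<lambda>k. w g k * z k)) \<le> B"
      unfolding norm_mult using mult_mono[OF u[OF g]] by fastforce
  qed
  also have "\<dots> = real (card G) * B" by simp
  finally show "norm (poly_eval m n (\<lambda>\<alpha>. if Q \<alpha> then c \<alpha> else 0) z) \<le> B"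
    using G by (simp add: card_gt_0_iff)
qed

lemma unimodular_root_exists:
  assumes "norm w = 1" "d \<ge> 1"
  shows "\<exists>v. norm v = 1 \<and> v ^ d = (w :: complex)"
proof (intro exI conjI)
  let ?v = "cis (Arg w / real d)"
  show "norm ?v = 1" by simp
  show "?v ^ d = w"
  proof -
    have "w \<noteq> 0" using assms by auto
    then show ?thesis using assms by (simp add: Complex.DeMoivre cis_Arg sgn_eq)
  qed
qed

definition class_degree :: "nat \<Rightarrow> (nat \<Rightarrow> nat) \<Rightarrow> (nat \<Rightarrow> nat) \<Rightarrow> nat \<Rightarrow> nat" where
  "class_degree n \<xi> \<alpha> l = (\<Sum>k\<in>{k\<in>{..<n}. \<xi> k = l}. \<alpha> k)"

text \<open>
  The indices of degree \<open>\<beta>\<^sub>l\<close> in the variables of colour \<open>l\<close>, whose exponent at a variable of colour \<open>l\<close>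
  is a multiple of \<open>\<beta>\<^sub>l\<close>. Since the degrees add up to \<open>\<beta>\<^sub>l\<close>, such an index contains exactly one variable of
  each colour, with exponent \<open>\<beta>\<^sub>l\<close> (\<open>captured_unique\<close>). Both conditions can be extracted by averaging
  over rotations.
\<close>

definition captured :: "nat \<Rightarrow> nat \<Rightarrow> nat \<Rightarrow> (nat \<Rightarrow> nat) \<Rightarrow> (nat \<Rightarrow> nat) \<Rightarrow> (nat \<Rightarrow> nat) set" where
  "captured m n s \<xi> \<beta> =
     {\<alpha>\<in>multi_indices m n. (\<forall>l<s. class_degree n \<xi> \<alpha> l = \<beta> l) \<and> (\<forall>k<n. \<beta> (\<xi> k) dvd \<alpha> k)}"

locale colouring =
  fixes m n s :: nat and \<xi> \<beta> :: "nat \<Rightarrow> nat"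
  assumes n: "n \<ge> 1" and \<xi>: "\<And>k. k < n \<Longrightarrow> \<xi> k < s" and \<beta>: "\<And>l. l < s \<Longrightarrow> \<beta> l \<ge> 1"
    and \<beta>_sum: "(\<Sum>l<s. \<beta> l) = m"
begin

lemma \<beta>_le: "l < s \<Longrightarrow> \<beta> l \<le> m"
  using member_le_sum[of l "{..<s}" \<beta>] \<beta>_sum by auto

text \<open>
  All variables of one colour are rotated by the same root of unity.
\<close>

lemma extract_class_degrees:
  assumes P: "polydisc_bound m n c B"
  shows "polydisc_bound m n (\<lambda>\<alpha>. if \<forall>l<s. class_degree n \<xi> \<alpha> l = \<beta> l then c \<alpha> else 0) B"
proof -
  define N where "N = Suc m"
  define t where "t i l = unity_root N ^ i l" for i :: "nat \<Rightarrow> nat" and l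
  show ?thesis
  proof (rule polydisc_bound_average[OF P, where G = "exponent_box s (N - 1)" and w = "\<lambda>i k. t i (\<xi> k)"
        and u = "\<lambda>i. cnj (monomial s (t i) \<beta>)"])
    show "exponent_box s (N - 1) \<noteq> {}"
      using card_exponent_box[of s "N - 1"] by auto
    show "norm (cnj (monomial s (t i) \<beta>)) \<le> 1" for i
      by (simp only: complex_mod_cnj norm_monomial) (simp add: t_def monomial_def)
  next
    fix \<alpha> assume a: "\<alpha> \<in> multi_indices m n"
    have mon: "monomial n (\<lambda>k. t i (\<xi> k)) \<alpha> = monomial s (t i) (class_degree n \<xi> \<alpha>)" for i
    proof -
      have "monomial s (t i) (class_degree n \<xi> \<alpha>) = (\<Prod>l<s. \<Prod>k\<in>{k\<in>{..<n}. \<xi> k = l}. t i (\<xi> k) ^ \<alpha> k)"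
        by (simp add: monomial_def class_degree_def power_sum)
      also have "\<dots> = (\<Prod>k<n. t i (\<xi> k) ^ \<alpha> k)"
        by (rule prod.group) (use \<xi> in auto)
      finally show ?thesis by (simp add: monomial_def)
    qed
    have "class_degree n \<xi> \<alpha> l \<le> m" for l
      unfolding class_degree_def multi_indices_sum[OF a, symmetric] by (intro sum_mono2) auto
    then have *: "(\<Sum>i\<in>exponent_box s (N - 1). monomial s (t i) (class_degree n \<xi> \<alpha>) * cnj (monomial s (t i) \<beta>))
       = (if \<forall>l<s. class_degree n \<xi> \<alpha> l = \<beta> l then of_nat N ^ s else 0)"
      unfolding t_def using \<beta>_le by (intro grid_orthogonal) (auto simp: N_def le_imp_less_Suc)
    then show "(\<Sum>i\<in>exponent_box s (N - 1). cnj (monomial s (t i) \<beta>) * monomial n (\<lambda>k. t i (\<xi> k)) \<alpha>)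
       = (if \<forall>l<s. class_degree n \<xi> \<alpha> l = \<beta> l then of_nat (card (exponent_box s (N - 1))) else 0)"
    proof -
      have "card (exponent_box s (N - 1)) = N ^ s" by (simp add: card_exponent_box N_def)
      then show ?thesis using * by (simp only: mon mult.commute[of "cnj _"] of_nat_power)
    qed
  qed (auto simp: t_def)
qed

text \<open>
  Each variable is rotated independently by a root of unity whose order is the degree prescribed for
  its colour. The common range of summation is \<open>m!\<close>, which is a multiple of all these orders.
\<close>

lemma extract_pure_powers:
  assumes P: "polydisc_bound m n c B"
  shows "polydisc_bound m n (\<lambda>\<alpha>. if \<forall>k<n. \<beta> (\<xi> k) dvd \<alpha> k then c \<alpha> else 0) B"
proof -
  define L :: nat where "L = fact m"
  have L: "L > 0" by (simp add: L_def)
  define \<rho> where "\<rho> k = unity_root (\<beta> (\<xi> k))" for k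
  show ?thesis
  proof (rule polydisc_bound_average[OF P, where G = "exponent_box n (L - 1)" and w = "\<lambda>i k. \<rho> k ^ i k" and u = "\<lambda>_. 1"])
    show "exponent_box n (L - 1) \<noteq> {}"
      using card_exponent_box[of n "L - 1"] by auto
  next
    fix \<alpha> assume a: "\<alpha> \<in> multi_indices m n"
    have "(\<Sum>i\<in>exponent_box n (L - 1). 1 * monomial n (\<lambda>k. \<rho> k ^ i k) \<alpha>) = (\<Prod>k<n. \<Sum>l\<le>L - 1. (\<rho> k ^ l) ^ \<alpha> k)"
      unfolding monomial_def by (simp add: sum_prod_exponent_box[where f = "\<lambda>k l. (\<rho> k ^ l) ^ \<alpha> k"])
    also have "\<dots> = (\<Prod>k<n. if \<beta> (\<xi> k) dvd \<alpha> k then of_nat L else 0)"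
    proof (intro prod.cong refl)
      fix k assume "k \<in> {..<n}"
      then have "\<xi> k < s" using \<xi> by simp
      then have "\<beta> (\<xi> k) > 0" "\<beta> (\<xi> k) dvd L"
        using \<beta>[of "\<xi> k"] \<beta>_le[of "\<xi> k"] unfolding L_def by (auto intro: dvd_fact)
      then show "(\<Sum>l\<le>L - 1. (\<rho> k ^ l) ^ \<alpha> k) = (if \<beta> (\<xi> k) dvd \<alpha> k then of_nat L else 0)"
        unfolding \<rho>_def lessThan_eq_atMost[OF L, symmetric] by (rule sum_unity_root_powers)
    qed
    also have "\<dots> = (if \<forall>k<n. \<beta> (\<xi> k) dvd \<alpha> k then of_nat L ^ n else 0)"
      by (auto intro!: prod_zero)
    finally show "(\<Sum>i\<in>exponent_box n (L - 1). 1 * monomial n (\<lambda>k. \<rho> k ^ i k) \<alpha>)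
      = (if \<forall>k<n. \<beta> (\<xi> k) dvd \<alpha> k then of_nat (card (exponent_box n (L - 1))) else 0)"
      using L by (simp add: card_exponent_box)
  qed (auto simp: \<rho>_def norm_power)
qed

text \<open>
  A transversal selects one variable \<open>i l\<close> of each colour \<open>l\<close>. Transversals are the multi-indices of
  the \<open>s\<close>-linear form carried by the captured coefficients; \<open>index_of\<close> maps them to the exponents
  of the polynomial.
\<close>

definition transversals :: "(nat \<Rightarrow> nat) set" where
  "transversals = {i\<in>exponent_box s (n - 1). \<forall>l<s. \<xi> (i l) = l}"

definition index_of :: "(nat \<Rightarrow> nat) \<Rightarrow> (nat \<Rightarrow> nat)" where
  "index_of i = (\<lambda>k. if k < n \<and> i (\<xi> k) = k then \<beta> (\<xi> k) else 0)"

lemma finite_transversals [simp, intro]: "finite transversals"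
  by (simp add: transversals_def)

lemma transversalsD:
  assumes "i \<in> transversals" "l < s"
  shows "i l < n" "\<xi> (i l) = l"
proof -
  have "i l \<le> n - 1" using assms by (auto simp: transversals_def exponent_box_def)
  then show "i l < n" using n by linarith
qed (use assms in \<open>auto simp: transversals_def\<close>)

lemma transversal_inj: "i \<in> transversals \<Longrightarrow> inj_on i {..<s}"
  by (rule inj_on_inverseI[where g = \<xi>]) (auto dest: transversalsD)

lemma prod_index_of:
  fixes g :: "nat \<Rightarrow> nat \<Rightarrow> 'a::comm_monoid_mult"
  assumes i: "i \<in> transversals" and g: "\<And>k. g k 0 = 1"
  shows "(\<Prod>k<n. g k (index_of i k)) = (\<Prod>l<s. g (i l) (\<beta> l))"
proof -
  have "(\<Prod>k<n. g k (index_of i k)) = (\<Prod>k\<in>i ` {..<s}. g k (index_of i k))"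
  proof (rule prod.mono_neutral_right)
    show "\<forall>k\<in>{..<n} - i ` {..<s}. g k (index_of i k) = 1"
      using \<xi> g by (force simp: index_of_def)
  qed (use transversalsD(1)[OF i] in auto)
  also have "\<dots> = (\<Prod>l<s. g (i l) (index_of i (i l)))"
    by (simp add: prod.reindex[OF transversal_inj[OF i]])
  also have "\<dots> = (\<Prod>l<s. g (i l) (\<beta> l))"
    by (intro prod.cong refl) (use transversalsD[OF i] in \<open>auto simp: index_of_def\<close>)
  finally show ?thesis .
qed

lemma index_of_captured:
  assumes i: "i \<in> transversals"
  shows "index_of i \<in> captured m n s \<xi> \<beta>"
proof -
  have cd: "class_degree n \<xi> (index_of i) l = \<beta> l" if l: "l < s" for l
  proof -
    have "class_degree n \<xi> (index_of i) l = (\<Sum>k\<in>{i l}. index_of i k)"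
      unfolding class_degree_def
      by (rule sum.mono_neutral_right) (use transversalsD[OF i l] in \<open>auto simp: index_of_def\<close>)
    then show ?thesis using transversalsD[OF i l] by (simp add: index_of_def)
  qed
  have "(\<Sum>k<n. index_of i k) = (\<Sum>l<s. class_degree n \<xi> (index_of i) l)"
    unfolding class_degree_def by (rule sum.group[symmetric]) (use \<xi> in auto)
  also have "\<dots> = m" using cd \<beta>_sum by simp
  finally show ?thesis using cd by (auto simp: captured_def multi_indices_def index_of_def)
qed

lemma captured_unique:
  assumes a: "\<alpha> \<in> captured m n s \<xi> \<beta>" and l: "l < s"
  shows "\<exists>k. k < n \<and> \<xi> k = l \<and> \<alpha> k = \<beta> l \<and> (\<forall>k'<n. \<xi> k' = l \<longrightarrow> k' \<noteq> k \<longrightarrow> \<alpha> k' = 0)"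
proof -
  have cd: "class_degree n \<xi> \<alpha> l = \<beta> l" and dv: "\<And>k. k < n \<Longrightarrow> \<beta> (\<xi> k) dvd \<alpha> k"
    using a l by (auto simp: captured_def)
  have "class_degree n \<xi> \<alpha> l \<noteq> 0" using cd \<beta>[OF l] by simp
  then obtain k where k: "k < n" "\<xi> k = l" "\<alpha> k \<noteq> 0"
    unfolding class_degree_def by (auto dest: sum.not_neutral_contains_not_neutral)
  have split: "class_degree n \<xi> \<alpha> l = \<alpha> k + (\<Sum>k'\<in>{k\<in>{..<n}. \<xi> k = l} - {k}. \<alpha> k')"
    unfolding class_degree_def using k by (intro sum.remove) auto
  have "\<beta> l \<le> \<alpha> k" using dv[OF k(1)] k by (auto intro: dvd_imp_le)
  then have "\<alpha> k = \<beta> l" "(\<Sum>k'\<in>{k\<in>{..<n}. \<xi> k = l} - {k}. \<alpha> k') = 0"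
    using split cd by linarith+
  then show ?thesis using k by (intro exI[of _ k]) auto
qed

lemma bij_betw_index_of: "bij_betw index_of transversals (captured m n s \<xi> \<beta>)"
proof (rule bij_betw_imageI)
  show "inj_on index_of transversals"
  proof (rule inj_onI)
    fix i i' assume i: "i \<in> transversals" "i' \<in> transversals" and eq: "index_of i = index_of i'"
    have "i l = i' l" for l
    proof (cases "l < s")
      case True
      have "index_of i (i l) = \<beta> l" using transversalsD[OF i(1) True] by (simp add: index_of_def)
      then have "index_of i' (i l) \<noteq> 0" using eq \<beta>[OF True] by simp
      then show ?thesis using transversalsD[OF i(1) True] by (simp add: index_of_def split: if_splits)
    next
      case False
      then show ?thesis using i by (auto simp: transversals_def exponent_box_def)
    qed
    then show "i = i'" by auto
  qed
  show "index_of ` transversals = captured m n s \<xi> \<beta>"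
  proof (intro equalityI subsetI)
    fix \<alpha> assume a: "\<alpha> \<in> captured m n s \<xi> \<beta>"
    from captured_unique[OF a] obtain k where k: "\<And>l. l < s \<Longrightarrow> k l < n \<and> \<xi> (k l) = l \<and> \<alpha> (k l) = \<beta> l
        \<and> (\<forall>k'<n. \<xi> k' = l \<longrightarrow> k' \<noteq> k l \<longrightarrow> \<alpha> k' = 0)" by metis
    define i where "i l = (if l < s then k l else 0)" for l
    have i: "i \<in> transversals"
      using k by (fastforce simp: transversals_def exponent_box_def i_def)
    have "index_of i j = \<alpha> j" for j
    proof (cases "j < n")
      case True
      then have "\<xi> j < s" by (rule \<xi>)
      then show ?thesis using k[of "\<xi> j"] True by (auto simp: index_of_def i_def)
    next
      case False
      then show ?thesis using a by (auto simp: index_of_def captured_def multi_indices_def)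
    qed
    then have "index_of i = \<alpha>" by auto
    then show "\<alpha> \<in> index_of ` transversals" using i by blast
  qed (use index_of_captured in auto)
qed

text \<open>
  A variable occurs in a captured monomial only with one exponent, the degree of its colour. Hence the
  polynomial takes at \<open>v\<close> the value of the multilinear form at \<open>W\<close> if \<open>v\<^sub>k\<close> is a root of that degree
  of the entry of \<open>W\<close>.
\<close>

lemma multilinear_bound:
  assumes P: "polydisc_bound m n c B"
    and W: "\<And>l k. l < s \<Longrightarrow> k < n \<Longrightarrow> norm (W l k) = 1"
  shows "norm (\<Sum>i\<in>transversals. c (index_of i) * (\<Prod>l<s. W l (i l))) \<le> B"
proof -
  have "\<exists>v. \<forall>k<n. norm (v k) = 1 \<and> v k ^ \<beta> (\<xi> k) = W (\<xi> k) k"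
  proof -
    have "\<exists>v. k < n \<longrightarrow> norm v = 1 \<and> v ^ \<beta> (\<xi> k) = W (\<xi> k) k" for k
      using unimodular_root_exists[of "W (\<xi> k) k" "\<beta> (\<xi> k)"] W[of "\<xi> k" k] \<xi>[of k] \<beta>[of "\<xi> k"] by blast
    then show ?thesis by metis
  qed
  then obtain v where v: "\<And>k. k < n \<Longrightarrow> norm (v k) = 1" "\<And>k. k < n \<Longrightarrow> v k ^ \<beta> (\<xi> k) = W (\<xi> k) k"
    by blast
  have "poly_eval m n (\<lambda>\<alpha>. if \<forall>k<n. \<beta> (\<xi> k) dvd \<alpha> k then
        if \<forall>l<s. class_degree n \<xi> \<alpha> l = \<beta> l then c \<alpha> else 0 else 0) v
      = (\<Sum>\<alpha>\<in>captured m n s \<xi> \<beta>. c \<alpha> * monomial n v \<alpha>)"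
    unfolding poly_eval_monomial
    by (rule sum.mono_neutral_cong_right) (auto simp: captured_def)
  also have "\<dots> = (\<Sum>i\<in>transversals. c (index_of i) * monomial n v (index_of i))"
    by (rule sum.reindex_bij_betw[OF bij_betw_index_of, symmetric])
  also have "\<dots> = (\<Sum>i\<in>transversals. c (index_of i) * (\<Prod>l<s. W l (i l)))"
  proof (intro sum.cong refl)
    fix i assume i: "i \<in> transversals"
    have "monomial n v (index_of i) = (\<Prod>l<s. v (i l) ^ \<beta> l)"
      unfolding monomial_def using prod_index_of[OF i, of "\<lambda>k e. v k ^ e"] by simp
    also have "\<dots> = (\<Prod>l<s. W l (i l))"
      by (intro prod.cong refl) (use transversalsD[OF i] v(2) in fastforce)
    finally show "c (index_of i) * monomial n v (index_of i) = c (index_of i) * (\<Prod>l<s. W l (i l))" by simp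
  qed
  finally show ?thesis
    using polydisc_boundD[OF extract_pure_powers[OF extract_class_degrees[OF P]], of v] v(1) by simp
qed

text \<open>
  The analogue of \<open>mixed_inequality\<close> for the multilinear form: the slot \<open>l0\<close> carries the outer sum, and
  the other \<open>s - 1\<close> slots are averaged. The outer sum of moduli is a value of the form, because the
  entries in slot \<open>l0\<close> can be chosen as signs. No derivative occurs, and therefore no factor \<open>c\<^sub>m\<close>.
\<close>

lemma decoupled_mixed_inequality:
  assumes P: "polydisc_bound m n c B" and l0: "l0 < s"
    and av: "averaging {\<phi>. \<forall>l. norm (\<phi> l) = 1} (\<lambda>_. 1 / \<kappa>) (n - 1) q" and q: "q > 1" and \<kappa>: "\<kappa> > 0"
  shows "(\<Sum>k<n. (\<Sum>i\<in>{i\<in>transversals. i l0 = k}. norm (c (index_of i)) powr q) powr (1 / q))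
       \<le> \<kappa> powr ((real s - 1) / q) * B"
proof -
  define \<Phi> where "\<Phi> l = (if l = l0 then {\<lambda>l :: nat. if l = 0 then 1 else (0::complex)} else {\<phi>. \<forall>l. norm (\<phi> l) = 1})"
    for l
  define \<omega> :: "nat \<Rightarrow> nat \<Rightarrow> real" where
    "\<omega> l = (if l = l0 then (\<lambda>l. if l = 0 then 1 else 0) else (\<lambda>_. 1 / \<kappa>))" for l
  \<comment> \<open>the variable selected in the slot \<open>l0\<close> is recorded by \<open>k\<close>, and the slot itself is set to \<open>0\<close>, the only
    coordinate on which \<open>averaging_trivial\<close> has a nonzero weight\<close>
  define slot where "slot k = {i\<in>exponent_box s (n - 1). i l0 = 0 \<and> i(l0 := k) \<in> transversals}" for k
  define r where "r k i = (if i \<in> slot k then c (index_of (i(l0 := k))) else 0)" for k i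
  have reduce: "(\<Sum>i\<in>exponent_box s (n - 1). g (r k i) i) = (\<Sum>i\<in>{i\<in>transversals. i l0 = k}. g (c (index_of i)) (i(l0 := 0)))"
    if g: "\<And>i. g 0 i = 0" for g :: "complex \<Rightarrow> (nat \<Rightarrow> nat) \<Rightarrow> 'b::comm_monoid_add" and k
  proof -
    have "(\<Sum>i\<in>exponent_box s (n - 1). g (r k i) i) = (\<Sum>i\<in>slot k. g (c (index_of (i(l0 := k)))) i)"
      by (rule sum.mono_neutral_cong_right) (auto simp: r_def slot_def g)
    also have "\<dots> = (\<Sum>i\<in>{i\<in>transversals. i l0 = k}. g (c (index_of i)) (i(l0 := 0)))"
    proof (rule sum.reindex_bij_witness[where i = "\<lambda>i. i(l0 := 0)" and j = "\<lambda>i. i(l0 := k)"])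
      fix i assume i: "i \<in> {i\<in>transversals. i l0 = k}"
      then have "(i(l0 := 0))(l0 := k) = i" by auto
      then show "i(l0 := 0) \<in> slot k"
        using i by (auto simp: slot_def transversals_def exponent_box_def)
    qed (auto simp: slot_def fun_upd_idem)
    finally show ?thesis .
  qed
  have "\<exists>\<phi>. (\<forall>l<s. \<phi> l \<in> \<Phi> l) \<and>
     (\<Sum>k\<in>{..<n}. (\<Sum>i\<in>exponent_box s (n - 1). (\<Prod>l<s. \<omega> l (i l)) * norm (r k i) powr q) powr (1 / q))
       \<le> (\<Sum>k\<in>{..<n}. norm (\<Sum>i\<in>exponent_box s (n - 1). r k i * (\<Prod>l<s. \<phi> l (i l))))"
    by (rule averaging_iterate) (use q \<kappa> av averaging_trivial in \<open>auto simp: \<Phi>_def \<omega>_def\<close>)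
  then obtain \<phi> where \<phi>: "\<And>l. l < s \<Longrightarrow> \<phi> l \<in> \<Phi> l"
    "(\<Sum>k\<in>{..<n}. (\<Sum>i\<in>exponent_box s (n - 1). (\<Prod>l<s. \<omega> l (i l)) * norm (r k i) powr q) powr (1 / q))
       \<le> (\<Sum>k\<in>{..<n}. norm (\<Sum>i\<in>exponent_box s (n - 1). r k i * (\<Prod>l<s. \<phi> l (i l))))"
    by blast
  have \<phi>1: "norm (\<phi> l k) = 1" if "l < s" "l \<noteq> l0" for l k using \<phi>(1)[OF that(1)] that(2) by (simp add: \<Phi>_def)
  have \<phi>0: "\<phi> l0 0 = 1" using \<phi>(1)[OF l0] by (simp add: \<Phi>_def)
  have prod_split: "(\<Prod>l<s. g l ((i(l0 := v)) l)) = g l0 v * (\<Prod>l\<in>{..<s} - {l0}. g l (i l))"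
    for g :: "nat \<Rightarrow> nat \<Rightarrow> 'b::comm_monoid_mult" and i v
    using l0 by (subst prod.remove[of _ l0]) auto
  have lhs: "(\<Sum>i\<in>exponent_box s (n - 1). (\<Prod>l<s. \<omega> l (i l)) * norm (r k i) powr q)
      = (1 / \<kappa>) ^ (s - 1) * (\<Sum>i\<in>{i\<in>transversals. i l0 = k}. norm (c (index_of i)) powr q)" for k
  proof -
    have "(\<Sum>i\<in>exponent_box s (n - 1). (\<Prod>l<s. \<omega> l (i l)) * norm (r k i) powr q)
       = (\<Sum>i\<in>{i\<in>transversals. i l0 = k}. (\<Prod>l<s. \<omega> l ((i(l0 := 0)) l)) * norm (c (index_of i)) powr q)"
      by (rule reduce) simp
    also have "\<dots> = (\<Sum>i\<in>{i\<in>transversals. i l0 = k}. (1 / \<kappa>) ^ (s - 1) * norm (c (index_of i)) powr q)"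
    proof (intro sum.cong refl)
      fix i
      have "(\<Prod>l<s. \<omega> l ((i(l0 := 0)) l)) = (\<Prod>l\<in>{..<s} - {l0}. 1 / \<kappa>)"
        unfolding prod_split by (simp add: \<omega>_def)
      also have "\<dots> = (1 / \<kappa>) ^ (s - 1)" using l0 by (subst prod_constant) simp
      finally show "(\<Prod>l<s. \<omega> l ((i(l0 := 0)) l)) * norm (c (index_of i)) powr q
        = (1 / \<kappa>) ^ (s - 1) * norm (c (index_of i)) powr q" by simp
    qed
    finally show ?thesis by (simp add: sum_distrib_left)
  qed
  define T where "T k = (\<Sum>i\<in>{i\<in>transversals. i l0 = k}. c (index_of i) * (\<Prod>l\<in>{..<s} - {l0}. \<phi> l (i l)))" for k
  have rhs: "(\<Sum>i\<in>exponent_box s (n - 1). r k i * (\<Prod>l<s. \<phi> l (i l))) = T k" for k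
  proof -
    have "(\<Sum>i\<in>exponent_box s (n - 1). r k i * (\<Prod>l<s. \<phi> l (i l)))
       = (\<Sum>i\<in>{i\<in>transversals. i l0 = k}. c (index_of i) * (\<Prod>l<s. \<phi> l ((i(l0 := 0)) l)))"
      by (rule reduce) simp
    then show ?thesis by (simp add: prod_split \<phi>0 T_def del: fun_upd_apply)
  qed
  define W where "W l k = (if l = l0 then (if T k = 0 then 1 else cnj (sgn (T k))) else \<phi> l k)" for l k
  have WT: "W l0 k * T k = of_real (norm (T k))" for k
  proof (cases "T k = 0")
    case False
    have "cnj (T k) * T k = of_real ((norm (T k))\<^sup>2)" by (simp only: complex_norm_square mult.commute)
    then show ?thesis using False by (simp add: W_def sgn_eq power2_eq_square)
  qed (simp add: W_def)
  have "(\<Sum>i\<in>transversals. c (index_of i) * (\<Prod>l<s. W l (i l)))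
      = (\<Sum>k<n. \<Sum>i\<in>{i\<in>transversals. i l0 = k}. c (index_of i) * (\<Prod>l<s. W l (i l)))"
    by (rule sum.group[symmetric]) (use transversalsD(1)[OF _ l0] in auto)
  also have "\<dots> = (\<Sum>k<n. W l0 k * T k)"
  proof (rule sum.cong[OF refl])
    fix k
    have "(\<Prod>l<s. W l (i l)) = W l0 k * (\<Prod>l\<in>{..<s} - {l0}. \<phi> l (i l))" if "i l0 = k" for i
    proof -
      have "(\<Prod>l<s. W l (i l)) = W l0 (i l0) * (\<Prod>l\<in>{..<s} - {l0}. W l (i l))"
        using l0 by (intro prod.remove) auto
      also have "(\<Prod>l\<in>{..<s} - {l0}. W l (i l)) = (\<Prod>l\<in>{..<s} - {l0}. \<phi> l (i l))"
        by (intro prod.cong refl) (auto simp: W_def)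
      finally show ?thesis using that by simp
    qed
    then show "(\<Sum>i\<in>{i\<in>transversals. i l0 = k}. c (index_of i) * (\<Prod>l<s. W l (i l))) = W l0 k * T k"
      unfolding T_def sum_distrib_left by (intro sum.cong refl) (auto simp: mult_ac)
  qed
  also have "\<dots> = of_real (\<Sum>k<n. norm (T k))" by (simp add: WT)
  finally have "norm (complex_of_real (\<Sum>k<n. norm (T k))) = norm (\<Sum>i\<in>transversals. c (index_of i) * (\<Prod>l<s. W l (i l)))"
    by simp
  also have "\<dots> \<le> B"
    by (rule multilinear_bound[OF P]) (use \<phi>1 in \<open>auto simp: W_def norm_sgn\<close>)
  finally have TB: "(\<Sum>k<n. norm (T k)) \<le> B" by (simp only: norm_of_real)
  define X where "X = (\<Sum>k<n. (\<Sum>i\<in>{i\<in>transversals. i l0 = k}. norm (c (index_of i)) powr q) powr (1 / q))"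
  have s1: "s \<ge> 1" using l0 by simp
  have pw: "((1 / \<kappa>) ^ (s - 1)) powr (1 / q) = 1 / \<kappa> powr ((real s - 1) / q)"
  proof -
    have "(1 / \<kappa>) ^ (s - 1) = (1 / \<kappa>) powr (real s - 1)"
      using \<kappa> s1 powr_realpow[of "1 / \<kappa>" "s - 1"] by (simp add: of_nat_diff)
    then show ?thesis using \<kappa> by (simp only: powr_powr) (simp add: powr_divide)
  qed
  have "(1 / \<kappa> powr ((real s - 1) / q)) * X
      = (\<Sum>k<n. ((1 / \<kappa>) ^ (s - 1) * (\<Sum>i\<in>{i\<in>transversals. i l0 = k}. norm (c (index_of i)) powr q)) powr (1 / q))"
    unfolding X_def pw[symmetric] by (subst sum_distrib_left) (use \<kappa> in \<open>simp add: powr_mult sum_nonneg\<close>)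
  also have "\<dots> \<le> (\<Sum>k<n. norm (T k))"
    using \<phi>(2) unfolding lhs rhs .
  also note TB
  finally show ?thesis using \<kappa> by (simp add: X_def field_simps)
qed

text \<open>
  Given \<open>x\<close>, the masses \<open>\<pi>\<^sub>l = \<Sum> x\<^sub>k\<^sup>p\<close> of the colour classes add up to \<open>1\<close>, as do the fractions
  \<open>\<beta>\<^sub>l / m\<close>; hence \<open>\<pi>\<^sub>l \<ge> \<beta>\<^sub>l / m\<close> for some colour. This colour is the outer slot in
  \<open>decoupled_mixed_inequality\<close>, and its class is the set \<open>S\<close> in \<open>sum_le_by_balancing\<close>. The factor
  \<open>\<beta>\<^sub>l\<close> that the Euler terms carry is compensated by \<open>\<pi>\<^sub>l\<close>.
\<close>

lemma sum_captured_bound: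
  assumes p: "real m < p" and q: "q = p / (p - real m)" and m: "m \<ge> 1"
    and av: "averaging {\<phi>. \<forall>l. norm (\<phi> l) = 1} (\<lambda>_. 1 / \<kappa>) (n - 1) q" and \<kappa>: "\<kappa> > 0"
  shows "(\<Sum>\<alpha>\<in>captured m n s \<xi> \<beta>. norm (a \<alpha>) powr q)
       \<le> real m powr (q - 1) * \<kappa> ^ (s - 1) * poly_norm (ereal p) m n a powr q"
proof -
  let ?A = "captured m n s \<xi> \<beta>"
  define N where "N = poly_norm (ereal p) m n a"
  define \<kappa>' where "\<kappa>' = \<kappa> powr ((real s - 1) / q)"
  have p0: "p > 0" using p by linarith
  have q1: "q > 1" unfolding q using p m by (simp add: pos_less_divide_eq)
  have N0: "N \<ge> 0" unfolding N_def using n p0 by (intro poly_norm_nonneg) auto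
  have s1: "s \<ge> 1" using \<xi>[of 0] n by simp
  define b where "b \<alpha> = (if \<alpha> \<in> ?A then norm (a \<alpha>) powr q else 0)" for \<alpha>
  have "real m * (\<Sum>\<alpha>\<in>multi_indices m n. b \<alpha>) \<le> (real m * \<kappa>' * N) powr q"
  proof (rule sum_le_by_balancing[OF _ m n p q])
    fix x :: "nat \<Rightarrow> real" assume x: "\<And>k. k < n \<Longrightarrow> x k > 0" "(\<Sum>k<n. x k powr p) = 1"
    define c where "c \<alpha> = a \<alpha> * of_real (monomial n x \<alpha>)" for \<alpha>
    have pd: "polydisc_bound m n c N"
      unfolding N_def c_def by (rule polydisc_bound_rescaled) (use n p0 x in \<open>auto intro: less_imp_le\<close>)
    define \<pi> where "\<pi> l = (\<Sum>k\<in>{k\<in>{..<n}. \<xi> k = l}. x k powr p)" for l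
    have "(\<Sum>l<s. \<pi> l) = 1"
      unfolding \<pi>_def using x(2) \<xi> by (subst sum.group) auto
    have "\<exists>l<s. real (\<beta> l) / real m \<le> \<pi> l"
    proof (rule ccontr)
      assume "\<not> ?thesis"
      then have "(\<Sum>l<s. \<pi> l) < (\<Sum>l<s. real (\<beta> l) / real m)"
        using s1 by (intro sum_strict_mono) (auto simp: not_le lessThan_empty_iff)
      also have "\<dots> = 1" using \<beta>_sum m by (simp flip: sum_divide_distrib of_nat_sum)
      finally show False using \<open>(\<Sum>l<s. \<pi> l) = 1\<close> by simp
    qed
    then obtain l0 where l0: "l0 < s" "real (\<beta> l0) / real m \<le> \<pi> l0" by blast
    define S where "S = {k\<in>{..<n}. \<xi> k = l0}"
    have E: "(\<Sum>\<alpha>\<in>multi_indices m n. real (\<alpha> k) * b \<alpha> * monomial n x \<alpha> powr q)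
        = real (\<beta> l0) * (\<Sum>i\<in>{i\<in>transversals. i l0 = k}. norm (c (index_of i)) powr q)" if k: "k \<in> S" for k
    proof -
      have mon0: "monomial n x \<alpha> \<ge> 0" for \<alpha> using x(1) by (intro monomial_nonneg) (auto intro: less_imp_le)
      have "(\<Sum>\<alpha>\<in>multi_indices m n. real (\<alpha> k) * b \<alpha> * monomial n x \<alpha> powr q)
          = (\<Sum>\<alpha>\<in>?A. real (\<alpha> k) * norm (c \<alpha>) powr q)"
        by (rule sum.mono_neutral_cong_right)
           (use mon0 in \<open>auto simp: captured_def b_def c_def norm_mult powr_mult\<close>)
      also have "\<dots> = (\<Sum>i\<in>transversals. real (index_of i k) * norm (c (index_of i)) powr q)"
        by (rule sum.reindex_bij_betw[OF bij_betw_index_of, symmetric])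
      also have "\<dots> = (\<Sum>i\<in>{i\<in>transversals. i l0 = k}. real (\<beta> l0) * norm (c (index_of i)) powr q)"
        by (rule sum.mono_neutral_cong_right) (use k in \<open>auto simp: S_def index_of_def\<close>)
      finally show ?thesis by (simp add: sum_distrib_left)
    qed
    have \<beta>1: "real (\<beta> l0) \<ge> 1" using \<beta>[OF l0(1)] by simp
    have "(\<Sum>k\<in>S. (\<Sum>\<alpha>\<in>multi_indices m n. real (\<alpha> k) * b \<alpha> * monomial n x \<alpha> powr q) powr (1 / q))
        = real (\<beta> l0) powr (1 / q) * (\<Sum>k\<in>S. (\<Sum>i\<in>{i\<in>transversals. i l0 = k}. norm (c (index_of i)) powr q) powr (1 / q))"
      unfolding sum_distrib_left by (intro sum.cong refl) (simp add: E powr_mult sum_nonneg)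
    also have "\<dots> \<le> real (\<beta> l0) * (\<kappa>' * N)"
    proof (rule mult_mono)
      show "real (\<beta> l0) powr (1 / q) \<le> real (\<beta> l0)"
        using powr_mono[of "1 / q" 1 "real (\<beta> l0)"] \<beta>1 q1 by simp
      have "(\<Sum>k\<in>S. (\<Sum>i\<in>{i\<in>transversals. i l0 = k}. norm (c (index_of i)) powr q) powr (1 / q))
          \<le> (\<Sum>k<n. (\<Sum>i\<in>{i\<in>transversals. i l0 = k}. norm (c (index_of i)) powr q) powr (1 / q))"
        by (intro sum_mono2) (auto simp: S_def)
      also have "\<dots> \<le> \<kappa>' * N"
        unfolding \<kappa>'_def by (rule decoupled_mixed_inequality[OF pd l0(1) av q1 \<kappa>])
      finally show "(\<Sum>k\<in>S. (\<Sum>i\<in>{i\<in>transversals. i l0 = k}. norm (c (index_of i)) powr q) powr (1 / q)) \<le> \<kappa>' * N" .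
    qed (auto intro!: sum_nonneg)
    also have "\<dots> \<le> (real m * \<pi> l0) * (\<kappa>' * N)"
      using l0(2) m N0 by (intro mult_right_mono) (auto simp: field_simps \<kappa>'_def)
    finally have "(\<Sum>k\<in>S. (\<Sum>\<alpha>\<in>multi_indices m n. real (\<alpha> k) * b \<alpha> * monomial n x \<alpha> powr q) powr (1 / q))
        \<le> real m * \<kappa>' * N * (\<Sum>k\<in>S. x k powr p)"
      by (simp add: \<pi>_def S_def mult_ac)
    moreover have "1 / real m \<le> (\<Sum>k\<in>S. x k powr p)"
    proof -
      have "1 / real m \<le> real (\<beta> l0) / real m" using \<beta>1 by (intro divide_right_mono) auto
      then show ?thesis using l0(2) by (simp add: \<pi>_def S_def)
    qed
    ultimately show "\<exists>S\<subseteq>{..<n}. 1 / real m \<le> (\<Sum>k\<in>S. x k powr p) \<and>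
        (\<Sum>k\<in>S. (\<Sum>\<alpha>\<in>multi_indices m n. real (\<alpha> k) * b \<alpha> * monomial n x \<alpha> powr q) powr (1 / q))
          \<le> real m * \<kappa>' * N * (\<Sum>k\<in>S. x k powr p)"
      by (intro exI[of _ S]) (auto simp: S_def)
  qed (use N0 in \<open>auto simp: b_def \<kappa>'_def\<close>)
  also have "(\<Sum>\<alpha>\<in>multi_indices m n. b \<alpha>) = (\<Sum>\<alpha>\<in>?A. norm (a \<alpha>) powr q)"
    by (rule sum.mono_neutral_cong_right) (auto simp: captured_def b_def)
  also have "(real m * \<kappa>' * N) powr q = real m * (real m powr (q - 1) * \<kappa> ^ (s - 1) * N powr q)"
  proof -
    have "\<kappa>' powr q = \<kappa> ^ (s - 1)"
      using q1 \<kappa> s1 by (simp add: \<kappa>'_def powr_powr of_nat_diff flip: powr_realpow)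
    moreover have "real m powr q = real m * real m powr (q - 1)"
      using m by (simp add: powr_diff)
    ultimately show ?thesis by (simp add: powr_mult mult_ac)
  qed
  finally show ?thesis using m by (simp add: N_def)
qed

end

text \<open>
  Subtracting \<open>1\<close> from every part turns compositions into lists with a prescribed sum.
\<close>

lemma card_compositions_le:
  assumes "s \<ge> 1" "s \<le> m"
  shows "card {\<beta>\<in>multi_indices m s. \<forall>l<s. \<beta> l \<ge> 1} \<le> (m - 1) choose (s - 1)"
proof -
  define f where "f \<beta> = map (\<lambda>l. \<beta> l - 1) [0..<s]" for \<beta> :: "nat \<Rightarrow> nat"
  define Ls where "Ls = {l :: nat list. length l = s \<and> sum_list l = m - s}"
  have "inj_on f {\<beta>\<in>multi_indices m s. \<forall>l<s. \<beta> l \<ge> 1}"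
  proof (rule inj_onI)
    fix \<beta> \<beta>' assume b: "\<beta> \<in> {\<beta>\<in>multi_indices m s. \<forall>l<s. \<beta> l \<ge> 1}" "\<beta>' \<in> {\<beta>\<in>multi_indices m s. \<forall>l<s. \<beta> l \<ge> 1}"
      and eq: "f \<beta> = f \<beta>'"
    have "\<beta> l = \<beta>' l" for l
    proof (cases "l < s")
      case True
      then have "\<beta> l - 1 = \<beta>' l - 1" using arg_cong[OF eq, of "\<lambda>xs. xs ! l"] by (simp add: f_def)
      moreover have "\<beta> l \<ge> 1" "\<beta>' l \<ge> 1" using b True by auto
      ultimately show ?thesis by linarith
    qed (use b in \<open>auto simp: multi_indices_def\<close>)
    then show "\<beta> = \<beta>'" by auto
  qed
  moreover have "f ` {\<beta>\<in>multi_indices m s. \<forall>l<s. \<beta> l \<ge> 1} \<subseteq> Ls"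
  proof clarsimp
    fix \<beta> assume b: "\<beta> \<in> multi_indices m s" "\<forall>l<s. Suc 0 \<le> \<beta> l"
    have "sum_list (f \<beta>) = (\<Sum>l<s. \<beta> l - 1)"
      by (simp add: f_def sum_list_distinct_conv_sum_set atLeast0LessThan)
    also have "\<dots> = (\<Sum>l<s. \<beta> l) - (\<Sum>l<s. 1)"
      using b(2) by (intro sum_subtractf_nat) auto
    finally show "f \<beta> \<in> Ls" using b(1) by (simp add: Ls_def f_def multi_indices_def)
  qed
  moreover have "finite Ls"
  proof (rule finite_subset)
    show "Ls \<subseteq> {l. set l \<subseteq> {..m - s} \<and> length l = s}"
      by (auto simp: Ls_def dest: member_le_sum_list)
  qed (rule finite_lists_length_eq, simp)
  ultimately have "card {\<beta>\<in>multi_indices m s. \<forall>l<s. \<beta> l \<ge> 1} \<le> card Ls"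
    by (rule card_inj_on_le)
  also have "card Ls = (m - s + s - 1) choose (m - s)"
    unfolding Ls_def by (rule card_length_sum_list)
  also have "\<dots> = (m - 1) choose (s - 1)"
    using assms binomial_symmetric[of "m - s" "m - 1"] by simp
  finally show ?thesis .
qed

lemma captured_of_injective_colouring:
  assumes a: "\<alpha> \<in> multi_indices m n" and \<xi>: "\<And>k. k < n \<Longrightarrow> \<xi> k < s"
    and inj: "inj_on \<xi> {k\<in>{..<n}. \<alpha> k \<noteq> 0}" and card: "card {k\<in>{..<n}. \<alpha> k \<noteq> 0} = s"
  shows "\<exists>\<beta>\<in>{\<beta>\<in>multi_indices m s. \<forall>l<s. \<beta> l \<ge> 1}. \<alpha> \<in> captured m n s \<xi> \<beta>"
proof -
  define S where "S = {k\<in>{..<n}. \<alpha> k \<noteq> 0}"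
  have img: "\<xi> ` S = {..<s}"
  proof (rule card_subset_eq)
    show "\<xi> ` S \<subseteq> {..<s}" using \<xi> by (auto simp: S_def)
    show "card (\<xi> ` S) = card {..<s}" using inj card by (simp add: card_image S_def)
  qed simp
  define \<beta> where "\<beta> l = (if l < s then class_degree n \<xi> \<alpha> l else 0)" for l
  have cd: "class_degree n \<xi> \<alpha> (\<xi> k) = \<alpha> k" if k: "k \<in> S" for k
  proof -
    have "class_degree n \<xi> \<alpha> (\<xi> k) = (\<Sum>k'\<in>{k}. \<alpha> k')"
      unfolding class_degree_def
      by (rule sum.mono_neutral_right) (use k inj in \<open>auto simp: S_def inj_on_def\<close>)
    then show ?thesis by simp
  qed
  have "(\<Sum>l<s. \<beta> l) = (\<Sum>l<s. sum \<alpha> {k\<in>{..<n}. \<xi> k = l})"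
    by (intro sum.cong refl) (simp add: \<beta>_def class_degree_def)
  also have "\<dots> = (\<Sum>k<n. \<alpha> k)" by (rule sum.group) (use \<xi> in auto)
  finally have "(\<Sum>l<s. \<beta> l) = (\<Sum>k<n. \<alpha> k)" .
  then have "\<beta> \<in> multi_indices m s" using multi_indices_sum[OF a] by (simp add: multi_indices_def \<beta>_def)
  moreover have "\<beta> l \<ge> 1" if l: "l < s" for l
  proof -
    obtain k where k: "k \<in> S" "l = \<xi> k" using img l by auto
    then show ?thesis using cd[OF k(1)] l by (simp add: \<beta>_def S_def)
  qed
  moreover have "\<beta> (\<xi> k) dvd \<alpha> k" if k: "k < n" for k
    using cd[of k] \<xi>[OF k] k by (cases "\<alpha> k = 0") (auto simp: \<beta>_def S_def)
  ultimately show ?thesis using a by (intro bexI[of _ \<beta>]) (auto simp: captured_def \<beta>_def)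
qed

text \<open>
  Double counting: an index with a support of size \<open>s\<close> is captured by every colouring that is
  injective on its support, together with a suitable composition. There are \<open>s\<^bsup>n - s\<^esup> s!\<close> such
  colourings out of \<open>s\<^sup>n\<close>, which yields the factor \<open>s\<^sup>s / s!\<close>.
\<close>

lemma sum_by_support_bound:
  assumes p: "real m < p" and q: "q = p / (p - real m)" and m: "m \<ge> 1" and n: "n \<ge> 1" and s: "s \<ge> 1" "s \<le> m"
    and av: "averaging {\<phi>. \<forall>l. norm (\<phi> l) = 1} (\<lambda>_. 1 / \<kappa>) (n - 1) q" and \<kappa>: "\<kappa> > 0"
  shows "(\<Sum>\<alpha>\<in>{\<alpha>\<in>multi_indices m n. card {k\<in>{..<n}. \<alpha> k \<noteq> 0} = s}. norm (a \<alpha>) powr q)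
       \<le> real s ^ s / fact s * real ((m - 1) choose (s - 1)) * \<kappa> ^ (s - 1)
          * (real m powr (q - 1) * poly_norm (ereal p) m n a powr q)"
proof (cases "s \<le> n")
  case False
  have "card {k\<in>{..<n}. \<alpha> k \<noteq> 0} \<le> n" for \<alpha> :: "nat \<Rightarrow> nat"
    using card_mono[of "{..<n}" "{k\<in>{..<n}. \<alpha> k \<noteq> 0}"] by auto
  then have "{\<alpha>\<in>multi_indices m n. card {k\<in>{..<n}. \<alpha> k \<noteq> 0} = s} = {}"
    using False by blast
  then show ?thesis using \<kappa> by (simp only: sum.empty) simp
next
  case True
  define M where "M = {\<alpha>\<in>multi_indices m n. card {k\<in>{..<n}. \<alpha> k \<noteq> 0} = s}"
  define C where "C = {\<beta>\<in>multi_indices m s. \<forall>l<s. \<beta> l \<ge> 1}"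
  define X where "X = {..<n} \<rightarrow>\<^sub>E {..<s}"
  define f where "f \<alpha> = norm (a \<alpha>) powr q" for \<alpha>
  define bd where "bd = real m powr (q - 1) * \<kappa> ^ (s - 1) * poly_norm (ereal p) m n a powr q"
  have finM: "finite M" and finC: "finite C" and finX: "finite X"
    by (auto simp: M_def C_def X_def intro!: finite_PiE)
  have bd0: "bd \<ge> 0" using \<kappa> by (simp add: bd_def)
  have cap: "(\<Sum>\<alpha>\<in>captured m n s \<xi> \<beta>. f \<alpha>) \<le> bd" if "\<xi> \<in> X" "\<beta> \<in> C" for \<xi> \<beta>
  proof -
    interpret colouring m n s \<xi> \<beta>
      by unfold_locales (use that n in \<open>auto simp: X_def C_def PiE_def Pi_def multi_indices_def\<close>)
    show ?thesis unfolding f_def bd_def by (rule sum_captured_bound[OF p q m av \<kappa>])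
  qed
  have cnt: "card {\<xi>\<in>X. inj_on \<xi> {k\<in>{..<n}. \<alpha> k \<noteq> 0}} = s ^ (n - s) * fact s" if "\<alpha> \<in> M" for \<alpha>
  proof -
    have c: "card {k\<in>{..<n}. \<alpha> k \<noteq> 0} = s" using that by (simp add: M_def)
    have "card {\<xi>\<in>X. inj_on \<xi> {k\<in>{..<n}. \<alpha> k \<noteq> 0}}
        = card {..<s} ^ (card {..<n} - card {k\<in>{..<n}. \<alpha> k \<noteq> 0}) * prod ((-) (card {..<s})) {0..<card {k\<in>{..<n}. \<alpha> k \<noteq> 0}}"
      unfolding X_def by (rule card_inj_on_subset_funcset) auto
    also have "prod ((-) (card {..<s})) {0..<card {k\<in>{..<n}. \<alpha> k \<noteq> 0}} = fact s"
      unfolding c by (simp add: fact_prod_rev)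
    finally show ?thesis unfolding c by simp
  qed
  have "real (s ^ (n - s) * fact s) * (\<Sum>\<alpha>\<in>M. f \<alpha>) = (\<Sum>\<alpha>\<in>M. \<Sum>\<xi>\<in>{\<xi>\<in>X. inj_on \<xi> {k\<in>{..<n}. \<alpha> k \<noteq> 0}}. f \<alpha>)"
    unfolding sum_distrib_left by (rule sum.cong[OF refl]) (simp only: sum_constant cnt)
  also have "\<dots> \<le> (\<Sum>\<alpha>\<in>M. \<Sum>\<xi>\<in>{\<xi>\<in>X. inj_on \<xi> {k\<in>{..<n}. \<alpha> k \<noteq> 0}}. \<Sum>\<beta>\<in>{\<beta>\<in>C. \<alpha> \<in> captured m n s \<xi> \<beta>}. f \<alpha>)"
  proof (intro sum_mono)
    fix \<alpha> \<xi> assume a: "\<alpha> \<in> M" and x: "\<xi> \<in> {\<xi>\<in>X. inj_on \<xi> {k\<in>{..<n}. \<alpha> k \<noteq> 0}}"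
    obtain \<beta> where "\<beta> \<in> C" "\<alpha> \<in> captured m n s \<xi> \<beta>"
      using captured_of_injective_colouring[of \<alpha> m n \<xi> s] a x
      by (auto simp: M_def X_def C_def PiE_def Pi_def)
    then show "f \<alpha> \<le> (\<Sum>\<beta>\<in>{\<beta>\<in>C. \<alpha> \<in> captured m n s \<xi> \<beta>}. f \<alpha>)"
      using finC by (intro member_le_sum[of \<beta> _ "\<lambda>_. f \<alpha>"]) (auto simp: f_def)
  qed
  also have "\<dots> \<le> (\<Sum>\<alpha>\<in>M. \<Sum>\<xi>\<in>X. \<Sum>\<beta>\<in>{\<beta>\<in>C. \<alpha> \<in> captured m n s \<xi> \<beta>}. f \<alpha>)"
    using finX by (intro sum_mono sum_mono2) (auto intro!: sum_nonneg simp: f_def)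
  also have "\<dots> = (\<Sum>\<xi>\<in>X. \<Sum>\<alpha>\<in>M. \<Sum>\<beta>\<in>{\<beta>\<in>C. \<alpha> \<in> captured m n s \<xi> \<beta>}. f \<alpha>)"
    by (rule sum.swap)
  also have "\<dots> = (\<Sum>\<xi>\<in>X. \<Sum>\<beta>\<in>C. \<Sum>\<alpha>\<in>{\<alpha>\<in>M. \<alpha> \<in> captured m n s \<xi> \<beta>}. f \<alpha>)"
    by (rule sum.cong[OF refl]) (rule sum.swap_restrict[OF finM finC])
  also have "\<dots> \<le> (\<Sum>\<xi>\<in>X. \<Sum>\<beta>\<in>C. bd)"
  proof (intro sum_mono)
    fix \<xi> \<beta> assume *: "\<xi> \<in> X" "\<beta> \<in> C"
    have "(\<Sum>\<alpha>\<in>{\<alpha>\<in>M. \<alpha> \<in> captured m n s \<xi> \<beta>}. f \<alpha>) \<le> (\<Sum>\<alpha>\<in>captured m n s \<xi> \<beta>. f \<alpha>)"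
      by (intro sum_mono2) (auto simp: captured_def f_def)
    then show "(\<Sum>\<alpha>\<in>{\<alpha>\<in>M. \<alpha> \<in> captured m n s \<xi> \<beta>}. f \<alpha>) \<le> bd" using cap[OF *] by linarith
  qed
  also have "\<dots> = real (s ^ n) * (real (card C) * bd)"
    by (simp add: X_def card_funcsetE)
  also have "\<dots> \<le> real (s ^ n) * (real ((m - 1) choose (s - 1)) * bd)"
    using card_compositions_le[OF s] bd0 by (intro mult_left_mono mult_right_mono) (auto simp: C_def)
  also have "s ^ n = s ^ (n - s) * s ^ s" using True by (simp flip: power_add)
  finally have "real (s ^ (n - s)) * (fact s * (\<Sum>\<alpha>\<in>M. f \<alpha>))
      \<le> real (s ^ (n - s)) * (real s ^ s * (real ((m - 1) choose (s - 1)) * bd))"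
    by (simp add: mult_ac)
  then have "fact s * (\<Sum>\<alpha>\<in>M. f \<alpha>) \<le> real s ^ s * (real ((m - 1) choose (s - 1)) * bd)"
    using s by simp
  then show ?thesis by (simp add: M_def f_def bd_def field_simps)
qed

lemma decoupled_coefficient_bound:
  assumes p: "real m < p" and q: "q = p / (p - real m)" and m: "m \<ge> 1" and n: "n \<ge> 1"
    and av: "averaging {\<phi>. \<forall>l. norm (\<phi> l) = 1} (\<lambda>_. 1 / \<kappa>) (n - 1) q" and \<kappa>: "\<kappa> > 0"
  shows "(\<Sum>\<alpha>\<in>multi_indices m n. norm (a \<alpha>) powr q)
       \<le> (\<Sum>s=1..m. real s ^ s / fact s * real ((m - 1) choose (s - 1)) * \<kappa> ^ (s - 1))
          * (real m powr (q - 1) * poly_norm (ereal p) m n a powr q)"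
proof -
  have "(\<Sum>\<alpha>\<in>multi_indices m n. norm (a \<alpha>) powr q)
      = (\<Sum>s=1..m. \<Sum>\<alpha>\<in>{\<alpha>\<in>multi_indices m n. card {k\<in>{..<n}. \<alpha> k \<noteq> 0} = s}. norm (a \<alpha>) powr q)"
  proof (rule sum.group[symmetric])
    show "(\<lambda>\<alpha>. card {k\<in>{..<n}. \<alpha> k \<noteq> 0}) ` multi_indices m n \<subseteq> {1..m}"
    proof clarify
      fix \<alpha> assume a: "\<alpha> \<in> multi_indices m n"
      have "card {k\<in>{..<n}. \<alpha> k \<noteq> 0} = (\<Sum>k\<in>{k\<in>{..<n}. \<alpha> k \<noteq> 0}. 1)" by simp
      also have "\<dots> \<le> (\<Sum>k\<in>{k\<in>{..<n}. \<alpha> k \<noteq> 0}. \<alpha> k)" by (intro sum_mono) auto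
      also have "\<dots> \<le> (\<Sum>k<n. \<alpha> k)" by (intro sum_mono2) auto
      finally have "card {k\<in>{..<n}. \<alpha> k \<noteq> 0} \<le> m" using multi_indices_sum[OF a] by simp
      moreover have "card {k\<in>{..<n}. \<alpha> k \<noteq> 0} \<noteq> 0"
      proof
        assume "card {k\<in>{..<n}. \<alpha> k \<noteq> 0} = 0"
        then have "\<forall>k<n. \<alpha> k = 0" by auto
        then show False using multi_indices_sum[OF a] m by simp
      qed
      ultimately show "card {k\<in>{..<n}. \<alpha> k \<noteq> 0} \<in> {1..m}" unfolding atLeastAtMost_iff by linarith
    qed
  qed auto
  also have "\<dots> \<le> (\<Sum>s=1..m. real s ^ s / fact s * real ((m - 1) choose (s - 1)) * \<kappa> ^ (s - 1)
          * (real m powr (q - 1) * poly_norm (ereal p) m n a powr q))"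
    by (intro sum_mono sum_by_support_bound[OF p q m n _ _ av \<kappa>]) auto
  finally show ?thesis by (simp add: sum_distrib_right)
qed

section \<open>Subexponential growth of the Bohnenblust--Hille constant\<close>

text \<open>
  The first summand of a splitting determines it, and \<open>\<delta>\<close> has at most \<open>\<Prod> 2\<^bsup>\<delta>\<^sub>j\<^esup> = 4\<^sup>m\<close> multi-indices
  below it, by the binomial theorem.
\<close>

lemma card_splittings_le:
  assumes "\<delta> \<in> multi_indices (2 * m) n"
  shows "card {x\<in>multi_indices m n \<times> multi_indices m n. (\<lambda>j. fst x j + snd x j) = \<delta>} \<le> 4 ^ m"
proof -
  define Z where "Z = {x\<in>multi_indices m n \<times> multi_indices m n. (\<lambda>j. fst x j + snd x j) = \<delta>}"
  have inj: "inj_on fst Z"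
  proof (rule inj_onI)
    fix x y assume xy: "x \<in> Z" "y \<in> Z" "fst x = fst y"
    then have "(\<lambda>j. fst x j + snd x j) = (\<lambda>j. fst y j + snd y j)"
      unfolding Z_def mem_Collect_eq by (simp only:)
    from fun_cong[OF this] have "snd x = snd y" using xy(3) by auto
    then show "x = y" using xy(3) by (simp add: prod_eq_iff)
  qed
  have "card Z = card (fst ` Z)" by (rule card_image[OF inj, symmetric])
  also have "\<dots> = (\<Sum>\<alpha>\<in>fst ` Z. 1)" by simp
  also have "\<dots> \<le> (\<Sum>\<alpha>\<in>fst ` Z. multi_choose n \<delta> \<alpha>)"
  proof (intro sum_mono)
    fix \<alpha> assume "\<alpha> \<in> fst ` Z"
    then have "\<alpha> j \<le> \<delta> j" for j unfolding Z_def by auto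
    then show "1 \<le> multi_choose n \<delta> \<alpha>"
      unfolding multi_choose_def by (simp add: Suc_le_eq prod_pos)
  qed
  also have "\<dots> \<le> (\<Sum>\<alpha>\<in>exponent_box n (2 * m). multi_choose n \<delta> \<alpha>)"
  proof (rule sum_mono2)
    show "fst ` Z \<subseteq> exponent_box n (2 * m)"
      using multi_indices_subset_box[of m n] by (fastforce simp: Z_def exponent_box_def)
  qed auto
  also have "\<dots> = (\<Prod>j<n. \<Sum>l\<le>2 * m. \<delta> j choose l)"
    unfolding multi_choose_def by (rule sum_prod_exponent_box)
  also have "\<dots> = (\<Prod>j<n. 2 ^ \<delta> j)"
  proof (intro prod.cong refl)
    fix j
    have "(\<Sum>l\<le>2 * m. \<delta> j choose l) = (\<Sum>l\<le>\<delta> j. \<delta> j choose l)"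
      by (rule sum.mono_neutral_right) (use multi_indices_le[OF assms, of j] in auto)
    then show "(\<Sum>l\<le>2 * m. \<delta> j choose l) = 2 ^ \<delta> j" by (simp add: choose_row_sum)
  qed
  also have "\<dots> = 2 ^ (2 * m)" using multi_indices_sum[OF assms] by (simp add: power_sum[symmetric])
  finally show ?thesis by (simp add: Z_def power_mult)
qed

text \<open>
  Parseval's identity for \<open>P\<^sup>2\<close>, whose coefficients are sums of at most \<open>4\<^sup>m\<close> products. The grid has more
  than \<open>2 m\<close> points in each direction, since \<open>P\<^sup>2\<close> has degree \<open>2 m\<close>.
\<close>

lemma grid_fourth_moment:
  assumes "N > 2 * m"
  shows "(\<Sum>i\<in>exponent_box n (N - 1). norm (poly_eval m n c (\<lambda>j. unity_root N ^ i j)) ^ 4)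
       \<le> real N ^ n * (4 ^ m * (\<Sum>\<alpha>\<in>multi_indices m n. (norm (c \<alpha>))\<^sup>2)\<^sup>2)"
proof -
  let ?M = "multi_indices m n" and ?D = "multi_indices (2 * m) n"
  define pl where "pl x = (\<lambda>j. fst x j + snd x j)" for x :: "(nat \<Rightarrow> nat) \<times> (nat \<Rightarrow> nat)"
  define Z where "Z \<delta> = {x\<in>?M \<times> ?M. pl x = \<delta>}" for \<delta>
  define C where "C \<delta> = (\<Sum>x\<in>Z \<delta>. c (fst x) * c (snd x))" for \<delta>
  have plD: "pl x \<in> ?D" if "x \<in> ?M \<times> ?M" for x
    using that by (auto simp: pl_def multi_indices_def sum.distrib)
  have sq: "(poly_eval m n c z)\<^sup>2 = (\<Sum>\<delta>\<in>?D. C \<delta> * monomial n z \<delta>)" for z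
  proof -
    have "(poly_eval m n c z)\<^sup>2 = (\<Sum>x\<in>?M \<times> ?M. c (fst x) * c (snd x) * monomial n z (pl x))"
      unfolding poly_eval_monomial power2_eq_square sum_product sum.cartesian_product
      by (intro sum.cong refl) (auto simp: pl_def monomial_def power_add prod.distrib)
    also have "\<dots> = (\<Sum>\<delta>\<in>?D. \<Sum>x\<in>Z \<delta>. c (fst x) * c (snd x) * monomial n z (pl x))"
      unfolding Z_def by (rule sum.group[symmetric]) (use plD in auto)
    also have "\<dots> = (\<Sum>\<delta>\<in>?D. C \<delta> * monomial n z \<delta>)"
      unfolding C_def sum_distrib_right by (intro sum.cong refl) (auto simp: Z_def)
    finally show ?thesis .
  qed
  have "(\<Sum>i\<in>exponent_box n (N - 1). norm (poly_eval m n c (\<lambda>j. unity_root N ^ i j)) ^ 4)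
      = (\<Sum>i\<in>exponent_box n (N - 1). (norm (\<Sum>\<delta>\<in>?D. C \<delta> * monomial n (\<lambda>j. unity_root N ^ i j) \<delta>))\<^sup>2)"
    unfolding sq[symmetric] by (intro sum.cong refl) (simp add: norm_power)
  also have "\<dots> = real N ^ n * (\<Sum>\<delta>\<in>?D. (norm (C \<delta>))\<^sup>2)"
    by (rule grid_parseval[OF multi_indices_subset_box assms])
  also have "(\<Sum>\<delta>\<in>?D. (norm (C \<delta>))\<^sup>2) \<le> (\<Sum>\<delta>\<in>?D. 4 ^ m * (\<Sum>x\<in>Z \<delta>. (norm (c (fst x)))\<^sup>2 * (norm (c (snd x)))\<^sup>2))"
  proof (intro sum_mono)
    fix \<delta> assume d: "\<delta> \<in> ?D"
    have "(norm (C \<delta>))\<^sup>2 \<le> (\<Sum>x\<in>Z \<delta>. 1 * norm (c (fst x) * c (snd x)))\<^sup>2"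
      unfolding C_def using norm_sum[of "\<lambda>x. c (fst x) * c (snd x)" "Z \<delta>"] by (intro power_mono) auto
    also have "\<dots> \<le> (\<Sum>x\<in>Z \<delta>. 1\<^sup>2) * (\<Sum>x\<in>Z \<delta>. (norm (c (fst x) * c (snd x)))\<^sup>2)"
      by (rule Cauchy_Schwarz_ineq_sum)
    also have "\<dots> = real (card (Z \<delta>)) * (\<Sum>x\<in>Z \<delta>. (norm (c (fst x)))\<^sup>2 * (norm (c (snd x)))\<^sup>2)"
      by (simp add: norm_mult power_mult_distrib)
    also have "\<dots> \<le> 4 ^ m * (\<Sum>x\<in>Z \<delta>. (norm (c (fst x)))\<^sup>2 * (norm (c (snd x)))\<^sup>2)"
    proof (rule mult_right_mono)
      have "card (Z \<delta>) \<le> 4 ^ m" unfolding Z_def pl_def by (rule card_splittings_le[OF d])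
      then show "real (card (Z \<delta>)) \<le> 4 ^ m"
        by (metis of_nat_le_iff of_nat_numeral of_nat_power)
    qed (auto intro!: sum_nonneg)
    finally show "(norm (C \<delta>))\<^sup>2 \<le> 4 ^ m * (\<Sum>x\<in>Z \<delta>. (norm (c (fst x)))\<^sup>2 * (norm (c (snd x)))\<^sup>2)" .
  qed
  also have "\<dots> = 4 ^ m * (\<Sum>x\<in>?M \<times> ?M. (norm (c (fst x)))\<^sup>2 * (norm (c (snd x)))\<^sup>2)"
    unfolding sum_distrib_left[symmetric] Z_def by (subst sum.group) (use plD in auto)
  also have "(\<Sum>x\<in>?M \<times> ?M. (norm (c (fst x)))\<^sup>2 * (norm (c (snd x)))\<^sup>2) = (\<Sum>\<alpha>\<in>?M. (norm (c \<alpha>))\<^sup>2)\<^sup>2"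
    by (simp add: power2_eq_square sum_product sum.cartesian_product case_prod_unfold)
  finally show ?thesis by (simp add: mult_left_mono)
qed

text \<open>
  Hoelder's inequality interpolates the second moment between the moments of order \<open>\<rho>\<close> and \<open>4\<close>; the
  latter is controlled by the second moment itself.
\<close>

lemma grid_low_moment:
  fixes n :: nat and c :: "(nat \<Rightarrow> nat) \<Rightarrow> complex"
  assumes N: "N > 2 * m" and \<rho>: "0 < \<rho>" "\<rho> < 2"
  defines "s \<equiv> (\<Sum>\<alpha>\<in>multi_indices m n. (norm (c \<alpha>))\<^sup>2)"
  shows "real N ^ n * s powr (\<rho> / 2)
      \<le> 2 powr (real m * (2 - \<rho>)) * (\<Sum>i\<in>exponent_box n (N - 1). norm (poly_eval m n c (\<lambda>j. unity_root N ^ i j)) powr \<rho>)"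
proof (cases "s = 0")
  case True
  then show ?thesis using \<rho> by (auto intro!: mult_nonneg_nonneg sum_nonneg)
next
  case False
  have "s \<ge> 0" unfolding s_def by (intro sum_nonneg) auto
  then have s: "s > 0" using False by simp
  define f where "f i = norm (poly_eval m n c (\<lambda>j. unity_root N ^ i j))" for i :: "nat \<Rightarrow> nat"
  define V where "V = real N ^ n"
  have V: "V > 0" using N by (simp add: V_def)
  define A where "A = (\<Sum>i\<in>exponent_box n (N - 1). f i powr \<rho>) / V"
  have A0: "A \<ge> 0" unfolding A_def using V by (intro divide_nonneg_pos sum_nonneg) auto
  define \<theta> where "\<theta> = 2 / (4 - \<rho>)"
  have \<theta>: "0 < \<theta>" "\<theta> < 1" "\<rho> * \<theta> + 4 * (1 - \<theta>) = 2"
  proof -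
    have "4 - \<rho> \<noteq> 0" using \<rho> by simp
    then have "(4 - \<rho>) * \<theta> = 2" unfolding \<theta>_def by (rule nonzero_mult_div_cancel_left[of "4 - \<rho>" 2, simplified times_divide_eq_right[symmetric]])
    then show "\<rho> * \<theta> + 4 * (1 - \<theta>) = 2" by (simp add: algebra_simps)
  qed (use \<rho> in \<open>auto simp: \<theta>_def\<close>)
  have "V * s = (\<Sum>i\<in>exponent_box n (N - 1). (f i)\<^sup>2)"
    unfolding f_def poly_eval_monomial V_def s_def
    by (rule grid_parseval[OF multi_indices_subset_box, symmetric]) (use N in simp)
  also have "\<dots> = (\<Sum>i\<in>exponent_box n (N - 1). (f i powr \<rho>) powr \<theta> * (f i ^ 4) powr (1 - \<theta>))"
  proof (intro sum.cong refl)
    fix i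
    show "(f i)\<^sup>2 = (f i powr \<rho>) powr \<theta> * (f i ^ 4) powr (1 - \<theta>)"
    proof (cases "f i = 0")
      case False
      then have fp: "f i > 0" by (simp add: f_def)
      then have "f i ^ 4 = f i powr 4" by simp
      then have "(f i powr \<rho>) powr \<theta> * (f i ^ 4) powr (1 - \<theta>) = f i powr (\<rho> * \<theta> + 4 * (1 - \<theta>))"
        by (simp only: powr_powr powr_add)
      also have "\<dots> = (f i)\<^sup>2" unfolding \<theta>(3) using fp by simp
      finally show ?thesis by simp
    qed simp
  qed
  also have "\<dots> \<le> (\<Sum>i\<in>exponent_box n (N - 1). f i powr \<rho>) powr \<theta> * (\<Sum>i\<in>exponent_box n (N - 1). f i ^ 4) powr (1 - \<theta>)"
    by (rule holder_sum) (use \<theta> in auto)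
  also have "\<dots> \<le> (V * A) powr \<theta> * (V * (4 ^ m * s\<^sup>2)) powr (1 - \<theta>)"
  proof (rule mult_mono)
    show "(\<Sum>i\<in>exponent_box n (N - 1). f i ^ 4) powr (1 - \<theta>) \<le> (V * (4 ^ m * s\<^sup>2)) powr (1 - \<theta>)"
      using grid_fourth_moment[OF N, of n c] \<theta>
      by (intro powr_mono2 sum_nonneg) (auto simp: f_def V_def s_def)
  qed (use V in \<open>auto simp: A_def\<close>)
  also have "\<dots> = (V powr \<theta> * V powr (1 - \<theta>)) * (A powr \<theta> * (4 ^ m * s\<^sup>2) powr (1 - \<theta>))"
    using V A0 s by (simp add: powr_mult)
  also have "V powr \<theta> * V powr (1 - \<theta>) = V" using V by (simp flip: powr_add)
  finally have "s \<le> A powr \<theta> * (4 ^ m * s\<^sup>2) powr (1 - \<theta>)" using V by simp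
  also have "(4 ^ m * s\<^sup>2) powr (1 - \<theta>) = 2 powr (2 * real m * (1 - \<theta>)) * s powr (2 * (1 - \<theta>))"
  proof -
    have "(4::real) ^ m = 2 powr (2 * real m)" using powr_powr[of "2::real" 2 "real m"] by (simp add: powr_realpow)
    moreover have "s\<^sup>2 = s powr 2" using s by simp
    ultimately show ?thesis using s by (simp only: powr_mult powr_powr)
  qed
  finally have le: "s \<le> A powr \<theta> * 2 powr (2 * real m * (1 - \<theta>)) * s powr (2 * (1 - \<theta>))" by (simp only: mult.assoc)
  have "s powr (1 - 2 * (1 - \<theta>)) = s / s powr (2 * (1 - \<theta>))"
    using s by (simp only: powr_diff) simp
  also have "\<dots> \<le> A powr \<theta> * 2 powr (2 * real m * (1 - \<theta>))"
    using le s by (subst pos_divide_le_eq) auto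
  finally have "(s powr (1 - 2 * (1 - \<theta>))) powr (1 / \<theta>) \<le> (A powr \<theta> * 2 powr (2 * real m * (1 - \<theta>))) powr (1 / \<theta>)"
    using \<theta> by (intro powr_mono2) auto
  moreover have "(1 - 2 * (1 - \<theta>)) * (1 / \<theta>) = \<rho> / 2" "2 * real m * (1 - \<theta>) * (1 / \<theta>) = real m * (2 - \<rho>)" "\<theta> * (1 / \<theta>) = 1"
  proof -
    have t: "1 / \<theta> = (4 - \<rho>) / 2" by (simp add: \<theta>_def)
    show t1: "\<theta> * (1 / \<theta>) = 1" using \<theta> by simp
    have "(1 - 2 * (1 - \<theta>)) * (1 / \<theta>) = 2 * (\<theta> * (1 / \<theta>)) - 1 / \<theta>" by (simp add: algebra_simps)
    also have "\<dots> = 2 * 1 - (4 - \<rho>) / 2" by (simp only: t1) (simp only: t)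
    finally show "(1 - 2 * (1 - \<theta>)) * (1 / \<theta>) = \<rho> / 2" by (simp add: field_simps)
    have "2 * real m * (1 - \<theta>) * (1 / \<theta>) = 2 * real m * (1 / \<theta> - \<theta> * (1 / \<theta>))" by (simp add: algebra_simps)
    also have "\<dots> = 2 * real m * ((4 - \<rho>) / 2 - 1)" by (simp only: t1) (simp only: t)
    also have "\<dots> = real m * (2 - \<rho>)" by (simp add: field_simps)
    finally show "2 * real m * (1 - \<theta>) * (1 / \<theta>) = real m * (2 - \<rho>)" .
  qed
  ultimately have "s powr (\<rho> / 2) \<le> A * 2 powr (real m * (2 - \<rho>))"
    using A0 by (simp only: powr_mult powr_powr) simp
  then have "V * s powr (\<rho> / 2) \<le> V * (A * 2 powr (real m * (2 - \<rho>)))" using V by simp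
  also have "\<dots> = 2 powr (real m * (2 - \<rho>)) * (\<Sum>i\<in>exponent_box n (N - 1). f i powr \<rho>)"
    using V by (simp add: A_def)
  finally show ?thesis by (simp add: V_def f_def)
qed

text \<open>
  For fixed \<open>z\<close> the values of \<open>z\<^sup>\<gamma> \<partial>\<^sup>\<gamma> P / \<gamma>!\<close> with \<open>|\<gamma>| = \<kappa>\<close> are the coefficients of a homogeneous polynomial
  of degree \<open>\<kappa>\<close> that is bounded by \<open>e m\<^sup>\<kappa> B\<close>, and the Bohnenblust--Hille inequality of degree \<open>\<kappa>\<close>
  applies to them. Averaging over \<open>z\<close> and using \<open>grid_low_moment\<close> for each \<open>\<gamma>\<close> replaces the values by
  square sums of coefficients. As \<open>\<rho> = 2 \<kappa>/(\<kappa> + 1)\<close> is close to \<open>2\<close>, this costs only \<open>2\<^bsup>m/\<kappa>\<^esup>\<close>.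
\<close>

lemma partial_square_sums_bound:
  assumes P: "polydisc_bound m n c B" and \<kappa>: "1 \<le> \<kappa>" "\<kappa> \<le> m" and n: "n \<ge> 1"
    and BH: "\<And>c' B'. polydisc_bound \<kappa> n c' B' \<Longrightarrow> coeff_norm (2 * real \<kappa> / (real \<kappa> + 1)) \<kappa> n c' \<le> D * B'"
    and D: "D \<ge> 0"
  shows "(\<Sum>\<gamma>\<in>multi_indices \<kappa> n. (\<Sum>\<alpha>\<in>multi_indices m n. (real (multi_choose n \<alpha> \<gamma>))\<^sup>2 * (norm (c \<alpha>))\<^sup>2) powr (real \<kappa> / (real \<kappa> + 1)))
       \<le> (2 powr (real m / real \<kappa>) * (D * (exp 1 * real m ^ \<kappa> * B))) powr (2 * real \<kappa> / (real \<kappa> + 1))"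
proof -
  define \<rho> where "\<rho> = 2 * real \<kappa> / (real \<kappa> + 1)"
  have \<rho>: "0 < \<rho>" "\<rho> < 2" "\<rho> / 2 = real \<kappa> / (real \<kappa> + 1)" using \<kappa> by (auto simp: \<rho>_def field_simps)
  have m1: "m \<ge> 1" using \<kappa> by simp
  have B0: "B \<ge> 0" by (rule polydisc_bound_nonneg[OF P])
  define N where "N = Suc (2 * m)"
  have N: "N > 2 * m" by (simp add: N_def)
  define z where "z i = (\<lambda>j. unity_root N ^ i j)" for i :: "nat \<Rightarrow> nat"
  define s where "s \<gamma> = (\<Sum>\<alpha>\<in>multi_indices m n. (real (multi_choose n \<alpha> \<gamma>))\<^sup>2 * (norm (c \<alpha>))\<^sup>2)" for \<gamma>
  define Y where "Y = D * (exp 1 * real m ^ \<kappa> * B)"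
  have Y0: "Y \<ge> 0" using D B0 by (simp add: Y_def)
  have pt: "(\<Sum>\<gamma>\<in>multi_indices \<kappa> n. norm (partial_eval m n c \<gamma> (z i)) powr \<rho>) \<le> Y powr \<rho>" for i
  proof -
    \<comment> \<open>with this radius \<open>(1 + t)\<^sup>m \<le> e\<close>\<close>
    define t where "t = 1 / real m"
    have t: "t > 0" using m1 by (simp add: t_def)
    have "polydisc_bound \<kappa> n (\<lambda>\<gamma>. partial_eval m n c \<gamma> (z i)) (exp 1 * real m ^ \<kappa> * B)"
      unfolding polydisc_bound_def
    proof (intro allI impI)
      fix u :: "nat \<Rightarrow> complex" assume u: "\<forall>j<n. norm (u j) \<le> 1"
      have "norm (\<Sum>\<gamma>\<in>multi_indices \<kappa> n. monomial n u \<gamma> * partial_eval m n c \<gamma> (z i)) * t ^ \<kappa> \<le> B * (1 + t) ^ m"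
        by (rule homogeneous_part_bound[OF P]) (use u t n \<kappa> in \<open>auto simp: z_def\<close>)
      also have "(1 + t) ^ m \<le> exp 1"
        using exp_ge_one_plus_x_over_n_power_n[of m 1] m1 by (simp add: t_def)
      finally have "norm (\<Sum>\<gamma>\<in>multi_indices \<kappa> n. monomial n u \<gamma> * partial_eval m n c \<gamma> (z i)) * t ^ \<kappa> \<le> B * exp 1"
        using B0 by (simp add: mult_left_mono)
      then show "norm (poly_eval \<kappa> n (\<lambda>\<gamma>. partial_eval m n c \<gamma> (z i)) u) \<le> exp 1 * real m ^ \<kappa> * B"
        using m1 by (simp add: poly_eval_monomial t_def power_one_over field_simps)
    qed
    from BH[OF this] have "(\<Sum>\<gamma>\<in>multi_indices \<kappa> n. norm (partial_eval m n c \<gamma> (z i)) powr \<rho>) powr (1 / \<rho>) \<le> Y"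
      by (simp add: coeff_norm_def \<rho>_def Y_def)
    then have "((\<Sum>\<gamma>\<in>multi_indices \<kappa> n. norm (partial_eval m n c \<gamma> (z i)) powr \<rho>) powr (1 / \<rho>)) powr \<rho> \<le> Y powr \<rho>"
      using \<rho> by (intro powr_mono2) auto
    then show ?thesis using \<rho> by (simp add: powr_powr sum_nonneg)
  qed
  have "real N ^ n * (\<Sum>\<gamma>\<in>multi_indices \<kappa> n. s \<gamma> powr (\<rho> / 2))
      \<le> (\<Sum>\<gamma>\<in>multi_indices \<kappa> n. 2 powr (real m * (2 - \<rho>)) * (\<Sum>i\<in>exponent_box n (N - 1). norm (partial_eval m n c \<gamma> (z i)) powr \<rho>))"
    unfolding sum_distrib_left[of "real N ^ n"]
  proof (intro sum_mono)
    fix \<gamma>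
    show "real N ^ n * s \<gamma> powr (\<rho> / 2) \<le> 2 powr (real m * (2 - \<rho>)) * (\<Sum>i\<in>exponent_box n (N - 1). norm (partial_eval m n c \<gamma> (z i)) powr \<rho>)"
      using grid_low_moment[OF N \<rho>(1,2), of n "\<lambda>\<alpha>. of_nat (multi_choose n \<alpha> \<gamma>) * c \<alpha>"]
      by (simp add: s_def partial_eval_def z_def norm_mult power_mult_distrib)
  qed
  also have "\<dots> = 2 powr (real m * (2 - \<rho>)) * (\<Sum>i\<in>exponent_box n (N - 1). \<Sum>\<gamma>\<in>multi_indices \<kappa> n. norm (partial_eval m n c \<gamma> (z i)) powr \<rho>)"
    unfolding sum_distrib_left[symmetric] by (subst sum.swap) simp
  also have "\<dots> \<le> 2 powr (real m * (2 - \<rho>)) * (\<Sum>i\<in>exponent_box n (N - 1). Y powr \<rho>)"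
    using pt by (intro mult_left_mono sum_mono) auto
  also have "\<dots> = real N ^ n * (2 powr (real m * (2 - \<rho>)) * Y powr \<rho>)"
    by (simp add: card_exponent_box N_def)
  finally have "(\<Sum>\<gamma>\<in>multi_indices \<kappa> n. s \<gamma> powr (\<rho> / 2)) \<le> 2 powr (real m * (2 - \<rho>)) * Y powr \<rho>"
    by (simp add: N_def del: of_nat_Suc)
  also have "2 powr (real m * (2 - \<rho>)) = (2 powr (real m / real \<kappa>)) powr \<rho>"
  proof -
    have "real m * (2 - \<rho>) = real m / real \<kappa> * \<rho>" using \<kappa> by (simp add: \<rho>_def field_simps)
    then show ?thesis by (simp add: powr_powr)
  qed
  also have "(2 powr (real m / real \<kappa>)) powr \<rho> * Y powr \<rho> = (2 powr (real m / real \<kappa>) * Y) powr \<rho>"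
    using Y0 by (simp add: powr_mult)
  finally show ?thesis by (simp only: s_def \<rho>(3) Y_def) (simp add: \<rho>_def)
qed

lemma multi_index_split:
  assumes "\<alpha> \<in> multi_indices (a + b) n"
  shows "\<exists>\<gamma>\<in>multi_indices a n. \<exists>\<delta>\<in>multi_indices b n. \<alpha> = (\<lambda>j. \<gamma> j + \<delta> j)"
  using assms
proof (induction a arbitrary: \<alpha>)
  case 0
  then show ?case by (intro bexI[of _ "\<lambda>_. 0"] bexI[of _ \<alpha>]) (auto simp: multi_indices_def)
next
  case (Suc a)
  then obtain k where k: "k < n" "\<alpha> k > 0"
    by (metis add_Suc gr0I lessThan_iff multi_indices_sum nat.distinct(1) sum.neutral)
  obtain \<beta> where \<beta>: "\<beta> \<in> multi_indices (a + b) n" "\<alpha> = \<beta>(k := Suc (\<beta> k))"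
    using bij_betw_increment[OF k(1), of "a + b"] Suc.prems k
    unfolding bij_betw_def by (auto simp: image_iff)
  obtain \<gamma> \<delta> where g: "\<gamma> \<in> multi_indices a n" "\<delta> \<in> multi_indices b n" "\<beta> = (\<lambda>j. \<gamma> j + \<delta> j)"
    using Suc.IH[OF \<beta>(1)] by blast
  have "\<gamma>(k := Suc (\<gamma> k)) \<in> multi_indices (Suc a) n"
    using bij_betw_increment[OF k(1), of a] g(1) unfolding bij_betw_def by auto
  moreover have "\<alpha> = (\<lambda>j. (\<gamma>(k := Suc (\<gamma> k))) j + \<delta> j)" using \<beta>(2) g(3) by auto
  ultimately show ?case using g(2) by blast
qed

lemma multi_index_decomposition:
  fixes r :: nat
  assumes "\<alpha> \<in> multi_indices (\<Sum>j<r. K j) n"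
  shows "\<exists>g. (\<forall>j<r. g j \<in> multi_indices (K j) n) \<and> \<alpha> = (\<lambda>i. \<Sum>j<r. g j i)"
  using assms
proof (induction r arbitrary: \<alpha>)
  case 0
  then have "\<alpha> = (\<lambda>i. 0)" by (auto simp: multi_indices_def fun_eq_iff) (metis lessThan_iff not_le)
  then show ?case by simp
next
  case (Suc r)
  then have "\<alpha> \<in> multi_indices ((\<Sum>j<r. K j) + K r) n" by simp
  then obtain \<gamma> \<delta> where gd: "\<gamma> \<in> multi_indices (\<Sum>j<r. K j) n" "\<delta> \<in> multi_indices (K r) n" "\<alpha> = (\<lambda>j. \<gamma> j + \<delta> j)"
    using multi_index_split by blast
  obtain g where g: "\<forall>j<r. g j \<in> multi_indices (K j) n" "\<gamma> = (\<lambda>i. \<Sum>j<r. g j i)"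
    using Suc.IH[OF gd(1)] by blast
  show ?case
    by (rule exI[of _ "g(r := \<delta>)"]) (use g gd in \<open>auto simp: less_Suc_eq\<close>)
qed

text \<open>
  The Bohnenblust--Hille norm of degree \<open>m\<close> is controlled by mixed norms of degrees \<open>K\<^sub>j\<close> with
  \<open>\<Sum> K\<^sub>j = m\<close>. Every \<open>\<alpha>\<close> is decomposed as \<open>\<Sum> g\<^sub>j\<close> with \<open>|g\<^sub>j| = K\<^sub>j\<close>. Let \<open>\<tau>\<^sub>j\<close> be the probability weights
  proportional to \<open>G\<^bsup>\<eta>\<^sub>j\<^esup>\<close>, where \<open>G \<gamma>\<close> is the square sum over the indices above \<open>\<gamma>\<close>. Then
  \<open>w \<alpha> = \<Prod> \<tau>\<^sub>j (g\<^sub>j)\<close> has total mass at most \<open>1\<close>, so \<open>weighted_l2_bound\<close> applies. The inequality between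
  weighted means splits \<open>w\<^bsup>-1/m\<^esup>\<close> into the terms \<open>\<tau>\<^sub>j (g\<^sub>j)\<^bsup>-1/K\<^sub>j\<^esup>\<close>, and the sum of squares against the \<open>j\<close>th
  term is the \<open>j\<close>th mixed norm. The summand \<open>\<epsilon>\<close> makes all weights positive.
\<close>

lemma block_interpolation:
  fixes v :: "(nat \<Rightarrow> nat) \<Rightarrow> real" and K :: "nat \<Rightarrow> nat" and r :: nat
  assumes K: "\<And>j. j < r \<Longrightarrow> K j \<ge> 1" "(\<Sum>j<r. K j) = m" and m: "m \<ge> 1" and n: "n \<ge> 1"
    and v: "\<And>\<alpha>. v \<alpha> \<ge> 0" and Y: "Y \<ge> 0"
    and hyp: "\<And>j. j < r \<Longrightarrow> (\<Sum>\<gamma>\<in>multi_indices (K j) n.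
        (\<Sum>\<alpha>\<in>{\<alpha>\<in>multi_indices m n. \<forall>i. \<gamma> i \<le> \<alpha> i}. (v \<alpha>)\<^sup>2) powr (real (K j) / (real (K j) + 1)))
          \<le> Y powr (2 * real (K j) / (real (K j) + 1))"
  shows "(\<Sum>\<alpha>\<in>multi_indices m n. v \<alpha> powr (2 * real m / (real m + 1))) powr (1 / (2 * real m / (real m + 1))) \<le> Y"
proof -
  let ?M = "multi_indices m n"
  define X where "X = (\<Sum>\<alpha>\<in>?M. v \<alpha> powr (2 * real m / (real m + 1))) powr (1 / (2 * real m / (real m + 1)))"
  define G where "G \<gamma> = (\<Sum>\<alpha>\<in>{\<alpha>\<in>?M. \<forall>i. \<gamma> i \<le> \<alpha> i}. (v \<alpha>)\<^sup>2)" for \<gamma>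
  define \<eta> where "\<eta> j = real (K j) / (real (K j) + 1)" for j
  have \<eta>: "0 < \<eta> j" "\<eta> j \<le> 1" "1 - \<eta> j / real (K j) = \<eta> j" if "j < r" for j
  proof -
    have "real (K j) > 0" using K(1)[OF that] by simp
    moreover from this have "real (K j) + real (K j) * real (K j) > 0" by (simp add: add_pos_pos)
    ultimately show "0 < \<eta> j" "\<eta> j \<le> 1" "1 - \<eta> j / real (K j) = \<eta> j"
      by (auto simp: \<eta>_def field_simps)
  qed
  have G0: "G \<gamma> \<ge> 0" for \<gamma> unfolding G_def by (intro sum_nonneg) auto
  have "\<forall>\<alpha>. \<exists>g. \<alpha> \<in> ?M \<longrightarrow> (\<forall>j<r. g j \<in> multi_indices (K j) n) \<and> \<alpha> = (\<lambda>i. \<Sum>j<r. g j i)"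
    using multi_index_decomposition[of _ K r n] K(2) by auto
  then obtain g where g: "\<And>\<alpha> j. \<alpha> \<in> ?M \<Longrightarrow> j < r \<Longrightarrow> g \<alpha> j \<in> multi_indices (K j) n"
    "\<And>\<alpha>. \<alpha> \<in> ?M \<Longrightarrow> \<alpha> = (\<lambda>i. \<Sum>j<r. g \<alpha> j i)" by metis
  have gle: "g \<alpha> j i \<le> \<alpha> i" if "\<alpha> \<in> ?M" "j < r" for \<alpha> j i
  proof -
    have "g \<alpha> j i \<le> (\<Sum>j<r. g \<alpha> j i)" using that by (intro member_le_sum[of j _ "\<lambda>j. g \<alpha> j i"]) auto
    then show ?thesis using fun_cong[OF g(2)[OF that(1)], of i] by simp
  qed
  define T where "T \<epsilon> j = (\<Sum>\<gamma>\<in>multi_indices (K j) n. (G \<gamma> + \<epsilon>) powr \<eta> j)" for \<epsilon> j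
  have step: "X\<^sup>2 \<le> (\<Sum>j<r. real (K j) / real m * T \<epsilon> j powr (1 / \<eta> j))" if \<epsilon>: "\<epsilon> > 0" for \<epsilon>
  proof -
    have Gp: "G \<gamma> + \<epsilon> > 0" for \<gamma> using G0[of \<gamma>] \<epsilon> by linarith
    have T: "T \<epsilon> j > 0" for j
      unfolding T_def using multi_indices_nonempty[OF n] Gp by (intro sum_pos) (auto simp: less_imp_neq[symmetric])
    define \<tau> where "\<tau> j \<gamma> = (G \<gamma> + \<epsilon>) powr \<eta> j / T \<epsilon> j" for j \<gamma>
    have \<tau>: "\<tau> j \<gamma> > 0" for j \<gamma> using T[of j] Gp[of \<gamma>] by (simp add: \<tau>_def)
    have \<tau>sum: "(\<Sum>\<gamma>\<in>multi_indices (K j) n. \<tau> j \<gamma>) = 1" for j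
      using T[of j] by (simp add: \<tau>_def T_def flip: sum_divide_distrib)
    define w where "w \<alpha> = (\<Prod>j<r. \<tau> j (g \<alpha> j))" for \<alpha>
    have w: "w \<alpha> > 0" for \<alpha> unfolding w_def using \<tau> by (intro prod_pos) auto
    have wsum: "(\<Sum>\<alpha>\<in>?M. w \<alpha>) \<le> 1"
    proof -
      define h where "h \<alpha> = restrict (g \<alpha>) {..<r}" for \<alpha>
      have inj: "inj_on h ?M"
      proof (rule inj_onI)
        fix \<alpha> \<beta> assume ab: "\<alpha> \<in> ?M" "\<beta> \<in> ?M" "h \<alpha> = h \<beta>"
        have "g \<alpha> j = g \<beta> j" if "j < r" for j
          using fun_cong[OF ab(3), of j] that by (simp add: h_def)
        then have "(\<lambda>i. \<Sum>j<r. g \<alpha> j i) = (\<lambda>i. \<Sum>j<r. g \<beta> j i)" by auto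
        then show "\<alpha> = \<beta>" using g(2)[OF ab(1)] g(2)[OF ab(2)] by simp
      qed
      have "(\<Sum>\<alpha>\<in>?M. w \<alpha>) = (\<Sum>\<alpha>\<in>?M. \<Prod>j<r. \<tau> j (h \<alpha> j))"
        by (simp add: w_def h_def)
      also have "\<dots> = (\<Sum>f\<in>h ` ?M. \<Prod>j<r. \<tau> j (f j))"
        by (simp add: sum.reindex[OF inj])
      also have "\<dots> \<le> (\<Sum>f\<in>PiE {..<r} (\<lambda>j. multi_indices (K j) n). \<Prod>j<r. \<tau> j (f j))"
      proof (rule sum_mono2)
        show "h ` ?M \<subseteq> PiE {..<r} (\<lambda>j. multi_indices (K j) n)" using g(1) by (auto simp: h_def)
        show "finite (PiE {..<r} (\<lambda>j. multi_indices (K j) n))" by (intro finite_PiE) auto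
      qed (rule prod_nonneg, use \<tau> in \<open>simp add: less_imp_le\<close>)
      also have "\<dots> = (\<Prod>j<r. \<Sum>\<gamma>\<in>multi_indices (K j) n. \<tau> j \<gamma>)"
        by (rule prod_sum_PiE[symmetric]) auto
      also have "\<dots> = 1" by (simp add: \<tau>sum)
      finally show ?thesis .
    qed
    have "X \<le> (\<Sum>\<alpha>\<in>?M. (v \<alpha>)\<^sup>2 * w \<alpha> powr (- 1 / real m)) powr (1 / 2)"
      unfolding X_def by (rule weighted_l2_bound) (use v w wsum m in auto)
    then have "X\<^sup>2 \<le> ((\<Sum>\<alpha>\<in>?M. (v \<alpha>)\<^sup>2 * w \<alpha> powr (- 1 / real m)) powr (1 / 2))\<^sup>2"
      by (intro power_mono) (auto simp: X_def)
    also have "\<dots> = (\<Sum>\<alpha>\<in>?M. (v \<alpha>)\<^sup>2 * w \<alpha> powr (- 1 / real m))"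
      by (simp add: powr_half_sqrt sum_nonneg)
    also have "\<dots> \<le> (\<Sum>\<alpha>\<in>?M. (v \<alpha>)\<^sup>2 * (\<Sum>j<r. real (K j) / real m * \<tau> j (g \<alpha> j) powr (- 1 / real (K j))))"
    proof (intro sum_mono mult_left_mono)
      fix \<alpha> assume a: "\<alpha> \<in> ?M"
      define u where "u j = \<tau> j (g \<alpha> j) powr (- 1 / real (K j))" for j
      define Ku where "Ku j = (if j < r then K j else 0)" for j
      have Ku: "Ku \<in> multi_indices m r" using K(2) by (auto simp: multi_indices_def Ku_def)
      have S0: "(\<Sum>j<r. real (Ku j) * u j) / real m \<ge> 0"
        by (intro divide_nonneg_nonneg sum_nonneg) (auto simp: u_def)
      have "monomial r u Ku = (\<Prod>j<r. 1 / \<tau> j (g \<alpha> j))"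
        unfolding monomial_def
      proof (intro prod.cong refl)
        fix j assume "j \<in> {..<r}"
        then have j: "j < r" "K j \<ge> 1" using K(1) by auto
        have "u j ^ Ku j = u j powr real (K j)" using \<tau>[of j "g \<alpha> j"] j by (simp add: u_def Ku_def powr_realpow)
        also have "\<dots> = \<tau> j (g \<alpha> j) powr (- 1)" using j by (simp add: u_def powr_powr)
        finally show "u j ^ Ku j = 1 / \<tau> j (g \<alpha> j)" using \<tau>[of j "g \<alpha> j"] by (simp add: powr_minus_divide)
      qed
      also have "\<dots> = 1 / w \<alpha>" by (simp add: w_def prod_dividef)
      finally have "1 / w \<alpha> \<le> ((\<Sum>j<r. real (Ku j) * u j) / real m) ^ m"
        using monomial_le_weighted_mean_power[OF Ku m, of u] \<tau> by (simp add: u_def less_imp_neq[symmetric])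
      moreover have "(w \<alpha> powr (- 1 / real m)) ^ m = 1 / w \<alpha>"
      proof -
        have "(w \<alpha> powr (- 1 / real m)) ^ m = (w \<alpha> powr (- 1 / real m)) powr real m" using w[of \<alpha>] by (simp add: powr_realpow)
        also have "\<dots> = w \<alpha> powr (- 1)" unfolding powr_powr using m by simp
        finally show ?thesis using w[of \<alpha>] by (simp add: powr_minus_divide)
      qed
      ultimately have "w \<alpha> powr (- 1 / real m) \<le> (\<Sum>j<r. real (Ku j) * u j) / real m"
        using S0 m power_mono_iff[of "w \<alpha> powr (- 1 / real m)" "(\<Sum>j<r. real (Ku j) * u j) / real m" m] by simp
      also have "\<dots> = (\<Sum>j<r. real (K j) / real m * u j)"
        by (simp add: sum_divide_distrib Ku_def)
      finally show "w \<alpha> powr (- 1 / real m) \<le> (\<Sum>j<r. real (K j) / real m * \<tau> j (g \<alpha> j) powr (- 1 / real (K j)))"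
        by (simp add: u_def)
    qed auto
    also have "\<dots> = (\<Sum>j<r. real (K j) / real m * (\<Sum>\<alpha>\<in>?M. (v \<alpha>)\<^sup>2 * \<tau> j (g \<alpha> j) powr (- 1 / real (K j))))"
      unfolding sum_distrib_left by (subst sum.swap) (simp add: mult_ac)
    also have "\<dots> \<le> (\<Sum>j<r. real (K j) / real m * T \<epsilon> j powr (1 / \<eta> j))"
    proof (intro sum_mono mult_left_mono)
      fix j assume "j \<in> {..<r}"
      then have j: "j < r" "K j \<ge> 1" using K(1) by auto
      let ?MK = "multi_indices (K j) n"
      have "(\<Sum>\<alpha>\<in>?M. (v \<alpha>)\<^sup>2 * \<tau> j (g \<alpha> j) powr (- 1 / real (K j)))
          \<le> (\<Sum>\<alpha>\<in>?M. \<Sum>\<gamma>\<in>{\<gamma>\<in>?MK. \<forall>i. \<gamma> i \<le> \<alpha> i}. (v \<alpha>)\<^sup>2 * \<tau> j \<gamma> powr (- 1 / real (K j)))"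
      proof (intro sum_mono)
        fix \<alpha> assume a: "\<alpha> \<in> ?M"
        show "(v \<alpha>)\<^sup>2 * \<tau> j (g \<alpha> j) powr (- 1 / real (K j)) \<le> (\<Sum>\<gamma>\<in>{\<gamma>\<in>?MK. \<forall>i. \<gamma> i \<le> \<alpha> i}. (v \<alpha>)\<^sup>2 * \<tau> j \<gamma> powr (- 1 / real (K j)))"
          using g(1)[OF a j(1)] gle[OF a j(1)]
          by (intro member_le_sum[of "g \<alpha> j" _ "\<lambda>\<gamma>. (v \<alpha>)\<^sup>2 * \<tau> j \<gamma> powr (- 1 / real (K j))"]) auto
      qed
      also have "\<dots> = (\<Sum>\<gamma>\<in>?MK. \<Sum>\<alpha>\<in>{\<alpha>\<in>?M. \<forall>i. \<gamma> i \<le> \<alpha> i}. (v \<alpha>)\<^sup>2 * \<tau> j \<gamma> powr (- 1 / real (K j)))"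
        by (rule sum.swap_restrict) auto
      also have "\<dots> = (\<Sum>\<gamma>\<in>?MK. G \<gamma> * \<tau> j \<gamma> powr (- 1 / real (K j)))"
        by (simp add: G_def sum_distrib_right)
      also have "\<dots> \<le> (\<Sum>\<gamma>\<in>?MK. (G \<gamma> + \<epsilon>) powr \<eta> j * T \<epsilon> j powr (1 / real (K j)))"
      proof (intro sum_mono)
        fix \<gamma>
        have \<tau>p: "\<tau> j \<gamma> powr (- 1 / real (K j)) = (G \<gamma> + \<epsilon>) powr (- \<eta> j / real (K j)) * T \<epsilon> j powr (1 / real (K j))"
          using T[of j] Gp[of \<gamma>] by (simp add: \<tau>_def powr_divide powr_powr powr_minus_divide)
        have "G \<gamma> * \<tau> j \<gamma> powr (- 1 / real (K j)) \<le> (G \<gamma> + \<epsilon>) * \<tau> j \<gamma> powr (- 1 / real (K j))"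
          using \<epsilon> by (intro mult_right_mono) auto
        also have "\<dots> = (G \<gamma> + \<epsilon>) powr (1 - \<eta> j / real (K j)) * T \<epsilon> j powr (1 / real (K j))"
          unfolding \<tau>p using Gp[of \<gamma>] by (simp add: powr_diff powr_minus_divide)
        finally show "G \<gamma> * \<tau> j \<gamma> powr (- 1 / real (K j)) \<le> (G \<gamma> + \<epsilon>) powr \<eta> j * T \<epsilon> j powr (1 / real (K j))"
          unfolding \<eta>(3)[OF j(1)] .
      qed
      also have "\<dots> = T \<epsilon> j * T \<epsilon> j powr (1 / real (K j))" by (simp add: T_def sum_distrib_right)
      also have "\<dots> = T \<epsilon> j powr (1 + 1 / real (K j))" using T[of j] by (simp add: powr_add)
      also have "1 + 1 / real (K j) = 1 / \<eta> j" using j by (simp add: \<eta>_def field_simps)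
      finally show "(\<Sum>\<alpha>\<in>?M. (v \<alpha>)\<^sup>2 * \<tau> j (g \<alpha> j) powr (- 1 / real (K j))) \<le> T \<epsilon> j powr (1 / \<eta> j)" .
    qed auto
    finally show ?thesis .
  qed
  define F where "F \<epsilon> = (\<Sum>j<r. real (K j) / real m * (\<Sum>\<gamma>\<in>multi_indices (K j) n. G \<gamma> powr \<eta> j + \<epsilon> powr \<eta> j) powr (1 / \<eta> j))" for \<epsilon>
  have XF: "X\<^sup>2 \<le> F \<epsilon>" if \<epsilon>: "\<epsilon> > 0" for \<epsilon>
  proof -
    have "(\<Sum>j<r. real (K j) / real m * T \<epsilon> j powr (1 / \<eta> j)) \<le> F \<epsilon>"
      unfolding F_def T_def using G0 \<epsilon> \<eta>
      by (intro sum_mono mult_left_mono powr_mono2 powr_subadditive sum_nonneg) (auto intro: less_imp_le)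
    then show ?thesis using step[OF \<epsilon>] by linarith
  qed
  have "(F \<longlongrightarrow> F 0) (at_right 0)"
    unfolding F_def
  proof (intro tendsto_sum tendsto_mult tendsto_const)
    fix j assume "j \<in> {..<r}"
    then have j: "j < r" by simp
    have "((\<lambda>\<epsilon>. \<epsilon> powr \<eta> j) \<longlongrightarrow> 0 powr \<eta> j) (at_right (0::real))"
      by (rule tendsto_powr'[OF tendsto_ident_at tendsto_const])
         (use \<eta>[OF j] in \<open>auto simp: eventually_at_right_field intro!: exI[of _ 1]\<close>)
    then have "((\<lambda>\<epsilon>. \<Sum>\<gamma>\<in>multi_indices (K j) n. G \<gamma> powr \<eta> j + \<epsilon> powr \<eta> j) \<longlongrightarrow>
        (\<Sum>\<gamma>\<in>multi_indices (K j) n. G \<gamma> powr \<eta> j + 0 powr \<eta> j)) (at_right 0)"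
      by (intro tendsto_sum tendsto_add tendsto_const)
    then show "((\<lambda>\<epsilon>. (\<Sum>\<gamma>\<in>multi_indices (K j) n. G \<gamma> powr \<eta> j + \<epsilon> powr \<eta> j) powr (1 / \<eta> j)) \<longlongrightarrow>
        (\<Sum>\<gamma>\<in>multi_indices (K j) n. G \<gamma> powr \<eta> j + 0 powr \<eta> j) powr (1 / \<eta> j)) (at_right 0)"
      by (rule tendsto_powr'[OF _ tendsto_const]) (use \<eta>[OF j] in \<open>auto intro!: always_eventually sum_nonneg\<close>)
  qed
  moreover have "\<forall>\<^sub>F \<epsilon> in at_right 0. X\<^sup>2 \<le> F \<epsilon>"
    using XF by (auto simp: eventually_at_right_field intro!: exI[of _ 1])
  ultimately have "X\<^sup>2 \<le> F 0" by (rule tendsto_lowerbound) simp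
  also have "F 0 \<le> (\<Sum>j<r. real (K j) / real m * Y\<^sup>2)"
    unfolding F_def
  proof (intro sum_mono mult_left_mono)
    fix j assume "j \<in> {..<r}"
    then have j: "j < r" by simp
    have "(\<Sum>\<gamma>\<in>multi_indices (K j) n. G \<gamma> powr \<eta> j + 0 powr \<eta> j) \<le> Y powr (2 * \<eta> j)"
      using hyp[OF j] \<eta>[OF j] by (simp add: \<eta>_def G_def)
    then have "(\<Sum>\<gamma>\<in>multi_indices (K j) n. G \<gamma> powr \<eta> j + 0 powr \<eta> j) powr (1 / \<eta> j) \<le> (Y powr (2 * \<eta> j)) powr (1 / \<eta> j)"
      using \<eta>[OF j] by (intro powr_mono2 sum_nonneg) auto
    also have "\<dots> = Y\<^sup>2" using \<eta>[OF j] Y by (cases "Y = 0") (simp_all add: powr_powr)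
    finally show "(\<Sum>\<gamma>\<in>multi_indices (K j) n. G \<gamma> powr \<eta> j + 0 powr \<eta> j) powr (1 / \<eta> j) \<le> Y\<^sup>2" .
  qed auto
  also have "\<dots> = (real (\<Sum>j<r. K j) / real m) * Y\<^sup>2"
    by (simp add: sum_distrib_right sum_divide_distrib)
  also have "\<dots> = Y\<^sup>2" using K(2) m by simp
  finally show ?thesis using Y power2_le_imp_le unfolding X_def by blast
qed

text \<open>
  A degree \<open>m \<ge> 2 k\<close> is the sum of blocks of sizes between \<open>k\<close> and \<open>2 k\<close>. In these degrees the
  constants \<open>\<Lambda>\<close> are bounded independently of \<open>m\<close>, so that the only exponential factor is \<open>2\<^bsup>m/k\<^esup>\<close>.
\<close>

lemma bohnenblust_hille_subexponential:
  assumes k: "k \<ge> 2" and m: "m \<ge> 2 * k" and n: "n \<ge> 1" and P: "polydisc_bound m n c B"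
  shows "coeff_norm (2 * real m / (real m + 1)) m n c
       \<le> 2 powr (real m / real k) * ((\<Sum>\<kappa><2 * k. Lambda_const (\<kappa> + 2)) * (exp 1 * real m ^ (2 * k))) * B"
proof -
  define C where "C = (\<Sum>\<kappa><2 * k. Lambda_const (\<kappa> + 2))"
  define r where "r = m div k"
  \<comment> \<open>all blocks have size \<open>k\<close>, except for the last one, which takes the remainder\<close>
  define K where "K j = (if j = r - 1 then m - (r - 1) * k else k)" for j
  define Y where "Y = 2 powr (real m / real k) * (C * (exp 1 * real m ^ (2 * k))) * B"
  have B0: "B \<ge> 0" by (rule polydisc_bound_nonneg[OF P])
  have C0: "C \<ge> 0" unfolding C_def using Lambda_const_pos by (intro sum_nonneg) (auto intro: less_imp_le)
  have r: "r \<ge> 2" unfolding r_def using k m by (simp add: less_eq_div_iff_mult_less_eq)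
  have rk: "(r - 1) * k + k = r * k" using r by (simp add: mult_eq_if)
  have md: "m = r * k + m mod k" by (simp add: r_def)
  have last: "m - (r - 1) * k = k + m mod k" using rk md by linarith
  have modk: "m mod k < k" using k by simp
  have Kb: "k \<le> K j" "K j < 2 * k" for j using last modk k by (auto simp: K_def)
  have Ksum: "(\<Sum>j<r. K j) = m"
  proof -
    have "{..<r} = insert (r - 1) {..<r - 1}" using r by auto
    then have "(\<Sum>j<r. K j) = K (r - 1) + (\<Sum>j<r - 1. K j)" by simp
    also have "(\<Sum>j<r - 1. K j) = (r - 1) * k" by (simp add: K_def)
    finally show ?thesis using last rk md by (simp add: K_def)
  qed
  have m1: "m \<ge> 1" using k m by linarith
  have "(\<Sum>\<alpha>\<in>multi_indices m n. norm (c \<alpha>) powr (2 * real m / (real m + 1))) powr (1 / (2 * real m / (real m + 1))) \<le> Y"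
  proof (rule block_interpolation[where K = K and r = r])
    fix j assume j: "j < r"
    define \<kappa> where "\<kappa> = K j"
    have \<kappa>: "2 \<le> \<kappa>" "\<kappa> \<le> m" "k \<le> \<kappa>" "\<kappa> < 2 * k" using Kb[of j] k m by (auto simp: \<kappa>_def)
    have LC: "Lambda_const \<kappa> \<le> C"
    proof -
      have "Lambda_const (\<kappa> - 2 + 2) \<le> C" unfolding C_def
        using \<kappa> Lambda_const_pos by (intro member_le_sum[of "\<kappa> - 2" _ "\<lambda>\<kappa>. Lambda_const (\<kappa> + 2)"]) (auto intro: less_imp_le)
      moreover have "\<kappa> - 2 + 2 = \<kappa>" using \<kappa> by simp
      ultimately show ?thesis by (simp only:)
    qed
    have L0: "Lambda_const \<kappa> \<ge> 0" using Lambda_const_pos[OF \<kappa>(1)] by simp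
    have "(\<Sum>\<gamma>\<in>multi_indices \<kappa> n. (\<Sum>\<alpha>\<in>{\<alpha>\<in>multi_indices m n. \<forall>i. \<gamma> i \<le> \<alpha> i}. (norm (c \<alpha>))\<^sup>2) powr (real \<kappa> / (real \<kappa> + 1)))
        \<le> (\<Sum>\<gamma>\<in>multi_indices \<kappa> n. (\<Sum>\<alpha>\<in>multi_indices m n. (real (multi_choose n \<alpha> \<gamma>))\<^sup>2 * (norm (c \<alpha>))\<^sup>2) powr (real \<kappa> / (real \<kappa> + 1)))"
    proof (intro sum_mono powr_mono2 sum_nonneg)
      fix \<gamma>
      have "(\<Sum>\<alpha>\<in>{\<alpha>\<in>multi_indices m n. \<forall>i. \<gamma> i \<le> \<alpha> i}. (norm (c \<alpha>))\<^sup>2)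
          \<le> (\<Sum>\<alpha>\<in>{\<alpha>\<in>multi_indices m n. \<forall>i. \<gamma> i \<le> \<alpha> i}. (real (multi_choose n \<alpha> \<gamma>))\<^sup>2 * (norm (c \<alpha>))\<^sup>2)"
      proof (intro sum_mono)
        fix \<alpha> assume "\<alpha> \<in> {\<alpha>\<in>multi_indices m n. \<forall>i. \<gamma> i \<le> \<alpha> i}"
        then have "multi_choose n \<alpha> \<gamma> > 0" unfolding multi_choose_def by (intro prod_pos) auto
        then have "1 \<le> (real (multi_choose n \<alpha> \<gamma>))\<^sup>2" by simp
        then have "1 * (norm (c \<alpha>))\<^sup>2 \<le> (real (multi_choose n \<alpha> \<gamma>))\<^sup>2 * (norm (c \<alpha>))\<^sup>2"
          by (rule mult_right_mono) simp
        then show "(norm (c \<alpha>))\<^sup>2 \<le> (real (multi_choose n \<alpha> \<gamma>))\<^sup>2 * (norm (c \<alpha>))\<^sup>2" by simp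
      qed
      also have "\<dots> \<le> (\<Sum>\<alpha>\<in>multi_indices m n. (real (multi_choose n \<alpha> \<gamma>))\<^sup>2 * (norm (c \<alpha>))\<^sup>2)"
        by (rule sum_mono2) auto
      finally show "(\<Sum>\<alpha>\<in>{\<alpha>\<in>multi_indices m n. \<forall>i. \<gamma> i \<le> \<alpha> i}. (norm (c \<alpha>))\<^sup>2)
          \<le> (\<Sum>\<alpha>\<in>multi_indices m n. (real (multi_choose n \<alpha> \<gamma>))\<^sup>2 * (norm (c \<alpha>))\<^sup>2)" .
    qed auto
    also have "\<dots> \<le> (2 powr (real m / real \<kappa>) * (Lambda_const \<kappa> * (exp 1 * real m ^ \<kappa> * B))) powr (2 * real \<kappa> / (real \<kappa> + 1))"
      by (rule partial_square_sums_bound[OF P _ \<kappa>(2) n _ L0])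
         (use \<kappa> bohnenblust_hille[OF _ \<kappa>(1) n] in auto)
    also have "\<dots> \<le> Y powr (2 * real \<kappa> / (real \<kappa> + 1))"
    proof (intro powr_mono2)
      have "2 powr (real m / real \<kappa>) * (Lambda_const \<kappa> * (exp 1 * real m ^ \<kappa> * B))
          \<le> 2 powr (real m / real k) * (C * (exp 1 * real m ^ (2 * k) * B))"
        using \<kappa> k m1 B0 L0 LC C0
        by (intro mult_mono powr_mono power_increasing divide_left_mono mult_nonneg_nonneg) auto
      then show "2 powr (real m / real \<kappa>) * (Lambda_const \<kappa> * (exp 1 * real m ^ \<kappa> * B)) \<le> Y"
        by (simp add: Y_def mult_ac)
    qed (use L0 B0 in auto)
    finally show "(\<Sum>\<gamma>\<in>multi_indices (K j) n. (\<Sum>\<alpha>\<in>{\<alpha>\<in>multi_indices m n. \<forall>i. \<gamma> i \<le> \<alpha> i}. (norm (c \<alpha>))\<^sup>2) powr (real (K j) / (real (K j) + 1)))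
        \<le> Y powr (2 * real (K j) / (real (K j) + 1))"
      by (simp add: \<kappa>_def)
  next
    show "K j \<ge> 1" for j using Kb(1)[of j] k by linarith
    show "Y \<ge> 0" using B0 C0 by (simp add: Y_def)
  qed (use Ksum m1 n in auto)
  then show ?thesis by (simp add: coeff_norm_def Y_def C_def)
qed

section \<open>Estimates for the optimal constants\<close>

lemma H_pol_le:
  assumes "\<And>n a. n \<ge> 1 \<Longrightarrow> coeff_norm (hl_exponent m p) m n a \<le> C * poly_norm p m n a"
  shows "H_pol m p \<le> ereal C"
  unfolding H_pol_def by (rule INF_lower[of C _ ereal]) (use assms in auto)

text \<open>
  The polynomial is the product of all variables, and the bound is the inequality between the means of
  the \<open>|z\<^sub>j|\<^sup>p\<close>.
\<close>

lemma poly_norm_product_le: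
  assumes m: "m \<ge> 1" and p: "ereal (real m) < p"
  defines "\<alpha> \<equiv> (\<lambda>j. if j < m then 1 else 0 :: nat)"
  shows "poly_norm p m m (\<lambda>\<beta>. if \<beta> = \<alpha> then 1 else 0) \<le> real m powr - real_of_ereal (ereal (real m) / p)"
proof (rule poly_norm_leI[OF m])
  show "p > 0" using p by (rule le_less_trans[rotated]) simp
  fix z assume z: "lp_norm p m z \<le> 1"
  have \<alpha>: "\<alpha> \<in> multi_indices m m" by (simp add: \<alpha>_def multi_indices_def)
  have "poly_eval m m (\<lambda>\<beta>. if \<beta> = \<alpha> then 1 else 0) z = (\<Sum>\<beta>\<in>multi_indices m m. if \<beta> = \<alpha> then (\<Prod>j<m. z j ^ \<beta> j) else 0)"
    unfolding poly_eval_def by (intro sum.cong refl) auto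
  also have "\<dots> = (\<Prod>j<m. z j ^ \<alpha> j)" using \<alpha> by (simp add: finite_multi_indices)
  also have "\<dots> = (\<Prod>j<m. z j)" by (simp add: \<alpha>_def)
  finally have eq: "norm (poly_eval m m (\<lambda>\<beta>. if \<beta> = \<alpha> then 1 else 0) z) = (\<Prod>j<m. norm (z j))"
    by (simp add: prod_norm)
  show "norm (poly_eval m m (\<lambda>\<beta>. if \<beta> = \<alpha> then 1 else 0) z) \<le> real m powr - real_of_ereal (ereal (real m) / p)"
    unfolding eq
  proof (cases p)
    case PInf
    then have "\<forall>j<m. norm (z j) \<le> 1" using z m by (simp add: lp_norm_infinity_le_1_iff)
    then have "(\<Prod>j<m. norm (z j)) \<le> 1" by (intro prod_le_1) auto
    then show "(\<Prod>j<m. norm (z j)) \<le> real m powr - real_of_ereal (ereal (real m) / p)" using PInf m by simp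
  next
    case (real r)
    then have r: "r > real m" "r > 0" using p m by auto
    have sum1: "(\<Sum>j<m. norm (z j) powr r) \<le> 1" using z real r by (simp add: lp_norm_le_1_iff)
    have "(\<Prod>j<m. norm (z j)) \<le> real m powr - (real m / r)"
    proof (cases "\<exists>j<m. z j = 0")
      case True
      then have "(\<Prod>j<m. norm (z j)) = 0" by (auto simp: prod_zero_iff)
      then show ?thesis by (simp only: powr_ge_zero)
    next
      case False
      define u where "u j = norm (z j) powr r" for j
      have u: "u j > 0" if "j < m" for j using that False by (auto simp: u_def)
      have "(\<Prod>j<m. u j) = monomial m u \<alpha>" by (simp add: monomial_def \<alpha>_def)
      also have "\<dots> \<le> ((\<Sum>j<m. real (\<alpha> j) * u j) / real m) ^ m"
        by (rule monomial_le_weighted_mean_power[OF \<alpha> m u])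
      also have "\<dots> \<le> (1 / real m) ^ m"
        using sum1 m by (intro power_mono divide_right_mono divide_nonneg_nonneg sum_nonneg) (auto simp: \<alpha>_def u_def)
      finally have "(\<Prod>j<m. u j) powr (1 / r) \<le> ((1 / real m) ^ m) powr (1 / r)"
        using r by (intro powr_mono2 prod_nonneg) (auto simp: u_def)
      also have "(\<Prod>j<m. u j) powr (1 / r) = (\<Prod>j<m. norm (z j))"
      proof -
        have "(\<Prod>j<m. u j) powr (1 / r) = (\<Prod>j<m. u j powr (1 / r))" by (simp add: prod_powr_distrib u_def)
        then show ?thesis using r by (simp add: u_def powr_powr)
      qed
      also have "((1 / real m) ^ m) powr (1 / r) = real m powr - (real m / r)"
      proof -
        have "(1 / real m) ^ m = real m powr - real m"
          using m by (simp add: powr_minus_divide powr_realpow power_one_over)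
        then show ?thesis by (simp only: powr_powr) simp
      qed
      finally show ?thesis .
    qed
    then show "(\<Prod>j<m. norm (z j)) \<le> real m powr - real_of_ereal (ereal (real m) / p)" using real r by simp
  qed (use p in auto)
qed

lemma H_pol_lower_bound:
  assumes m: "m \<ge> 1" and p: "ereal (real m) < p"
  shows "ereal (real m powr real_of_ereal (ereal (real m) / p)) \<le> H_pol m p"
  unfolding H_pol_def
proof (rule INF_greatest)
  fix C assume "C \<in> {C. \<forall>n\<ge>1. \<forall>a. coeff_norm (hl_exponent m p) m n a \<le> C * poly_norm p m n a}"
  then have C: "coeff_norm (hl_exponent m p) m n a \<le> C * poly_norm p m n a" if "n \<ge> 1" for n a
    using that by simp
  define \<alpha> :: "nat \<Rightarrow> nat" where "\<alpha> = (\<lambda>j. if j < m then 1 else 0)"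
  define a :: "(nat \<Rightarrow> nat) \<Rightarrow> complex" where "a = (\<lambda>\<beta>. if \<beta> = \<alpha> then 1 else 0)"
  define t where "t = real_of_ereal (ereal (real m) / p)"
  have \<alpha>: "\<alpha> \<in> multi_indices m m" by (simp add: \<alpha>_def multi_indices_def)
  have "(\<Sum>\<beta>\<in>multi_indices m m. norm (a \<beta>) powr hl_exponent m p) = (\<Sum>\<beta>\<in>multi_indices m m. if \<beta> = \<alpha> then 1 else 0)"
    by (intro sum.cong refl) (auto simp: a_def)
  also have "\<dots> = 1" using \<alpha> by (simp add: finite_multi_indices)
  finally have 1: "1 \<le> C * poly_norm p m m a" using C[of m a] m by (simp add: coeff_norm_def)
  have "p > 0" using p by (rule le_less_trans[rotated]) simp
  then have "poly_norm p m m a \<ge> 0" using m by (intro poly_norm_nonneg) auto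
  with 1 have "C > 0" by (smt (verit) mult_nonneg_nonneg mult_nonpos_nonneg)
  moreover have "poly_norm p m m a \<le> real m powr - t"
    using poly_norm_product_le[OF m p] by (simp add: a_def \<alpha>_def t_def)
  ultimately have "1 \<le> C * real m powr - t"
    using 1 by (meson less_imp_le mult_left_mono order_trans)
  then have "real m powr t \<le> C" using m by (simp add: powr_minus_divide pos_le_divide_eq)
  then show "ereal (real m powr real_of_ereal (ereal (real m) / p)) \<le> ereal C" by (simp add: t_def)
qed

lemma H_pol_ge_1:
  assumes m: "m \<ge> 1" and p: "ereal (real m) < p"
  shows "1 \<le> H_pol m p"
proof -
  have "real_of_ereal (ereal (real m) / p) \<ge> 0" using p by (cases p) auto
  then have "1 \<le> real m powr real_of_ereal (ereal (real m) / p)" using m by (intro ge_one_powr_ge_zero) auto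
  then show ?thesis using H_pol_lower_bound[OF m p] by (metis ereal_less_eq(3) one_ereal_def order_trans)
qed

lemma H_pol_bound_small_exponent:
  assumes m: "m \<ge> 2" and p: "ereal (real m) < p" "p \<le> ereal (2 * real m)"
  shows "H_pol m p \<le> ereal (c_const m * real m powr real_of_ereal (ereal (real m) / p) *
           2 powr ((real m - 1) / hl_exponent m p))"
proof -
  obtain r where r: "p = ereal r" using p by (cases p) auto
  show ?thesis
  proof (rule H_pol_le)
    fix n a assume n: "n \<ge> (1::nat)"
    show "coeff_norm (hl_exponent m p) m n a \<le> c_const m * real m powr real_of_ereal (ereal (real m) / p) *
        2 powr ((real m - 1) / hl_exponent m p) * poly_norm p m n a"
      using coeff_norm_bound_small_exponent[OF m n, of r "hl_exponent m p" a] hl_exponent_le_2m[of m p] p m r by simp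
  qed
qed

lemma H_pol_infinity_le:
  assumes C: "\<And>n c B. n \<ge> 1 \<Longrightarrow> polydisc_bound m n c B \<Longrightarrow> coeff_norm (2 * real m / (real m + 1)) m n c \<le> C * B"
  shows "H_pol m \<infinity> \<le> ereal C"
  by (rule H_pol_le) (simp add: hl_exponent_def C[OF _ polydisc_bound_infinity])

lemma
  assumes m: "m \<ge> 2"
  shows H_pol_infinity: "H_pol m \<infinity> = ereal (D_const m)"
    and D_const_ge_1: "1 \<le> D_const m"
    and D_const_le_Lambda_const: "D_const m \<le> Lambda_const m"
proof -
  have up: "H_pol m \<infinity> \<le> ereal (Lambda_const m)"
    by (rule H_pol_infinity_le) (use bohnenblust_hille m in blast)
  have lo: "1 \<le> H_pol m \<infinity>" using m by (intro H_pol_ge_1) auto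
  show *: "H_pol m \<infinity> = ereal (D_const m)" using up lo unfolding D_const_def by (cases "H_pol m \<infinity>") auto
  show "1 \<le> D_const m" "D_const m \<le> Lambda_const m" using up lo unfolding * by auto
qed

text \<open>
  The infimum that defines the optimal constant is attained, since each admissible constant is at least
  the quotient of the two norms of a given polynomial.
\<close>

lemma bohnenblust_hille_D_const:
  assumes m: "m \<ge> 2" and n: "n \<ge> 1" and P: "polydisc_bound m n c B"
  shows "coeff_norm (2 * real m / (real m + 1)) m n c \<le> D_const m * B"
proof -
  define N where "N = poly_norm \<infinity> m n c"
  have N0: "N \<ge> 0" unfolding N_def using n by (intro poly_norm_nonneg) auto
  have NB: "N \<le> B" unfolding N_def
    by (rule poly_norm_leI[OF n]) (use P n in \<open>auto simp: polydisc_bound_def lp_norm_infinity_le_1_iff\<close>)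
  have "coeff_norm (2 * real m / (real m + 1)) m n c \<le> D_const m * N"
  proof (cases "N = 0")
    case True
    then show ?thesis
      using bohnenblust_hille[OF polydisc_bound_infinity[OF n, of m c] m n] by (simp add: N_def)
  next
    case False
    have "ereal (coeff_norm (2 * real m / (real m + 1)) m n c / N) \<le> H_pol m \<infinity>"
      unfolding H_pol_def
    proof (rule INF_greatest)
      fix C assume "C \<in> {C. \<forall>n\<ge>1. \<forall>a. coeff_norm (hl_exponent m \<infinity>) m n a \<le> C * poly_norm \<infinity> m n a}"
      then have "coeff_norm (2 * real m / (real m + 1)) m n c \<le> C * N" using n by (simp add: hl_exponent_def N_def)
      then show "ereal (coeff_norm (2 * real m / (real m + 1)) m n c / N) \<le> ereal C"
        using False N0 by (simp add: pos_divide_le_eq)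
    qed
    then show ?thesis using False N0 by (simp add: H_pol_infinity[OF m] pos_divide_le_eq)
  qed
  also have "\<dots> \<le> D_const m * B" using NB D_const_ge_1[OF m] by (intro mult_left_mono) auto
  finally show ?thesis .
qed

lemma H_pol_bound_large_exponent:
  assumes m: "m \<ge> 2" and p: "ereal (2 * real m) \<le> p" and \<tau>: "\<tau> = real_of_ereal (ereal (2 * real m) / p)"
  shows "H_pol m p \<le> ereal (D_const m powr (1 - \<tau>) * Lambda_const m powr \<tau>)"
proof (cases p)
  case PInf
  then show ?thesis using \<tau> D_const_ge_1[OF m] Lambda_const_pos[OF m] by (simp add: H_pol_infinity[OF m])
next
  case (real r)
  then have r: "2 * real m \<le> r" using p by simp
  have q: "hl_exponent m p = 2 * real m * r / (real m * r + r - 2 * real m)" using r real by (simp add: hl_exponent_def)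
  have D: "D_const m > 0" using D_const_ge_1[OF m] by simp
  have \<tau>r: "\<tau> = 2 * real m / r" using r m by (simp add: \<tau> real)
  show ?thesis
    by (rule H_pol_le)
      (use coeff_norm_bound_large_exponent[OF bohnenblust_hille_D_const[OF m] D m _ r q \<tau>r] in \<open>auto simp: real\<close>)
qed (use p in auto)

section \<open>The bound uniform in the exponent\<close>

lemma exp_1_bounds: "27 / 10 \<le> exp (1::real)" "exp (1::real) \<le> 272 / 100"
  using e_approx_32 e_less_272 by (auto simp: abs_if power_divide split: if_splits)

lemma growth_base_bounds:
  shows "35 / 8 \<le> 1 + 4 * exp 1 / pi" and "1 + exp 1 * (32 / 27) \<le> 1 + 4 * exp 1 / pi"
proof -
  have "pi \<le> 63 / 20" using pi_approx by simp
  moreover have "32 / 27 * (63 / 20 :: real) \<le> 4" by simp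
  ultimately have 1: "32 / 27 * pi \<le> 4" by linarith
  have "exp 1 * (32 / 27) \<le> 4 * exp 1 / pi"
    using mult_left_mono[OF 1, of "exp 1"] by (simp add: pos_le_divide_eq mult_ac)
  then show "1 + exp 1 * (32 / 27) \<le> 1 + 4 * exp 1 / pi" by simp
  have "27 / 8 * pi \<le> 4 * (27 / 10)" using \<open>pi \<le> 63 / 20\<close> by simp
  also have "\<dots> \<le> 4 * exp 1" using exp_1_bounds(1) by simp
  finally have "27 / 8 \<le> 4 * exp 1 / pi" by (simp add: pos_le_divide_eq)
  then show "35 / 8 \<le> 1 + 4 * exp 1 / pi" by simp
qed

lemma c_const_le_exp: "m \<ge> 2 \<Longrightarrow> c_const m \<le> exp 1"
proof -
  assume m: "m \<ge> 2"
  have "c_const m = (1 + 1 / real (m - 1)) ^ (m - 1)"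
    using m by (simp add: c_const_def field_simps of_nat_diff)
  also have "\<dots> \<le> exp 1" using exp_ge_one_plus_x_over_n_power_n[of "m - 1" 1] m by simp
  finally show ?thesis .
qed

lemma c_const_ge_1: "m \<ge> 2 \<Longrightarrow> 1 \<le> c_const m"
  unfolding c_const_def by (intro one_le_power) (simp add: pos_le_divide_eq)

text \<open>
  The ratio of consecutive values of \<open>s\<^sup>s / s!\<close> is \<open>(1 + 1/s)\<^sup>s \<le> e\<close>.
\<close>

lemma power_self_le_fact_exp:
  assumes "s \<ge> 1"
  shows "real s ^ s \<le> fact s * exp 1 ^ (s - 1)"
  using assms
proof (induction s rule: dec_induct)
  case base
  then show ?case by simp
next
  case (step s)
  have "(1 + 1 / real s) ^ s \<le> exp 1"
    using exp_ge_one_plus_x_over_n_power_n[of s 1] step.hyps by simp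
  then have "real s ^ s * (1 + 1 / real s) ^ s \<le> (fact s * exp 1 ^ (s - 1)) * exp 1"
    using step.IH by (intro mult_mono) auto
  also have "real s ^ s * (1 + 1 / real s) ^ s = real (Suc s) ^ s"
    using step.hyps by (simp add: field_simps flip: power_mult_distrib)
  also have "(fact s * exp 1 ^ (s - 1)) * exp 1 = fact s * exp (1::real) ^ s"
    using step.hyps by (cases s) (auto simp: mult_ac)
  finally have "real (Suc s) * real (Suc s) ^ s \<le> real (Suc s) * (fact s * exp 1 ^ s)"
    by (intro mult_left_mono) auto
  then show ?case by (simp add: algebra_simps)
qed

lemma composition_sum_le:
  assumes m: "m \<ge> 1" and \<kappa>: "\<kappa> \<ge> 0"
  shows "(\<Sum>s=1..m. real s ^ s / fact s * real ((m - 1) choose (s - 1)) * \<kappa> ^ (s - 1)) \<le> (1 + exp 1 * \<kappa>) ^ (m - 1)"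
proof -
  have "(\<Sum>s=1..m. real s ^ s / fact s * real ((m - 1) choose (s - 1)) * \<kappa> ^ (s - 1))
      \<le> (\<Sum>s=1..m. exp 1 ^ (s - 1) * real ((m - 1) choose (s - 1)) * \<kappa> ^ (s - 1))"
    using power_self_le_fact_exp \<kappa>
    by (intro sum_mono mult_right_mono) (auto simp: pos_divide_le_eq mult_ac)
  also have "\<dots> = (\<Sum>k\<le>m - 1. real ((m - 1) choose k) * (exp 1 * \<kappa>) ^ k * 1 ^ (m - 1 - k))"
    by (rule sum.reindex_bij_witness[of _ Suc "\<lambda>s. s - 1"]) (use m in \<open>auto simp: power_mult_distrib\<close>)
  also have "\<dots> = (exp 1 * \<kappa> + 1) ^ (m - 1)" by (rule binomial_ring[symmetric])
  finally show ?thesis by (simp add: add.commute)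
qed

lemma H_pol_le_decoupled:
  assumes m: "m \<ge> 2" and p: "ereal (real m) < p" "p \<le> ereal (2 * real m)"
    and \<kappa>: "hl_exponent m p \<ge> 2 \<and> \<kappa> = 2 \<or> hl_exponent m p \<ge> 4 \<and> \<kappa> = 32 / 27"
    and E: "(\<Sum>s=1..m. real s ^ s / fact s * real ((m - 1) choose (s - 1)) * \<kappa> ^ (s - 1)) \<le> E"
  shows "H_pol m p \<le> ereal (real m powr real_of_ereal (ereal (real m) / p) * E powr (1 / hl_exponent m p))"
proof (rule H_pol_le)
  fix n and a :: "(nat \<Rightarrow> nat) \<Rightarrow> complex" assume n: "n \<ge> (1::nat)"
  obtain r where r: "p = ereal r" using p by (cases p) auto
  have rm: "real m < r" using p r by simp
  define q where "q = hl_exponent m p"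
  have q: "q = r / (r - real m)" using hl_exponent_le_2m[of m p] p m by (simp add: r q_def)
  have q0: "q > 0" using rm by (simp add: q)
  define N where "N = poly_norm p m n a"
  have N0: "N \<ge> 0" unfolding N_def using n rm m by (intro poly_norm_nonneg) (auto simp: r)
  define S where "S = (\<Sum>s=1..m. real s ^ s / fact s * real ((m - 1) choose (s - 1)) * \<kappa> ^ (s - 1))"
  have \<kappa>0: "\<kappa> > 0" using \<kappa> by auto
  have S0: "S \<ge> 0" unfolding S_def using \<kappa>0 by (intro sum_nonneg) auto
  have "(\<Sum>\<alpha>\<in>multi_indices m n. norm (a \<alpha>) powr q) \<le> S * (real m powr (q - 1) * N powr q)"
    unfolding S_def N_def r
    by (rule decoupled_coefficient_bound) (use rm q m n \<kappa> averaging_linear[of q \<kappa> "n - 1"] \<kappa>0 in \<open>auto simp: q_def\<close>)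
  also have "\<dots> \<le> E * (real m powr (q - 1) * N powr q)" using E unfolding S_def by (intro mult_right_mono) auto
  finally have "coeff_norm q m n a \<le> (E * (real m powr (q - 1) * N powr q)) powr (1 / q)"
    unfolding coeff_norm_def using q0 by (intro powr_mono2 sum_nonneg) auto
  also have "\<dots> = E powr (1 / q) * real m powr ((q - 1) * (1 / q)) * N"
    using S0 E N0 q0 by (simp add: S_def powr_mult powr_powr)
  also have "(q - 1) * (1 / q) = real m / r" using rm m by (simp add: q field_simps)
  finally show "coeff_norm (hl_exponent m p) m n a
      \<le> real m powr real_of_ereal (ereal (real m) / p) * E powr (1 / hl_exponent m p) * poly_norm p m n a"
    using rm m by (simp add: q_def N_def r mult_ac)
qed

text \<open>
  The sums are \<open>5\<close>, \<open>27\<close> and \<open>457/3\<close>.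
\<close>

lemma small_degree_numerics:
  assumes "m \<in> {2, 3, 4}"
  shows "(\<Sum>s=1..m. real s ^ s / fact s * real ((m - 1) choose (s - 1)) * 2 ^ (s - 1)) \<le> exp 1 * (1 + 4 * exp 1 / pi) ^ (m - 1)"
proof -
  have "27 / 10 * (35 / 8) ^ (m - 1) \<le> exp 1 * (1 + 4 * exp 1 / pi) ^ (m - 1)"
    using exp_1_bounds growth_base_bounds by (intro mult_mono power_mono) auto
  moreover have "(\<Sum>s=1..m. real s ^ s / fact s * real ((m - 1) choose (s - 1)) * 2 ^ (s - 1)) \<le> 27 / 10 * (35 / 8) ^ (m - 1)"
  proof -
    have s2: "{1..2} = {1, 2::nat}" and s3: "{1..3} = {1, 2, 3::nat}" and s4: "{1..4} = {1, 2, 3, 4::nat}" by auto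
    have c: "3 choose 2 = (3::nat)" by (simp add: numeral_eq_Suc)
    show ?thesis using assms
      by (elim insertE emptyE) (simp_all only: s2 s3 s4, simp_all add: fact_numeral c power_divide)
  qed
  ultimately show ?thesis by linarith
qed

text \<open>
  For \<open>m \<ge> 4\<close> it suffices that \<open>c\<^sub>m \<le> e\<close>; for \<open>m = 2\<close> and \<open>m = 3\<close> that bound is too weak, and
  \<open>c\<^sub>m\<close> is computed.
\<close>

lemma c_const_square_le: "m \<ge> 2 \<Longrightarrow> (c_const m)\<^sup>2 * real m \<le> exp 1 * 2 ^ m"
proof -
  assume m: "m \<ge> 2"
  consider "m = 2" | "m = 3" | "m \<ge> 4" using m by linarith
  then show ?thesis
  proof cases
    case 3
    have "exp 1 * real m \<le> 2 ^ m" using 3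
    proof (induction m rule: dec_induct)
      case base
      then show ?case using exp_1_bounds by simp
    next
      case (step m)
      have "real (Suc m) \<le> 2 * real m" using step.hyps by simp
      then have "exp 1 * real (Suc m) \<le> exp 1 * (2 * real m)" by (intro mult_left_mono) auto
      also have "\<dots> \<le> 2 ^ Suc m" using step.IH by simp
      finally show ?case .
    qed
    then have "exp 1 * (exp 1 * real m) \<le> exp 1 * 2 ^ m" by simp
    moreover have "(c_const m)\<^sup>2 \<le> (exp 1)\<^sup>2"
      using c_const_le_exp[OF m] c_const_ge_1[OF m] by (intro power_mono) auto
    then have "(c_const m)\<^sup>2 * real m \<le> (exp 1)\<^sup>2 * real m" by (intro mult_right_mono) auto
    moreover have "(exp 1)\<^sup>2 * real m = exp 1 * (exp 1 * real m)" by (simp only: power2_eq_square mult.assoc)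
    ultimately show ?thesis by linarith
  qed (use exp_1_bounds in \<open>auto simp: c_const_def power2_eq_square eval_nat_numeral\<close>)
qed

lemma Lambda_const_square: "m \<ge> 1 \<Longrightarrow> (Lambda_const m)\<^sup>2 = (c_const m)\<^sup>2 * real m * 2 ^ (m - 1)"
proof -
  assume m: "m \<ge> 1"
  have "(2 powr ((real m - 1) / 2))\<^sup>2 = 2 powr real (m - 1)"
    using m by (simp add: power2_eq_square of_nat_diff flip: powr_add)
  then show ?thesis by (simp add: Lambda_const_def power_mult_distrib powr_realpow)
qed

text \<open>
  The bound (iii) with \<open>D\<^sub>m \<le> \<Lambda>\<^sub>m\<close> inserted, which makes it independent of \<open>\<tau>\<close>.
\<close>

lemma H_pol_le_Lambda_const:
  assumes m: "m \<ge> 2" and p: "ereal (2 * real m) \<le> p"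
  shows "H_pol m p \<le> ereal (Lambda_const m)"
proof -
  define \<tau> where "\<tau> = real_of_ereal (ereal (2 * real m) / p)"
  have \<tau>: "0 \<le> \<tau>" "\<tau> \<le> 1" using p m by (cases p; auto simp: \<tau>_def pos_divide_le_eq)+
  have "H_pol m p \<le> ereal (D_const m powr (1 - \<tau>) * Lambda_const m powr \<tau>)"
    by (rule H_pol_bound_large_exponent[OF m p \<tau>_def])
  also have "D_const m powr (1 - \<tau>) * Lambda_const m powr \<tau> \<le> Lambda_const m powr (1 - \<tau>) * Lambda_const m powr \<tau>"
    using D_const_ge_1[OF m] D_const_le_Lambda_const[OF m] \<tau> by (intro mult_right_mono powr_mono2) auto
  also have "\<dots> = Lambda_const m" using Lambda_const_pos[OF m] by (simp flip: powr_add)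
  finally show ?thesis by simp
qed

text \<open>
  Let \<open>E\<close> be the quantity in square brackets. For \<open>p \<le> 2 m\<close> three cases are distinguished. If
  \<open>q \<ge> 4\<close>, decoupling with \<open>\<kappa> = 32/27\<close> gives \<open>(1 + e \<kappa>)\<^bsup>m - 1\<^esup>\<close>, and \<open>\<kappa> \<le> 4/\<pi>\<close>. If \<open>m \<le> 4\<close>,
  decoupling with \<open>\<kappa> = 2\<close> is good enough. Otherwise \<open>c\<^sub>m\<^sup>q \<le> e\<^sup>4\<close>, and (ii) suffices, because \<open>E\<close>
  exceeds \<open>e 2\<^bsup>m - 1\<^esup>\<close> by a factor of more than \<open>e\<^sup>3\<close> when \<open>m \<ge> 5\<close>. For \<open>p \<ge> 2 m\<close> the two sides are
  compared at the ends \<open>\<tau> = 0\<close> and \<open>\<tau> = 1\<close> of (iii), in the form \<open>\<Lambda>\<^sub>m\<^sup>2 \<le> E\<^bsup>1 + 1/m\<^esup>\<close> and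
  \<open>\<Lambda>\<^sub>m\<^sup>2 \<le> m E\<close>.
\<close>

lemma H_pol_upper_bound:
  assumes m: "m \<ge> 2" and p: "ereal (real m) < p"
  shows "H_pol m p \<le> ereal (real m powr real_of_ereal (ereal (real m) / p) *
           (exp 1 * (1 + 4 * exp 1 / pi) ^ (m - 1)) powr (1 / hl_exponent m p))"
proof -
  define A where "A = 1 + 4 * exp 1 / pi"
  define E where "E = exp 1 * A ^ (m - 1)"
  define q where "q = hl_exponent m p"
  define \<sigma> where "\<sigma> = real_of_ereal (ereal (real m) / p)"
  have A: "A \<ge> 35 / 8" using growth_base_bounds by (simp add: A_def)
  have E0: "E > 0" using A by (simp add: E_def)
  have "H_pol m p \<le> ereal (real m powr \<sigma> * E powr (1 / q))"
  proof (cases "p \<le> ereal (2 * real m)")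
    case le: True
    obtain r where r: "p = ereal r" using p le by (cases p) auto
    have qr: "q = r / (r - real m)" using hl_exponent_le_2m[of m p] p le m by (simp add: r q_def)
    have q2: "q \<ge> 2" using p le m by (simp add: r qr pos_le_divide_eq)
    consider "q \<ge> 4" | "m \<le> 4" | "m \<ge> 5" "q < 4" by linarith
    then show ?thesis
    proof cases
      case 1
      have "(\<Sum>s=1..m. real s ^ s / fact s * real ((m - 1) choose (s - 1)) * (32 / 27) ^ (s - 1)) \<le> (1 + exp 1 * (32 / 27)) ^ (m - 1)"
        using m by (intro composition_sum_le) auto
      also have "\<dots> \<le> A ^ (m - 1)" unfolding A_def by (rule power_mono[OF growth_base_bounds(2)]) auto
      also have "\<dots> \<le> E" using A exp_1_bounds unfolding E_def by (simp add: mult_le_cancel_right1)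
      finally show ?thesis unfolding q_def \<sigma>_def
        by (intro H_pol_le_decoupled[OF m p le]) (use 1 in \<open>auto simp: q_def\<close>)
    next
      case 2
      have m4: "m \<in> {2, 3, 4}" using 2 m by auto
      show ?thesis unfolding q_def \<sigma>_def
        by (rule H_pol_le_decoupled[OF m p le, of 2])
          (use q2 small_degree_numerics[OF m4] in \<open>auto simp: q_def E_def A_def\<close>)
    next
      case 3
      have "exp 1 ^ 3 \<le> (272 / 100 :: real) ^ 3" using exp_1_bounds by (intro power_mono) auto
      also have "\<dots> \<le> (35 / 16) ^ 4" by (simp add: power_divide)
      also have "\<dots> \<le> (35 / 16) ^ (m - 1)" using 3 by (intro power_increasing) auto
      also have "\<dots> \<le> (A / 2) ^ (m - 1)" using A by (intro power_mono) auto
      finally have A2: "exp 1 ^ 3 \<le> (A / 2) ^ (m - 1)" .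
      have "c_const m powr q \<le> exp 1 powr q"
        using c_const_le_exp[OF m] c_const_ge_1[OF m] q2 by (intro powr_mono2) auto
      also have "\<dots> \<le> exp 1 powr 4" using 3 by (intro powr_mono) auto
      also have "\<dots> = exp 1 * exp 1 ^ 3" by (simp add: numeral_eq_Suc)
      also have "\<dots> \<le> exp 1 * (A / 2) ^ (m - 1)" using A2 by simp
      finally have "c_const m powr q * 2 ^ (m - 1) \<le> exp 1 * (A / 2) ^ (m - 1) * 2 ^ (m - 1)"
        by (intro mult_right_mono) auto
      also have "\<dots> = E" by (simp add: E_def mult.assoc flip: power_mult_distrib)
      finally have "(c_const m powr q * 2 powr (real m - 1)) powr (1 / q) \<le> E powr (1 / q)"
        using q2 m by (intro powr_mono2) (auto simp: powr_realpow[symmetric] of_nat_diff)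
      moreover have "(c_const m powr q * 2 powr (real m - 1)) powr (1 / q) = c_const m * 2 powr ((real m - 1) / q)"
        using c_const_ge_1[OF m] q2 by (simp add: powr_mult powr_powr)
      ultimately have "c_const m * real m powr \<sigma> * 2 powr ((real m - 1) / q) \<le> real m powr \<sigma> * E powr (1 / q)"
        by (simp add: mult.assoc mult.left_commute[of _ "real m powr \<sigma>"] mult_left_mono)
      then show ?thesis using H_pol_bound_small_exponent[OF m p le] unfolding q_def \<sigma>_def
        by (meson ereal_less_eq(3) order_trans)
    qed
  next
    case False
    then have ge: "ereal (2 * real m) \<le> p" by simp
    define \<tau> where "\<tau> = 2 * \<sigma>"
    have \<tau>: "0 \<le> \<tau>" "\<tau> \<le> 1" using ge m by (cases p; auto simp: \<tau>_def \<sigma>_def pos_divide_le_eq)+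
    have q: "1 / q = (1 - \<tau>) * ((real m + 1) / (2 * real m)) + \<tau> / 2"
    proof (cases p)
      case PInf
      then show ?thesis by (simp add: q_def \<tau>_def \<sigma>_def hl_exponent_def)
    next
      case (real r)
      then have "r > 0" "r \<ge> 2 * real m" using ge m by auto
      then show ?thesis using m by (simp add: q_def \<tau>_def \<sigma>_def hl_exponent_def real field_simps)
    qed (use ge in auto)
    define L where "L = Lambda_const m"
    have L: "L > 0" unfolding L_def by (rule Lambda_const_pos[OF m])
    have c: "(c_const m)\<^sup>2 * real m \<le> exp 1 * 2 ^ m" by (rule c_const_square_le[OF m])
    have pow: "(2::real) ^ m = 2 * 2 ^ (m - 1)" using m by (cases m) auto
    have E4: "exp 1 * 4 ^ (m - 1) \<le> E" unfolding E_def using A by (intro mult_left_mono power_mono) auto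
    have four: "(4::real) ^ (m - 1) = 2 ^ (m - 1) * 2 ^ (m - 1)" by (simp flip: power_mult_distrib)
    have L2: "L\<^sup>2 \<le> 2 * E"
    proof -
      have "L\<^sup>2 \<le> exp 1 * 2 ^ m * 2 ^ (m - 1)"
        unfolding L_def using Lambda_const_square[of m] c m by (simp add: mult_right_mono)
      also have "\<dots> = 2 * (exp 1 * 4 ^ (m - 1))" by (simp only: pow four mult_ac)
      finally show ?thesis using E4 by simp
    qed
    have L2': "L\<^sup>2 \<le> real m * E"
    proof -
      have "(c_const m)\<^sup>2 * 2 \<le> (c_const m)\<^sup>2 * real m" using m by (intro mult_left_mono) auto
      then have "(c_const m)\<^sup>2 \<le> exp 1 * 2 ^ (m - 1)" using c unfolding pow by linarith
      then have "(c_const m)\<^sup>2 * (real m * 2 ^ (m - 1)) \<le> exp 1 * 2 ^ (m - 1) * (real m * 2 ^ (m - 1))"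
        by (intro mult_right_mono) auto
      also have "\<dots> = real m * (exp 1 * 4 ^ (m - 1))" by (simp only: four mult_ac)
      also have "\<dots> \<le> real m * E" using E4 by (intro mult_left_mono) auto
      moreover have "L\<^sup>2 = (c_const m)\<^sup>2 * (real m * 2 ^ (m - 1))"
        using Lambda_const_square[of m] m by (simp add: L_def mult.assoc)
      ultimately show ?thesis by simp
    qed
    have "2 ^ m \<le> E"
    proof -
      have "2 ^ m \<le> 2 * (4::real) ^ (m - 1)" unfolding pow by (intro mult_left_mono power_mono) auto
      also have "\<dots> \<le> exp 1 * 4 ^ (m - 1)" using exp_1_bounds by (intro mult_right_mono) auto
      finally show ?thesis using E4 by simp
    qed
    then have "(2 ^ m) powr (1 / real m) \<le> E powr (1 / real m)" by (intro powr_mono2) auto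
    moreover have "((2::real) ^ m) powr (1 / real m) = 2"
    proof -
      have "(2::real) ^ m = 2 powr real m" by (simp add: powr_realpow)
      then show ?thesis using m by (simp only: powr_powr) simp
    qed
    ultimately have Em: "2 \<le> E powr (1 / real m)" by simp
    have "L = (L\<^sup>2) powr (1 / 2)" using L by (simp add: powr_half_sqrt)
    also have "\<dots> \<le> (E powr (1 / real m) * E) powr (1 / 2)"
      using order_trans[OF L2 mult_right_mono[OF Em]] E0 by (intro powr_mono2) auto
    also have "\<dots> = E powr ((1 / real m + 1) * (1 / 2))" using E0 by (subst powr_powr[symmetric]) (simp add: powr_add)
    also have "(1 / real m + 1) * (1 / 2) = (real m + 1) / (2 * real m)" using m by (simp add: field_simps)
    finally have L1: "L \<le> E powr ((real m + 1) / (2 * real m))" .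
    have "L = (L\<^sup>2) powr (1 / 2)" using L by (simp add: powr_half_sqrt)
    also have "\<dots> \<le> (real m * E) powr (1 / 2)" using L2' by (intro powr_mono2) auto
    finally have L3: "L \<le> (real m * E) powr (1 / 2)" .
    have "L = L powr (1 - \<tau>) * L powr \<tau>" using L by (simp flip: powr_add)
    also have "\<dots> \<le> (E powr ((real m + 1) / (2 * real m))) powr (1 - \<tau>) * ((real m * E) powr (1 / 2)) powr \<tau>"
      using L1 L3 L \<tau> by (intro mult_mono powr_mono2) auto
    also have "\<dots> = real m powr \<sigma> * (E powr ((1 - \<tau>) * ((real m + 1) / (2 * real m))) * E powr (\<tau> / 2))"
      using E0 by (simp add: powr_powr powr_mult \<tau>_def mult_ac)
    also have "\<dots> = real m powr \<sigma> * E powr (1 / q)" unfolding q by (simp only: powr_add)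
    finally show ?thesis using H_pol_le_Lambda_const[OF m ge] unfolding L_def
      by (meson ereal_less_eq(3) order_trans)
  qed
  then show ?thesis by (simp add: q_def \<sigma>_def E_def A_def)
qed

section \<open>Asymptotics\<close>

lemma Lambda_const_le: "m \<ge> 2 \<Longrightarrow> Lambda_const m \<le> (exp 1 * real m) * 2 powr (real m / 2)"
    unfolding Lambda_const_def using c_const_le_exp[of m] c_const_ge_1[of m]
    by (intro mult_mono powr_mono) (auto intro: real_le_lsqrt simp: power2_eq_square)

text \<open>
  For \<open>p \<le> 2 m\<close> the exponent \<open>q\<close> is at least \<open>2\<close>, so the exponential factor in (ii) is at most the one in
  \<open>\<Lambda>\<^sub>m\<close>. For larger \<open>p\<close> the bound \<open>\<Lambda>\<^sub>m\<close> itself is available.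
\<close>

lemma H_pol_le_uniform:
  assumes m: "m \<ge> 2" and p: "ereal (real m) < p"
  shows "H_pol m p \<le> ereal (exp 1 * real m * 2 powr (real m / 2))"
proof (cases "p \<le> ereal (2 * real m)")
  case le: True
  obtain r where r: "p = ereal r" using p le by (cases p) auto
  have r': "real m < r" "r \<le> 2 * real m" using p le by (auto simp: r)
  define q where "q = hl_exponent m p"
  have q: "q = r / (r - real m)" using hl_exponent_le_2m[of m p] p le m by (simp add: r q_def)
  have q2: "q \<ge> 2" using r' by (simp add: q pos_le_divide_eq)
  have "(real m - 1) / q \<le> (real m - 1) / 2" using q2 m by (intro divide_left_mono) auto
  then have "(real m - 1) / q \<le> real m / 2" by simp
  then have "c_const m * real m powr (real m / r) * 2 powr ((real m - 1) / q) \<le> exp 1 * real m powr 1 * 2 powr (real m / 2)"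
    using r' m c_const_le_exp[OF m] c_const_ge_1[OF m]
    by (intro mult_mono powr_mono) auto
  then have "c_const m * real m powr real_of_ereal (ereal (real m) / p) * 2 powr ((real m - 1) / hl_exponent m p)
      \<le> exp 1 * real m * 2 powr (real m / 2)" using r' m by (simp add: r q_def[symmetric, unfolded r])
  then show ?thesis using H_pol_bound_small_exponent[OF m p le] by (meson ereal_less_eq(3) order_trans)
next
  case False
  show ?thesis using Lambda_const_le[OF m] H_pol_le_Lambda_const[of m p] m False
    by (meson ereal_less_eq(3) order_trans linear)
qed

lemma
  assumes m: "m \<ge> 2" and p: "ereal (real m) < p"
  shows H_pol_real: "H_pol m p = ereal (real_of_ereal (H_pol m p))"
    and H_pol_real_ge_1: "1 \<le> real_of_ereal (H_pol m p)"
proof -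
  have "1 \<le> H_pol m p" using H_pol_ge_1[of m p] m p by simp
  with H_pol_le_uniform[OF m p]
  show "H_pol m p = ereal (real_of_ereal (H_pol m p))" "1 \<le> real_of_ereal (H_pol m p)"
    by (cases "H_pol m p"; auto)+
qed

lemma H_pol_real_le: "m \<ge> 2 \<Longrightarrow> ereal (real m) < p \<Longrightarrow> H_pol m p \<le> ereal x \<Longrightarrow> real_of_ereal (H_pol m p) \<le> x"
  by (subst (asm) H_pol_real) auto

lemma uniform_root_limit: "(\<lambda>m. (exp 1 * real m * 2 powr (real m / 2)) powr (1 / real m)) \<longlonglongrightarrow> sqrt 2"
proof -
  have "(\<lambda>m. (exp 1 * real m) powr (1 / real m) * sqrt 2) \<longlonglongrightarrow> 1 * sqrt 2"
    by (intro tendsto_mult tendsto_const) real_asymp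
  moreover have "\<forall>\<^sub>F m in sequentially. (exp 1 * real m) powr (1 / real m) * sqrt 2 = (exp 1 * real m * 2 powr (real m / 2)) powr (1 / real m)"
    using eventually_gt_at_top[of 0]
  proof eventually_elim
    case (elim m)
    then show ?case by (simp add: powr_mult powr_powr powr_half_sqrt)
  qed
  ultimately show ?thesis by (simp add: tendsto_cong)
qed

lemma limsup_root_H_pol:
  "limsup (\<lambda>m. SUP p\<in>{p. ereal (real m) < p}. ereal (real_of_ereal (H_pol m p) powr (1 / real m))) \<le> ereal (sqrt 2)"
proof -
  have "limsup (\<lambda>m. SUP p\<in>{p. ereal (real m) < p}. ereal (real_of_ereal (H_pol m p) powr (1 / real m)))
      \<le> limsup (\<lambda>m. ereal ((exp 1 * real m * 2 powr (real m / 2)) powr (1 / real m)))"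
  proof (rule Limsup_mono)
    show "\<forall>\<^sub>F m in sequentially. (SUP p\<in>{p. ereal (real m) < p}. ereal (real_of_ereal (H_pol m p) powr (1 / real m)))
        \<le> ereal ((exp 1 * real m * 2 powr (real m / 2)) powr (1 / real m))"
      using eventually_ge_at_top[of 2]
    proof eventually_elim
      case (elim m)
      show ?case
      proof (rule SUP_least)
        fix p assume "p \<in> {p. ereal (real m) < p}"
        then have p: "ereal (real m) < p" by simp
        have "real_of_ereal (H_pol m p) powr (1 / real m) \<le> (exp 1 * real m * 2 powr (real m / 2)) powr (1 / real m)"
          using H_pol_real_ge_1[OF elim p] H_pol_real_le[OF elim p H_pol_le_uniform[OF elim p]] by (intro powr_mono2) auto
        then show "ereal (real_of_ereal (H_pol m p) powr (1 / real m)) \<le> ereal ((exp 1 * real m * 2 powr (real m / 2)) powr (1 / real m))"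
          by simp
      qed
    qed
  qed
  also have "\<dots> = ereal (sqrt 2)"
    by (rule lim_imp_Limsup) (use uniform_root_limit in auto)
  finally show ?thesis .
qed

text \<open>
  For fixed \<open>k\<close> the bound of \<open>bohnenblust_hille_subexponential\<close> is \<open>2\<^bsup>m/k\<^esup>\<close> times a polynomial in \<open>m\<close>, whose
  \<open>m\<close>th root tends to \<open>2\<^bsup>1/k\<^esup>\<close>; and \<open>k\<close> is arbitrary.
\<close>

lemma D_const_root_limit: "(\<lambda>m. D_const m powr (1 / real m)) \<longlonglongrightarrow> 1"
proof (rule order_tendstoI)
  fix a :: real assume "a < 1"
  show "\<forall>\<^sub>F m in sequentially. a < D_const m powr (1 / real m)"
    using eventually_ge_at_top[of 2]
  proof eventually_elim
    case (elim m)
    have "1 \<le> D_const m powr (1 / real m)" by (intro ge_one_powr_ge_zero D_const_ge_1 elim) auto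
    then show ?case using \<open>a < 1\<close> by simp
  qed
next
  fix a :: real assume a: "1 < a"
  have "(\<lambda>k. 2 powr (1 / real k)) \<longlonglongrightarrow> (1::real)" by real_asymp
  then have "\<forall>\<^sub>F k in sequentially. 2 powr (1 / real k) < a" using a by (rule order_tendstoD)
  then have "\<forall>\<^sub>F k in sequentially. 2 powr (1 / real k) < a \<and> k \<ge> 2"
    using eventually_ge_at_top[of 2] by eventually_elim auto
  then obtain k :: nat where k: "2 powr (1 / real k) < a" "k \<ge> 2"
    by (auto dest: eventually_happens)
  define K where "K = (\<Sum>\<kappa><2 * k. Lambda_const (\<kappa> + 2))"
  have K: "K > 0" unfolding K_def using k by (intro sum_pos) (auto intro: Lambda_const_pos simp: lessThan_empty_iff)
  have "(\<lambda>m. 2 powr (1 / real k) * ((K * exp 1) powr (1 / real m) * (real m powr (1 / real m)) ^ (2 * k)))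
      \<longlonglongrightarrow> 2 powr (1 / real k) * ((K * exp 1) powr 0 * 1 ^ (2 * k))"
  proof (intro tendsto_mult tendsto_power tendsto_const)
    show "(\<lambda>m. (K * exp 1) powr (1 / real m)) \<longlonglongrightarrow> (K * exp 1) powr 0"
      by (intro tendsto_powr tendsto_const) (use K in \<open>auto intro: lim_1_over_n\<close>)
    show "(\<lambda>m. real m powr (1 / real m)) \<longlonglongrightarrow> 1" by real_asymp
  qed
  then have "(\<lambda>m. 2 powr (1 / real k) * ((K * exp 1) powr (1 / real m) * (real m powr (1 / real m)) ^ (2 * k))) \<longlonglongrightarrow> 2 powr (1 / real k)"
    using K by simp
  then have "\<forall>\<^sub>F m in sequentially. 2 powr (1 / real k) * ((K * exp 1) powr (1 / real m) * (real m powr (1 / real m)) ^ (2 * k)) < a"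
    using k(1) by (rule order_tendstoD)
  then show "\<forall>\<^sub>F m in sequentially. D_const m powr (1 / real m) < a"
    using eventually_ge_at_top[of "2 * k"]
  proof eventually_elim
    case (elim m)
    have m: "m \<ge> 2" using elim(2) k(2) by simp
    have "H_pol m \<infinity> \<le> ereal (2 powr (real m / real k) * (K * (exp 1 * real m ^ (2 * k))))"
      by (rule H_pol_infinity_le) (use bohnenblust_hille_subexponential[OF k(2) elim(2)] in \<open>simp add: K_def\<close>)
    then have "D_const m \<le> 2 powr (real m / real k) * (K * (exp 1 * real m ^ (2 * k)))"
      by (simp add: H_pol_infinity[OF m])
    then have "D_const m powr (1 / real m) \<le> (2 powr (real m / real k) * (K * (exp 1 * real m ^ (2 * k)))) powr (1 / real m)"
      using D_const_ge_1[OF m] by (intro powr_mono2) auto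
    also have "\<dots> = 2 powr (1 / real k) * ((K * exp 1) powr (1 / real m) * (real m powr (1 / real m)) ^ (2 * k))"
    proof -
      have "(real m ^ (2 * k)) powr (1 / real m) = (real m powr (1 / real m)) ^ (2 * k)"
        using m by (simp add: powr_power powr_powr flip: powr_realpow)
      moreover have "(2 powr (real m / real k)) powr (1 / real m) = 2 powr (1 / real k)"
        using m by (simp add: powr_powr)
      ultimately show ?thesis using K m by (simp add: powr_mult mult.assoc)
    qed
    finally show ?case using elim(1) by simp
  qed
qed

lemma H_pol_le_D_const:
  assumes m: "m \<ge> 2" and p: "ereal (2 * real m) \<le> p" and \<tau>: "\<tau> = real_of_ereal (ereal (2 * real m) / p)"
  shows "real_of_ereal (H_pol m p) \<le> D_const m * Lambda_const m powr \<tau>"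
proof -
  have \<tau>0: "0 \<le> \<tau>" using p m by (cases p) (auto simp: \<tau>)
  have mp: "ereal (real m) < p" using p m by (intro less_le_trans[OF _ p]) auto
  have "D_const m powr (1 - \<tau>) \<le> D_const m powr 1" using D_const_ge_1[OF m] \<tau>0 by (intro powr_mono) auto
  then have "D_const m powr (1 - \<tau>) * Lambda_const m powr \<tau> \<le> D_const m * Lambda_const m powr \<tau>"
    using D_const_ge_1[OF m] by (intro mult_right_mono) auto
  then show ?thesis using H_pol_real_le[OF m mp H_pol_bound_large_exponent[OF m p \<tau>]] by linarith
qed

lemma interpolation_parameter_le:
  assumes "x > 0" "ereal x \<le> p" "m \<ge> (1::nat)"
  shows "0 \<le> real_of_ereal (ereal (2 * real m) / p)" "real_of_ereal (ereal (2 * real m) / p) \<le> 2 * real m / x"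
proof -
  show "0 \<le> real_of_ereal (ereal (2 * real m) / p)" using assms by (cases p) auto
  show "real_of_ereal (ereal (2 * real m) / p) \<le> 2 * real m / x"
  proof (cases p)
    case (real r)
    then show ?thesis using assms by (simp add: frac_le)
  qed (use assms in auto)
qed

text \<open>
  A crude exponential bound, which suffices whenever \<open>\<Lambda>\<^sub>m\<close> is raised to a power \<open>\<tau>\<close> with \<open>\<tau> \<rightarrow> 0\<close> or
  \<open>m \<tau> \<rightarrow> 0\<close>.
\<close>

lemma Lambda_const_le_8: "m \<ge> 2 \<Longrightarrow> Lambda_const m \<le> 8 powr real m"
proof -
  assume m: "m \<ge> 2"
  have le2: "real m \<le> 2 ^ m" using of_nat_less_two_power[of m, where 'a=real] by simp
  have "(exp 1::real) \<le> 2 ^ 2" using exp_1_bounds by simp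
  also have "\<dots> \<le> 2 ^ m" using m by (intro power_increasing) auto
  finally have e: "(exp 1::real) \<le> 2 powr real m" by (simp add: powr_realpow)
  have "(exp 1 * real m) * 2 powr (real m / 2) \<le> (2 powr real m * 2 powr real m) * 2 powr real m"
    using e le2 by (intro mult_mono powr_mono) (auto simp: powr_realpow)
  also have "\<dots> = 8 powr real m" by (simp flip: powr_mult)
  finally show ?thesis using Lambda_const_le[OF m] by simp
qed

lemma H_pol_le_D_const_8:
  assumes m: "m \<ge> 2" and p: "ereal (real m * x) \<le> p" and x: "x \<ge> 2"
  shows "real_of_ereal (H_pol m p) \<le> D_const m * 8 powr (2 * real m / x)"
proof -
  define \<tau> where "\<tau> = real_of_ereal (ereal (2 * real m) / p)"
  have "2 * real m \<le> real m * x" using x m by (simp add: mult.commute)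
  then have p2: "ereal (2 * real m) \<le> p" using p by (meson ereal_less_eq(3) order_trans)
  have "\<tau> \<le> 2 * real m / (real m * x)" unfolding \<tau>_def using p x m by (intro interpolation_parameter_le) auto
  then have \<tau>: "\<tau> \<le> 2 / x" using m by simp
  have \<tau>0: "\<tau> \<ge> 0" unfolding \<tau>_def using p2 m by (intro interpolation_parameter_le[of "2 * real m"]) auto
  have "Lambda_const m powr \<tau> \<le> (8 powr real m) powr \<tau>"
    using Lambda_const_le_8[OF m] Lambda_const_pos[OF m] \<tau>0 by (intro powr_mono2) auto
  also have "\<dots> \<le> 8 powr (2 * real m / x)"
    unfolding powr_powr using mult_left_mono[OF \<tau>, of "real m"] by (intro powr_mono) (auto simp: mult.commute)
  finally have "D_const m * Lambda_const m powr \<tau> \<le> D_const m * 8 powr (2 * real m / x)"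
    using D_const_ge_1[OF m] by (intro mult_left_mono) auto
  then show ?thesis using H_pol_le_D_const[OF m p2 \<tau>_def] by linarith
qed

lemma root_H_pol_limit:
  assumes R: "filterlim R at_top sequentially"
  shows "(\<lambda>m. SUP p\<in>{p. ereal (real m) < p \<and> ereal (real m * R m) \<le> p}.
         ereal \<bar>real_of_ereal (H_pol m p) powr (1 / real m) - 1\<bar>) \<longlonglongrightarrow> 0"
proof -
  define u where "u m = D_const m powr (1 / real m) * 8 powr (2 / R m) - 1" for m
  have "(\<lambda>m. 2 / R m) \<longlonglongrightarrow> 0" by (intro tendsto_divide_0[OF tendsto_const] filterlim_at_top_imp_at_infinity R)
  then have "u \<longlonglongrightarrow> 1 * 8 powr 0 - 1"
    unfolding u_def by (intro tendsto_diff tendsto_mult D_const_root_limit tendsto_powr tendsto_const) auto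
  then have "u \<longlonglongrightarrow> 0" by simp
  then have lim: "(\<lambda>m. ereal (u m)) \<longlonglongrightarrow> 0" by (simp add: zero_ereal_def)
  have ev: "\<forall>\<^sub>F m in sequentially. R m \<ge> 2 \<and> m \<ge> 2"
    using R eventually_ge_at_top[of 2] by (auto simp: filterlim_at_top intro: eventually_conj)
  have upper: "\<forall>\<^sub>F m in sequentially. (SUP p\<in>{p. ereal (real m) < p \<and> ereal (real m * R m) \<le> p}.
         ereal \<bar>real_of_ereal (H_pol m p) powr (1 / real m) - 1\<bar>) \<le> ereal (u m)"
    using ev
  proof eventually_elim
    case (elim m)
    then have m: "m \<ge> 2" and Rm: "R m \<ge> 2" by auto
    show ?case
    proof (rule SUP_least)
      fix p assume "p \<in> {p. ereal (real m) < p \<and> ereal (real m * R m) \<le> p}"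
      then have p: "ereal (real m) < p" "ereal (real m * R m) \<le> p" by auto
      define h where "h = real_of_ereal (H_pol m p)"
      have h1: "1 \<le> h" unfolding h_def by (rule H_pol_real_ge_1[OF m p(1)])
      have "h powr (1 / real m) \<le> (D_const m * 8 powr (2 * real m / R m)) powr (1 / real m)"
        unfolding h_def using h1 H_pol_le_D_const_8[OF m p(2) Rm] by (intro powr_mono2) (auto simp: h_def)
      also have "\<dots> = u m + 1" using D_const_ge_1[OF m] m by (simp add: u_def powr_mult powr_powr)
      finally have "h powr (1 / real m) - 1 \<le> u m" by simp
      moreover have "1 \<le> h powr (1 / real m)" using h1 by (intro ge_one_powr_ge_zero) auto
      ultimately show "ereal \<bar>real_of_ereal (H_pol m p) powr (1 / real m) - 1\<bar> \<le> ereal (u m)" by (simp add: h_def)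
    qed
  qed
  have lower: "\<forall>\<^sub>F m in sequentially. 0 \<le> (SUP p\<in>{p. ereal (real m) < p \<and> ereal (real m * R m) \<le> p}.
         ereal \<bar>real_of_ereal (H_pol m p) powr (1 / real m) - 1\<bar>)"
    by (intro always_eventually allI SUP_upper2[of \<infinity>]) auto
  show ?thesis by (rule tendsto_sandwich[OF lower upper tendsto_const lim])
qed

text \<open>
  The growth condition gives \<open>\<tau> \<le> 2 (ln m)/(c m)\<close>. Then the exponential part of \<open>\<Lambda>\<^sub>m\<^bsup>\<tau>\<^esup>\<close> is
  \<open>2\<^bsup>m\<tau>/2\<^esup> \<le> 2\<^bsup>(ln m)/c\<^esup> = m\<^bsup>(ln 2)/c\<^esup>\<close>, and the remaining part \<open>(e m)\<^bsup>\<tau>\<^esup>\<close> tends to \<open>1\<close>.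
\<close>

lemma H_pol_le_polynomial:
  assumes D: "\<forall>m\<ge>2. D_const m \<le> C * real m powr b" and c: "c > 0"
    and p: "\<forall>m\<ge>2. ereal (real m) < p m \<and> ereal (c * (real m)\<^sup>2 / ln (real m)) \<le> p m"
  shows "\<exists>\<epsilon> :: nat \<Rightarrow> real. \<epsilon> \<longlonglongrightarrow> 0 \<and> (\<forall>m\<ge>2. H_pol m (p m) \<le> ereal (real m powr (b + ln 2 / c + \<epsilon> m)))"
proof -
  have "1 \<le> C * 2 powr b" using D D_const_ge_1[of 2] by force
  then have C: "C > 0" by (smt (verit) mult_nonpos_nonneg powr_ge_zero)
  define h where "h m = real_of_ereal (H_pol m (p m))" for m
  have H: "H_pol m (p m) = ereal (h m)" "1 \<le> h m" if "m \<ge> 2" for m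
    using H_pol_real[of m "p m"] H_pol_real_ge_1[of m "p m"] p that by (auto simp: h_def)
  define \<delta> where "\<delta> m = (ln C + 2 * ln (real m) / (c * real m) * (1 + ln (real m))) / ln (real m)" for m
  \<comment> \<open>for the finitely many \<open>m\<close> with \<open>p m < 2 m\<close> the exponent is fitted to the actual value\<close>
  define \<epsilon> where "\<epsilon> m = (if ereal (2 * real m) \<le> p m then \<delta> m else ln (h m) / ln (real m) - (b + ln 2 / c))" for m
  have "\<forall>\<^sub>F m in sequentially. 2 * real m \<le> c * (real m)\<^sup>2 / ln (real m)"
    using c by real_asymp
  then have "\<forall>\<^sub>F m in sequentially. \<delta> m = \<epsilon> m"
    using eventually_ge_at_top[of 2]
  proof eventually_elim
    case (elim m)
    then have "ereal (2 * real m) \<le> p m" using p by (meson ereal_less_eq(3) order_trans)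
    then show ?case by (simp add: \<epsilon>_def)
  qed
  moreover have "\<delta> \<longlonglongrightarrow> 0" unfolding \<delta>_def using c C by real_asymp
  ultimately have "\<epsilon> \<longlonglongrightarrow> 0" using tendsto_cong by fast
  moreover have "h m \<le> real m powr (b + ln 2 / c + \<epsilon> m)" if m: "m \<ge> 2" for m
  proof (cases "ereal (2 * real m) \<le> p m")
    case ge: True
    have lnm: "ln (real m) > 0" using m by simp
    define \<tau> where "\<tau> = real_of_ereal (ereal (2 * real m) / p m)"
    define x where "x = c * (real m)\<^sup>2 / ln (real m)"
    have x: "x > 0" "ereal x \<le> p m" using p m c lnm by (auto simp: x_def)
    have \<tau>: "0 \<le> \<tau>" "\<tau> \<le> 2 * real m / x" unfolding \<tau>_def using interpolation_parameter_le[OF x, of m] m by auto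
    have "2 * real m / x = 2 * ln (real m) / (c * real m)"
      using m c lnm by (simp add: x_def power2_eq_square field_simps)
    with \<tau> have \<tau>le: "\<tau> \<le> 2 * ln (real m) / (c * real m)" by simp
    have "Lambda_const m powr \<tau> \<le> ((exp 1 * real m) * 2 powr (real m / 2)) powr \<tau>"
      using Lambda_const_le[OF m] Lambda_const_pos[OF m] \<tau> by (intro powr_mono2) auto
    also have "\<dots> \<le> ((exp 1 * real m) * 2 powr (real m / 2)) powr (2 * ln (real m) / (c * real m))"
    proof (rule powr_mono[OF \<tau>le])
      have "1 * 1 * 1 \<le> exp 1 * real m * 2 powr (real m / 2)"
        using m exp_1_bounds by (intro mult_mono ge_one_powr_ge_zero) auto
      then show "1 \<le> exp 1 * real m * 2 powr (real m / 2)" by simp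
    qed
    finally have "Lambda_const m powr \<tau> \<le> exp (2 * ln (real m) / (c * real m) * (1 + ln (real m) + real m / 2 * ln 2))"
      using m by (simp add: powr_def ln_mult exp_add[symmetric] algebra_simps)
    then have "D_const m * Lambda_const m powr \<tau>
        \<le> (C * real m powr b) * exp (2 * ln (real m) / (c * real m) * (1 + ln (real m) + real m / 2 * ln 2))"
      using D m D_const_ge_1[OF m] C by (intro mult_mono) auto
    also have "\<dots> = exp (ln C + b * ln (real m) + 2 * ln (real m) / (c * real m) * (1 + ln (real m) + real m / 2 * ln 2))"
      using C m by (simp add: exp_add powr_def)
    also have "ln C + b * ln (real m) + 2 * ln (real m) / (c * real m) * (1 + ln (real m) + real m / 2 * ln 2)
        = (b + ln 2 / c + \<epsilon> m) * ln (real m)"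
      using ge c m lnm by (simp add: \<epsilon>_def \<delta>_def field_simps)
    also have "exp \<dots> = real m powr (b + ln 2 / c + \<epsilon> m)" using m by (simp add: powr_def)
    finally show ?thesis using H_pol_le_D_const[OF m ge \<tau>_def] by (simp add: h_def)
  next
    case False
    then have "b + ln 2 / c + \<epsilon> m = ln (h m) / ln (real m)" by (simp add: \<epsilon>_def)
    then show ?thesis using H(2)[OF m] m by (simp add: powr_def)
  qed
  ultimately show ?thesis using H(1) by (intro exI[of _ \<epsilon>]) simp
qed

text \<open>
  Here \<open>m \<tau> = 2 m\<^sup>2 / p\<^sub>m \<rightarrow> 0\<close>, so that \<open>8\<^bsup>m\<tau>\<^esup> \<rightarrow> 1\<close>.
\<close>

lemma H_pol_asymp_D_const:
  assumes p: "\<forall>m\<ge>2. ereal (real m) < p m" and lim: "(\<lambda>m. p m / ereal ((real m)\<^sup>2)) \<longlonglongrightarrow> \<infinity>"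
  shows "\<exists>\<epsilon> :: nat \<Rightarrow> real. \<epsilon> \<longlonglongrightarrow> 0 \<and> (\<forall>m\<ge>2. H_pol m (p m) \<le> ereal ((1 + \<epsilon> m) * D_const m))"
proof -
  define h where "h m = real_of_ereal (H_pol m (p m))" for m
  define \<epsilon> where "\<epsilon> m = max 0 (h m / D_const m - 1)" for m
  have "\<epsilon> \<longlonglongrightarrow> 0"
  proof (rule order_tendstoI)
    fix a :: real assume "a < 0"
    then show "\<forall>\<^sub>F m in sequentially. a < \<epsilon> m" by (intro always_eventually) (simp add: \<epsilon>_def max_def)
  next
    fix a :: real assume a: "0 < a"
    have "((\<lambda>x. 8 powr (2 / x)) \<longlongrightarrow> (1::real)) at_top" by real_asymp
    then have "\<forall>\<^sub>F x in at_top. 8 powr (2 / x) < 1 + a" using a by (intro order_tendstoD) auto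
    then have "\<forall>\<^sub>F x in at_top. 8 powr (2 / x) < 1 + a \<and> x > (2::real)"
      using eventually_gt_at_top by (rule eventually_conj)
    then obtain K where K: "8 powr (2 / K) < 1 + a" "K > (2::real)" by (auto dest: eventually_happens)
    have "\<forall>\<^sub>F m in sequentially. ereal K < p m / ereal ((real m)\<^sup>2)"
      using lim unfolding tendsto_PInfty by blast
    then show "\<forall>\<^sub>F m in sequentially. \<epsilon> m < a"
      using eventually_ge_at_top[of 2]
    proof eventually_elim
      case (elim m)
      then have m: "m \<ge> 2" by simp
      have "ereal (K * (real m)\<^sup>2) \<le> p m"
        using elim(1) m by (cases "p m") (auto simp: pos_less_divide_eq)
      then have pK: "ereal (real m * (K * real m)) \<le> p m" by (simp add: power2_eq_square mult_ac)
      have "2 * 1 \<le> K * real m" using K m by (intro mult_mono) auto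
      then have "h m \<le> D_const m * 8 powr (2 * real m / (K * real m))"
        unfolding h_def by (intro H_pol_le_D_const_8[OF m pK]) simp
      also have "2 * real m / (K * real m) = 2 / K" using m by simp
      finally have "h m / D_const m \<le> 8 powr (2 / K)" using D_const_ge_1[OF m] by (simp add: pos_divide_le_eq mult.commute)
      then show ?case using K(1) a by (simp add: \<epsilon>_def)
    qed
  qed
  moreover have "H_pol m (p m) \<le> ereal ((1 + \<epsilon> m) * D_const m)" if m: "m \<ge> 2" for m
  proof -
    have D: "D_const m > 0" using D_const_ge_1[OF m] by simp
    have "h m / D_const m \<le> 1 + \<epsilon> m" by (simp add: \<epsilon>_def)
    then have "h m \<le> (1 + \<epsilon> m) * D_const m" using D by (simp add: pos_divide_le_eq)
    then show ?thesis using H_pol_real[OF m, of "p m"] p m by (simp add: h_def) (metis ereal_less_eq(3))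
  qed
  ultimately show ?thesis by blast
qed

theorem theoremA:
  "(\<forall>m::nat. m \<ge> 2 \<longrightarrow>
      (\<forall>p::ereal. ereal (real m) < p \<longrightarrow>
         ereal (real m powr real_of_ereal (ereal (real m) / p)) \<le> H_pol m p \<and>
         H_pol m p \<le> ereal (real m powr real_of_ereal (ereal (real m) / p) *
           (exp 1 * (1 + 4 * exp 1 / pi) ^ (m - 1)) powr (1 / hl_exponent m p))) \<and>
      (\<forall>p::ereal. ereal (real m) < p \<and> p \<le> ereal (2 * real m) \<longrightarrow>
         H_pol m p \<le> ereal (c_const m * real m powr real_of_ereal (ereal (real m) / p) *
           2 powr ((real m - 1) / hl_exponent m p))) \<and>
      (\<forall>(p::ereal) \<tau>::real. ereal (2 * real m) \<le> p \<and> \<tau> = real_of_ereal (ereal (2 * real m) / p) \<longrightarrow>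
         H_pol m p \<le> ereal (D_const m powr (1 - \<tau>) * Lambda_const m powr \<tau>)))
   \<and>
   limsup (\<lambda>m. SUP p\<in>{p. ereal (real m) < p}.
       ereal (real_of_ereal (H_pol m p) powr (1 / real m))) \<le> ereal (sqrt 2)
   \<and>
   (\<forall>R :: nat \<Rightarrow> real. filterlim R at_top sequentially \<longrightarrow>
      (\<lambda>m. SUP p\<in>{p. ereal (real m) < p \<and> ereal (real m * R m) \<le> p}.
         ereal \<bar>real_of_ereal (H_pol m p) powr (1 / real m) - 1\<bar>) \<longlonglongrightarrow> 0)
   \<and>
   (\<forall>(C::real) (b::real) (c::real).
      (\<forall>m\<ge>2. D_const m \<le> C * real m powr b) \<and> c > 0 \<longrightarrow>
      (\<forall>p :: nat \<Rightarrow> ereal.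
         (\<forall>m\<ge>2. ereal (real m) < p m \<and> ereal (c * (real m)\<^sup>2 / ln (real m)) \<le> p m) \<longrightarrow>
         (\<exists>\<epsilon> :: nat \<Rightarrow> real. \<epsilon> \<longlonglongrightarrow> 0 \<and>
            (\<forall>m\<ge>2. H_pol m (p m) \<le> ereal (real m powr (b + ln 2 / c + \<epsilon> m))))))
   \<and>
   (\<forall>p :: nat \<Rightarrow> ereal.
      (\<forall>m\<ge>2. ereal (real m) < p m) \<and> (\<lambda>m. p m / ereal ((real m)\<^sup>2)) \<longlonglongrightarrow> \<infinity> \<longrightarrow>
      (\<exists>\<epsilon> :: nat \<Rightarrow> real. \<epsilon> \<longlonglongrightarrow> 0 \<and>
         (\<forall>m\<ge>2. H_pol m (p m) \<le> ereal ((1 + \<epsilon> m) * D_const m))))"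
proof (intro conjI allI impI)
  fix m :: nat assume m: "m \<ge> 2"
  fix p :: ereal assume p: "ereal (real m) < p"
  show "ereal (real m powr real_of_ereal (ereal (real m) / p)) \<le> H_pol m p" using H_pol_lower_bound[of m p] m p by simp
  show "H_pol m p \<le> ereal (real m powr real_of_ereal (ereal (real m) / p) *
           (exp 1 * (1 + 4 * exp 1 / pi) ^ (m - 1)) powr (1 / hl_exponent m p))" by (rule H_pol_upper_bound[OF m p])
qed (use H_pol_bound_small_exponent H_pol_bound_large_exponent limsup_root_H_pol root_H_pol_limit H_pol_le_polynomial H_pol_asymp_D_const in blast)+

end
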